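(* Let $p\ge2$ be an integer. For every $1\le i\le p$, both $\Lambda(i)$ and $\Pi(i)$ are irreducible $\mathcal{W}(p)$-modules.
   Context: Definition of $\mathcal{W}(p)$. Let $L=\mathbb{Z}\alpha$ with $\langle\alpha,\alpha\rangle=2p$, and let $V_L=\mathcal{U}(\hat{\mathfrak h}_{<0})\otimes\mathbb{C}[L]$ be the lattice vertex algebra with vacuum $\mathbf 1$ and conformal vector $\omega=\frac{\alpha(-1)^2}{4p}\mathbf 1+\frac{p-1}{2p}\alpha(-2)\mathbf 1$ (central charge $1-\frac{6(p-1)^2}{p}$). Let $L^\circ=\mathbb{Z}\frac{\alpha}{2p}$ be the dual lattice and $V_{L^\circ}=\bigoplus_{\lambda\in L^\circ/L}V_{L+\lambda}$ the generalized vertex algebra, where $V_{L+\lambda}=\mathcal{U}(\hat{\mathfrak h}_{<0})\otimes e^\lambda\mathbb{C}[L]$ are the irreducible $V_L$-modules. Let $\tilde Q=e^{-\alpha/p}_0:V_L\to V_{L^\circ}$ and let $Q=e^\alpha_0$ (acting on each $V_L$-module), where $u_n$ denotes the coefficient of $x^{-n-1}$ in $Y(u,x)$. Then $\mathcal{W}(p)=\operatorname{Ker}(\tilde Q|_{V_L})$, a vertex operator algebra with conformal vector $\omega$; each $V_{L+\lambda}$ is a $\mathcal{W}(p)$-module by restriction. The spaces $\Lambda(i),\Pi(i)$. Put $\gamma_i=\frac{i}{2p}\alpha$. For $0\le i\le p-2$ let $\overline{V_{L+\gamma_i}}\subset V_{L+\gamma_i}$ be the Virasoro submodule generated by the singular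 vectors $Q^je^{\gamma_i-n\alpha}$, $n\ge0$, $0\le j\le 2n$. For $p\le i\le 2p-2$ let $\overline{V_{L+\gamma_i}}\subset V_{L+\gamma_i}$ be the Virasoro submodule generated by the singular vectors $Q^je^{\gamma_i-n\alpha}$, $n\ge1$, $0\le j\le 2n-1$. For $1\le i\le p-1$ set $\Lambda(i)=\overline{V_{L+\gamma_{i-1}}}$ and $\Pi(p-i)=\overline{V_{L+\gamma_{2p-i-1}}}$; set also $\Lambda(p)=V_{L+\gamma_{p-1}}$ and $\Pi(p)=V_{L+\gamma_{2p-1}}$. *)

theory Defs
  imports Complex_Main "HOL-Library.Multiset" "HOL-Library.Poly_Mapping"
begin

section \<open>The space of the generalized vertex algebra of the dual lattice\<close>

text \<open>
  Throughout, \<open>L = \<int>\<alpha>\<close> with \<open>\<langle>\<alpha>,\<alpha>\<rangle> = 2p\<close>, and \<open>L\<degree> = \<int>\<alpha>/2p\<close> is its dual lattice.  The underlying vector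
  space \<open>U(h\<^sub><\<^sub>0) \<otimes> C[L\<degree>]\<close> does not depend on \<open>p\<close>.  It has the basis of all
  \<open>\<alpha>(-j\<^sub>1-1) \<dots> \<alpha>(-j\<^sub>r-1) \<otimes> exp(k\<alpha>/2p)\<close>, where \<open>{#j\<^sub>1,\<dots>,j\<^sub>r#}\<close> is a multiset of natural
  numbers and \<open>k\<close> is an integer.  Note the shift: the element \<open>j\<close> of the multiset stands for
  \<open>\<alpha>(-j-1)\<close>, so that \<open>j = 0\<close> is allowed.
\<close>

type_synonym fock = "(nat multiset \<times> int) \<Rightarrow>\<^sub>0 complex"

abbreviation basis :: "nat multiset \<Rightarrow> int \<Rightarrow> fock" where
  "basis \<mu> k \<equiv> Poly_Mapping.single (\<mu>, k) 1"

definition fscale :: "complex \<Rightarrow> fock \<Rightarrow> fock" where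
  "fscale c v = Poly_Mapping.map ((*) c) v"

lemma lookup_fscale: "Poly_Mapping.lookup (fscale c v) x = c * Poly_Mapping.lookup v x"
  by (simp add: fscale_def Poly_Mapping.map.rep_eq when_def)

global_interpretation fock: vector_space fscale
  by standard (auto intro!: poly_mapping_eqI simp: lookup_fscale lookup_add algebra_simps)

definition lin_ext :: "(nat multiset \<Rightarrow> int \<Rightarrow> fock) \<Rightarrow> fock \<Rightarrow> fock" where
  "lin_ext f v = (\<Sum>(\<mu>, k)\<in>Poly_Mapping.keys v. fscale (Poly_Mapping.lookup v (\<mu>, k)) (f \<mu> k))"

text \<open>The vector \<open>exp(k\<alpha>/2p)\<close>; in particular \<open>\<gamma>\<^sub>i\<close> corresponds to \<open>k = i\<close> and
  \<open>\<alpha>\<close> to \<open>k = 2p\<close>.\<close>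

definition fexp :: "int \<Rightarrow> fock" where
  "fexp k = basis {#} k"

abbreviation vac :: fock where
  "vac \<equiv> fexp 0"

section \<open>Vertex operators\<close>

text \<open>\<open>heis p n\<close> is \<open>\<alpha>(n)\<close>: multiplication for \<open>n < 0\<close>, the eigenvalue
  \<open>\<langle>\<alpha>, k\<alpha>/2p\<rangle> = k\<close> for \<open>n = 0\<close>, and the derivation with \<open>[\<alpha>(n), \<alpha>(-n)] = 2pn\<close> for \<open>n > 0\<close>.\<close>

definition heis :: "nat \<Rightarrow> int \<Rightarrow> fock \<Rightarrow> fock" where
  "heis p n = lin_ext (\<lambda>\<mu> k.
     if n < 0 then basis (add_mset (nat (- n - 1)) \<mu>) k
     else if n = 0 then fscale (of_int k) (basis \<mu> k)
     else fscale (2 * of_nat p * of_int n * of_nat (count \<mu> (nat (n - 1))))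
            (basis (\<mu> - {#nat (n - 1)#}) k))"

text \<open>A power series with operator coefficients is the function giving its coefficients;
  \<open>op_pow F r\<close> is its \<open>r\<close>-th power, and \<open>op_exp F\<close> its exponential, which is correct
  when the constant term of \<open>F\<close> vanishes (powers \<open>r > n\<close> then do not contribute to degree \<open>n\<close>).\<close>

primrec op_pow :: "(nat \<Rightarrow> fock \<Rightarrow> fock) \<Rightarrow> nat \<Rightarrow> nat \<Rightarrow> fock \<Rightarrow> fock" where
  "op_pow F 0 n v = (if n = 0 then v else 0)"
| "op_pow F (Suc r) n v = (\<Sum>i\<le>n. F i (op_pow F r (n - i) v))"

definition op_exp :: "(nat \<Rightarrow> fock \<Rightarrow> fock) \<Rightarrow> nat \<Rightarrow> fock \<Rightarrow> fock" where
  "op_exp F n v = (\<Sum>r\<le>n. fscale (1 / fact r) (op_pow F r n v))"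

text \<open>For \<open>\<lambda> = k\<alpha>/2p\<close>, these are the coefficient of \<open>x\<^sup>n\<close> in \<open>exp (\<Sum>\<^sub>n\<^sub>>\<^sub>0 \<lambda>(-n) x\<^sup>n / n)\<close> and the
  coefficient of \<open>x\<^sup>-\<^sup>n\<close> in \<open>exp (- \<Sum>\<^sub>n\<^sub>>\<^sub>0 \<lambda>(n) x\<^sup>-\<^sup>n / n)\<close>.\<close>

definition Eminus :: "nat \<Rightarrow> int \<Rightarrow> nat \<Rightarrow> fock \<Rightarrow> fock" where
  "Eminus p k = op_exp (\<lambda>n v. if n = 0 then 0
     else fscale (of_int k / (2 * of_nat p * of_nat n)) (heis p (- int n) v))"

definition Eplus :: "nat \<Rightarrow> int \<Rightarrow> nat \<Rightarrow> fock \<Rightarrow> fock" where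
  "Eplus p k = op_exp (\<lambda>n v. if n = 0 then 0
     else fscale (- (of_int k / (2 * of_nat p * of_nat n))) (heis p (int n) v))"

text \<open>
  \<open>exp_mode p k m\<close> is the coefficient of \<open>x\<^sup>-\<^sup>m\<^sup>-\<^sup>1\<close> in
  \<open>Y(exp \<lambda>, x) = exp (\<Sum>\<^sub>n\<^sub>>\<^sub>0 \<lambda>(-n) x\<^sup>n / n) exp (- \<Sum>\<^sub>n\<^sub>>\<^sub>0 \<lambda>(n) x\<^sup>-\<^sup>n / n) e\<^sub>\<lambda> x\<^bsup>\<lambda>(0)\<^esup>\<close>
  for \<open>\<lambda> = k\<alpha>/2p\<close> (with trivial cocycle, the lattice having rank one).  On the component of
  \<open>exp(l\<alpha>/2p)\<close> the operator \<open>x\<^bsup>\<lambda>(0)\<^esup>\<close> is \<open>x\<^bsup>kl/2p\<^esup>\<close>, so exponents are rational.  Only finitely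
  many pairs \<open>(a, b)\<close> contribute, since \<open>Eplus p k b\<close> kills a given vector for large \<open>b\<close>.
\<close>

definition exp_mode :: "nat \<Rightarrow> int \<Rightarrow> rat \<Rightarrow> fock \<Rightarrow> fock" where
  "exp_mode p k m = lin_ext (\<lambda>\<mu> l. Sum_any (\<lambda>(a :: nat, b :: nat).
     if of_nat a - of_nat b + of_int (k * l) / of_nat (2 * p) = - m - 1
     then Eminus p k a (Eplus p k b (basis \<mu> (l + k))) else 0))"

text \<open>
  Modes of \<open>\<alpha>(-n\<^sub>1-1) \<dots> \<alpha>(-n\<^sub>r-1) exp(k\<alpha>/2p)\<close>, from
  \<open>Y(\<alpha>(-n-1)u, x) = : (\<partial>\<^sup>n/n!) \<alpha>(x) Y(u, x) :\<close> with \<open>\<alpha>(x) = \<Sum>\<^sub>i \<alpha>(i) x\<^sup>-\<^sup>i\<^sup>-\<^sup>1\<close>, where normal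
  ordering puts \<open>\<alpha>(i)\<close> to the left of \<open>Y(u, x)\<close> for \<open>i < 0\<close> and to the right for \<open>i \<ge> 0\<close>.
  The coefficient of \<open>\<alpha>(i) x\<^sup>-\<^sup>i\<^sup>-\<^sup>1\<^sup>-\<^sup>n\<close> in \<open>(\<partial>\<^sup>n/n!) \<alpha>(x)\<close> is \<open>-i-1 gchoose n\<close>; the first sum
  below is over \<open>i = -j-1\<close> and the second over \<open>i = j\<close>.
\<close>

primrec mon_mode :: "nat \<Rightarrow> nat list \<Rightarrow> int \<Rightarrow> rat \<Rightarrow> fock \<Rightarrow> fock" where
  "mon_mode p [] k m v = exp_mode p k m v"
| "mon_mode p (n # ns) k m v =
     Sum_any (\<lambda>j :: nat. fscale (of_nat j gchoose n)
       (heis p (- int j - 1) (mon_mode p ns k (m + of_nat j - of_nat n) v)))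
   + Sum_any (\<lambda>j :: nat. fscale ((- of_nat j - 1) gchoose n)
       (mon_mode p ns k (m - of_nat j - of_nat n - 1) (heis p (int j) v)))"

text \<open>\<open>mode p u m\<close> is \<open>u\<^sub>m\<close>, the coefficient of \<open>x\<^sup>-\<^sup>m\<^sup>-\<^sup>1\<close> in \<open>Y(u, x)\<close>.\<close>

definition mode :: "nat \<Rightarrow> fock \<Rightarrow> rat \<Rightarrow> fock \<Rightarrow> fock" where
  "mode p u m v = lin_ext (\<lambda>\<mu> k. mon_mode p (sorted_list_of_multiset \<mu>) k m v) u"

section \<open>The lattice vertex algebra, its modules, and the triplet vertex algebra\<close>

text \<open>\<open>VL p i\<close> is \<open>V\<^bsub>L+\<gamma>\<^sub>i\<^esub>\<close> where \<open>\<gamma>\<^sub>i = i\<alpha>/2p\<close>; in particular \<open>VL p 0\<close> is \<open>V\<^sub>L\<close>.\<close>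

definition VL :: "nat \<Rightarrow> int \<Rightarrow> fock set" where
  "VL p i = {v. \<forall>(\<mu>, k)\<in>Poly_Mapping.keys v. 2 * int p dvd k - i}"

definition conf :: "nat \<Rightarrow> fock" where
  "conf p = fscale (1 / (4 * of_nat p)) (heis p (- 1) (heis p (- 1) vac))
          + fscale ((of_nat p - 1) / (2 * of_nat p)) (heis p (- 2) vac)"

definition Vir :: "nat \<Rightarrow> int \<Rightarrow> fock \<Rightarrow> fock" where
  "Vir p n = mode p (conf p) (of_int (n + 1))"

definition Q :: "nat \<Rightarrow> fock \<Rightarrow> fock" where
  "Q p = mode p (fexp (2 * int p)) 0"

definition Qtilde :: "nat \<Rightarrow> fock \<Rightarrow> fock" where
  "Qtilde p = mode p (fexp (- 2)) 0"

definition triplet :: "nat \<Rightarrow> fock set" where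
  "triplet p = {v \<in> VL p 0. Qtilde p v = 0}"

section \<open>Modules\<close>

text \<open>
  Let \<open>A\<close> be a vertex operator subalgebra of \<open>V\<^sub>L\<close> with the conformal vector \<open>conf p\<close>.
  \<open>voa_module p A M\<close> says that \<open>M\<close>, with \<open>u \<in> A\<close> acting by the (restricted) integral modes of
  \<open>Y(u, x)\<close>, is a module for the vertex operator algebra \<open>A\<close>: the action is bilinear, truncated,
  satisfies the vacuum property and the Jacobi identity (stated in components, i.e. as the
  Borcherds identity), and \<open>M\<close> is graded by \<open>L(0)\<close>-eigenvalues with finite-dimensional
  homogeneous subspaces and a lower bound on each coset of the integers.
\<close>

definition action_closed :: "nat \<Rightarrow> fock set \<Rightarrow> fock set \<Rightarrow> bool" where
  "action_closed p A M \<longleftrightarrow> (\<forall>u\<in>A. \<forall>n :: int. \<forall>w\<in>M. mode p u (of_int n) w \<in> M)"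

definition borcherds :: "nat \<Rightarrow> fock \<Rightarrow> fock \<Rightarrow> fock \<Rightarrow> bool" where
  "borcherds p u v w \<longleftrightarrow> (\<forall>l m n :: int.
     Sum_any (\<lambda>j :: nat. fscale (of_int m gchoose j)
       (mode p (mode p u (of_int (l + int j)) v) (of_int (m + n - int j)) w))
   = Sum_any (\<lambda>j :: nat. fscale ((- 1) ^ j * (of_int l gchoose j))
       (mode p u (of_int (m + l - int j)) (mode p v (of_int (n + int j)) w)
        - fscale ((- 1) powi l)
            (mode p v (of_int (n + l - int j)) (mode p u (of_int (m + int j)) w)))))"

definition weight_space :: "nat \<Rightarrow> fock set \<Rightarrow> complex \<Rightarrow> fock set" where
  "weight_space p M h = {w \<in> M. Vir p 0 w = fscale h w}"

definition voa_module :: "nat \<Rightarrow> fock set \<Rightarrow> fock set \<Rightarrow> bool" where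
  "voa_module p A M \<longleftrightarrow>
     fock.subspace M
   \<and> action_closed p A M
   \<and> (\<forall>u\<in>A. \<forall>v\<in>A. \<forall>w\<in>M. \<forall>w'\<in>M. \<forall>c. \<forall>n :: int.
        mode p (u + v) (of_int n) w = mode p u (of_int n) w + mode p v (of_int n) w
      \<and> mode p (fscale c u) (of_int n) w = fscale c (mode p u (of_int n) w)
      \<and> mode p u (of_int n) (w + w') = mode p u (of_int n) w + mode p u (of_int n) w'
      \<and> mode p u (of_int n) (fscale c w) = fscale c (mode p u (of_int n) w))
   \<and> (\<forall>u\<in>A. \<forall>w\<in>M. \<exists>N :: int. \<forall>n\<ge>N. mode p u (of_int n) w = 0)
   \<and> (\<forall>w\<in>M. \<forall>n :: int. mode p vac (of_int n) w = (if n = - 1 then w else 0))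
   \<and> (\<forall>u\<in>A. \<forall>v\<in>A. \<forall>w\<in>M. borcherds p u v w)
   \<and> M = fock.span (\<Union>h. weight_space p M h)
   \<and> (\<forall>h. \<exists>B. finite B \<and> weight_space p M h \<subseteq> fock.span B)
   \<and> (\<forall>h. \<exists>N :: nat. \<forall>n\<ge>N. weight_space p M (h - of_nat n) = {0})"

definition irreducible_voa_module :: "nat \<Rightarrow> fock set \<Rightarrow> fock set \<Rightarrow> bool" where
  "irreducible_voa_module p A M \<longleftrightarrow> voa_module p A M \<and> M \<noteq> {0}
   \<and> (\<forall>N. N \<subseteq> M \<and> fock.subspace N \<and> action_closed p A N \<longrightarrow> N = {0} \<or> N = M)"

section \<open>The spaces \<open>\<Lambda>(i)\<close> and \<open>\<Pi>(i)\<close>\<close>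

definition vir_submodule :: "nat \<Rightarrow> fock set \<Rightarrow> bool" where
  "vir_submodule p N \<longleftrightarrow> fock.subspace N \<and> (\<forall>n. \<forall>w\<in>N. Vir p n w \<in> N)"

text \<open>\<open>VLbar p i\<close> is the Virasoro submodule of \<open>VL p i\<close> generated by the singular vectors
  \<open>Q\<^sup>j exp(\<gamma>\<^sub>i - n\<alpha>)\<close>; it is only used for \<open>0 \<le> i \<le> p-2\<close> and \<open>p \<le> i \<le> 2p-2\<close>.\<close>

definition VLbar :: "nat \<Rightarrow> int \<Rightarrow> fock set" where
  "VLbar p i = vir_submodule p hull
     {(Q p ^^ j) (fexp (i - 2 * int p * int n)) | j n :: nat.
        0 \<le> i \<and> i \<le> int p - 2 \<and> int j \<le> 2 * int n
      \<or> int p \<le> i \<and> i \<le> 2 * int p - 2 \<and> 1 \<le> n \<and> int j \<le> 2 * int n - 1}"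

definition Lam :: "nat \<Rightarrow> nat \<Rightarrow> fock set" where
  "Lam p i = (if i = p then VL p (int p - 1) else VLbar p (int i - 1))"

text \<open>For \<open>1 \<le> i \<le> p-1\<close>, \<open>\<Pi>(p-i)\<close> is attached to \<open>\<gamma>\<close> with index \<open>2p-i-1\<close>; hence \<open>\<Pi>(i)\<close> is
  attached to the index \<open>2p-(p-i)-1\<close>.\<close>

definition Pi_mod :: "nat \<Rightarrow> nat \<Rightarrow> fock set" where
  "Pi_mod p i = (if i = p then VL p (2 * int p - 1)
                 else VLbar p (2 * int p - (int p - int i) - 1))"

end

theory Submission
  imports Defs "HOL-Computational_Algebra.Formal_Power_Series"
begin

text \<open>
  Consider the vectors \<open>a\<^sup>- = exp(-\<alpha>/2)\<close> and \<open>a\<^sup>+ = Q a\<^sup>-\<close> of the generalized vertex algebra.  Both are primary and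
  satisfy a null vector equation of level two, so their modes on a vector \<open>w\<close> obey a recursion with
  values in the Virasoro module generated by the higher modes.  The product of \<open>a\<^sup>-\<close> and \<open>a\<^sup>+\<close> has a nonzero multiple of the
  vacuum as its top term.  Hence a family of subspaces that is stable under \<open>a\<^sup>\<plusminus>\<close> and the Virasoro operators is
  determined by its vectors of weight at most \<open>0\<close>.

  The modules \<open>\<Lambda>\<close> and \<open>\<Pi>\<close> form such families: \<open>a\<^sup>-\<close> maps one singular exponential to the next, and the recursion
  computes \<open>a\<^sup>+\<close> on it as a multiple of \<open>Q a\<^sup>-\<close>.  So does the kernel of \<open>Q~\<close>, which identifies the triplet algebra with \<open>\<Lambda>(1)\<close>.
  The modes of the triplet algebra are then built from those of \<open>a\<^sup>\<plusminus>\<close>, of \<open>Q\<close> and of the conformal vector.  A nonzero submodule \<open>N\<close> of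
  \<open>\<Lambda>\<close> or \<open>\<Pi>\<close> yields the stable family \<open>(N, a\<^sup>\<plusminus> N)\<close>, which therefore contains a singular vector of weight at most
  \<open>0\<close>.  The recursion shows that such a vector is an exponential, and this exponential generates everything.
\<close>

section \<open>Linear maps on the Fock space\<close>

text \<open>The fields of the triplet algebra obey no short recursion, so the proof leaves the
  lattice: at charge -p, half a step of L, the exponential has a null vector of level two, and this
  one equation replaces the structure theory of Fock spaces as Virasoro modules. The price is that
  inner products with \<alpha>/2 are half-integral. Modes are therefore indexed by rationals and the
  Borcherds identity is needed with fractional exponents; it is reduced letter by letter to vacuum
  coefficients of three exponentials, where it is the residue theorem for
  \<open>x^M (x - y)^L\<close>. The threshold 0 comes from the coefficient
  \<open>J (J + 1 - p) - p H\<close> of the recursion. For \<open>H > 0\<close> its nonnegative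
  zeros lie so high that the resulting vector has smaller weight than the argument, and an induction
  on weights passes them. For \<open>H \<le> 0\<close> this fails, but only the exponentials of
  charge 0 to 2p - 2 have such weights. The case i = p stands apart, because its modules are given
  as whole spaces and not by generators; that singular vectors generate them has to be
  proved.\<close>

abbreviation lk :: "fock \<Rightarrow> nat multiset \<times> int \<Rightarrow> complex" where
  "lk \<equiv> Poly_Mapping.lookup"

definition flin :: "(fock \<Rightarrow> fock) \<Rightarrow> bool" where
  "flin f \<longleftrightarrow> (\<forall>x y. f (x + y) = f x + f y) \<and> (\<forall>c x. f (fscale c x) = fscale c (f x))"

definition clin :: "(fock \<Rightarrow> complex) \<Rightarrow> bool" where
  "clin f \<longleftrightarrow> (\<forall>x y. f (x + y) = f x + f y) \<and> (\<forall>c x. f (fscale c x) = c * f x)"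

lemma flinI:
  "(\<And>x y. f (x + y) = f x + f y) \<Longrightarrow> (\<And>c x. f (fscale c x) = fscale c (f x)) \<Longrightarrow> flin f"
  by (simp add: flin_def)

lemma clinI:
  "(\<And>x y. f (x + y) = f x + f y) \<Longrightarrow> (\<And>c x. f (fscale c x) = c * f x) \<Longrightarrow> clin f"
  by (simp add: clin_def)

lemma flin_add: "flin f \<Longrightarrow> f (x + y) = f x + f y"
  and flin_scale: "flin f \<Longrightarrow> f (fscale c x) = fscale c (f x)"
  by (auto simp: flin_def)

lemma clin_add: "clin f \<Longrightarrow> f (x + y) = f x + f y"
  and clin_scale: "clin f \<Longrightarrow> f (fscale c x) = c * f x"
  by (auto simp: clin_def)

lemma flin_0: "flin f \<Longrightarrow> f 0 = 0"
  using flin_scale[of f 0 0] by simp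

lemma clin_0: "clin f \<Longrightarrow> f 0 = 0"
  using clin_scale[of f 0 0] by simp

lemma flin_uminus: "flin f \<Longrightarrow> f (- x) = - f x"
  using flin_scale[of f "-1" x] by simp

lemma flin_diff: "flin f \<Longrightarrow> f (x - y) = f x - f y"
  using flin_add[of f x "- y"] flin_uminus[of f y] by simp

lemma clin_uminus: "clin f \<Longrightarrow> f (- x) = - f x"
  using clin_scale[of f "-1" x] by simp

lemma clin_diff: "clin f \<Longrightarrow> f (x - y) = f x - f y"
  using clin_add[of f x "- y"] clin_uminus[of f y] by simp

lemma flin_sum: "flin f \<Longrightarrow> f (sum g A) = (\<Sum>a\<in>A. f (g a))"
  by (induction A rule: infinite_finite_induct) (auto simp: flin_0 flin_add)

lemma clin_sum: "clin f \<Longrightarrow> f (sum g A) = (\<Sum>a\<in>A. f (g a))"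
  by (induction A rule: infinite_finite_induct) (auto simp: clin_0 clin_add)

lemma flin_comp: "flin f \<Longrightarrow> flin g \<Longrightarrow> flin (\<lambda>x. f (g x))"
  by (simp add: flin_def)

lemma clin_comp: "clin f \<Longrightarrow> flin g \<Longrightarrow> clin (\<lambda>x. f (g x))"
  by (simp add: flin_def clin_def)

lemma flin_zero [simp]: "flin (\<lambda>x. 0)"
  by (simp add: flin_def)

lemma flin_id [simp]: "flin (\<lambda>x. x)"
  by (simp add: flin_def)

lemma flin_plus: "flin f \<Longrightarrow> flin g \<Longrightarrow> flin (\<lambda>x. f x + g x)"
  by (simp add: flin_def fock.scale_right_distrib algebra_simps)

lemma flin_minus: "flin f \<Longrightarrow> flin g \<Longrightarrow> flin (\<lambda>x. f x - g x)"
  by (simp add: flin_def fock.scale_right_diff_distrib algebra_simps)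

lemma flin_fscale: "flin f \<Longrightarrow> flin (\<lambda>x. fscale c (f x))"
  by (simp add: flin_def fock.scale_right_distrib fock.scale_left_commute)

lemma flin_setsum: "(\<And>a. a \<in> A \<Longrightarrow> flin (f a)) \<Longrightarrow> flin (\<lambda>x. \<Sum>a\<in>A. f a x)"
  by (induction A rule: infinite_finite_induct) (auto intro!: flin_plus)

lemma clin_lookup: "clin (\<lambda>x. lk x a)"
  by (simp add: clin_def lookup_add lookup_fscale)

lemma fock_expand: "v = (\<Sum>a\<in>Poly_Mapping.keys v. fscale (lk v a) (Poly_Mapping.single a 1))"
proof (rule poly_mapping_eqI)
  fix x
  have "lk (\<Sum>a\<in>Poly_Mapping.keys v. fscale (lk v a) (Poly_Mapping.single a 1)) x
      = (\<Sum>a\<in>Poly_Mapping.keys v. lk v a * (if a = x then 1 else 0))"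
    by (simp add: clin_sum[OF clin_lookup] lookup_fscale lookup_single when_def)
  also have "\<dots> = (\<Sum>a\<in>Poly_Mapping.keys v. if a = x then lk v a else 0)"
    by (rule sum.cong) auto
  also have "\<dots> = lk v x"
    by (simp add: in_keys_iff)
  finally show "lk v x = lk (\<Sum>a\<in>Poly_Mapping.keys v. fscale (lk v a) (Poly_Mapping.single a 1)) x"
    by simp
qed

lemma fock_induct [case_names zero basis add scale]:
  assumes "P 0" "\<And>\<mu> k. P (basis \<mu> k)" "\<And>x y. P x \<Longrightarrow> P y \<Longrightarrow> P (x + y)"
    "\<And>c x. P x \<Longrightarrow> P (fscale c x)"
  shows "P v"
proof -
  have "P (\<Sum>a\<in>A. fscale (lk v a) (Poly_Mapping.single a 1))" if "finite A" for A
    using that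
  proof (induction A)
    case (insert a A)
    then show ?case using assms by (cases a) auto
  qed (use assms in auto)
  from this[of "Poly_Mapping.keys v"] show ?thesis by (simp add: fock_expand[symmetric])
qed

lemma flin_eqI:
  assumes "flin f" "flin g" "\<And>\<mu> k. f (basis \<mu> k) = g (basis \<mu> k)"
  shows "f v = g v"
  by (induction v rule: fock_induct)
    (use assms in \<open>auto simp: flin_0 flin_add flin_scale\<close>)

lemma clin_eqI:
  assumes "clin f" "clin g" "\<And>\<mu> k. f (basis \<mu> k) = g (basis \<mu> k)"
  shows "f v = g v"
  by (induction v rule: fock_induct)
    (use assms in \<open>auto simp: clin_0 clin_add clin_scale\<close>)

lemma lin_ext_superset:
  assumes "finite A" "Poly_Mapping.keys v \<subseteq> A"
  shows "lin_ext f v = (\<Sum>a\<in>A. fscale (lk v a) (f (fst a) (snd a)))"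
proof -
  have "lin_ext f v = (\<Sum>a\<in>Poly_Mapping.keys v. fscale (lk v a) (f (fst a) (snd a)))"
    by (simp add: lin_ext_def split_beta)
  also have "\<dots> = (\<Sum>a\<in>A. fscale (lk v a) (f (fst a) (snd a)))"
    using assms by (intro sum.mono_neutral_left) (auto simp: in_keys_iff)
  finally show ?thesis .
qed

lemma flin_lin_ext: "flin (lin_ext f)"
proof (rule flinI)
  fix x y :: fock and c :: complex
  let ?A = "Poly_Mapping.keys x \<union> Poly_Mapping.keys y"
  have "Poly_Mapping.keys (x + y) \<subseteq> ?A" by (rule Poly_Mapping.keys_add)
  then show "lin_ext f (x + y) = lin_ext f x + lin_ext f y"
    by (simp add: lin_ext_superset[of ?A] lookup_add fock.scale_left_distrib sum.distrib)
  have "Poly_Mapping.keys (fscale c x) \<subseteq> Poly_Mapping.keys x"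
    by (auto simp: in_keys_iff lookup_fscale)
  then show "lin_ext f (fscale c x) = fscale c (lin_ext f x)"
    by (simp add: lin_ext_superset[of "Poly_Mapping.keys x"] lookup_fscale fock.scale_sum_right)
qed

lemma lin_ext_basis: "lin_ext f (basis \<mu> k) = f \<mu> k"
  by (simp add: lin_ext_def)

section \<open>Locally finite sums\<close>

text \<open>\<open>Sum_any\<close> is 0 on families with infinite support, so it is additive only
  under a finiteness condition. For families indexed by natural numbers, the truncation of modes
  supplies it in this form.\<close>

definition evz :: "(nat \<Rightarrow> 'a::zero) \<Rightarrow> bool" where
  "evz g \<longleftrightarrow> (\<exists>N. \<forall>j\<ge>N. g j = 0)"

lemma evz_finite: "evz g \<Longrightarrow> finite {a. g a \<noteq> 0}"
  unfolding evz_def by (metis (mono_tags, lifting) finite_nat_set_iff_bounded leI mem_Collect_eq)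

lemma Sum_any_bound:
  fixes g :: "nat \<Rightarrow> 'a::comm_monoid_add"
  assumes "\<And>j. j \<ge> N \<Longrightarrow> g j = 0"
  shows "Sum_any g = sum g {..<N}"
  using assms by (intro Sum_any.expand_superset) (auto simp: not_less[symmetric])

lemma Sum_any_rec:
  fixes f :: "nat \<Rightarrow> fock"
  assumes "evz f"
  shows "Sum_any f = f 0 + Sum_any (\<lambda>j. f (Suc j))"
proof -
  obtain N where N: "\<And>j. j \<ge> N \<Longrightarrow> f j = 0" using assms unfolding evz_def by blast
  have "Sum_any f = sum f {..<Suc N}" "Sum_any (\<lambda>j. f (Suc j)) = (\<Sum>j<N. f (Suc j))"
    by (rule Sum_any_bound, use N in auto)+
  then show ?thesis by (simp add: sum.lessThan_Suc_shift del: sum.lessThan_Suc)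
qed

lemma evz_add: "evz f \<Longrightarrow> evz g \<Longrightarrow> evz (\<lambda>j. f j + (g j :: 'a::comm_monoid_add))"
  unfolding evz_def by (metis add.right_neutral le_trans nat_le_linear)

lemma evz_comp0: "evz f \<Longrightarrow> (\<And>j. f j = 0 \<Longrightarrow> g j = 0) \<Longrightarrow> evz g"
  unfolding evz_def by metis

lemma Sum_any_add:
  "evz f \<Longrightarrow> evz g \<Longrightarrow> Sum_any (\<lambda>j. f j + g j) = Sum_any f + (Sum_any g :: 'a::comm_monoid_add)"
  by (intro Sum_any.distrib evz_finite)

lemma Sum_any_flin: "flin h \<Longrightarrow> evz f \<Longrightarrow> h (Sum_any f) = Sum_any (\<lambda>j. h (f j))"
proof -
  assume h: "flin h" "evz f"
  then obtain N where "\<forall>j\<ge>N. f j = 0" by (auto simp: evz_def)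
  then show ?thesis using h by (simp add: Sum_any_bound[of N] flin_0 flin_sum)
qed

lemma Sum_any_clin: "clin h \<Longrightarrow> evz f \<Longrightarrow> h (Sum_any f) = Sum_any (\<lambda>j. h (f j))"
proof -
  assume h: "clin h" "evz f"
  then obtain N where "\<forall>j\<ge>N. f j = 0" by (auto simp: evz_def)
  then show ?thesis using h by (simp add: Sum_any_bound[of N] clin_0 clin_sum)
qed

lemma Sum_any_diff:
  "evz f \<Longrightarrow> evz g \<Longrightarrow> Sum_any (\<lambda>j. f j - g j) = Sum_any f - (Sum_any g :: 'a::ab_group_add)"
proof -
  assume "evz f" "evz g"
  then obtain N M where N: "\<forall>j\<ge>N. f j = 0" "\<forall>j\<ge>M. g j = 0" by (auto simp: evz_def)
  have "Sum_any (\<lambda>j. f j - g j) = sum (\<lambda>j. f j - g j) {..<max N M}"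
    "Sum_any f = sum f {..<max N M}" "Sum_any g = sum g {..<max N M}"
    using N by (auto intro!: Sum_any_bound)
  then show ?thesis by (simp add: sum_subtractf)
qed

lemma Sum_any_cmult: "evz f \<Longrightarrow> Sum_any (\<lambda>j. c * f j) = c * (Sum_any f :: complex)"
proof -
  assume "evz f"
  then obtain N where "\<forall>j\<ge>N. f j = 0" by (auto simp: evz_def)
  then show ?thesis by (simp add: Sum_any_bound[of N] sum_distrib_left)
qed

lemma Sum_any_fscale: "evz f \<Longrightarrow> Sum_any (\<lambda>j. fscale c (f j)) = fscale c (Sum_any f)"
  using Sum_any_flin[of "fscale c" f] by (simp add: flin_fscale)

section \<open>The Heisenberg operators\<close>

lemma flin_heis: "flin (heis p n)"
  by (simp add: heis_def flin_lin_ext)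

lemma flin_heis': "flin f \<Longrightarrow> flin (\<lambda>x. heis p n (f x))"
  by (rule flin_comp[OF flin_heis])

lemma heis_basis:
  "heis p n (basis \<mu> k) =
     (if n < 0 then basis (add_mset (nat (- n - 1)) \<mu>) k
     else if n = 0 then fscale (of_int k) (basis \<mu> k)
     else fscale (2 * of_nat p * of_int n * of_nat (count \<mu> (nat (n - 1))))
            (basis (\<mu> - {#nat (n - 1)#}) k))"
  by (simp add: heis_def lin_ext_basis)

lemma heis_comm:
  "heis p r (heis p s v) = heis p s (heis p r v)
     + (if r + s = 0 then fscale (2 * of_nat p * of_int r) v else 0)"
proof (rule flin_eqI[where f="\<lambda>v. heis p r (heis p s v)" and g="\<lambda>v. heis p s (heis p r v)
     + (if r + s = 0 then fscale (2 * of_nat p * of_int r) v else 0)"])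
  show "flin (\<lambda>v. heis p r (heis p s v))"
    by (intro flin_heis' flin_id)
  have if_lin: "flin (\<lambda>v. if r + s = 0 then fscale (2 * of_nat p * of_int r) v else 0)"
    by (simp add: flin_def fock.scale_right_distrib fock.scale_left_commute)
  show "flin (\<lambda>v. heis p s (heis p r v)
     + (if r + s = 0 then fscale (2 * of_nat p * of_int r) v else 0))"
    by (intro flin_plus flin_heis' flin_id if_lin)
next
  fix \<mu> k
  \<comment> \<open>The source of the central term: once \<alpha>(-a-1) has created the letter
    \<open>a\<close>, its multiplicity is \<open>count \<mu> a + 1\<close>.\<close>
  have mixed: "heis p r (heis p s (basis \<mu> k)) = heis p s (heis p r (basis \<mu> k))
     + (if r + s = 0 then fscale (2 * of_nat p * of_int r) (basis \<mu> k) else 0)"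
    if "r > 0" "s < 0" for r s
  proof (cases "r + s = 0")
    case True
    define a where "a = nat (r - 1)"
    have n: "nat (- s - 1) = a" using True by (simp add: a_def)
    have L: "heis p r (heis p s (basis \<mu> k))
        = fscale (2 * of_nat p * of_int r * of_nat (count \<mu> a + 1)) (basis \<mu> k)"
      using that by (simp add: heis_basis n a_def[symmetric])
    have "heis p s (heis p r (basis \<mu> k))
        = fscale (2 * of_nat p * of_int r * of_nat (count \<mu> a)) (basis (add_mset a (\<mu> - {#a#})) k)"
      using that by (simp add: heis_basis n a_def[symmetric] flin_scale[OF flin_heis])
    also have "\<dots> = fscale (2 * of_nat p * of_int r * of_nat (count \<mu> a)) (basis \<mu> k)"
      by (cases "a \<in># \<mu>") (auto simp: not_in_iff)
    finally show ?thesis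
      unfolding L using True by (simp add: fock.scale_left_distrib[symmetric] ring_distribs)
  next
    case False
    then have "nat (- s - 1) \<noteq> nat (r - 1)" using that by linarith
    then show ?thesis using that False
      by (simp add: heis_basis flin_scale[OF flin_heis] diff_add_mset_swap)
  qed
  consider "r > 0" "s < 0" | "r < 0" "s > 0" | "r = 0 \<or> s = 0" | "r < 0" "s < 0" | "r > 0" "s > 0"
    by linarith
  then show "heis p r (heis p s (basis \<mu> k)) = heis p s (heis p r (basis \<mu> k))
     + (if r + s = 0 then fscale (2 * of_nat p * of_int r) (basis \<mu> k) else 0)"
  proof cases
    case 1
    then show ?thesis by (rule mixed)
  next
    case 2
    show ?thesis
    proof (cases "r + s = 0")
      case True
      then have s: "s = - r" by simp
      show ?thesis using mixed[OF 2(2,1)] unfolding s by simp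
    next
      case False
      then have "s + r \<noteq> 0" by simp
      then show ?thesis using mixed[OF 2(2,1)] False by simp
    qed
  next
    case 3
    have "heis p 0 (basis \<nu> k) = fscale (of_int k) (basis \<nu> k)" for \<nu>
      by (simp add: heis_basis)
    then have z: "heis p 0 (heis p n (basis \<mu> k)) = heis p n (heis p 0 (basis \<mu> k))" for n
      by (simp add: heis_basis[of p n] flin_scale[OF flin_heis] fock.scale_left_commute)
    show ?thesis
    proof (cases "r = 0")
      case True
      then show ?thesis using z[of s] by simp
    next
      case False
      then show ?thesis using z[of r] 3 by simp
    qed
  next
    case 4
    have "add_mset (nat (- r - 1)) (add_mset (nat (- s - 1)) \<mu>)
      = add_mset (nat (- s - 1)) (add_mset (nat (- r - 1)) \<mu>)"
      by (rule add_mset_commute)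
    then show ?thesis using 4 by (simp only: heis_basis if_True) simp
  next
    case 5
    show ?thesis
    proof (cases "r = s")
      case False
      then have ne: "nat (r - 1) \<noteq> nat (s - 1)" using 5 by linarith
      show ?thesis using 5 ne ne[symmetric]
        by (simp add: heis_basis flin_scale[OF flin_heis]
          add_mset_commute[of "nat (r - 1)"] mult.assoc mult.left_commute)
    qed (use 5 in simp)
  qed
qed

section \<open>The grading\<close>

definition wlev :: "nat multiset \<Rightarrow> nat" where
  "wlev \<mu> = (\<Sum>n\<in>#\<mu>. n + 1)"

lemma wlev_simps [simp]: "wlev {#} = 0" "wlev (add_mset n \<mu>) = n + 1 + wlev \<mu>"
  by (auto simp: wlev_def)

lemma wlev_diff: "n \<in># \<mu> \<Longrightarrow> wlev (\<mu> - {#n#}) + n + 1 = wlev \<mu>"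
  by (metis insert_DiffM wlev_simps(2) add.commute add.assoc)

lemma wlev_0: "wlev \<mu> = 0 \<longleftrightarrow> \<mu> = {#}"
  by (auto simp: wlev_def)

text \<open>The level is rational so that the formula for the level of \<open>u\<^sub>m v\<close> needs no integrality condition:
  if it is not a natural number, then \<open>u\<^sub>m v = 0\<close>.\<close>

definition gr :: "int \<Rightarrow> rat \<Rightarrow> fock set" where
  "gr k d = {v. \<forall>(\<mu>, l)\<in>Poly_Mapping.keys v. l = k \<and> of_nat (wlev \<mu>) = d}"

lemma gr_iff: "v \<in> gr k d \<longleftrightarrow> (\<forall>\<mu> l. lk v (\<mu>, l) \<noteq> 0 \<longrightarrow> l = k \<and> of_nat (wlev \<mu>) = d)"
  by (auto simp: gr_def in_keys_iff)

lemma gr_0 [simp]: "0 \<in> gr k d"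
  by (simp add: gr_iff)

lemma gr_add: "x \<in> gr k d \<Longrightarrow> y \<in> gr k d \<Longrightarrow> x + y \<in> gr k d"
  unfolding gr_iff lookup_add by (metis add.right_neutral)

lemma gr_scale: "x \<in> gr k d \<Longrightarrow> fscale c x \<in> gr k d"
  by (auto simp: gr_iff lookup_fscale)

lemma subspace_gr: "fock.subspace (gr k d)"
  by (simp add: fock.subspace_def gr_add gr_scale)

lemma gr_sum: "(\<And>a. a \<in> A \<Longrightarrow> f a \<in> gr k d) \<Longrightarrow> sum f A \<in> gr k d"
  by (rule fock.subspace_sum[OF subspace_gr])

lemma Sum_any_subspace:
  assumes "fock.subspace S" "\<And>a. f a \<in> S"
  shows "Sum_any f \<in> S"
  unfolding Sum_any.expand_set by (rule fock.subspace_sum) (use assms in auto)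

lemma gr_Sum_any: "(\<And>a. f a \<in> gr k d) \<Longrightarrow> Sum_any f \<in> gr k d"
  by (rule Sum_any_subspace[OF subspace_gr])

lemma gr_basis: "basis \<mu> k \<in> gr k (of_nat (wlev \<mu>))"
  by (auto simp: gr_iff lookup_single when_def)

lemma gr_empty: "v \<in> gr k d \<Longrightarrow> d \<notin> \<nat> \<Longrightarrow> v = 0"
  by (rule poly_mapping_eqI) (metis gr_iff lookup_zero of_nat_in_Nats surj_pair)

lemma gr_neg: "v \<in> gr k d \<Longrightarrow> d < 0 \<Longrightarrow> v = 0"
  by (rule gr_empty) (auto elim!: Nats_cases)

lemma gr_lin:
  assumes "flin f" "\<And>\<mu>. of_nat (wlev \<mu>) = d \<Longrightarrow> f (basis \<mu> k) \<in> gr k' d'" "v \<in> gr k d"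
  shows "f v \<in> gr k' d'"
proof -
  have "f v = (\<Sum>a\<in>Poly_Mapping.keys v. fscale (lk v a) (f (Poly_Mapping.single a 1)))"
    using arg_cong[OF fock_expand, of f v] by (simp add: flin_sum[OF assms(1)] flin_scale[OF assms(1)])
  also have "\<dots> \<in> gr k' d'"
    using assms(2,3) by (intro gr_sum gr_scale) (fastforce simp: gr_def[of k d])
  finally show ?thesis .
qed

lemma gr_heis: "v \<in> gr k d \<Longrightarrow> heis p n v \<in> gr k (d - of_int n)"
proof (rule gr_lin[OF flin_heis])
  fix \<mu> assume d: "of_nat (wlev \<mu>) = d"
  consider "n < 0" | "n = 0" | "n > 0" "nat (n - 1) \<in># \<mu>" | "n > 0" "nat (n - 1) \<notin># \<mu>"
    by linarith
  then show "heis p n (basis \<mu> k) \<in> gr k (d - of_int n)"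
  proof cases
    case 1
    have "of_nat (wlev (add_mset (nat (- n - 1)) \<mu>)) = d - of_int n"
      using 1 d by (simp add: of_nat_nat)
    then show ?thesis using 1 gr_basis[of "add_mset (nat (- n - 1)) \<mu>" k]
      by (simp add: heis_basis)
  next
    case 3
    have "of_nat (wlev (\<mu> - {#nat (n - 1)#})) = d - of_int n"
    proof -
      have "int (wlev (\<mu> - {#nat (n - 1)#})) = int (wlev \<mu>) - n"
        using wlev_diff[OF 3(2)] 3(1) by linarith
      then have "(of_int (int (wlev (\<mu> - {#nat (n - 1)#}))) :: rat) = of_int (int (wlev \<mu>) - n)"
        by (simp only:)
      then show ?thesis using d by simp
    qed
    then show ?thesis using 3 gr_basis[of "\<mu> - {#nat (n - 1)#}" k]
      by (simp add: heis_basis gr_scale)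
  qed (use d in \<open>auto simp: heis_basis not_in_iff intro!: gr_scale gr_basis\<close>)
qed

lemma heis_eventually_0: "\<exists>N. \<forall>n\<ge>N. heis p (int n) v = 0"
proof (induction v rule: fock_induct)
  case (basis \<mu> k)
  have "heis p (int n) (basis \<mu> k) = 0" if "n \<ge> wlev \<mu> + 1" for n
  proof -
    have "heis p (int n) (basis \<mu> k) \<in> gr k (of_nat (wlev \<mu>) - of_int (int n))"
      by (rule gr_heis[OF gr_basis])
    then show ?thesis by (rule gr_neg) (use that in simp)
  qed
  then show ?case by blast
next
  case (add x y)
  then obtain N M where "\<forall>n\<ge>N. heis p (int n) x = 0" "\<forall>n\<ge>M. heis p (int n) y = 0" by blast
  then have "\<forall>n\<ge>max N M. heis p (int n) (x + y) = 0" by (simp add: flin_add[OF flin_heis])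
  then show ?case by blast
next
  case (scale c x)
  then show ?case by (auto simp: flin_scale[OF flin_heis])
qed (simp add: flin_0[OF flin_heis])

text \<open>Up to a nonzero factor, \<alpha>(n+1) reads off the coefficient at
  \<open>add_mset n \<mu>\<close>; hence iterated annihilation followed by the vacuum coefficient
  separates vectors. This turns identities between vectors into identities between complex
  numbers.\<close>

lemma fock_zeroI:
  assumes "\<And>rs K. list_all (\<lambda>r. r > 0) rs \<Longrightarrow> lk (fold (heis p) rs v) ({#}, K) = 0" "p > 0"
  shows "v = 0"
proof -
  have look: "lk (heis p (int n + 1) v) (\<mu>, K)
      = 2 * of_nat p * (of_nat n + 1) * (of_nat (count \<mu> n) + 1) * lk v (add_mset n \<mu>, K)" for n \<mu> K v
  proof (rule clin_eqI[of "\<lambda>v. lk (heis p (int n + 1) v) (\<mu>, K)"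
        "\<lambda>v. 2 * of_nat p * (of_nat n + 1) * (of_nat (count \<mu> n) + 1) * lk v (add_mset n \<mu>, K)"])
    show "clin (\<lambda>v. lk (heis p (int n + 1) v) (\<mu>, K))"
      by (rule clin_comp[OF clin_lookup flin_heis])
    show "clin (\<lambda>v. 2 * of_nat p * (of_nat n + 1) * (of_nat (count \<mu> n) + 1) * lk v (add_mset n \<mu>, K))"
      by (intro clinI) (simp_all add: lookup_add lookup_fscale distrib_left)
    fix \<nu> l
    show "lk (heis p (int n + 1) (basis \<nu> l)) (\<mu>, K)
      = 2 * of_nat p * (of_nat n + 1) * (of_nat (count \<mu> n) + 1) * lk (basis \<nu> l) (add_mset n \<mu>, K)"
    proof (cases "n \<in># \<nu>")
      case True
      then obtain \<nu>' where "\<nu> = add_mset n \<nu>'" by (metis insert_DiffM)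
      then show ?thesis
        by (auto simp: heis_basis lookup_fscale lookup_single when_def nat_add_distrib)
    next
      case False
      then show ?thesis
        by (auto simp: heis_basis lookup_fscale lookup_single when_def not_in_iff)
    qed
  qed
  have "lk v (\<mu>, K) = 0" for \<mu> K
    using assms(1)
  proof (induction \<mu> arbitrary: v)
    case empty
    show ?case using empty[of "[]"] by simp
  next
    case (add n \<mu>)
    have "lk (heis p (int n + 1) v) (\<mu>, K) = 0"
    proof (rule add.IH)
      fix rs :: "int list" and K assume "list_all (\<lambda>r. r > 0) rs"
      then show "lk (fold (heis p) rs (heis p (int n + 1) v)) ({#}, K) = 0"
        using add.prems[of "(int n + 1) # rs" K] by simp
    qed
    moreover have "(of_nat n + 1 :: complex) \<noteq> 0" "(of_nat (count \<mu> n) + 1 :: complex) \<noteq> 0"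
      by (metis of_nat_Suc of_nat_eq_0_iff nat.distinct(1) add.commute)+
    ultimately show ?case using look[of n v \<mu> K] \<open>p > 0\<close> by simp
  qed
  then show ?thesis by (intro poly_mapping_eqI) (auto simp: split_paired_all)
qed

section \<open>Exponentials of Heisenberg operators\<close>

lemma sum_triangle_swap:
  "(\<Sum>i\<le>n. \<Sum>j\<le>n - i. f i j) = (\<Sum>j\<le>n. \<Sum>i\<le>n - j. f i (j::nat) :: 'a::comm_monoid_add)"
proof -
  have *: "{j. j \<in> {..n} \<and> i + j \<le> n} = {..n - i}" "{j. j \<in> {..n} \<and> j + i \<le> n} = {..n - i}"
    if "i \<in> {..n}" for i
    using that by auto
  have "(\<Sum>i\<le>n. \<Sum>j\<le>n - i. f i j) = (\<Sum>i\<in>{..n}. sum (f i) {j. j \<in> {..n} \<and> i + j \<le> n})"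
    by (rule sum.cong[OF refl]) (simp only: *)
  also have "\<dots> = (\<Sum>j\<in>{..n}. sum (\<lambda>i. f i j) {i. i \<in> {..n} \<and> i + j \<le> n})"
    by (rule sum.swap_restrict) auto
  also have "\<dots> = (\<Sum>j\<le>n. \<Sum>i\<le>n - j. f i j)"
    by (rule sum.cong[OF refl]) (simp only: *)
  finally show ?thesis .
qed

lemma flin_op_pow: "(\<And>i. flin (F i)) \<Longrightarrow> flin (op_pow F r n)"
proof (induction r arbitrary: n)
  case 0
  then show ?case by (cases "n = 0") auto
next
  case (Suc r)
  show ?case unfolding op_pow.simps
    by (rule flin_setsum, rule flin_comp) (use Suc in auto)
qed

lemma flin_op_exp: "(\<And>i. flin (F i)) \<Longrightarrow> flin (op_exp F n)"
  unfolding op_exp_def by (rule flin_setsum, rule flin_fscale, rule flin_op_pow)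

lemma op_pow_big:
  assumes "\<And>i. flin (F i)" "\<And>v. F 0 v = 0"
  shows "r > n \<Longrightarrow> op_pow F r n v = 0"
proof (induction r arbitrary: n)
  case (Suc r)
  have "F i (op_pow F r (n - i) v) = 0" if "i \<le> n" for i
  proof (cases "i = 0")
    case False
    then have "r > n - i" using Suc.prems that by linarith
    then show ?thesis by (simp add: Suc.IH flin_0[OF assms(1)])
  qed (simp add: assms)
  then show ?case by simp
qed simp

text \<open>The coefficient form of \<open>x (F^(r+1))' = (r + 1) (x F') F^r\<close>, which holds
  because the coefficients of \<open>F\<close> commute.\<close>

lemma op_pow_newton:
  assumes lin: "\<And>i. flin (F i)" and com: "\<And>i j v. F i (F j v) = F j (F i v)"
  shows "fscale (of_nat n) (op_pow F (Suc r) n v)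
       = fscale (of_nat (Suc r)) (\<Sum>i\<le>n. fscale (of_nat i) (F i (op_pow F r (n - i) v)))"
proof (induction r arbitrary: n)
  case 0
  have e: "fscale (of_nat n) (F i (op_pow F 0 (n - i) v))
      = fscale (of_nat i) (F i (op_pow F 0 (n - i) v))" if "i \<le> n" for i
    using that by (cases "i = n") (auto simp: flin_0[OF lin])
  have "(\<Sum>i\<le>n. fscale (of_nat n) (F i (op_pow F 0 (n - i) v)))
      = (\<Sum>i\<le>n. fscale (of_nat i) (F i (op_pow F 0 (n - i) v)))"
    by (rule sum.cong[OF refl]) (use e in simp)
  then show ?case by (simp add: fock.scale_sum_right)
next
  case (Suc r)
  let ?P = "op_pow F"
  have split: "fscale (of_nat n) (F i (?P (Suc r) (n - i) v))
      = fscale (of_nat i) (F i (?P (Suc r) (n - i) v))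
        + F i (fscale (of_nat (n - i)) (?P (Suc r) (n - i) v))" if "i \<le> n" for i
    using that by (simp add: flin_scale[OF lin] fock.scale_left_distrib[symmetric] of_nat_diff
      del: op_pow.simps)
  have inner: "F i (fscale (of_nat (n - i)) (?P (Suc r) (n - i) v))
     = fscale (of_nat (Suc r)) (\<Sum>j\<le>n - i. fscale (of_nat j) (F j (F i (?P r (n - i - j) v))))" for i
    unfolding Suc.IH by (simp add: flin_scale[OF lin] flin_sum[OF lin] com[of i])
  have "fscale (of_nat n) (?P (Suc (Suc r)) n v)
      = (\<Sum>i\<le>n. fscale (of_nat n) (F i (?P (Suc r) (n - i) v)))"
    by (simp only: op_pow.simps(2)[of F "Suc r"] fock.scale_sum_right)
  also have "\<dots> = (\<Sum>i\<le>n. fscale (of_nat i) (F i (?P (Suc r) (n - i) v)))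
      + (\<Sum>i\<le>n. F i (fscale (of_nat (n - i)) (?P (Suc r) (n - i) v)))"
    unfolding sum.distrib[symmetric] by (rule sum.cong) (use split in auto)
  also have "(\<Sum>i\<le>n. F i (fscale (of_nat (n - i)) (?P (Suc r) (n - i) v)))
      = fscale (of_nat (Suc r)) (\<Sum>i\<le>n. \<Sum>j\<le>n - i. fscale (of_nat j) (F j (F i (?P r (n - i - j) v))))"
    unfolding inner fock.scale_sum_right[symmetric] ..
  also have "(\<Sum>i\<le>n. \<Sum>j\<le>n - i. fscale (of_nat j) (F j (F i (?P r (n - i - j) v))))
      = (\<Sum>j\<le>n. \<Sum>i\<le>n - j. fscale (of_nat j) (F j (F i (?P r (n - i - j) v))))"
    by (rule sum_triangle_swap)
  also have "\<dots> = (\<Sum>j\<le>n. fscale (of_nat j) (F j (?P (Suc r) (n - j) v)))"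
    by (rule sum.cong)
      (auto simp: flin_sum[OF lin] fock.scale_sum_right diff_diff_left add.commute)
  finally have "fscale (of_nat n) (?P (Suc (Suc r)) n v)
      = (\<Sum>i\<le>n. fscale (of_nat i) (F i (?P (Suc r) (n - i) v)))
        + fscale (of_nat (Suc r)) (\<Sum>i\<le>n. fscale (of_nat i) (F i (?P (Suc r) (n - i) v)))" .
  then show ?case
    by (simp del: op_pow.simps of_nat_Suc add: of_nat_Suc[of "Suc r"] fock.scale_left_distrib)
qed

text \<open>The coefficient form of \<open>x (exp F)' = (x F') exp F\<close>. It determines the
  exponential recursively, so that commutators follow by induction on the degree, without powers of
  \<open>F\<close>.\<close>

lemma op_exp_newton:
  assumes lin: "\<And>i. flin (F i)" and com: "\<And>i j v. F i (F j v) = F j (F i v)"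
    and F0: "\<And>v. F 0 v = 0"
  shows "fscale (of_nat n) (op_exp F n v) = (\<Sum>i=1..n. fscale (of_nat i) (F i (op_exp F (n - i) v)))"
proof (cases n)
  case (Suc m)
  let ?P = "op_pow F"
  have "fscale (of_nat n) (op_exp F n v)
      = (\<Sum>r\<le>n. fscale (1 / fact r) (fscale (of_nat n) (?P r n v)))"
    by (simp add: op_exp_def fock.scale_sum_right mult.commute)
  also have "\<dots> = (\<Sum>r\<le>m. fscale (1 / fact (Suc r)) (fscale (of_nat n) (?P (Suc r) n v)))"
    unfolding Suc sum.atMost_Suc_shift by simp
  also have "\<dots> = (\<Sum>r\<le>m. fscale (1 / fact r) (\<Sum>i\<le>n. fscale (of_nat i) (F i (?P r (n - i) v))))"
    unfolding op_pow_newton[of F, OF lin com] by (simp add: field_simps del: of_nat_Suc)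
  also have "\<dots> = (\<Sum>i\<le>n. \<Sum>r\<le>m. fscale (1 / fact r) (fscale (of_nat i) (F i (?P r (n - i) v))))"
    unfolding fock.scale_sum_right by (rule sum.swap)
  also have "\<dots> = (\<Sum>i=1..n. \<Sum>r\<le>m. fscale (1 / fact r) (fscale (of_nat i) (F i (?P r (n - i) v))))"
    by (rule sum.mono_neutral_right) (auto simp: not_le)
  also have "\<dots> = (\<Sum>i=1..n. fscale (of_nat i) (F i (op_exp F (n - i) v)))"
  proof (rule sum.cong[OF refl])
    fix i assume i: "i \<in> {1..n}"
    have trunc: "(\<Sum>r\<le>m. fscale (1 / fact r) (?P r (n - i) v)) = (\<Sum>r\<le>n - i. fscale (1 / fact r) (?P r (n - i) v))"
      using i Suc by (intro sum.mono_neutral_right) (auto simp: op_pow_big[of F, OF lin F0])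
    show "(\<Sum>r\<le>m. fscale (1 / fact r) (fscale (of_nat i) (F i (?P r (n - i) v))))
        = fscale (of_nat i) (F i (op_exp F (n - i) v))"
      unfolding op_exp_def by (simp only: flin_sum[OF lin] flin_scale[OF lin] fock.scale_sum_right
          fock.scale_left_commute[of "of_nat i"] trunc[symmetric])
  qed
  finally show ?thesis .
qed simp

lemma op_exp_0: "op_exp F 0 v = v"
  by (simp add: op_exp_def)

lemma gr_op_pow:
  assumes "\<And>i l d v. v \<in> gr l d \<Longrightarrow> F i v \<in> gr l (d + e * of_nat i)"
  shows "v \<in> gr l d \<Longrightarrow> op_pow F r n v \<in> gr l (d + e * of_nat n)"
proof (induction r arbitrary: n)
  case (Suc r)
  have "F i (op_pow F r (n - i) v) \<in> gr l (d + e * of_nat n)" if "i \<le> n" for i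
    using assms[OF Suc.IH[OF Suc.prems, of "n - i"], of i] that
    by (simp add: of_nat_diff algebra_simps)
  then show ?case by (auto intro: gr_sum)
qed auto

lemma gr_op_exp:
  assumes "\<And>i l d v. v \<in> gr l d \<Longrightarrow> F i v \<in> gr l (d + e * of_nat i)" "v \<in> gr l d"
  shows "op_exp F n v \<in> gr l (d + e * of_nat n)"
  unfolding op_exp_def by (intro gr_sum gr_scale gr_op_pow assms)

text \<open>The hypotheses characterise the exponential \<open>G\<close> of \<open>c \<Sum>\<^sub>i h(\<plusminus>i)/i\<close>.\<close>

lemma newton_comm:
  fixes G :: "nat \<Rightarrow> fock \<Rightarrow> fock" and e :: int
  assumes G0: "\<And>v. G 0 v = v"
    and newton: "\<And>n v. fscale (of_nat n) (G n v) = (\<Sum>i=1..n. fscale c (heis p (e * int i) (G (n - i) v)))"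
    and e: "e = 1 \<or> e = - 1"
  shows "heis p r (G n v) = G n (heis p r v)
     + (if - e * r > 0 \<and> nat (- e * r) \<le> n
        then fscale (- 2 * of_nat p * of_int e * c) (G (n - nat (- e * r)) v) else 0)"
proof (induction n arbitrary: v rule: less_induct)
  case (less n)
  define s where "s = nat (- e * r)"
  define z where "z = - 2 * of_nat p * of_int e * c"
  have ee: "e * (e * x) = x" for x using e by auto
  let ?R = "\<lambda>n. if - e * r > 0 \<and> s \<le> n then fscale z (G (n - s) v) else 0"
  show ?case
  proof (cases "n = 0")
    case True
    then show ?thesis by (auto simp: G0)
  next
    case False
    have trm: "heis p r (heis p (e * int i) (G (n - i) v))
        = heis p (e * int i) (G (n - i) (heis p r v)) + heis p (e * int i) (?R (n - i))
          + (if i = s \<and> - e * r > 0 then fscale (2 * of_nat p * of_int r) (G (n - s) v) else 0)"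
      if i: "i \<in> {1..n}" for i
    proof -
      have c: "(r + e * int i = 0) = (i = s \<and> - e * r > 0)"
        using i e by (auto simp: s_def)
      have IH: "heis p r (G (n - i) v) = G (n - i) (heis p r v) + ?R (n - i)"
        unfolding s_def z_def by (rule less.IH) (use i False in auto)
      show ?thesis
        unfolding heis_comm[of p r "e * int i"] IH c flin_add[OF flin_heis]
        by (intro arg_cong2[of _ _ _ _ "(+)"] refl) auto
    qed
    \<comment> \<open>The three sums contribute \<open>n\<close>, \<open>n - s\<close> and
      \<open>s\<close> times the expected terms. The last two combine to the factor
      \<open>n\<close>, which then cancels.\<close>
    have "fscale (of_nat n) (heis p r (G n v)) = (\<Sum>i=1..n. fscale c (heis p r (heis p (e * int i) (G (n - i) v))))"
      by (simp add: flin_scale[OF flin_heis, symmetric] newton flin_sum[OF flin_heis])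
    also have "\<dots> = (\<Sum>i=1..n. fscale c (heis p (e * int i) (G (n - i) (heis p r v))))
        + (\<Sum>i=1..n. fscale c (heis p (e * int i) (?R (n - i))))
        + (\<Sum>i=1..n. if i = s \<and> - e * r > 0 then fscale (c * (2 * of_nat p * of_int r)) (G (n - s) v) else 0)"
      unfolding sum.distrib[symmetric]
      by (rule sum.cong) (auto simp: trm fock.scale_right_distrib)
    also have "(\<Sum>i=1..n. fscale c (heis p (e * int i) (G (n - i) (heis p r v))))
        = fscale (of_nat n) (G n (heis p r v))"
      by (simp add: newton)
    also have "(\<Sum>i=1..n. fscale c (heis p (e * int i) (?R (n - i)))) = fscale (of_nat (n - s)) (?R n)"
    proof (cases "- e * r > 0 \<and> s \<le> n")
      case True
      have "(\<Sum>i=1..n. fscale c (heis p (e * int i) (?R (n - i))))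
          = (\<Sum>i=1..n - s. fscale c (heis p (e * int i) (fscale z (G (n - s - i) v))))"
        using True by (intro sum.mono_neutral_cong_right)
          (auto simp: flin_0[OF flin_heis] add.commute[of s])
      also have "\<dots> = fscale z (fscale (of_nat (n - s)) (G (n - s) v))"
        by (simp add: newton flin_scale[OF flin_heis] fock.scale_sum_right fock.scale_left_commute mult.commute)
      finally show ?thesis using True by (simp add: mult.commute)
    next
      case False
      then have R0: "?R (n - i) = 0" "?R n = 0" for i by auto
      show ?thesis by (simp only: R0 flin_0[OF flin_heis] fock.scale_zero_right sum.neutral_const)
    qed
    also have "(\<Sum>i=1..n. if i = s \<and> - e * r > 0 then fscale (c * (2 * of_nat p * of_int r)) (G (n - s) v) else 0)
        = fscale (of_nat s) (?R n)"
    proof (cases "- e * r > 0 \<and> s \<le> n")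
      case True
      then have "s \<in> {1..n}" by (auto simp: s_def)
      moreover have "of_nat s = - of_int e * (of_int r :: complex)"
        using True by (metis (no_types, lifting) mult_minus_left of_int_minus of_int_mult of_int_of_nat_eq s_def
            int_nat_eq order_less_imp_le)
      moreover have "of_int e * of_int e = (1 :: complex)" using e by auto
      ultimately show ?thesis using True
        by (simp add: z_def if_distrib algebra_simps cong: if_cong)
    next
      case False
      then have "\<not> (i = s \<and> - e * r > 0)" if "i \<in> {1..n}" for i using that by auto
      then show ?thesis using False by (auto intro!: sum.neutral)
    qed
    finally have "fscale (of_nat n) (heis p r (G n v)) = fscale (of_nat n) (G n (heis p r v))
        + (fscale (of_nat (n - s)) (?R n) + fscale (of_nat s) (?R n))"
      by (simp only: add.assoc)
    also have "fscale (of_nat (n - s)) (?R n) + fscale (of_nat s) (?R n) = fscale (of_nat n) (?R n)"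
      by (auto simp: fock.scale_left_distrib[symmetric] of_nat_add[symmetric] simp del: of_nat_add)
    finally have "fscale (of_nat n) (heis p r (G n v)) = fscale (of_nat n) (G n (heis p r v) + ?R n)"
      by (simp only: fock.scale_right_distrib)
    then show ?thesis using False by (simp add: s_def z_def)
  qed
qed

locale lattice_va =
  fixes p :: nat
  assumes p2: "p \<ge> 2"
begin

abbreviation h :: "int \<Rightarrow> fock \<Rightarrow> fock" where "h \<equiv> heis p"

lemma p0: "p > 0" "of_nat p \<noteq> (0::complex)" "of_nat p \<noteq> (0::rat)" "(of_nat p::rat) > 0"
  using p2 by auto

text \<open>The index is an integer, with value 0 at negative ones, so that shifts such as
  \<open>a - r\<close> in \<open>h_EM\<close> need no case distinction.\<close>

definition EM :: "int \<Rightarrow> int \<Rightarrow> fock \<Rightarrow> fock" where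
  "EM k a v = (if a < 0 then 0 else Eminus p k (nat a) v)"

definition EP :: "int \<Rightarrow> int \<Rightarrow> fock \<Rightarrow> fock" where
  "EP k a v = (if a < 0 then 0 else Eplus p k (nat a) v)"

abbreviation (input) Fm where
  "Fm k \<equiv> (\<lambda>n v. if n = 0 then 0 else fscale (of_int k / (2 * of_nat p * of_nat n)) (heis p (- int n) v))"

abbreviation (input) Fp where
  "Fp k \<equiv> (\<lambda>n v. if n = 0 then 0 else fscale (- (of_int k / (2 * of_nat p * of_nat n))) (heis p (int n) v))"

lemma flin_if_scaled: "flin (\<lambda>v. if n = 0 then 0 else fscale c (h r v))"
  by (cases "n = 0") (simp_all only: if_True if_False flin_zero flin_fscale[OF flin_heis] simp_thms)

lemmas flin_Fm = flin_if_scaled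
lemmas flin_Fp = flin_if_scaled

lemma Fm_comm: "Fm k i (Fm k j v) = Fm k j (Fm k i v)"
  by (simp add: flin_scale[OF flin_heis] flin_0[OF flin_heis] fock.scale_left_commute heis_comm[of p "- int i" "- int j"])

lemma Fp_comm: "Fp k i (Fp k j v) = Fp k j (Fp k i v)"
  by (simp add: flin_scale[OF flin_heis] flin_0[OF flin_heis] flin_uminus[OF flin_heis] fock.scale_left_commute mult.commute heis_comm[of p "int i" "int j"])

lemma flin_EM: "flin (EM k a)"
proof (cases "a < 0")
  case True
  then have "EM k a = (\<lambda>v. 0)" by (simp add: EM_def fun_eq_iff)
  then show ?thesis by simp
next
  case False
  then have "EM k a = op_exp (Fm k) (nat a)" by (simp add: EM_def fun_eq_iff Eminus_def)
  then show ?thesis using flin_op_exp[of "Fm k", OF flin_Fm] by simp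
qed

lemma flin_EP: "flin (EP k a)"
proof (cases "a < 0")
  case True
  then have "EP k a = (\<lambda>v. 0)" by (simp add: EP_def fun_eq_iff)
  then show ?thesis by simp
next
  case False
  then have "EP k a = op_exp (Fp k) (nat a)" by (simp add: EP_def fun_eq_iff Eplus_def)
  then show ?thesis using flin_op_exp[of "Fp k", OF flin_Fp] by simp
qed

lemma EM_0 [simp]: "EM k 0 v = v" and EP_0 [simp]: "EP k 0 v = v"
  by (simp_all add: EM_def EP_def Eminus_def Eplus_def op_exp_0)

lemma EM_neg: "a < 0 \<Longrightarrow> EM k a v = 0" and EP_neg: "a < 0 \<Longrightarrow> EP k a v = 0"
  by (simp_all add: EM_def EP_def)

lemma Eminus_newton:
  "fscale (of_nat n) (Eminus p k n v)
    = (\<Sum>i=1..n. fscale (of_int k / (2 * of_nat p)) (h (- 1 * int i) (Eminus p k (n - i) v)))"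
proof -
  have "fscale (of_nat n) (op_exp (Fm k) n v)
     = (\<Sum>i=1..n. fscale (of_nat i) (Fm k i (op_exp (Fm k) (n - i) v)))"
    by (rule op_exp_newton[of "Fm k", OF flin_Fm Fm_comm]) auto
  also have "\<dots> = (\<Sum>i=1..n. fscale (of_int k / (2 * of_nat p)) (h (- 1 * int i) (op_exp (Fm k) (n - i) v)))"
    by (rule sum.cong) (use p0 in auto)
  finally show ?thesis by (simp add: Eminus_def)
qed

lemma Eplus_newton:
  "fscale (of_nat n) (Eplus p k n v)
    = (\<Sum>i=1..n. fscale (- of_int k / (2 * of_nat p)) (h (1 * int i) (Eplus p k (n - i) v)))"
proof -
  have "fscale (of_nat n) (op_exp (Fp k) n v)
     = (\<Sum>i=1..n. fscale (of_nat i) (Fp k i (op_exp (Fp k) (n - i) v)))"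
    by (rule op_exp_newton[of "Fp k", OF flin_Fp Fp_comm]) auto
  also have "\<dots> = (\<Sum>i=1..n. fscale (- of_int k / (2 * of_nat p)) (h (1 * int i) (op_exp (Fp k) (n - i) v)))"
    by (rule sum.cong) (use p0 in auto)
  finally show ?thesis by (simp add: Eplus_def)
qed

lemma h_EM: "h r (EM k a v) = EM k a (h r v) + (if r > 0 then fscale (of_int k) (EM k (a - r) v) else 0)"
proof (cases "a < 0")
  case True
  then show ?thesis by (auto simp: EM_def flin_0[OF flin_heis])
next
  case False
  have "h r (Eminus p k (nat a) v) = Eminus p k (nat a) (h r v)
     + (if - (- 1) * r > 0 \<and> nat (- (- 1) * r) \<le> nat a
        then fscale (- 2 * of_nat p * of_int (- 1) * (of_int k / (2 * of_nat p)))
          (Eminus p k (nat a - nat (- (- 1) * r)) v) else 0)"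
    by (rule newton_comm[of "Eminus p k", OF _ Eminus_newton]) (simp_all add: Eminus_def op_exp_0)
  then show ?thesis using False p0
    by (auto simp: EM_def nat_diff_distrib nat_le_iff)
qed

lemma h_EP: "h r (EP k a v) = EP k a (h r v) + (if r < 0 then fscale (of_int k) (EP k (a + r) v) else 0)"
proof (cases "a < 0")
  case True
  then show ?thesis by (auto simp: EP_def flin_0[OF flin_heis])
next
  case False
  have "h r (Eplus p k (nat a) v) = Eplus p k (nat a) (h r v)
     + (if - 1 * r > 0 \<and> nat (- 1 * r) \<le> nat a
        then fscale (- 2 * of_nat p * of_int 1 * (- of_int k / (2 * of_nat p)))
          (Eplus p k (nat a - nat (- 1 * r)) v) else 0)"
    by (rule newton_comm[of "Eplus p k", OF _ Eplus_newton]) (simp_all add: Eplus_def op_exp_0)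
  moreover have "nat a - nat (- r) = nat (a + r)" if "r < 0"
    using that False by (simp add: nat_diff_distrib'[symmetric])
  ultimately show ?thesis using False p0
    by (auto simp: EP_def nat_le_iff)
qed

lemma gr_Fm: "v \<in> gr l d \<Longrightarrow> Fm k i v \<in> gr l (d + 1 * of_nat i)"
  using gr_heis[of v l d p "- int i"] by (auto intro!: gr_scale)

lemma gr_Fp: "v \<in> gr l d \<Longrightarrow> Fp k i v \<in> gr l (d + (- 1) * of_nat i)"
  using gr_heis[of v l d p "int i"] by (auto simp del: fock.scale_minus_left intro!: gr_scale)

lemma gr_EM: "v \<in> gr l d \<Longrightarrow> EM k a v \<in> gr l (d + of_int a)"
  using gr_op_exp[of "Fm k" 1 v l d "nat a", OF gr_Fm] by (auto simp: EM_def Eminus_def)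

lemma gr_EP: "v \<in> gr l d \<Longrightarrow> EP k a v \<in> gr l (d - of_int a)"
  using gr_op_exp[of "Fp k" "- 1" v l d "nat a", OF gr_Fp] by (auto simp: EP_def Eplus_def)

lemma EP_finite: "finite {b. EP k b v \<noteq> 0}"
proof (induction v rule: fock_induct)
  case (basis \<mu> l)
  have "EP k b (basis \<mu> l) = 0" if "b > int (wlev \<mu>)" for b
  proof (rule gr_neg)
    show "EP k b (basis \<mu> l) \<in> gr l (of_nat (wlev \<mu>) - of_int b)"
      by (rule gr_EP[OF gr_basis])
    have "rat_of_int (int (wlev \<mu>)) < of_int b" using that by (simp only: of_int_less_iff)
    then show "of_nat (wlev \<mu>) - of_int b < (0::rat)" by simp
  qed
  then have "{b. EP k b (basis \<mu> l) \<noteq> 0} \<subseteq> {0..int (wlev \<mu>)}"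
    by (auto simp: EP_neg not_less[symmetric])
  then show ?case by (rule finite_subset) simp
next
  case (add x y)
  have "{b. EP k b (x + y) \<noteq> 0} \<subseteq> {b. EP k b x \<noteq> 0} \<union> {b. EP k b y \<noteq> 0}"
    by (auto simp: flin_add[OF flin_EP])
  then show ?case using add by (meson finite_UnI finite_subset)
next
  case (scale c x)
  have "{b. EP k b (fscale c x) \<noteq> 0} \<subseteq> {b. EP k b x \<noteq> 0}"
    by (auto simp: flin_scale[OF flin_EP])
  then show ?case using scale by (meson finite_subset)
qed (simp add: flin_0[OF flin_EP])

section \<open>Vertex operators of exponentials\<close>

text \<open>The product of the creation and the annihilation exponential, cut to the part that
  raises the level by \<open>C\<close>. The shift of charge and the power of x are split off, since
  they only decide which \<open>C\<close> belongs to a mode.\<close>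

definition vertop :: "int \<Rightarrow> int \<Rightarrow> fock \<Rightarrow> fock" where
  "vertop k C v = Sum_any (\<lambda>b::int. EM k (b + C) (EP k b v))"

lemma vertop_superset:
  "finite A \<Longrightarrow> {b. EP k b v \<noteq> 0} \<subseteq> A \<Longrightarrow> vertop k C v = (\<Sum>b\<in>A. EM k (b + C) (EP k b v))"
  unfolding vertop_def
  by (rule Sum_any.expand_superset) (auto simp: flin_0[OF flin_EM])

lemma flin_vertop: "flin (vertop k C)"
proof (rule flinI)
  fix x y
  let ?A = "{b. EP k b x \<noteq> 0} \<union> {b. EP k b y \<noteq> 0}"
  have A: "finite ?A" by (simp add: EP_finite)
  show "vertop k C (x + y) = vertop k C x + vertop k C y"
    using A by (subst (1 2 3) vertop_superset[of ?A])
      (auto simp: flin_add[OF flin_EP] flin_add[OF flin_EM] sum.distrib)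
next
  fix c x
  show "vertop k C (fscale c x) = fscale c (vertop k C x)"
    by (subst (1 2) vertop_superset[OF EP_finite[of k x]])
      (auto simp: flin_scale[OF flin_EP] flin_scale[OF flin_EM] fock.scale_sum_right)
qed

lemma h_vertop:
  assumes "r \<noteq> 0"
  shows "h r (vertop k C v) = vertop k C (h r v) + fscale (of_int k) (vertop k (C - r) v)"
proof -
  let ?A = "{b. EP k b v \<noteq> 0} \<union> {b. EP k b (h r v) \<noteq> 0}"
  \<comment> \<open>Contains a translate of \<open>?A\<close>, so that the sum can be reindexed by
    \<open>b + r\<close> when the commutator comes from \<open>EP\<close>.\<close>
  let ?B = "?A \<union> (\<lambda>b. b - r) ` ?A"
  have A: "finite ?B" by (simp add: EP_finite)
  have e: "h r (vertop k C v) = (\<Sum>b\<in>?B. h r (EM k (b + C) (EP k b v)))"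
    using A by (subst vertop_superset[of ?B]) (auto simp: flin_sum[OF flin_heis])
  have e2: "vertop k C (h r v) = (\<Sum>b\<in>?B. EM k (b + C) (EP k b (h r v)))"
    using A by (subst vertop_superset[of ?B]) auto
  show ?thesis
  proof (cases "r > 0")
    case True
    have "vertop k (C - r) v = (\<Sum>b\<in>?B. EM k (b + (C - r)) (EP k b v))"
      using A by (subst vertop_superset[of ?B]) auto
    then show ?thesis unfolding e e2 using True
      by (simp add: h_EM h_EP sum.distrib fock.scale_sum_right algebra_simps)
  next
    case False
    then have r: "r < 0" using assms by simp
    have "(\<Sum>b\<in>?B. EM k (b + C) (EP k (b + r) v)) = (\<Sum>b\<in>(\<lambda>b. b + r) ` ?B. EM k (b - r + C) (EP k b v))"
      by (subst sum.reindex) (auto simp: inj_on_def)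
    also have "\<dots> = vertop k (C - r) v"
    proof -
      have "vertop k (C - r) v = (\<Sum>b\<in>(\<lambda>b. b + r) ` ?B. EM k (b + (C - r)) (EP k b v))"
      proof (rule vertop_superset)
        have "b \<in> (\<lambda>b. b + r) ` ?B" if "EP k b v \<noteq> 0" for b
          using that by (intro image_eqI[of _ _ "b - r"]) auto
        then show "{b. EP k b v \<noteq> 0} \<subseteq> (\<lambda>b. b + r) ` ?B" by blast
      qed (use A in simp)
      then show ?thesis by (simp add: algebra_simps)
    qed
    finally have shift: "(\<Sum>b\<in>?B. EM k (b + C) (EP k (b + r) v)) = vertop k (C - r) v" .
    have "h r (vertop k C v) = (\<Sum>b\<in>?B. EM k (b + C) (EP k b (h r v)) + fscale (of_int k) (EM k (b + C) (EP k (b + r) v)))"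
      unfolding e using r
      by (intro sum.cong) (auto simp: h_EM h_EP flin_add[OF flin_EM] flin_scale[OF flin_EM])
    then show ?thesis
      unfolding e2 shift[symmetric] by (simp add: sum.distrib fock.scale_sum_right)
  qed
qed

lemma gr_vertop: "v \<in> gr l d \<Longrightarrow> vertop k C v \<in> gr l (d + of_int C)"
proof -
  assume v: "v \<in> gr l d"
  have "EM k (b + C) (EP k b v) \<in> gr l (d + of_int C)" for b
    using gr_EM[OF gr_EP[OF v, of k b], of k "b + C"] by (simp add: algebra_simps)
  then show ?thesis unfolding vertop_def by (intro gr_Sum_any)
qed

definition shift_charge :: "int \<Rightarrow> fock \<Rightarrow> fock" where
  "shift_charge k = lin_ext (\<lambda>\<mu> l. basis \<mu> (l + k))"

lemma flin_shift_charge: "flin (shift_charge k)"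
  by (simp add: shift_charge_def flin_lin_ext)

lemma shift_charge_basis: "shift_charge k (basis \<mu> l) = basis \<mu> (l + k)"
  by (simp add: shift_charge_def lin_ext_basis)

lemma h_shift_charge: "r \<noteq> 0 \<Longrightarrow> h r (shift_charge k v) = shift_charge k (h r v)"
  by (rule flin_eqI[of "\<lambda>v. h r (shift_charge k v)" "\<lambda>v. shift_charge k (h r v)"])
    (auto intro!: flin_comp[OF flin_heis flin_shift_charge] flin_comp[OF flin_shift_charge flin_heis]
      simp: shift_charge_basis heis_basis flin_scale[OF flin_shift_charge])

text \<open>The mode prescribes \<open>a - b\<close>, so the double sum of the definition has one
  free index left, and is empty if the prescribed difference is not an integer.\<close>

lemma exp_mode_basis:
  "exp_mode p k m (basis \<mu> l) =
    (let c = - m - 1 - of_int (k * l) / of_nat (2 * p)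
     in if c \<in> \<int> then vertop k \<lfloor>c\<rfloor> (shift_charge k (basis \<mu> l)) else 0)"
proof -
  define c where "c = - m - 1 - of_int (k * l) / of_nat (2 * p)"
  define w where "w = basis \<mu> (l + k)"
  have cond: "(of_nat a - of_nat b + of_int (k * l) / of_nat (2 * p) = - m - 1) \<longleftrightarrow> c = of_int (int a - int b)"
    for a b :: nat unfolding c_def by (auto simp: algebra_simps)
  have E: "exp_mode p k m (basis \<mu> l) = Sum_any (\<lambda>(a :: nat, b :: nat).
     if c = of_int (int a - int b) then EM k (int a) (EP k (int b) w) else 0)"
    unfolding exp_mode_def lin_ext_basis cond by (simp add: EM_def EP_def w_def cong: if_cong)
  show ?thesis
  proof (cases "c \<in> \<int>")
    case False
    then have "c \<noteq> of_int (int a - int b)" for a b :: nat by (metis Ints_of_int)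
    then show ?thesis using False unfolding E c_def[symmetric] by (simp add: case_prod_unfold)
  next
    case True
    then obtain C where C: "c = of_int C" by (auto elim: Ints_cases)
    let ?A = "{b. EP k b w \<noteq> 0} \<inter> {b. b \<ge> 0 \<and> b + C \<ge> 0}"
    let ?f = "\<lambda>b. (nat (b + C), nat b)"
    have fin: "finite ?A" using EP_finite[of k w] by blast
    have "exp_mode p k m (basis \<mu> l) = (\<Sum>(a, b)\<in>?f ` ?A. EM k (int a) (EP k (int b) w))"
    proof -
      let ?g = "\<lambda>(a :: nat, b :: nat). if c = of_int (int a - int b) then EM k (int a) (EP k (int b) w) else 0"
      have sub: "{ab. ?g ab \<noteq> 0} \<subseteq> ?f ` ?A"
      proof (clarsimp simp: C split: if_splits)
        fix a b :: nat
        assume nz: "EM k (int a) (EP k (int b) w) \<noteq> 0" and "of_int C = rat_of_nat a - rat_of_nat b"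
        then have "rat_of_int C = of_int (int a - int b)" by simp
        then have Ce: "C = int a - int b" by (simp only: of_int_eq_iff)
        have "EP k (int b) w \<noteq> 0" using nz flin_0[OF flin_EM] by metis
        then show "(a, b) \<in> ?f ` ?A" using Ce by (intro image_eqI[of _ _ "int b"]) auto
      qed
      have "exp_mode p k m (basis \<mu> l) = sum ?g (?f ` ?A)"
        unfolding E by (rule Sum_any.expand_superset[OF _ sub]) (use fin in simp)
      also have "\<dots> = (\<Sum>(a, b)\<in>?f ` ?A. EM k (int a) (EP k (int b) w))"
        by (rule sum.cong) (auto simp: C)
      finally show ?thesis .
    qed
    also have "\<dots> = (\<Sum>b\<in>?A. EM k (b + C) (EP k b w))"
      by (subst sum.reindex) (auto simp: inj_on_def intro!: sum.cong)
    also have "\<dots> = vertop k C w"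
      unfolding vertop_superset[OF EP_finite subset_refl, of k C w] using EP_finite[of k w]
      by (intro sum.mono_neutral_left) (auto simp: EP_def EM_def split: if_splits)
    finally show ?thesis unfolding c_def[symmetric] Let_def using C by (simp add: w_def shift_charge_basis)
  qed
qed

lemma h0_gr: "v \<in> gr l d \<Longrightarrow> h 0 v = fscale (of_int l) v"
proof -
  assume v: "v \<in> gr l d"
  have "h 0 v = (\<Sum>a\<in>Poly_Mapping.keys v. fscale (lk v a) (h 0 (Poly_Mapping.single a 1)))"
    using arg_cong[OF fock_expand, of "h 0" v] by (simp add: flin_sum[OF flin_heis] flin_scale[OF flin_heis])
  also have "\<dots> = (\<Sum>a\<in>Poly_Mapping.keys v. fscale (of_int l) (fscale (lk v a) (Poly_Mapping.single a 1)))"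
    by (rule sum.cong) (use v in \<open>auto simp: heis_basis gr_def mult.commute\<close>)
  also have "\<dots> = fscale (of_int l) v"
    by (simp only: fock.scale_sum_right[symmetric] fock_expand[symmetric])
  finally show ?thesis .
qed

lemma flin_exp_mode: "flin (exp_mode p k m)"
  by (simp add: exp_mode_def flin_lin_ext)

lemma lin_ch:
  assumes "flin f" "flin g" "\<And>\<mu>. f (basis \<mu> l) = g (basis \<mu> l)" "\<forall>(\<mu>, k)\<in>Poly_Mapping.keys v. k = l"
  shows "f v = g v"
proof -
  have "f v = (\<Sum>a\<in>Poly_Mapping.keys v. fscale (lk v a) (f (Poly_Mapping.single a 1)))"
    using arg_cong[OF fock_expand, of f v] by (simp add: flin_sum[OF assms(1)] flin_scale[OF assms(1)])
  also have "\<dots> = (\<Sum>a\<in>Poly_Mapping.keys v. fscale (lk v a) (g (Poly_Mapping.single a 1)))"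
    using assms(3,4) by (intro sum.cong) auto
  also have "\<dots> = g v"
    using arg_cong[OF fock_expand, of g v] by (simp add: flin_sum[OF assms(2)] flin_scale[OF assms(2)])
  finally show ?thesis .
qed

lemma exp_mode_ch:
  assumes "\<forall>(\<mu>, k')\<in>Poly_Mapping.keys v. k' = l"
  shows "exp_mode p k m v = (let c = - m - 1 - of_int (k * l) / of_nat (2 * p)
     in if c \<in> \<int> then vertop k \<lfloor>c\<rfloor> (shift_charge k v) else 0)"
proof (rule lin_ch[of "exp_mode p k m" "\<lambda>v. let c = - m - 1 - of_int (k * l) / of_nat (2 * p)
     in if c \<in> \<int> then vertop k \<lfloor>c\<rfloor> (shift_charge k v) else 0", OF flin_exp_mode])
  show "flin (\<lambda>v. let c = - m - 1 - of_int (k * l) / of_nat (2 * p)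
     in if c \<in> \<int> then vertop k \<lfloor>c\<rfloor> (shift_charge k v) else 0)"
    by (cases "- m - 1 - of_int (k * l) / of_nat (2 * p) \<in> \<int>")
      (simp_all add: flin_comp[OF flin_vertop flin_shift_charge])
qed (use assms in \<open>auto simp: exp_mode_basis\<close>)

text \<open>One formula with three origins: \<open>r > 0\<close> gets its contribution from
  \<open>EM\<close>, \<open>r < 0\<close> from \<open>EP\<close>, and \<open>r = 0\<close> from the
  shift of charge.\<close>

lemma h_exp_mode: "h r (exp_mode p k m v) = exp_mode p k m (h r v) + fscale (of_int k) (exp_mode p k (m + of_int r) v)"
proof (rule flin_eqI[of "\<lambda>v. h r (exp_mode p k m v)"
      "\<lambda>v. exp_mode p k m (h r v) + fscale (of_int k) (exp_mode p k (m + of_int r) v)"])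
  fix \<mu> l
  show "h r (exp_mode p k m (basis \<mu> l)) = exp_mode p k m (h r (basis \<mu> l))
      + fscale (of_int k) (exp_mode p k (m + of_int r) (basis \<mu> l))"
  proof (cases "r = 0")
    case True
    let ?c = "- m - 1 - of_int (k * l) / of_nat (2 * p)"
    have "vertop k \<lfloor>?c\<rfloor> (basis \<mu> (l + k)) \<in> gr (l + k) (of_nat (wlev \<mu>) + of_int \<lfloor>?c\<rfloor>)"
      by (rule gr_vertop[OF gr_basis])
    then have "h 0 (vertop k \<lfloor>?c\<rfloor> (basis \<mu> (l + k))) = fscale (of_int (l + k)) (vertop k \<lfloor>?c\<rfloor> (basis \<mu> (l + k)))"
      by (rule h0_gr)
    then show ?thesis using True
      by (simp add: exp_mode_basis shift_charge_basis heis_basis flin_scale[OF flin_exp_mode] flin_0[OF flin_heis]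
          Let_def fock.scale_left_distrib del: of_int_mult of_nat_mult)
  next
    case False
    let ?c = "- m - 1 - of_int (k * l) / of_nat (2 * p)"
    have c2: "- (m + of_int r) - 1 - of_int (k * l) / of_nat (2 * p) = ?c - of_int r" by simp
    have "\<forall>(\<nu>, k')\<in>Poly_Mapping.keys (h r (basis \<mu> l)). k' = l"
      using gr_heis[OF gr_basis[of \<mu> l], of p r] by (auto simp: gr_def)
    note 1 = exp_mode_ch[OF this, of k m]
    show ?thesis
    proof (cases "?c \<in> \<int>")
      case True
      then have "?c - of_int r \<in> \<int>" by simp
      then show ?thesis using True \<open>r \<noteq> 0\<close> unfolding 1 exp_mode_basis c2
        by (simp add: h_vertop h_shift_charge del: of_int_mult of_nat_mult)
    next
      case False
      then have "?c - of_int r \<notin> \<int>" by (metis Ints_add Ints_of_int diff_add_cancel)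
      then show ?thesis using False \<open>r \<noteq> 0\<close> unfolding 1 exp_mode_basis c2
        by (simp add: flin_0[OF flin_heis] del: of_int_mult of_nat_mult)
    qed
  qed
next
  show "flin (\<lambda>v. h r (exp_mode p k m v))"
    by (rule flin_heis'[OF flin_exp_mode])
  show "flin (\<lambda>v. exp_mode p k m (h r v) + fscale (of_int k) (exp_mode p k (m + of_int r) v))"
    by (rule flin_plus[OF flin_comp[OF flin_exp_mode flin_heis] flin_fscale[OF flin_exp_mode]])
qed

lemma gr_exp_mode:
  assumes "v \<in> gr l d"
  shows "exp_mode p k m v \<in> gr (k + l) (d - m - 1 - of_int (k * l) / of_nat (2 * p))"
proof (rule gr_lin[OF flin_exp_mode _ assms])
  fix \<mu> assume d: "of_nat (wlev \<mu>) = d"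
  let ?c = "- m - 1 - of_int (k * l) / of_nat (2 * p)"
  show "exp_mode p k m (basis \<mu> l) \<in> gr (k + l) (d - m - 1 - of_int (k * l) / of_nat (2 * p))"
  proof (cases "?c \<in> \<int>")
    case True
    then have e: "d - m - 1 - of_int (k * l) / of_nat (2 * p) = of_nat (wlev \<mu>) + of_int \<lfloor>?c\<rfloor>"
      using d by (simp del: of_int_mult of_nat_mult)
    show ?thesis unfolding e using True gr_vertop[OF gr_basis[of \<mu> "l + k"], of k "\<lfloor>?c\<rfloor>"]
      by (simp add: exp_mode_basis shift_charge_basis add.commute del: of_int_mult of_nat_mult)
  qed (simp add: exp_mode_basis del: of_int_mult of_nat_mult)
qed

section \<open>Commutators of modes with the Heisenberg operators\<close>

text \<open>Fields in the sense of vertex algebras, except that the modes carry rational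
  indices.\<close>

definition good :: "(rat \<Rightarrow> fock \<Rightarrow> fock) \<Rightarrow> bool" where
  "good A \<longleftrightarrow> (\<forall>m. flin (A m)) \<and> (\<forall>v. \<exists>N::int. \<forall>m\<ge>of_int N. A m v = 0)"

lemma good_flin: "good A \<Longrightarrow> flin (A m)"
  by (simp add: good_def)

lemma evz_rat:
  assumes "\<And>m. m \<ge> of_int N \<Longrightarrow> f m = 0"
  shows "evz (\<lambda>j. f (x + of_nat j :: rat))"
  unfolding evz_def
proof (intro exI allI impI)
  fix j assume "j \<ge> nat \<lceil>of_int N - x\<rceil>"
  then have "of_nat j \<ge> of_int N - x" by linarith
  then show "f (x + of_nat j) = 0" by (intro assms) (simp add: algebra_simps)
qed

lemma good_evz: "good A \<Longrightarrow> evz (\<lambda>j. A (m + of_nat j - of_nat n) v)"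
proof -
  assume "good A"
  then obtain N where "\<And>m. m \<ge> of_int N \<Longrightarrow> A m v = 0" unfolding good_def by blast
  then have "evz (\<lambda>j. A ((m - of_nat n) + of_nat j) v)" by (rule evz_rat)
  then show ?thesis by (simp add: algebra_simps)
qed

lemma evz_heis: "evz (\<lambda>j. h (int j) v)"
  unfolding evz_def by (rule heis_eventually_0)

text \<open>The recursion step of \<open>mon_mode\<close>, that is, the normally ordered product
  with a divided derivative of \<alpha>(x). It is detached from monomials so that it applies to any
  field.\<close>

definition stepm :: "nat \<Rightarrow> (rat \<Rightarrow> fock \<Rightarrow> fock) \<Rightarrow> rat \<Rightarrow> fock \<Rightarrow> fock" where
  "stepm n A m v = Sum_any (\<lambda>j::nat. fscale (of_nat j gchoose n) (h (- int j - 1) (A (m + of_nat j - of_nat n) v)))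
    + Sum_any (\<lambda>j::nat. fscale ((- of_nat j - 1) gchoose n) (A (m - of_nat j - of_nat n - 1) (h (int j) v)))"

lemma mon_mode_Cons: "mon_mode p (n # ns) k m v = stepm n (mon_mode p ns k) m v"
  by (simp add: stepm_def)

lemma evz_creation:
  "good A \<Longrightarrow> evz (\<lambda>j::nat. fscale (c j) (h (d j) (A (m + of_nat j - of_nat n) v)))"
  by (rule evz_comp0[OF good_evz[of A m n v]]) (auto simp: flin_0[OF flin_heis])

lemma evz_annihilation:
  "good A \<Longrightarrow> evz (\<lambda>j::nat. fscale (c j) (A (d j) (h (int j) v)))"
  by (rule evz_comp0[OF evz_heis[of v]]) (auto simp: flin_0[OF good_flin])

lemma good_stepm:
  assumes A: "good A"
  shows "good (stepm n A)"
  unfolding good_def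
proof (intro conjI allI)
  fix m
  show "flin (stepm n A m)"
  proof (rule flinI)
    show "stepm n A m (x + y) = stepm n A m x + stepm n A m y" for x y
      by (simp add: stepm_def flin_add[OF flin_heis] flin_add[OF good_flin[OF A]]
          fock.scale_right_distrib Sum_any_add evz_creation[OF A] evz_annihilation[OF A]
          add.assoc add.left_commute)
    show "stepm n A m (fscale c x) = fscale c (stepm n A m x)" for c x
      by (simp only: stepm_def flin_scale[OF flin_heis] flin_scale[OF good_flin[OF A]]
          fock.scale_left_commute[of _ c] Sum_any_fscale evz_creation[OF A] evz_annihilation[OF A]
          fock.scale_right_distrib)
  qed
next
  fix v
  obtain N0 :: int where N0: "\<And>m. m \<ge> of_int N0 \<Longrightarrow> A m v = 0" using A unfolding good_def by blast
  obtain J where J: "\<And>j. j \<ge> J \<Longrightarrow> h (int j) v = 0" using heis_eventually_0 by blast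
  have "\<forall>j. \<exists>N::int. \<forall>m\<ge>of_int N. A m (h (int j) v) = 0" using A unfolding good_def by blast
  then obtain Nf :: "nat \<Rightarrow> int" where Nf: "\<And>j m. m \<ge> of_int (Nf j) \<Longrightarrow> A m (h (int j) v) = 0" by metis
  \<comment> \<open>Only the finitely many \<open>j < J\<close> matter, so the bounds of the vectors
    \<open>h (int j) v\<close> can be replaced by a common one.\<close>
  define M where "M = (\<Sum>j<J. \<bar>Nf j\<bar>)"
  define N where "N = max (N0 + int n) (M + int J + int n + 1)"
  have "stepm n A m v = 0" if m: "m \<ge> of_int N" for m
  proof -
    have "rat_of_int (N0 + int n) \<le> m" "rat_of_int (M + int J + int n + 1) \<le> m"
      using m by (auto simp: N_def intro: order.trans[rotated])
    then have m1: "of_int N0 + of_nat n \<le> m" and m2: "of_int M + of_nat J + of_nat n + 1 \<le> m" by auto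
    have "A (m + of_nat j - of_nat n) v = 0" for j :: nat
    proof (rule N0)
      have "(0::rat) \<le> of_nat j" by simp
      then show "of_int N0 \<le> m + of_nat j - of_nat n" using m1 by linarith
    qed
    moreover have "A (m - of_nat j - of_nat n - 1) (h (int j) v) = 0" for j :: nat
    proof (cases "j < J")
      case True
      have "Nf j \<le> \<bar>Nf j\<bar>" by simp
      also have "\<dots> \<le> M" unfolding M_def using True by (intro member_le_sum) auto
      finally have "rat_of_int (Nf j) \<le> of_int M" by simp
      moreover have "rat_of_nat j \<le> of_nat J" using True by simp
      ultimately show ?thesis using m2 by (intro Nf) linarith
    qed (simp add: J flin_0[OF good_flin[OF A]])
    ultimately show ?thesis by (simp add: stepm_def flin_0[OF flin_heis])
  qed
  then show "\<exists>N::int. \<forall>m\<ge>of_int N. stepm n A m v = 0" by blast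
qed

lemma good_exp_mode: "good (exp_mode p k)"
  unfolding good_def
proof (intro conjI allI)
  fix v
  show "\<exists>N::int. \<forall>m\<ge>of_int N. exp_mode p k m v = 0"
  proof (induction v rule: fock_induct)
    case (basis \<mu> l)
    let ?x = "of_nat (wlev \<mu>) - of_int (k * l) / of_nat (2 * p) :: rat"
    have "exp_mode p k m (basis \<mu> l) = 0" if m: "m \<ge> of_int \<lceil>?x\<rceil>" for m
    proof (rule gr_neg)
      show "exp_mode p k m (basis \<mu> l) \<in> gr (k + l) (of_nat (wlev \<mu>) - m - 1 - of_int (k * l) / of_nat (2 * p))"
        by (rule gr_exp_mode[OF gr_basis])
      have "?x \<le> m" using m le_of_int_ceiling order.trans by blast
      then show "of_nat (wlev \<mu>) - m - 1 - of_int (k * l) / of_nat (2 * p) < 0" by linarith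
    qed
    then show ?case by blast
  next
    case (add x y)
    then obtain N M :: int where "\<forall>m\<ge>of_int N. exp_mode p k m x = 0" "\<forall>m\<ge>of_int M. exp_mode p k m y = 0"
      by blast
    then have "\<forall>m\<ge>of_int (max N M). exp_mode p k m (x + y) = 0"
      by (simp add: flin_add[OF flin_exp_mode] of_int_max)
    then show ?case by blast
  qed (auto simp: flin_0[OF flin_exp_mode] flin_scale[OF flin_exp_mode])
qed (rule flin_exp_mode)

lemma good_mon: "good (mon_mode p ns k)"
proof (induction ns)
  case Nil
  have "mon_mode p [] k = exp_mode p k" by (simp add: fun_eq_iff)
  then show ?case by (simp add: good_exp_mode)
next
  case (Cons n ns)
  have "mon_mode p (n # ns) k = stepm n (mon_mode p ns k)" by (simp only: fun_eq_iff mon_mode_Cons) simp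
  then show ?case using good_stepm[OF Cons] by simp
qed

lemma good_add: "good A \<Longrightarrow> good B \<Longrightarrow> good (\<lambda>m v. A m v + B m v)"
  unfolding good_def
proof (intro conjI allI)
  fix v assume "(\<forall>m. flin (A m)) \<and> (\<forall>v. \<exists>N::int. \<forall>m\<ge>of_int N. A m v = 0)"
    "(\<forall>m. flin (B m)) \<and> (\<forall>v. \<exists>N::int. \<forall>m\<ge>of_int N. B m v = 0)"
  then obtain N M :: int where "\<forall>m\<ge>of_int N. A m v = 0" "\<forall>m\<ge>of_int M. B m v = 0" by blast
  then have "\<forall>m\<ge>of_int (max N M). A m v + B m v = 0" by (simp add: of_int_max)
  then show "\<exists>N::int. \<forall>m\<ge>of_int N. A m v + B m v = 0" by blast
qed (auto intro: flin_plus)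

lemma good_scale: "good A \<Longrightarrow> good (\<lambda>m v. fscale c (A m v))"
  unfolding good_def by (auto intro: flin_fscale) (metis fock.scale_zero_right)

lemma good_zero: "good (\<lambda>m v. 0)"
  by (simp add: good_def)

lemma good_sum: "(\<And>t. t \<in> S \<Longrightarrow> good (A t)) \<Longrightarrow> good (\<lambda>m v. \<Sum>t\<in>S. A t m v)"
  by (induction S rule: infinite_finite_induct) (auto intro: good_add good_zero)

lemma good_shift: "good A \<Longrightarrow> good (\<lambda>m. A (m + x))"
  unfolding good_def
proof (intro conjI allI)
  fix v assume "(\<forall>m. flin (A m)) \<and> (\<forall>v. \<exists>N::int. \<forall>m\<ge>of_int N. A m v = 0)"
  then obtain N :: int where N: "\<And>m. m \<ge> of_int N \<Longrightarrow> A m v = 0" by blast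
  have "A (m + x) v = 0" if "m \<ge> of_int \<lceil>of_int N - x\<rceil>" for m
    by (rule N) (use that in \<open>linarith\<close>)
  then show "\<exists>N::int. \<forall>m\<ge>of_int N. A (m + x) v = 0" by blast
qed auto

lemma stepm_add:
  assumes A: "good A" and B: "good B"
  shows "stepm n (\<lambda>m v. A m v + B m v) m v = stepm n A m v + stepm n B m v"
  by (simp add: stepm_def flin_add[OF flin_heis] fock.scale_right_distrib Sum_any_add
      evz_creation[OF A] evz_annihilation[OF A] evz_creation[OF B] evz_annihilation[OF B]
      add.assoc add.left_commute)

lemma stepm_scale:
  assumes A: "good A"
  shows "stepm n (\<lambda>m v. fscale c (A m v)) m v = fscale c (stepm n A m v)"
  by (simp only: stepm_def flin_scale[OF flin_heis]
          fock.scale_left_commute[of _ c] Sum_any_fscale evz_creation[OF A] evz_annihilation[OF A]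
          fock.scale_right_distrib)

lemma stepm_zero: "stepm n (\<lambda>m v. 0) m v = 0"
  by (simp add: stepm_def flin_0[OF flin_heis])

lemma stepm_sum:
  "(\<And>t. t \<in> S \<Longrightarrow> good (A t)) \<Longrightarrow> stepm n (\<lambda>m v. \<Sum>t\<in>S. A t m v) m v = (\<Sum>t\<in>S. stepm n (A t) m v)"
proof (induction S rule: infinite_finite_induct)
  case (insert t S)
  then show ?case by (simp add: stepm_add good_sum)
qed (auto simp: stepm_zero)

lemma stepm_shift: "stepm n (\<lambda>m. A (m + x)) m v = stepm n A (m + x) v"
  by (simp add: stepm_def algebra_simps)

text \<open>The last summand is the contraction of \<alpha>(r) with the new letter. It occurs in
  exactly one of the two sums: in the creation part for \<open>r > 0\<close> and in the annihilation
  part for \<open>r \<le> 0\<close>.\<close>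

lemma h_stepm:
  assumes A: "good A" and B: "good B"
    and comm: "\<And>m v. h r (A m v) = A m (h r v) + B m v"
  shows "h r (stepm n A m v) = stepm n A m (h r v) + stepm n B m v
    + fscale (2 * of_nat p * (of_int r * ((of_int r - 1) gchoose n))) (A (m + of_int r - of_nat n - 1) v)"
proof -
  define z where "z = fscale (2 * of_nat p * (of_int r * ((of_int r - 1) gchoose n))) (A (m + of_int r - of_nat n - 1) v)"
  let ?c = "\<lambda>j::nat. of_nat j gchoose n :: complex" and ?d = "\<lambda>j::nat. (- of_nat j - 1) gchoose n :: complex"
  let ?m = "\<lambda>j::nat. m + of_nat j - of_nat n" and ?m' = "\<lambda>j::nat. m - of_nat j - of_nat n - 1"
  have c1: "fscale (?c j) (h r (h (- int j - 1) (A (?m j) v))) =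
      fscale (?c j) (h (- int j - 1) (A (?m j) (h r v))) + fscale (?c j) (h (- int j - 1) (B (?m j) v))
      + (if j = nat (r - 1) \<and> r > 0 then z else 0)" for j
  proof -
    have "(r + (- int j - 1) = 0) = (j = nat (r - 1) \<and> r > 0)" by auto
    moreover have "of_nat (nat (r - 1)) = (of_int r - 1 :: complex)"
      "of_nat (nat (r - 1)) = (of_int r - 1 :: rat)" if "r > 0"
      using that by (simp_all add: of_nat_nat)
    ultimately show ?thesis
      by (auto simp: heis_comm[of p r "- int j - 1"] comm flin_add[OF flin_heis]
          fock.scale_right_distrib z_def algebra_simps)
  qed
  have c2: "fscale (?d j) (h r (A (?m' j) (h (int j) v))) =
      fscale (?d j) (A (?m' j) (h (int j) (h r v))) + fscale (?d j) (B (?m' j) (h (int j) v))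
      + (if j = nat (- r) \<and> r \<le> 0 then z else 0)" for j
  proof -
    have "(r + int j = 0) = (j = nat (- r) \<and> r \<le> 0)" by auto
    moreover have "of_nat (nat (- r)) = (- of_int r :: complex)"
      "of_nat (nat (- r)) = (- of_int r :: rat)" if "r \<le> 0"
      using that by (simp_all add: of_nat_nat)
    ultimately show ?thesis
      by (auto simp: heis_comm[of p r "int j"] comm flin_add[OF good_flin[OF A]] flin_scale[OF good_flin[OF A]]
          flin_0[OF good_flin[OF A]] fock.scale_right_distrib z_def algebra_simps)
  qed
  have ev: "evz (\<lambda>j. if j = a \<and> P then z else 0)" for a and P :: bool
    unfolding evz_def by (intro exI[of _ "Suc a"]) auto
  have delta: "Sum_any (\<lambda>j. if j = a \<and> P then z else 0) = (if P then z else 0)" for a :: nat and P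
    by (cases P) simp_all
  have "h r (stepm n A m v) = Sum_any (\<lambda>j. fscale (?c j) (h r (h (- int j - 1) (A (?m j) v))))
      + Sum_any (\<lambda>j. fscale (?d j) (h r (A (?m' j) (h (int j) v))))"
    by (simp add: stepm_def flin_add[OF flin_heis] Sum_any_flin[OF flin_heis] evz_creation[OF A]
        evz_annihilation[OF A] flin_scale[OF flin_heis])
  also have "Sum_any (\<lambda>j. fscale (?c j) (h r (h (- int j - 1) (A (?m j) v)))) =
      Sum_any (\<lambda>j. fscale (?c j) (h (- int j - 1) (A (?m j) (h r v))))
      + Sum_any (\<lambda>j. fscale (?c j) (h (- int j - 1) (B (?m j) v))) + (if r > 0 then z else 0)"
    unfolding c1 by (simp only: Sum_any_add evz_add evz_creation[OF A] evz_creation[OF B] ev delta)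
  also have "Sum_any (\<lambda>j. fscale (?d j) (h r (A (?m' j) (h (int j) v)))) =
      Sum_any (\<lambda>j. fscale (?d j) (A (?m' j) (h (int j) (h r v))))
      + Sum_any (\<lambda>j. fscale (?d j) (B (?m' j) (h (int j) v))) + (if r \<le> 0 then z else 0)"
    unfolding c2 by (simp only: Sum_any_add evz_add evz_annihilation[OF A] evz_annihilation[OF B] ev delta)
  finally show ?thesis unfolding stepm_def z_def[symmetric] by auto
qed

abbreviation del :: "nat \<Rightarrow> nat list \<Rightarrow> nat list" where
  "del t ns \<equiv> take t ns @ drop (Suc t) ns"

text \<open>The letter \<open>x\<close> is removed by \<alpha>(x+1) with factor
  \<open>2p (x + 1)\<close>; the binomial is the coefficient of this term in the commutator
  formula.\<close>

abbreviation (input) mcoef :: "int \<Rightarrow> nat \<Rightarrow> complex" where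
  "mcoef r x \<equiv> (of_int r gchoose (x + 1)) * (2 * of_nat p * (of_nat x + 1))"

lemma h_mon:
  "h r (mon_mode p ns k m v) = mon_mode p ns k m (h r v) + fscale (of_int k) (mon_mode p ns k (m + of_int r) v)
    + (\<Sum>t<length ns. fscale (mcoef r (ns ! t)) (mon_mode p (del t ns) k (m + of_int r - of_nat (ns ! t) - 1) v))"
proof (induction ns arbitrary: m v)
  case Nil
  then show ?case by (simp add: h_exp_mode)
next
  case (Cons n ns)
  let ?A = "mon_mode p ns k"
  let ?C = "\<lambda>t m v. fscale (mcoef r (ns ! t)) (mon_mode p (del t ns) k (m + (of_int r - of_nat (ns ! t) - 1)) v)"
  let ?B1 = "\<lambda>m v. fscale (of_int k) (?A (m + of_int r) v)"
  let ?B2 = "\<lambda>m v. \<Sum>t<length ns. ?C t m v"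
  have gC: "good (?C t)" for t
    by (rule good_scale[OF good_shift[OF good_mon]])
  have g1: "good ?B1" by (rule good_scale[OF good_shift[OF good_mon]])
  have g2: "good ?B2" by (rule good_sum[OF gC])
  have "h r (stepm n ?A m v) = stepm n ?A m (h r v) + stepm n (\<lambda>m v. ?B1 m v + ?B2 m v) m v
    + fscale (2 * of_nat p * (of_int r * ((of_int r - 1) gchoose n))) (?A (m + of_int r - of_nat n - 1) v)"
    by (rule h_stepm[OF good_mon good_add[OF g1 g2]]) (simp add: Cons.IH add.assoc diff_diff_eq add_diff_eq)
  also have "stepm n (\<lambda>m v. ?B1 m v + ?B2 m v) m v = stepm n ?B1 m v + stepm n ?B2 m v"
    by (rule stepm_add[OF g1 g2])
  also have "stepm n ?B1 m v = fscale (of_int k) (stepm n ?A (m + of_int r) v)"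
    unfolding stepm_scale[OF good_shift[OF good_mon]] stepm_shift[of n ?A] ..
  also have "stepm n ?B2 m v = (\<Sum>t<length ns. fscale (mcoef r (ns ! t))
      (stepm n (mon_mode p (del t ns) k) (m + (of_int r - of_nat (ns ! t) - 1)) v))"
    unfolding stepm_sum[of "{..<length ns}" ?C, OF gC] stepm_scale[OF good_shift[OF good_mon]]
      stepm_shift[of n "mon_mode p _ k"] ..
  also have "2 * of_nat p * (of_int r * ((of_int r - 1) gchoose n)) = mcoef r n"
    by (subst gbinomial_absorption[symmetric]) (simp add: algebra_simps)
  finally show ?case
    unfolding mon_mode_Cons[symmetric] length_Cons sum.lessThan_Suc_shift
    by (simp add: algebra_simps del: mon_mode.simps)
qed

text \<open>Applied to a difference, this says that a vertex operator is determined by its commutators with the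
  Heisenberg operators and by its vacuum components.\<close>

lemma covariant_zero:
  assumes lin: "\<And>m. flin (D m)"
    and comm: "\<And>r m v. r \<noteq> 0 \<Longrightarrow> h r (D m v) = D m (h r v) + fscale (of_int k) (D (m + of_int r) v)"
    and vac: "\<And>m l K. lk (D m (fexp l)) ({#}, K) = 0"
  shows "D m v = 0"
proof -
  have he: "h r (fexp l) = 0" if "r > 0" for r l
    using that by (simp add: fexp_def heis_basis)
  have e0: "D m (fexp l) = 0" for m l
  proof (rule fock_zeroI[OF _ p0(1)])
    fix rs :: "int list" and K
    assume "list_all (\<lambda>r. r > 0) rs"
    \<comment> \<open>Annihilation operators kill \<open>fexp l\<close>, so by covariance they
      merely shift the index of the mode, and the vacuum coefficients decide.\<close>
    then have "\<exists>c m'. fold h rs (fscale b (D m (fexp l))) = fscale c (D m' (fexp l))" for b m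
    proof (induction rs arbitrary: b m)
      case Nil
      then show ?case by auto
    next
      case (Cons r rs)
      then have "h r (fscale b (D m (fexp l))) = fscale (b * of_int k) (D (m + of_int r) (fexp l))"
        by (simp add: comm he flin_0[OF lin] flin_scale[OF flin_heis])
      then show ?case using Cons by simp
    qed
    from this[of 1 m] show "lk (fold h rs (D m (fexp l))) ({#}, K) = 0"
      by (auto simp: lookup_fscale vac)
  qed
  have "D m (basis \<mu> l) = 0" for m \<mu> l
  proof (induction \<mu> arbitrary: m)
    case empty
    then show ?case using e0 by (simp add: fexp_def)
  next
    case (add n \<mu>)
    have b: "basis (add_mset n \<mu>) l = h (- int n - 1) (basis \<mu> l)"
      by (simp add: heis_basis)
    have "h (- int n - 1) (D m (basis \<mu> l)) = D m (h (- int n - 1) (basis \<mu> l))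
        + fscale (of_int k) (D (m + of_int (- int n - 1)) (basis \<mu> l))"
      by (rule comm) simp
    then show ?case unfolding b add.IH by (simp add: flin_0[OF flin_heis])
  qed
  then show ?thesis
    using flin_eqI[of "D m" "\<lambda>v. 0", OF lin flin_zero] by simp
qed

lemma lk_create: "n < 0 \<Longrightarrow> lk (h n v) ({#}, K) = 0"
proof (rule clin_eqI[of "\<lambda>v. lk (h n v) ({#}, K)" "\<lambda>v. 0", OF clin_comp[OF clin_lookup flin_heis]])
  show "clin (\<lambda>v. 0)" by (simp add: clin_def)
qed (auto simp: heis_basis lookup_single when_def)

lemma h_fexp: "r > 0 \<Longrightarrow> h r (fexp l) = 0" "h 0 (fexp l) = fscale (of_int l) (fexp l)"
  by (simp_all add: fexp_def heis_basis)

text \<open>A creation operator on the left leaves no vacuum coefficient, and \<alpha>(j) with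
  \<open>j > 0\<close> kills \<open>fexp l\<close>; only \<alpha>(0) contributes.\<close>

lemma lk_stepm_fexp:
  assumes "good A"
  shows "lk (stepm n A m (fexp l)) ({#}, K) = (- 1) ^ n * of_int l * lk (A (m - of_nat n - 1) (fexp l)) ({#}, K)"
proof -
  have "lk (Sum_any (\<lambda>j::nat. fscale (of_nat j gchoose n) (h (- int j - 1) (A (m + of_nat j - of_nat n) (fexp l))))) ({#}, K) = 0"
    by (subst Sum_any_clin[OF clin_lookup evz_creation[OF assms]]) (simp add: lookup_fscale lk_create)
  moreover have "Sum_any (\<lambda>j::nat. fscale ((- of_nat j - 1) gchoose n) (A (m - of_nat j - of_nat n - 1) (h (int j) (fexp l))))
      = (\<Sum>j<Suc 0. fscale ((- of_nat j - 1) gchoose n) (A (m - of_nat j - of_nat n - 1) (h (int j) (fexp l))))"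
    by (rule Sum_any_bound) (simp add: h_fexp flin_0[OF good_flin[OF assms]])
  moreover have "(- 1 :: complex) gchoose n = (- 1) ^ n"
    by (simp add: gbinomial_pochhammer fact_prod[symmetric] pochhammer_fact[symmetric])
  ultimately show ?thesis
    by (simp add: stepm_def lookup_add lookup_fscale h_fexp flin_scale[OF good_flin[OF assms]])
qed

lemma lk_mon_fexp:
  "lk (mon_mode p ns k m (fexp l)) ({#}, K)
    = (\<Prod>n\<leftarrow>ns. (- 1) ^ n * of_int l) * lk (exp_mode p k (m - (\<Sum>n\<leftarrow>ns. of_nat n + 1)) (fexp l)) ({#}, K)"
proof (induction ns arbitrary: m)
  case (Cons n ns)
  then show ?case
    by (simp add: mon_mode_Cons lk_stepm_fexp[OF good_mon] algebra_simps del: mon_mode.simps(2))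
qed simp

lemma sum_nth_mset: "(\<Sum>t<length ns. g (ns ! t)) = (\<Sum>x\<in>#mset ns. g x :: 'a::comm_monoid_add)"
proof -
  have "(\<Sum>t<length ns. g (ns ! t)) = sum_list (map g ns)"
    by (simp add: sum_list_sum_nth lessThan_atLeast0)
  also have "\<dots> = sum_mset (mset (map g ns))"
    by (simp only: sum_mset_sum_list)
  finally show ?thesis by simp
qed

lemma mset_del: "t < length ns \<Longrightarrow> mset (take t ns) + mset (drop (Suc t) ns) = mset ns - {#ns ! t#}"
  by (metis (no_types, lifting) add_mset_remove_trivial append_take_drop_id Cons_nth_drop_Suc
      mset.simps(2) mset_append union_mset_add_mset_right)

text \<open>Needed because \<open>mode\<close> sorts the letters: a new letter corresponds to
  \<open>stepm\<close> in front only if its position is immaterial. By induction both orders have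
  the same commutators, and they have the same vacuum coefficients, so \<open>covariant_zero\<close>
  applies to the difference.\<close>

lemma mon_perm: "mset xs = mset ys \<Longrightarrow> mon_mode p xs k m v = mon_mode p ys k m v"
proof (induction "length xs" arbitrary: xs ys m v rule: less_induct)
  case less
  define g where "g r m v x = fscale (mcoef r x)
      (mon_mode p (sorted_list_of_multiset (mset xs - {#x#})) k (m + of_int r - of_nat x - 1) v)" for r m v x
  have len: "length ys = length xs" using less.prems mset_eq_length by metis
  have del: "(\<Sum>t<length zs. fscale (mcoef r (zs ! t)) (mon_mode p (del t zs) k (m + of_int r - of_nat (zs ! t) - 1) v))
      = (\<Sum>x\<in>#mset xs. g r m v x)" if zs: "mset zs = mset xs" for zs r m v
  proof -
    have "length zs = length xs" using zs mset_eq_length by metis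
    then have "mon_mode p (del t zs) k m' v = mon_mode p (sorted_list_of_multiset (mset xs - {#zs ! t#})) k m' v"
      if "t < length zs" for t m'
      using that zs by (intro less.hyps) (auto simp: mset_del)
    then have "(\<Sum>t<length zs. fscale (mcoef r (zs ! t)) (mon_mode p (del t zs) k (m + of_int r - of_nat (zs ! t) - 1) v))
       = (\<Sum>t<length zs. g r m v (zs ! t))" unfolding g_def by (intro sum.cong) auto
    then show ?thesis using sum_nth_mset[of "g r m v" zs] zs by simp
  qed
  define D where "D m v = mon_mode p xs k m v - mon_mode p ys k m v" for m v
  have "D m v = 0"
  proof (rule covariant_zero[of D k])
    show "flin (D m)" for m unfolding D_def by (intro flin_minus good_flin[OF good_mon])
    show "h r (D m v) = D m (h r v) + fscale (of_int k) (D (m + of_int r) v)" for r m v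
      unfolding D_def flin_diff[OF flin_heis] h_mon del[OF refl] del[OF less.prems[symmetric]]
      by (simp add: fock.scale_right_diff_distrib)
    have "mset (map f xs) = mset (map f ys)" for f :: "nat \<Rightarrow> complex"
      using less.prems by simp
    then have "prod_list (map f xs) = prod_list (map f ys)" for f :: "nat \<Rightarrow> complex"
      by (metis prod_mset_prod_list)
    moreover have "mset (map f xs) = mset (map f ys)" for f :: "nat \<Rightarrow> rat"
      using less.prems by simp
    then have "sum_list (map f xs) = sum_list (map f ys)" for f :: "nat \<Rightarrow> rat"
      by (metis sum_mset_sum_list)
    ultimately show "lk (D m (fexp l)) ({#}, K) = 0" for m l K
      unfolding D_def lookup_minus lk_mon_fexp by simp
  qed
  then show ?case by (simp add: D_def)
qed

section \<open>Modes of arbitrary vectors\<close>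

definition mset_mode :: "nat multiset \<Rightarrow> int \<Rightarrow> rat \<Rightarrow> fock \<Rightarrow> fock" where
  "mset_mode \<mu> k = mon_mode p (sorted_list_of_multiset \<mu>) k"

lemma good_mset_mode: "good (mset_mode \<mu> k)"
  by (simp add: mset_mode_def good_mon)

lemma mset_mode_empty: "mset_mode {#} k = exp_mode p k"
  by (simp add: mset_mode_def fun_eq_iff)

lemma mset_mode_add: "mset_mode (add_mset n \<mu>) k m v = stepm n (mset_mode \<mu> k) m v"
  unfolding mset_mode_def mon_mode_Cons[symmetric] by (rule mon_perm) simp

lemma h_mset_mode:
  "h r (mset_mode \<mu> k m v) = mset_mode \<mu> k m (h r v) + fscale (of_int k) (mset_mode \<mu> k (m + of_int r) v)
    + (\<Sum>x\<in>#\<mu>. fscale (mcoef r x) (mset_mode (\<mu> - {#x#}) k (m + of_int r - of_nat x - 1) v))"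
proof -
  let ?ns = "sorted_list_of_multiset \<mu>"
  have "(\<Sum>t<length ?ns. fscale (mcoef r (?ns ! t)) (mon_mode p (del t ?ns) k (m + of_int r - of_nat (?ns ! t) - 1) v))
    = (\<Sum>t<length ?ns. (\<lambda>x. fscale (mcoef r x) (mset_mode (\<mu> - {#x#}) k (m + of_int r - of_nat x - 1) v)) (?ns ! t))"
  proof (rule sum.cong[OF refl])
    fix t assume "t \<in> {..<length ?ns}"
    then have "mset (del t ?ns) = mset (sorted_list_of_multiset (\<mu> - {#?ns ! t#}))"
      by (simp add: mset_del)
    note mon_perm[OF this]
    then show "fscale (mcoef r (?ns ! t)) (mon_mode p (del t ?ns) k (m + of_int r - of_nat (?ns ! t) - 1) v)
      = fscale (mcoef r (?ns ! t)) (mset_mode (\<mu> - {#?ns ! t#}) k (m + of_int r - of_nat (?ns ! t) - 1) v)"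
      by (simp only: mset_mode_def)
  qed
  also have "\<dots> = (\<Sum>x\<in>#\<mu>. fscale (mcoef r x) (mset_mode (\<mu> - {#x#}) k (m + of_int r - of_nat x - 1) v))"
    using sum_nth_mset[of "\<lambda>x. fscale (mcoef r x) (mset_mode (\<mu> - {#x#}) k (m + of_int r - of_nat x - 1) v)" ?ns]
    by simp
  finally show ?thesis unfolding mset_mode_def h_mon by simp
qed

lemma mode_lin: "mode p u m v = lin_ext (\<lambda>\<mu> k. mset_mode \<mu> k m v) u"
  by (simp add: mode_def mset_mode_def)

lemma mode_basis: "mode p (basis \<mu> k) m v = mset_mode \<mu> k m v"
  by (simp add: mode_lin lin_ext_basis)

lemma flin_mode1: "flin (\<lambda>u. mode p u m v)"
  unfolding mode_lin by (rule flin_lin_ext)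

lemma flin_mode2: "flin (mode p u m)"
proof (induction u rule: fock_induct)
  case zero
  have "mode p 0 m = (\<lambda>v. 0)" using flin_0[OF flin_mode1] by blast
  then show ?case by simp
next
  case (basis \<mu> k)
  have "mode p (basis \<mu> k) m = mset_mode \<mu> k m" by (simp add: fun_eq_iff mode_basis)
  then show ?case by (simp add: good_flin[OF good_mset_mode])
next
  case (add x y)
  have "mode p (x + y) m = (\<lambda>v. mode p x m v + mode p y m v)" using flin_add[OF flin_mode1] by blast
  then show ?case using add by (simp add: flin_plus)
next
  case (scale c x)
  have "mode p (fscale c x) m = (\<lambda>v. fscale c (mode p x m v))" using flin_scale[OF flin_mode1] by blast
  then show ?case using scale by (simp add: flin_fscale)
qed

lemma good_mode: "good (mode p u)"
proof (induction u rule: fock_induct)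
  case zero
  have "mode p 0 = (\<lambda>m v. 0)" using flin_0[OF flin_mode1] by blast
  then show ?case by (simp add: good_zero)
next
  case (basis \<mu> k)
  have "mode p (basis \<mu> k) = mset_mode \<mu> k" by (simp add: fun_eq_iff mode_basis)
  then show ?case by (simp add: good_mset_mode)
next
  case (add x y)
  have "mode p (x + y) = (\<lambda>m v. mode p x m v + mode p y m v)" using flin_add[OF flin_mode1] by blast
  then show ?case using add by (simp add: good_add)
next
  case (scale c x)
  have "mode p (fscale c x) = (\<lambda>m v. fscale c (mode p x m v))" using flin_scale[OF flin_mode1] by blast
  then show ?case using scale by (simp add: good_scale)
qed

lemmas mode_add1 = flin_add[OF flin_mode1]
lemmas mode_scale1 = flin_scale[OF flin_mode1]
lemmas mode_01 = flin_0[OF flin_mode1]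
lemmas mode_sum1 = flin_sum[OF flin_mode1]
lemmas mode_add2 = flin_add[OF flin_mode2]
lemmas mode_scale2 = flin_scale[OF flin_mode2]
lemmas mode_02 = flin_0[OF flin_mode2]
lemmas mode_sum2 = flin_sum[OF flin_mode2]
lemmas h_add = flin_add[OF flin_heis]
lemmas h_scale = flin_scale[OF flin_heis]
lemmas h_0 = flin_0[OF flin_heis]
lemma evz_mode1: "evz f \<Longrightarrow> evz (\<lambda>i. fscale (c i) (mode p (f i) (d i) v))"
  by (rule evz_comp0) (auto simp: mode_01)

lemma sum_count_mset:
  "finite S \<Longrightarrow> set_mset \<mu> \<subseteq> S \<Longrightarrow> (\<Sum>x\<in>#\<mu>. g x) = (\<Sum>x\<in>S. fscale (of_nat (count \<mu> x)) (g x))"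
proof (induction \<mu>)
  case (add n \<mu>)
  have "(\<Sum>x\<in>S. fscale (of_nat (count (add_mset n \<mu>) x)) (g x))
      = (\<Sum>x\<in>S. fscale (of_nat (count \<mu> x)) (g x) + (if x = n then g x else 0))"
    by (rule sum.cong) (auto simp: fock.scale_left_distrib)
  then show ?case using add by (simp add: sum.distrib)
qed simp

text \<open>The commutator formula with \<alpha>(x). On a monomial, \<open>i = 0\<close> gives the
  charge and \<open>i = x + 1\<close> the contraction with the letter \<open>x\<close>.\<close>

theorem h_mode:
  "h r (mode p u m v) = mode p u m (h r v)
    + Sum_any (\<lambda>i::nat. fscale (of_int r gchoose i) (mode p (h (int i) u) (m + of_int r - of_nat i) v))"
proof (induction u rule: fock_induct)
  case zero
  then show ?case by (simp add: mode_01 h_0)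
next
  case (add x y)
  then show ?case
    by (simp add: mode_add1 h_add fock.scale_right_distrib Sum_any_add evz_mode1[OF evz_heis])
next
  case (scale c x)
  have "Sum_any (\<lambda>i::nat. fscale (of_int r gchoose i) (mode p (h (int i) (fscale c x)) (m + of_int r - of_nat i) v))
    = fscale c (Sum_any (\<lambda>i::nat. fscale (of_int r gchoose i) (mode p (h (int i) x) (m + of_int r - of_nat i) v)))"
    by (simp only: mode_scale1 h_scale fock.scale_left_commute[of _ c] Sum_any_fscale evz_mode1[OF evz_heis])
  then show ?case by (simp only: scale mode_scale1 h_scale fock.scale_right_distrib)
next
  case (basis \<mu> k)
  let ?f = "\<lambda>i::nat. fscale (of_int r gchoose i) (mode p (h (int i) (basis \<mu> k)) (m + of_int r - of_nat i) v)"
  let ?g = "\<lambda>x. fscale (mcoef r x) (mset_mode (\<mu> - {#x#}) k (m + of_int r - of_nat x - 1) v)"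
  define N where "N = Suc (Max (insert 0 (set_mset \<mu>)))"
  have N: "set_mset \<mu> \<subseteq> {..<N}" unfolding N_def by (auto simp: less_Suc_eq_le)
  have f0: "?f 0 = fscale (of_int k) (mset_mode \<mu> k (m + of_int r) v)"
    by (simp add: heis_basis mode_scale1 mode_basis)
  have fS: "?f (Suc x) = fscale (of_nat (count \<mu> x)) (?g x)" for x
    by (simp add: heis_basis mode_scale1 mode_basis nat_add_distrib add.commute mult.commute mult.left_commute
        diff_diff_eq)
  have z: "?f j = 0" if j: "j \<ge> Suc N" for j
  proof -
    obtain x where x: "j = Suc x" "x \<ge> N" using j by (cases j) auto
    then have "x \<notin># \<mu>" using N by auto
    then show ?thesis unfolding x(1) fS by (simp add: not_in_iff)
  qed
  have "Sum_any ?f = sum ?f {..<Suc N}"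
    by (rule Sum_any_bound) (rule z)
  also have "\<dots> = ?f 0 + (\<Sum>x<N. ?f (Suc x))"
    by (rule sum.lessThan_Suc_shift)
  also have "(\<Sum>x<N. ?f (Suc x)) = (\<Sum>x<N. fscale (of_nat (count \<mu> x)) (?g x))"
    unfolding fS ..
  also have "\<dots> = (\<Sum>x\<in>set_mset \<mu>. fscale (of_nat (count \<mu> x)) (?g x))"
    using N by (intro sum.mono_neutral_right) (auto simp: not_in_iff)
  also have "\<dots> = (\<Sum>x\<in>#\<mu>. ?g x)"
    by (rule sum_count_mset[symmetric]) auto
  finally show ?case unfolding mode_basis h_mset_mode f0 by (simp add: add.assoc)
qed

lemma mode_create: "mode p (h (- int n - 1) u) m v = stepm n (mode p u) m v"
proof (induction u rule: fock_induct)
  case zero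
  have "mode p 0 = (\<lambda>m v. 0)" by (simp add: fun_eq_iff mode_01)
  then show ?case by (simp add: h_0 mode_01 stepm_zero)
next
  case (basis \<mu> k)
  have "mode p (basis \<mu> k) = mset_mode \<mu> k" by (simp add: fun_eq_iff mode_basis)
  then show ?case by (simp add: heis_basis mode_basis mset_mode_add)
next
  case (add x y)
  have "mode p (x + y) = (\<lambda>m v. mode p x m v + mode p y m v)" by (simp add: fun_eq_iff mode_add1)
  then show ?case by (simp add: h_add mode_add1 add stepm_add good_mode)
next
  case (scale c x)
  have "mode p (fscale c x) = (\<lambda>m v. fscale c (mode p x m v))" by (simp add: fun_eq_iff mode_scale1)
  then show ?case by (simp add: h_scale mode_scale1 scale stepm_scale good_mode)
qed

text \<open>The inner product of k\<alpha>/2p and l\<alpha>/2p, the source of all fractional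
  exponents.\<close>

definition sp :: "int \<Rightarrow> int \<Rightarrow> rat" where
  "sp k l = of_int (k * l) / of_nat (2 * p)"

lemma sp_add1: "sp (k + k') l = sp k l + sp k' l" and sp_add2: "sp k (l + l') = sp k l + sp k l'"
  by (simp_all add: sp_def ring_distribs add_divide_distrib)

lemma sp_commute: "sp k l = sp l k"
  by (simp add: sp_def mult.commute)

lemma gr_mset_mode:
  assumes "v \<in> gr l d"
  shows "mset_mode \<mu> k m v \<in> gr (k + l) (of_nat (wlev \<mu>) + d - m - 1 - sp k l)"
  using assms
proof (induction \<mu> arbitrary: m v d)
  case empty
  then show ?case using gr_exp_mode[of v l d k m] by (simp add: mset_mode_empty sp_def)
next
  case (add n \<mu>)
  have "h (- int j - 1) (mset_mode \<mu> k (m + of_nat j - of_nat n) v)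
      \<in> gr (k + l) (of_nat (wlev (add_mset n \<mu>)) + d - m - 1 - sp k l)" for j
    using gr_heis[OF add.IH[OF add.prems, of "m + of_nat j - of_nat n"], of p "- int j - 1"]
    by (simp add: algebra_simps)
  moreover have "mset_mode \<mu> k (m - of_nat j - of_nat n - 1) (h (int j) v)
      \<in> gr (k + l) (of_nat (wlev (add_mset n \<mu>)) + d - m - 1 - sp k l)" for j
    using add.IH[OF gr_heis[OF add.prems, of p "int j"], of "m - of_nat j - of_nat n - 1"]
    by (simp add: algebra_simps)
  ultimately show ?case
    unfolding mset_mode_add stepm_def by (intro gr_add gr_Sum_any gr_scale)
qed

lemma gr_mode:
  assumes "u \<in> gr k d" "v \<in> gr l e"
  shows "mode p u m v \<in> gr (k + l) (d + e - m - 1 - sp k l)"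
  by (rule gr_lin[OF flin_mode1 _ assms(1)]) (use gr_mset_mode[OF assms(2)] in \<open>auto simp: mode_basis\<close>)

section \<open>The Borcherds identity for coefficient arrays\<close>

text \<open>
  An array \<open>c\<close> collects the coefficients of the three expansions of one and the same rational function
  in \<open>x\<close> and \<open>y\<close>: \<open>c 1\<close> for \<open>|x| > |y|\<close>, \<open>c 2\<close> for \<open>|y| > |x|\<close>, \<open>c 3\<close> in powers of \<open>x - y\<close> and \<open>y\<close>.
  Multiplying this function by a power of \<open>x\<close>, \<open>y\<close> or \<open>x - y\<close> preserves the Borcherds identity.
\<close>

type_synonym arr = "nat \<Rightarrow> rat \<Rightarrow> rat \<Rightarrow> complex"

text \<open>The parameters stand for the inner products of the charges of u and v, of u and w, and
  of v and w. The three exponents run over the integers shifted by them, and the sign is that of the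
  integer \<open>L\<close>, since a fractional power of -1 has no meaning here.\<close>

definition borch_id :: "rat \<Rightarrow> rat \<Rightarrow> rat \<Rightarrow> arr \<Rightarrow> bool" where
  "borch_id s t r c \<longleftrightarrow> (\<forall>L M N :: int.
     Sum_any (\<lambda>j::nat. (of_rat (of_int M - t) gchoose j) * c 3 (of_int L - s + of_nat j) (of_int M - t + (of_int N - r) - of_nat j))
   = Sum_any (\<lambda>j::nat. (- 1) ^ j * (of_rat (of_int L - s) gchoose j) *
      (c 1 (of_int M - t + (of_int L - s) - of_nat j) (of_int N - r + of_nat j)
       - (- 1) powi L * c 2 (of_int M - t + of_nat j) (of_int N - r + (of_int L - s) - of_nat j))))"

definition trunc_arr :: "arr \<Rightarrow> bool" where
  "trunc_arr c \<longleftrightarrow> (\<exists>N::int. \<forall>a b. (b \<ge> of_int N \<longrightarrow> c 1 a b = 0) \<and> (a \<ge> of_int N \<longrightarrow> c 2 a b = 0) \<and> (a \<ge> of_int N \<longrightarrow> c 3 a b = 0))"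

definition borch_arr :: "rat \<Rightarrow> rat \<Rightarrow> rat \<Rightarrow> arr \<Rightarrow> bool" where
  "borch_arr s t r c \<longleftrightarrow> trunc_arr c \<and> borch_id s t r c"

lemma evz_rat2:
  assumes "\<And>m. m \<ge> of_int N \<Longrightarrow> (\<And>x. f x m = 0)"
  shows "evz (\<lambda>j. g j * (f (d j) (x + of_nat j :: rat) :: complex))"
  unfolding evz_def
proof (intro exI allI impI)
  fix j assume "j \<ge> nat \<lceil>of_int N - x\<rceil>"
  then have "of_nat j \<ge> of_int N - x" by linarith
  then have "f (d j) (x + of_nat j) = 0" by (intro assms) (simp add: algebra_simps)
  then show "g j * f (d j) (x + of_nat j) = 0" by simp
qed

lemma trunc_arr_evz:
  assumes "trunc_arr c"
  shows "evz (\<lambda>j. g j * c 1 (d j) (x + of_nat j))" "evz (\<lambda>j. g j * c 2 (x + of_nat j) (d j))"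
    "evz (\<lambda>j. g j * c 3 (x + of_nat j) (d j))"
proof -
  obtain N :: int where N: "\<And>a b. b \<ge> of_int N \<Longrightarrow> c 1 a b = 0" "\<And>a b. a \<ge> of_int N \<Longrightarrow> c 2 a b = 0"
    "\<And>a b. a \<ge> of_int N \<Longrightarrow> c 3 a b = 0" using assms unfolding trunc_arr_def by blast
  show "evz (\<lambda>j. g j * c 1 (d j) (x + of_nat j))" by (rule evz_rat2[of N "c 1"]) (rule N)
  show "evz (\<lambda>j. g j * c 2 (x + of_nat j) (d j))" by (rule evz_rat2[of N "\<lambda>b a. c 2 a b"]) (rule N)
  show "evz (\<lambda>j. g j * c 3 (x + of_nat j) (d j))" by (rule evz_rat2[of N "\<lambda>b a. c 3 a b"]) (rule N)
qed

lemma evz_diff: "evz f \<Longrightarrow> evz g \<Longrightarrow> evz (\<lambda>j. f j - (g j :: complex))"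
  using evz_add[of f "\<lambda>j. - g j"] evz_comp0[of g "\<lambda>j. - g j"] by simp

lemma evz_cmult: "evz f \<Longrightarrow> evz (\<lambda>j. x * (f j :: complex))"
  by (rule evz_comp0) auto

lemma trunc_arr_evz_rhs:
  assumes "trunc_arr c"
  shows "evz (\<lambda>j. g j * (c 1 (d j) (x + of_nat j) - e * c 2 (y + of_nat j) (d' j)))"
  using evz_diff[OF trunc_arr_evz(1)[OF assms, of g d x] trunc_arr_evz(2)[OF assms, of "\<lambda>j. g j * e" y d']]
  by (simp add: algebra_simps)

lemma trunc_arr_add: "trunc_arr c \<Longrightarrow> trunc_arr d \<Longrightarrow> trunc_arr (\<lambda>k a b. c k a b + d k a b)"
proof -
  assume "trunc_arr c" "trunc_arr d"
  then obtain N M :: int where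
    "\<forall>a b. (b \<ge> of_int N \<longrightarrow> c 1 a b = 0) \<and> (a \<ge> of_int N \<longrightarrow> c 2 a b = 0) \<and> (a \<ge> of_int N \<longrightarrow> c 3 a b = 0)"
    "\<forall>a b. (b \<ge> of_int M \<longrightarrow> d 1 a b = 0) \<and> (a \<ge> of_int M \<longrightarrow> d 2 a b = 0) \<and> (a \<ge> of_int M \<longrightarrow> d 3 a b = 0)"
    unfolding trunc_arr_def by blast
  then show ?thesis unfolding trunc_arr_def by (intro exI[of _ "max N M"]) (simp add: of_int_max)
qed

lemma trunc_arr_scale: "trunc_arr c \<Longrightarrow> trunc_arr (\<lambda>k a b. e * c k a b)"
  unfolding trunc_arr_def by auto

lemma borch_arr_add:
  assumes "borch_arr s t r c" "borch_arr s t r d"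
  shows "borch_arr s t r (\<lambda>k a b. c k a b + d k a b)"
proof -
  have trunc_arr: "trunc_arr c" "trunc_arr d" using assms by (auto simp: borch_arr_def)
  have "borch_id s t r (\<lambda>k a b. c k a b + d k a b)"
    unfolding borch_id_def
  proof (intro allI)
    fix L M N :: int
    let ?l = "of_int L - s" and ?m = "of_int M - t" and ?n = "of_int N - r"
    have 1: "Sum_any (\<lambda>j::nat. (of_rat ?m gchoose j) * c 3 (?l + of_nat j) (?m + ?n - of_nat j))
      = Sum_any (\<lambda>j::nat. (- 1) ^ j * (of_rat ?l gchoose j) * (c 1 (?m + ?l - of_nat j) (?n + of_nat j)
       - (- 1) powi L * c 2 (?m + of_nat j) (?n + ?l - of_nat j)))"
      "Sum_any (\<lambda>j::nat. (of_rat ?m gchoose j) * d 3 (?l + of_nat j) (?m + ?n - of_nat j))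
      = Sum_any (\<lambda>j::nat. (- 1) ^ j * (of_rat ?l gchoose j) * (d 1 (?m + ?l - of_nat j) (?n + of_nat j)
       - (- 1) powi L * d 2 (?m + of_nat j) (?n + ?l - of_nat j)))"
      using assms by (auto simp: borch_arr_def borch_id_def)
    have r: "x * (c1 + d1 - y * (c2 + d2)) = x * (c1 - y * c2) + x * (d1 - y * d2)" for x y c1 c2 d1 d2 :: complex
      by (simp add: algebra_simps)
    show "Sum_any (\<lambda>j::nat. (of_rat ?m gchoose j) * (c 3 (?l + of_nat j) (?m + ?n - of_nat j) + d 3 (?l + of_nat j) (?m + ?n - of_nat j)))
      = Sum_any (\<lambda>j::nat. (- 1) ^ j * (of_rat ?l gchoose j) * (c 1 (?m + ?l - of_nat j) (?n + of_nat j) + d 1 (?m + ?l - of_nat j) (?n + of_nat j)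
       - (- 1) powi L * (c 2 (?m + of_nat j) (?n + ?l - of_nat j) + d 2 (?m + of_nat j) (?n + ?l - of_nat j))))"
      unfolding r distrib_left[of "of_rat _ gchoose _"]
        Sum_any_add[OF trunc_arr_evz(3)[OF trunc_arr(1)] trunc_arr_evz(3)[OF trunc_arr(2)]] 1
        Sum_any_add[OF trunc_arr_evz_rhs[OF trunc_arr(1)] trunc_arr_evz_rhs[OF trunc_arr(2)]] ..
  qed
  then show ?thesis using trunc_arr_add[OF trunc_arr] by (simp add: borch_arr_def)
qed

lemma borch_arr_scale:
  assumes "borch_arr s t r c"
  shows "borch_arr s t r (\<lambda>k a b. e * c k a b)"
proof -
  have trunc_arr: "trunc_arr c" using assms by (auto simp: borch_arr_def)
  have "borch_id s t r (\<lambda>k a b. e * c k a b)"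
    unfolding borch_id_def
  proof (intro allI)
    fix L M N :: int
    let ?l = "of_int L - s" and ?m = "of_int M - t" and ?n = "of_int N - r"
    have 1: "Sum_any (\<lambda>j::nat. (of_rat ?m gchoose j) * c 3 (?l + of_nat j) (?m + ?n - of_nat j))
      = Sum_any (\<lambda>j::nat. (- 1) ^ j * (of_rat ?l gchoose j) * (c 1 (?m + ?l - of_nat j) (?n + of_nat j)
       - (- 1) powi L * c 2 (?m + of_nat j) (?n + ?l - of_nat j)))"
      using assms by (auto simp: borch_arr_def borch_id_def)
    have r: "x * (e * c1 - y * (e * c2)) = e * (x * (c1 - y * c2))" for x y c1 c2 :: complex
      by (simp add: algebra_simps)
    show "Sum_any (\<lambda>j::nat. (of_rat ?m gchoose j) * (e * c 3 (?l + of_nat j) (?m + ?n - of_nat j)))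
      = Sum_any (\<lambda>j::nat. (- 1) ^ j * (of_rat ?l gchoose j) * (e * c 1 (?m + ?l - of_nat j) (?n + of_nat j)
       - (- 1) powi L * (e * c 2 (?m + of_nat j) (?n + ?l - of_nat j))))"
      unfolding r mult.left_commute[of "of_rat _ gchoose _" e]
        Sum_any_cmult[OF trunc_arr_evz(3)[OF trunc_arr]] 1 Sum_any_cmult[OF trunc_arr_evz_rhs[OF trunc_arr]] ..
  qed
  then show ?thesis using trunc_arr_scale[OF trunc_arr] by (simp add: borch_arr_def)
qed

lemma borch_arr_zero: "borch_arr s t r (\<lambda>k a b. 0)"
  by (auto simp: borch_arr_def borch_id_def trunc_arr_def)

lemma borch_arr_sum: "(\<And>i. i \<in> A \<Longrightarrow> borch_arr s t r (c i)) \<Longrightarrow> borch_arr s t r (\<lambda>k a b. \<Sum>i\<in>A. c i k a b)"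
  by (induction A rule: infinite_finite_induct) (auto intro: borch_arr_zero borch_arr_add)

text \<open>\<open>(1 + z)^x (1 + z)^y = (1 + z)^(x + y)\<close>, paired with a sequence. It merges
  the expansion of a new factor with the one already present in the Borcherds identity.\<close>

lemma Vandermonde_Sum_any:
  fixes g :: "nat \<Rightarrow> complex"
  assumes "evz g"
  shows "Sum_any (\<lambda>j. (x gchoose j) * Sum_any (\<lambda>i. (y gchoose i) * g (j + i)))
      = Sum_any (\<lambda>k. ((x + y) gchoose k) * g k)"
proof -
  obtain N where N: "\<And>j. j \<ge> N \<Longrightarrow> g j = 0" using assms unfolding evz_def by blast
  have inner: "Sum_any (\<lambda>i. (y gchoose i) * g (j + i)) = (\<Sum>i<N. (y gchoose i) * g (j + i))" for j
    by (rule Sum_any_bound) (simp add: N)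
  have "Sum_any (\<lambda>j. (x gchoose j) * Sum_any (\<lambda>i. (y gchoose i) * g (j + i)))
      = (\<Sum>j<N. (x gchoose j) * (\<Sum>i<N. (y gchoose i) * g (j + i)))"
    unfolding inner by (rule Sum_any_bound) (simp add: N)
  also have "\<dots> = (\<Sum>(j, i)\<in>{..<N} \<times> {..<N}. (x gchoose j) * ((y gchoose i) * g (j + i)))"
    by (simp add: sum_distrib_left sum.cartesian_product)
  also have "\<dots> = (\<Sum>(j, i)\<in>{(j, i). j + i < N}. (x gchoose j) * ((y gchoose i) * g (j + i)))"
    by (rule sum.mono_neutral_right) (auto, meson N not_le)
  also have "\<dots> = (\<Sum>k<N. \<Sum>j\<le>k. (x gchoose j) * ((y gchoose (k - j)) * g (j + (k - j))))"
    by (rule sum.triangle_reindex)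
  also have "\<dots> = (\<Sum>k<N. ((x + y) gchoose k) * g k)"
  proof (rule sum.cong[OF refl])
    fix k
    have "(\<Sum>j\<le>k. (x gchoose j) * ((y gchoose (k - j)) * g (j + (k - j))))
       = (\<Sum>j\<le>k. (x gchoose j) * (y gchoose (k - j))) * g k"
      by (simp add: sum_distrib_right mult.assoc)
    then show "(\<Sum>j\<le>k. (x gchoose j) * ((y gchoose (k - j)) * g (j + (k - j)))) = ((x + y) gchoose k) * g k"
      using gbinomial_Vandermonde[of x y k] by (simp add: atMost_atLeast0)
  qed
  also have "\<dots> = Sum_any (\<lambda>k. ((x + y) gchoose k) * g k)"
    by (rule Sum_any_bound[symmetric]) (simp add: N)
  finally show ?thesis .
qed

text \<open>Multiplication by \<open>x^P\<close>: a shift in the first two expansions, while in the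
  third \<open>x = (x - y) + y\<close> is expanded in nonnegative powers of
  \<open>x - y\<close>.\<close>

definition mulx :: "int \<Rightarrow> arr \<Rightarrow> arr" where
  "mulx P c k a b = (if k = 3 then Sum_any (\<lambda>i::nat. (of_int P gchoose i) * c 3 (a + of_nat i) (b + of_int P - of_nat i))
     else c k (a + of_int P) b)"

definition muly :: "int \<Rightarrow> arr \<Rightarrow> arr" where
  "muly P c k a b = c k a (b + of_int P)"

text \<open>Multiplication by \<open>(x - y)^P\<close>, expanded in each of the domains; the power
  of -1 turns \<open>x - y\<close> into \<open>y - x\<close>.\<close>

definition mulz :: "int \<Rightarrow> arr \<Rightarrow> arr" where
  "mulz P c k a b =
    (if k = 1 then Sum_any (\<lambda>i::nat. (- 1) ^ i * (of_int P gchoose i) * c 1 (a + of_int P - of_nat i) (b + of_nat i))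
     else if k = 2 then (- 1) powi P * Sum_any (\<lambda>i::nat. (- 1) ^ i * (of_int P gchoose i) * c 2 (a + of_nat i) (b + of_int P - of_nat i))
     else c k (a + of_int P) b)"

text \<open>The right side only sees \<open>M\<close> replaced by \<open>M + P\<close>; on the left,
  Vandermonde merges the two expansions.\<close>

lemma borch_arr_mulx:
  assumes "borch_arr s t r c"
  shows "borch_arr s t r (mulx P c)"
proof -
  have trunc_arr: "trunc_arr c" using assms by (auto simp: borch_arr_def)
  then obtain N :: int where N: "\<And>a b. b \<ge> of_int N \<Longrightarrow> c 1 a b = 0" "\<And>a b. a \<ge> of_int N \<Longrightarrow> c 2 a b = 0"
    "\<And>a b. a \<ge> of_int N \<Longrightarrow> c 3 a b = 0" unfolding trunc_arr_def by blast
  have "trunc_arr (mulx P c)"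
    unfolding trunc_arr_def
  proof (intro exI[of _ "max N (N - P)"] allI conjI impI)
    fix a b :: rat assume a: "of_int (max N (N - P)) \<le> a"
    then have "of_int N \<le> a" "of_int N \<le> a + of_int P" by (auto simp: of_int_max)
    then have "of_int N \<le> a + of_nat i" for i :: nat by (simp add: add_increasing2)
    then show "mulx P c 2 a b = 0" "mulx P c 3 a b = 0"
      using \<open>of_int N \<le> a + of_int P\<close> by (simp_all add: mulx_def N)
  next
    fix a b :: rat assume a: "of_int (max N (N - P)) \<le> b"
    then show "mulx P c 1 a b = 0" by (simp add: mulx_def N[unfolded One_nat_def] of_int_max)
  qed
  moreover have "borch_id s t r (mulx P c)"
    unfolding borch_id_def
  proof (intro allI)
    fix L M N :: int
    let ?l = "of_int L - s" and ?m = "of_int M - t" and ?n = "of_int N - r"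
    have old: "Sum_any (\<lambda>j::nat. (of_rat (of_int (M + P) - t) gchoose j) * c 3 (?l + of_nat j) (of_int (M + P) - t + ?n - of_nat j))
      = Sum_any (\<lambda>j::nat. (- 1) ^ j * (of_rat ?l gchoose j) * (c 1 (of_int (M + P) - t + ?l - of_nat j) (?n + of_nat j)
       - (- 1) powi L * c 2 (of_int (M + P) - t + of_nat j) (?n + ?l - of_nat j)))"
      using assms unfolding borch_arr_def borch_id_def by blast
    have "Sum_any (\<lambda>j::nat. (of_rat ?m gchoose j) * mulx P c 3 (?l + of_nat j) (?m + ?n - of_nat j))
       = Sum_any (\<lambda>j::nat. (of_rat ?m gchoose j) * Sum_any (\<lambda>i::nat. (of_int P gchoose i) *
           (\<lambda>k. c 3 (?l + of_nat k) (of_int (M + P) - t + ?n - of_nat k)) (j + i)))"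
      by (simp add: mulx_def algebra_simps)
    also have "\<dots> = Sum_any (\<lambda>k::nat. ((of_rat ?m + of_int P) gchoose k) * c 3 (?l + of_nat k) (of_int (M + P) - t + ?n - of_nat k))"
      by (rule Vandermonde_Sum_any) (use trunc_arr_evz(3)[OF trunc_arr, of "\<lambda>_. 1"] in simp)
    also have "of_rat ?m + of_int P = (of_rat (of_int (M + P) - t) :: complex)"
      by (simp add: of_rat_diff of_rat_add)
    finally show "Sum_any (\<lambda>j::nat. (of_rat ?m gchoose j) * mulx P c 3 (?l + of_nat j) (?m + ?n - of_nat j))
      = Sum_any (\<lambda>j::nat. (- 1) ^ j * (of_rat ?l gchoose j) * (mulx P c 1 (?m + ?l - of_nat j) (?n + of_nat j)
       - (- 1) powi L * mulx P c 2 (?m + of_nat j) (?n + ?l - of_nat j)))"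
      unfolding old by (simp add: mulx_def algebra_simps)
  qed
  ultimately show ?thesis by (simp add: borch_arr_def)
qed

lemma borch_arr_muly:
  assumes "borch_arr s t r c"
  shows "borch_arr s t r (muly P c)"
proof -
  have trunc_arr: "trunc_arr c" using assms by (auto simp: borch_arr_def)
  then obtain N :: int where N: "\<And>a b. b \<ge> of_int N \<Longrightarrow> c 1 a b = 0" "\<And>a b. a \<ge> of_int N \<Longrightarrow> c 2 a b = 0"
    "\<And>a b. a \<ge> of_int N \<Longrightarrow> c 3 a b = 0" unfolding trunc_arr_def by blast
  have "trunc_arr (muly P c)"
    unfolding trunc_arr_def
  proof (intro exI[of _ "max N (N - P)"] allI conjI impI)
    fix a b :: rat assume a: "of_int (max N (N - P)) \<le> b"
    then have "of_int N \<le> b + of_int P" by (auto simp: of_int_max)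
    then show "muly P c 1 a b = 0" by (simp add: muly_def N[unfolded One_nat_def])
  qed (auto simp: muly_def N of_int_max)
  moreover have "borch_id s t r (muly P c)"
    unfolding borch_id_def
  proof (intro allI)
    fix L M N :: int
    let ?l = "of_int L - s" and ?m = "of_int M - t" and ?n = "of_int N - r"
    have old: "Sum_any (\<lambda>j::nat. (of_rat ?m gchoose j) * c 3 (?l + of_nat j) (?m + (of_int (N + P) - r) - of_nat j))
      = Sum_any (\<lambda>j::nat. (- 1) ^ j * (of_rat ?l gchoose j) * (c 1 (?m + ?l - of_nat j) ((of_int (N + P) - r) + of_nat j)
       - (- 1) powi L * c 2 (?m + of_nat j) ((of_int (N + P) - r) + ?l - of_nat j)))"
      using assms unfolding borch_arr_def borch_id_def by blast
    then show "Sum_any (\<lambda>j::nat. (of_rat ?m gchoose j) * muly P c 3 (?l + of_nat j) (?m + ?n - of_nat j))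
      = Sum_any (\<lambda>j::nat. (- 1) ^ j * (of_rat ?l gchoose j) * (muly P c 1 (?m + ?l - of_nat j) (?n + of_nat j)
       - (- 1) powi L * muly P c 2 (?m + of_nat j) (?n + ?l - of_nat j)))"
      by (simp add: muly_def algebra_simps)
  qed
  ultimately show ?thesis by (simp add: borch_arr_def)
qed

text \<open>Compared with \<open>mulx\<close> the sides change roles: on the left \<open>L\<close>
  becomes \<open>L + P\<close>, and Vandermonde is applied on the right, where the sign of the
  second expansion accounts for the passage from \<open>L\<close> to \<open>L + P\<close>.\<close>

lemma borch_arr_mulz:
  assumes "borch_arr s t r c"
  shows "borch_arr s t r (mulz P c)"
proof -
  have trunc_arr: "trunc_arr c" using assms by (auto simp: borch_arr_def)
  then obtain N :: int where N: "\<And>a b. b \<ge> of_int N \<Longrightarrow> c 1 a b = 0" "\<And>a b. a \<ge> of_int N \<Longrightarrow> c 2 a b = 0"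
    "\<And>a b. a \<ge> of_int N \<Longrightarrow> c 3 a b = 0" unfolding trunc_arr_def by blast
  have "trunc_arr (mulz P c)"
    unfolding trunc_arr_def
  proof (intro exI[of _ "max N (N - P)"] allI conjI impI)
    fix a b :: rat assume a: "of_int (max N (N - P)) \<le> a"
    then have "of_int N \<le> a" "of_int N \<le> a + of_int P" by (auto simp: of_int_max)
    then have "of_int N \<le> a + of_nat i" for i :: nat by (simp add: add_increasing2)
    then show "mulz P c 2 a b = 0" "mulz P c 3 a b = 0"
      using \<open>of_int N \<le> a + of_int P\<close> by (simp_all add: mulz_def N)
  next
    fix a b :: rat assume a: "of_int (max N (N - P)) \<le> b"
    then have "of_int N \<le> b" by (auto simp: of_int_max)
    then have "of_int N \<le> b + of_nat i" for i :: nat by (simp add: add_increasing2)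
    then show "mulz P c 1 a b = 0" by (simp add: mulz_def N[unfolded One_nat_def])
  qed
  moreover have "borch_id s t r (mulz P c)"
    unfolding borch_id_def
  proof (intro allI)
    fix L M N :: int
    let ?l = "of_int L - s" and ?m = "of_int M - t" and ?n = "of_int N - r" and ?l' = "of_int (L + P) - s"
    define g where "g k = (- 1) ^ k * (c 1 (?m + ?l' - of_nat k) (?n + of_nat k)
       - (- 1) powi (L + P) * c 2 (?m + of_nat k) (?n + ?l' - of_nat k))" for k :: nat
    have old: "Sum_any (\<lambda>j::nat. (of_rat ?m gchoose j) * c 3 (?l' + of_nat j) (?m + ?n - of_nat j))
      = Sum_any (\<lambda>j::nat. (- 1) ^ j * (of_rat ?l' gchoose j) * (c 1 (?m + ?l' - of_nat j) (?n + of_nat j)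
       - (- 1) powi (L + P) * c 2 (?m + of_nat j) (?n + ?l' - of_nat j)))"
      using assms unfolding borch_arr_def borch_id_def by blast
    also have "\<dots> = Sum_any (\<lambda>j::nat. ((of_rat ?l + of_int P) gchoose j) * g j)"
      by (simp add: g_def of_rat_diff of_rat_add add_diff_eq diff_add_eq mult.left_commute mult.assoc)
    also have "\<dots> = Sum_any (\<lambda>j. (of_rat ?l gchoose j) * Sum_any (\<lambda>i. (of_int P gchoose i) * g (j + i)))"
      by (rule Vandermonde_Sum_any[symmetric]) (unfold g_def, rule trunc_arr_evz_rhs[OF trunc_arr])
    also have "\<dots> = Sum_any (\<lambda>j::nat. (- 1) ^ j * (of_rat ?l gchoose j) * (mulz P c 1 (?m + ?l - of_nat j) (?n + of_nat j)
       - (- 1) powi L * mulz P c 2 (?m + of_nat j) (?n + ?l - of_nat j)))"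
    proof (rule Sum_any.cong)
      fix j :: nat
      define F1 where "F1 i = (- 1) ^ i * (of_int P gchoose i) * c 1 (?m + ?l - of_nat j + of_int P - of_nat i) (?n + of_nat j + of_nat i)" for i :: nat
      define F2 where "F2 i = (- 1) ^ i * (of_int P gchoose i) * c 2 (?m + of_nat j + of_nat i) (?n + ?l - of_nat j + of_int P - of_nat i)" for i :: nat
      have e: "evz F1" "evz F2" unfolding F1_def F2_def by (rule trunc_arr_evz[OF trunc_arr])+
      have "Sum_any (\<lambda>i. (of_int P gchoose i) * g (j + i))
        = Sum_any (\<lambda>i. (- 1) ^ j * F1 i - (- 1) ^ j * (- 1) powi (L + P) * F2 i)"
        by (rule Sum_any.cong) (simp add: g_def F1_def F2_def power_add algebra_simps)
      also have "\<dots> = (- 1) ^ j * Sum_any F1 - (- 1) ^ j * (- 1) powi (L + P) * Sum_any F2"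
        by (simp only: Sum_any_diff evz_cmult e Sum_any_cmult)
      also have "Sum_any F1 = mulz P c 1 (?m + ?l - of_nat j) (?n + of_nat j)"
        unfolding F1_def mulz_def by simp
      also have "(- 1) ^ j * (- 1) powi (L + P) * Sum_any F2
         = (- 1) ^ j * ((- 1) powi L * mulz P c 2 (?m + of_nat j) (?n + ?l - of_nat j))"
        unfolding F2_def mulz_def by (simp add: power_int_add)
      finally have fin: "Sum_any (\<lambda>i. (of_int P gchoose i) * g (j + i))
        = (- 1) ^ j * mulz P c 1 (?m + ?l - of_nat j) (?n + of_nat j)
         - (- 1) ^ j * ((- 1) powi L * mulz P c 2 (?m + of_nat j) (?n + ?l - of_nat j))" .
      show "(of_rat ?l gchoose j) * Sum_any (\<lambda>i. (of_int P gchoose i) * g (j + i))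
        = (- 1) ^ j * (of_rat ?l gchoose j) * (mulz P c 1 (?m + ?l - of_nat j) (?n + of_nat j)
       - (- 1) powi L * mulz P c 2 (?m + of_nat j) (?n + ?l - of_nat j))"
        unfolding fin by (simp only: right_diff_distrib mult.assoc mult.left_commute)
    qed
    finally show "Sum_any (\<lambda>j::nat. (of_rat ?m gchoose j) * mulz P c 3 (?l + of_nat j) (?m + ?n - of_nat j))
      = Sum_any (\<lambda>j::nat. (- 1) ^ j * (of_rat ?l gchoose j) * (mulz P c 1 (?m + ?l - of_nat j) (?n + of_nat j)
       - (- 1) powi L * mulz P c 2 (?m + of_nat j) (?n + ?l - of_nat j)))"
      by (simp add: mulz_def algebra_simps)
  qed
  ultimately show ?thesis by (simp add: borch_arr_def)
qed

end

section \<open>Binomial identities behind reindexed locally finite sums\<close>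

lemma Sum_any_sum_swap:
  fixes f :: "'b \<Rightarrow> nat \<Rightarrow> complex"
  assumes "\<And>t. t \<in> A \<Longrightarrow> evz (f t)"
  shows "Sum_any (\<lambda>i. \<Sum>t\<in>A. f t i) = (\<Sum>t\<in>A. Sum_any (f t))" "evz (\<lambda>i. \<Sum>t\<in>A. f t i)"
proof -
  have "Sum_any (\<lambda>i. \<Sum>t\<in>A. f t i) = (\<Sum>t\<in>A. Sum_any (f t)) \<and> evz (\<lambda>i. \<Sum>t\<in>A. f t i)"
    using assms
    by (induction A rule: infinite_finite_induct) (auto simp: Sum_any_add evz_add, auto simp: evz_def)
  then show "Sum_any (\<lambda>i. \<Sum>t\<in>A. f t i) = (\<Sum>t\<in>A. Sum_any (f t))" "evz (\<lambda>i. \<Sum>t\<in>A. f t i)" by auto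
qed

lemma evz_mult: "evz f \<Longrightarrow> evz (\<lambda>j. c j * (f j :: complex))"
  by (rule evz_comp0) auto

lemma evz_shift: "evz g \<Longrightarrow> evz (\<lambda>i. g (i + t))"
  unfolding evz_def by (metis trans_le_add1)

lemma Sum_any_shift:
  fixes f :: "nat \<Rightarrow> complex"
  assumes "evz f" "\<And>i. i < t \<Longrightarrow> f i = 0"
  shows "Sum_any f = Sum_any (\<lambda>k. f (k + t))"
proof -
  obtain N where N: "\<And>j. j \<ge> N \<Longrightarrow> f j = 0" using assms unfolding evz_def by blast
  have "Sum_any f = sum f {..<N + t}" by (rule Sum_any_bound) (simp add: N)
  also have "\<dots> = sum f {t..<N + t}"
    by (rule sum.mono_neutral_right) (auto simp: assms(2))
  also have "\<dots> = (\<Sum>k<N. f (k + t))"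
    using sum.shift_bounds_nat_ivl[of f 0 t N] by (simp add: lessThan_atLeast0)
  also have "\<dots> = Sum_any (\<lambda>k. f (k + t))" by (rule Sum_any_bound[symmetric]) (simp add: N)
  finally show ?thesis .
qed

lemma gbinomial_small: "i < t \<Longrightarrow> (of_nat i :: complex) gchoose t = 0"
  by (simp flip: binomial_gbinomial)

text \<open>From \<open>(x gchoose i) (i gchoose t) = (x gchoose t) (x - t gchoose i - t)\<close>;
  such products arise when one commutator formula is applied inside another.\<close>

lemma trinomial_shift:
  fixes g :: "nat \<Rightarrow> complex"
  assumes "evz g"
  shows "Sum_any (\<lambda>i. (x gchoose i) * (of_nat i gchoose t) * g i)
    = (x gchoose t) * Sum_any (\<lambda>k. ((x - of_nat t) gchoose k) * g (k + t))"
proof -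
  have "Sum_any (\<lambda>i. (x gchoose i) * (of_nat i gchoose t) * g i)
      = Sum_any (\<lambda>k. (x gchoose (k + t)) * (of_nat (k + t) gchoose t) * g (k + t))"
    by (rule Sum_any_shift) (use assms in \<open>auto simp: gbinomial_small intro: evz_mult\<close>)
  also have "\<dots> = Sum_any (\<lambda>k. (x gchoose t) * (((x - of_nat t) gchoose k) * g (k + t)))"
    by (rule Sum_any.cong) (use gbinomial_trinomial_revision[of t _ x] in \<open>simp del: of_nat_add\<close>)
  also have "\<dots> = (x gchoose t) * Sum_any (\<lambda>k. ((x - of_nat t) gchoose k) * g (k + t))"
    by (rule Sum_any_cmult, rule evz_mult, rule evz_shift[OF assms])
  finally show ?thesis .
qed

lemma gbinomial_fact2: "(of_nat (a + b) :: complex) gchoose a = fact (a + b) / (fact a * fact b)"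
  by (simp only: binomial_gbinomial[symmetric] binomial_fact[OF le_add1] add_diff_cancel_left')

lemma gbinomial_neg: "(- of_nat x - 1 :: complex) gchoose n = (- 1) ^ n * (of_nat (x + n) gchoose n)"
proof -
  have "(- of_nat x - 1 :: complex) = - (of_nat x + 1)"
    "of_nat x + 1 + of_nat n - 1 = (of_nat (x + n) :: complex)" by simp_all
  then show ?thesis by (simp only: gbinomial_minus)
qed

text \<open>Up to the sign \<open>(- 1) ^ n\<close>, both sides are the trinomial coefficient
  \<open>(n + i + t)! / (n! i! t!)\<close>.\<close>

lemma gbinomial_cross:
  "((- of_nat (t + i) - 1 :: complex) gchoose n) * (of_nat (t + i) gchoose i)
   = (- 1) ^ n * (of_nat (n + i) gchoose i) * ((- 1) ^ t * ((- of_nat n - 1 - of_nat i) gchoose t))"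
proof -
  have "(- of_nat n - 1 - of_nat i :: complex) = - of_nat (n + i) - 1" by simp
  then have 1: "((- of_nat n - 1 - of_nat i :: complex) gchoose t) = (- 1) ^ t * (of_nat (n + i + t) gchoose t)"
    by (simp only: gbinomial_neg)
  have e: "(- 1) ^ t * ((- 1) ^ t * x) = (x :: complex)" for x
    by (simp flip: mult.assoc power_mult_distrib)
  have a: "(of_nat (t + i + n) gchoose n :: complex) = fact (t + i + n) / (fact n * fact (t + i))"
    using gbinomial_fact2[of n "t + i"] by (simp only: add.commute[of n])
  have b: "(of_nat (t + i) gchoose i :: complex) = fact (t + i) / (fact i * fact t)"
    using gbinomial_fact2[of i t] by (simp only: add.commute[of i])
  have c: "(of_nat (n + i) gchoose i :: complex) = fact (n + i) / (fact i * fact n)"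
    using gbinomial_fact2[of i n] by (simp only: add.commute[of i])
  have d: "(of_nat (n + i + t) gchoose t :: complex) = fact (t + i + n) / (fact t * fact (n + i))"
    using gbinomial_fact2[of t "n + i"] by (simp only: ac_simps)
  show ?thesis unfolding 1 e gbinomial_neg a b c d by simp
qed

lemma cross_shift:
  fixes g :: "nat \<Rightarrow> complex"
  assumes "evz g"
  shows "Sum_any (\<lambda>j. ((- of_nat j - 1) gchoose n) * (of_nat j gchoose i) * g j)
    = (- 1) ^ n * (of_nat (n + i) gchoose i) * Sum_any (\<lambda>t. (- 1) ^ t * ((- of_nat n - 1 - of_nat i) gchoose t) * g (t + i))"
proof -
  have "Sum_any (\<lambda>j. ((- of_nat j - 1) gchoose n) * (of_nat j gchoose i) * g j)
      = Sum_any (\<lambda>t. ((- of_nat (t + i) - 1) gchoose n) * (of_nat (t + i) gchoose i) * g (t + i))"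
    by (rule Sum_any_shift) (use assms in \<open>auto simp: gbinomial_small intro: evz_mult\<close>)
  also have "\<dots> = Sum_any (\<lambda>t. (- 1) ^ n * (of_nat (n + i) gchoose i) * ((- 1) ^ t * ((- of_nat n - 1 - of_nat i) gchoose t) * g (t + i)))"
    unfolding gbinomial_cross by (simp only: mult.assoc)
  also have "\<dots> = (- 1) ^ n * (of_nat (n + i) gchoose i) * Sum_any (\<lambda>t. (- 1) ^ t * ((- of_nat n - 1 - of_nat i) gchoose t) * g (t + i))"
    by (rule Sum_any_cmult, rule evz_mult, rule evz_shift[OF assms])
  finally show ?thesis .
qed

lemma borch_arr_cong:
  assumes "lattice_va.borch_arr s t r c" "lattice_va p" and "\<And>k a b. k \<in> {1, 2, 3} \<Longrightarrow> c k a b = d k a b"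
  shows "lattice_va.borch_arr s t r d"
proof -
  have *: "c 1 a b = d 1 a b" "c 2 a b = d 2 a b" "c 3 a b = d 3 a b" for a b
    using assms(3) by auto
  show ?thesis using assms(1)
    unfolding lattice_va.borch_arr_def[OF assms(2)] lattice_va.borch_id_def[OF assms(2)] lattice_va.trunc_arr_def[OF assms(2)] * .
qed

section \<open>Arrays of matrix coefficients of products and iterates of modes\<close>

context lattice_va
begin

text \<open>The two orders of the product and the iterate have matrix coefficients that form the
  three expansions.\<close>

definition mode_arr :: "(fock \<Rightarrow> complex) \<Rightarrow> fock \<Rightarrow> fock \<Rightarrow> fock \<Rightarrow> arr" where
  "mode_arr \<phi> u v w k a b = (if k = 1 then \<phi> (mode p u a (mode p v b w))
     else if k = 2 then \<phi> (mode p v b (mode p u a w))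
     else \<phi> (mode p (mode p u a v) b w))"

lemma trunc_arr_mode_arr: "clin \<phi> \<Longrightarrow> trunc_arr (mode_arr \<phi> u v w)"
proof -
  assume \<phi>: "clin \<phi>"
  obtain N1 :: int where N1: "\<And>m. m \<ge> of_int N1 \<Longrightarrow> mode p v m w = 0" using good_mode unfolding good_def by blast
  obtain N2 :: int where N2: "\<And>m. m \<ge> of_int N2 \<Longrightarrow> mode p u m w = 0" using good_mode unfolding good_def by blast
  obtain N3 :: int where N3: "\<And>m. m \<ge> of_int N3 \<Longrightarrow> mode p u m v = 0" using good_mode unfolding good_def by blast
  show ?thesis unfolding trunc_arr_def
    by (intro exI[of _ "max N1 (max N2 N3)"]) (auto simp: mode_arr_def N1 N2 N3 of_int_max mode_01 mode_02 clin_0[OF \<phi>])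
qed

lemma h_mode_bd:
  assumes "\<And>i. i \<ge> I \<Longrightarrow> h (int i) u = 0"
  shows "h r (mode p u m v) = mode p u m (h r v)
    + (\<Sum>i<I. fscale (of_int r gchoose i) (mode p (h (int i) u) (m + of_int r - of_nat i) v))"
  unfolding h_mode by (subst Sum_any_bound[of I]) (auto simp: assms mode_01)

lemma clin_mode: "clin \<phi> \<Longrightarrow> clin (\<lambda>x. \<phi> (mode p u m x))"
  by (rule clin_comp[OF _ flin_mode2])

lemma clin_mode1: "clin \<phi> \<Longrightarrow> clin (\<lambda>x. \<phi> (mode p x m w))"
  by (rule clin_comp[OF _ flin_mode1])

lemma Sum_any_cut: "(\<And>j::nat. j \<ge> I \<Longrightarrow> f j = (0::complex)) \<Longrightarrow> Sum_any f = (\<Sum>j<I. f j)"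
  by (rule Sum_any_bound)

lemma evz_cut: "(\<And>j. j \<ge> I \<Longrightarrow> f j = (0::complex)) \<Longrightarrow> evz f"
  unfolding evz_def by blast

text \<open>As \<alpha>(r) travels to w, its commutators with u and v act as multiplication by
  powers of x and y, and this uniformly in all three expansions. In the third one the commutator
  formula is used twice, which is where trinomial revision enters.\<close>

lemma mode_arr_comm:
  assumes \<phi>: "clin \<phi>" and u: "\<And>i. i \<ge> I \<Longrightarrow> h (int i) u = 0" and v: "\<And>i. i \<ge> I \<Longrightarrow> h (int i) v = 0"
    and k: "k \<in> {1, 2, 3}"
  shows "mode_arr (\<lambda>x. \<phi> (h r x)) u v w k a b = mode_arr \<phi> u v (h r w) k a b
     + (\<Sum>i<I. (of_int r gchoose i) * mulx (r - int i) (mode_arr \<phi> (h (int i) u) v w) k a b)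
     + (\<Sum>i<I. (of_int r gchoose i) * muly (r - int i) (mode_arr \<phi> u (h (int i) v) w) k a b)"
proof -
  note lins = clin_add[OF \<phi>] clin_scale[OF \<phi>] clin_sum[OF \<phi>]
  consider "k = 1" | "k = 2" | "k = 3" using k by auto
  then show ?thesis
  proof cases
    case 3
    define y where "y = mode p u a v"
    define c3 where "c3 t q M = \<phi> (mode p (mode p (h (int t) u) q v) M w)" for t :: nat and q M
    have hy: "h (int i) y = mode p u a (h (int i) v)
        + (\<Sum>t<I. fscale (of_nat i gchoose t) (mode p (h (int t) u) (a + of_nat i - of_nat t) v))" for i
      unfolding y_def using h_mode_bd[of I u "int i" a v] u by simp
    have ev: "evz (\<lambda>i. c3 t (a + of_nat i - of_nat t) (b + of_int r - of_nat i))" for t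
      unfolding c3_def by (rule evz_comp0[OF good_evz[OF good_mode, of "h (int t) u" a t v]])
        (simp add: mode_01 clin_0[OF \<phi>])
    have e1: "evz (\<lambda>i. (of_int r gchoose i) * \<phi> (mode p (mode p u a (h (int i) v)) (b + of_int r - of_nat i) w))"
      by (rule evz_cut[of I]) (simp add: v mode_01 mode_02 clin_0[OF \<phi>])
    have "\<phi> (h r (mode p y b w)) = \<phi> (mode p y b (h r w))
       + Sum_any (\<lambda>i. (of_int r gchoose i) * \<phi> (mode p (h (int i) y) (b + of_int r - of_nat i) w))"
      unfolding h_mode by (simp add: lins Sum_any_clin[OF \<phi> evz_mode1[OF evz_heis]])
    also have "Sum_any (\<lambda>i. (of_int r gchoose i) * \<phi> (mode p (h (int i) y) (b + of_int r - of_nat i) w))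
       = Sum_any (\<lambda>i. (of_int r gchoose i) * \<phi> (mode p (mode p u a (h (int i) v)) (b + of_int r - of_nat i) w)
          + (\<Sum>t<I. (of_int r gchoose i) * (of_nat i gchoose t) * c3 t (a + of_nat i - of_nat t) (b + of_int r - of_nat i)))"
      unfolding hy c3_def
      by (simp add: mode_add1 mode_sum1 mode_scale1 lins distrib_left sum_distrib_left mult.assoc)
    also have "\<dots> = Sum_any (\<lambda>i. (of_int r gchoose i) * \<phi> (mode p (mode p u a (h (int i) v)) (b + of_int r - of_nat i) w))
        + (\<Sum>t<I. Sum_any (\<lambda>i. (of_int r gchoose i) * (of_nat i gchoose t) * c3 t (a + of_nat i - of_nat t) (b + of_int r - of_nat i)))"
      by (simp only: Sum_any_add[OF e1 Sum_any_sum_swap(2)[OF evz_mult[OF ev]]] Sum_any_sum_swap(1)[OF evz_mult[OF ev]])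
    also have "(\<Sum>t<I. Sum_any (\<lambda>i. (of_int r gchoose i) * (of_nat i gchoose t) * c3 t (a + of_nat i - of_nat t) (b + of_int r - of_nat i)))
       = (\<Sum>t<I. (of_int r gchoose t) * Sum_any (\<lambda>k. ((of_int r - of_nat t) gchoose k) * c3 t (a + of_nat k) (b + of_int r - of_nat t - of_nat k)))"
      by (rule sum.cong[OF refl], subst trinomial_shift[OF ev]) (simp add: algebra_simps)
    also have "Sum_any (\<lambda>i. (of_int r gchoose i) * \<phi> (mode p (mode p u a (h (int i) v)) (b + of_int r - of_nat i) w))
       = (\<Sum>i<I. (of_int r gchoose i) * \<phi> (mode p (mode p u a (h (int i) v)) (b + of_int r - of_nat i) w))"
      by (rule Sum_any_cut) (simp add: v mode_01 mode_02 clin_0[OF \<phi>])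
    finally show ?thesis
      unfolding 3 by (simp add: mode_arr_def mulx_def muly_def y_def c3_def add_diff_eq)
  qed (simp_all add: mode_arr_def mulx_def muly_def h_mode_bd[OF u] h_mode_bd[OF v] lins mode_add2 mode_sum2 mode_scale2
        add_diff_eq)
qed

lemma kill_stepm:
  assumes "clin \<phi>" "\<And>j x. \<phi> (h (- int j - 1) x) = 0" "good A"
  shows "\<phi> (stepm n A m x) = Sum_any (\<lambda>j::nat. ((- of_nat j - 1) gchoose n) * \<phi> (A (m - of_nat j - of_nat n - 1) (h (int j) x)))"
  unfolding stepm_def
  by (simp add: clin_add[OF assms(1)] Sum_any_clin[OF assms(1)] evz_creation[OF assms(3)] evz_annihilation[OF assms(3)]
      clin_scale[OF assms(1)] assms(2))

text \<open>A functional that kills creation operators leaves only the annihilation half of the new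
  letter. On its way to w it is contracted with v, and these contractions add up to an expansion of
  \<open>(x - y)^(-n-1-i)\<close>.\<close>

lemma move_annihilation:
  assumes \<phi>: "clin \<phi>" and kill: "\<And>j x. \<phi> (h (- int j - 1) x) = 0"
    and v: "\<And>i. i \<ge> I \<Longrightarrow> h (int i) v = 0" and w: "\<And>i. i \<ge> I \<Longrightarrow> h (int i) w = 0"
  shows "\<phi> (stepm n (mode p u) a (mode p v b w)) =
      (\<Sum>i<I. (- 1) ^ n * (of_nat (n + i) gchoose i) * Sum_any (\<lambda>t. (- 1) ^ t * ((- of_nat n - 1 - of_nat i) gchoose t) *
          \<phi> (mode p u (a - of_nat n - 1 - of_nat i - of_nat t) (mode p (h (int i) v) (b + of_nat t) w))))
     + (\<Sum>j<I. ((- of_nat j - 1) gchoose n) * \<phi> (mode p u (a - of_nat j - of_nat n - 1) (mode p v b (h (int j) w))))"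
proof -
  define G where "G i j = \<phi> (mode p u (a - of_nat j - of_nat n - 1) (mode p (h (int i) v) (b + of_nat j - of_nat i) w))"
    for i j :: nat
  have ev: "evz (G i)" for i
    unfolding G_def by (rule evz_comp0[OF good_evz[OF good_mode, of "h (int i) v" b i w]])
      (simp add: mode_02 clin_0[OF \<phi>])
  have hv: "h r (mode p v m x) = mode p v m (h r x)
      + (\<Sum>i<I. fscale (of_int r gchoose i) (mode p (h (int i) v) (m + of_int r - of_nat i) x))" for r m x
    by (rule h_mode_bd) (rule v)
  have e1: "evz (\<lambda>j::nat. ((- of_nat j - 1) gchoose n) * \<phi> (mode p u (a - of_nat j - of_nat n - 1) (mode p v b (h (int j) w))))"
    by (rule evz_cut[of I]) (simp add: w mode_02 clin_0[OF \<phi>])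
  have "\<phi> (stepm n (mode p u) a (mode p v b w)) = Sum_any (\<lambda>j::nat. ((- of_nat j - 1) gchoose n) *
      \<phi> (mode p u (a - of_nat j - of_nat n - 1) (h (int j) (mode p v b w))))"
    by (rule kill_stepm[OF \<phi> kill good_mode])
  also have "\<dots> = Sum_any (\<lambda>j::nat. ((- of_nat j - 1) gchoose n) * \<phi> (mode p u (a - of_nat j - of_nat n - 1) (mode p v b (h (int j) w)))
      + (\<Sum>i<I. ((- of_nat j - 1) gchoose n) * (of_nat j gchoose i) * G i j))"
    unfolding hv G_def
    by (simp add: mode_add2 mode_sum2 mode_scale2 clin_add[OF \<phi>] clin_sum[OF \<phi>] clin_scale[OF \<phi>]
        distrib_left sum_distrib_left mult.assoc)
  also have "\<dots> = Sum_any (\<lambda>j::nat. ((- of_nat j - 1) gchoose n) * \<phi> (mode p u (a - of_nat j - of_nat n - 1) (mode p v b (h (int j) w))))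
      + (\<Sum>i<I. Sum_any (\<lambda>j. ((- of_nat j - 1) gchoose n) * (of_nat j gchoose i) * G i j))"
    by (simp only: Sum_any_add[OF e1 Sum_any_sum_swap(2)[OF evz_mult[OF ev]]] Sum_any_sum_swap(1)[OF evz_mult[OF ev]])
  also have "(\<Sum>i<I. Sum_any (\<lambda>j. ((- of_nat j - 1) gchoose n) * (of_nat j gchoose i) * G i j))
      = (\<Sum>i<I. (- 1) ^ n * (of_nat (n + i) gchoose i) * Sum_any (\<lambda>t. (- 1) ^ t * ((- of_nat n - 1 - of_nat i) gchoose t) *
          \<phi> (mode p u (a - of_nat n - 1 - of_nat i - of_nat t) (mode p (h (int i) v) (b + of_nat t) w))))"
    by (rule sum.cong[OF refl], subst cross_shift[OF ev]) (simp add: G_def algebra_simps)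
  also have "Sum_any (\<lambda>j::nat. ((- of_nat j - 1) gchoose n) * \<phi> (mode p u (a - of_nat j - of_nat n - 1) (mode p v b (h (int j) w))))
      = (\<Sum>j<I. ((- of_nat j - 1) gchoose n) * \<phi> (mode p u (a - of_nat j - of_nat n - 1) (mode p v b (h (int j) w))))"
    by (rule Sum_any_cut) (simp add: w mode_02 clin_0[OF \<phi>])
  finally show ?thesis by simp
qed

text \<open>With v on the outside it is the creation half that gets contracted, on its way to the
  functional. The result is the same power of \<open>x - y\<close>, expanded in the other domain,
  hence the extra sign.\<close>

lemma move_creation:
  assumes \<phi>: "clin \<phi>" and kill: "\<And>j x. \<phi> (h (- int j - 1) x) = 0"
    and v: "\<And>i. i \<ge> I \<Longrightarrow> h (int i) v = 0" and w: "\<And>i. i \<ge> I \<Longrightarrow> h (int i) w = 0"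
  shows "\<phi> (mode p v b (stepm n (mode p u) a w)) =
     - (\<Sum>i<I. (- 1) ^ i * (of_nat (n + i) gchoose i) * Sum_any (\<lambda>t. (- 1) ^ t * ((- of_nat n - 1 - of_nat i) gchoose t) *
          \<phi> (mode p (h (int i) v) (b - of_nat n - 1 - of_nat i - of_nat t) (mode p u (a + of_nat t) w))))
     + (\<Sum>j<I. ((- of_nat j - 1) gchoose n) * \<phi> (mode p v b (mode p u (a - of_nat j - of_nat n - 1) (h (int j) w))))"
proof -
  define G where "G i j = \<phi> (mode p (h (int i) v) (b - of_nat j - 1 - of_nat i) (mode p u (a + of_nat j - of_nat n) w))"
    for i j :: nat
  have ev: "evz (G i)" for i
    unfolding G_def by (rule evz_comp0[OF good_evz[OF good_mode, of u a n w]])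
      (simp add: mode_02 clin_0[OF \<phi>])
  have cr: "\<phi> (mode p v b (h (- int j - 1) x))
      = - (\<Sum>i<I. ((- of_nat j - 1) gchoose i) * \<phi> (mode p (h (int i) v) (b - of_nat j - 1 - of_nat i) x))" for j x
  proof -
    have hv: "h (- int j - 1) (mode p v b x) = mode p v b (h (- int j - 1) x)
      + (\<Sum>i<I. fscale (of_int (- int j - 1) gchoose i) (mode p (h (int i) v) (b + of_int (- int j - 1) - of_nat i) x))"
      by (rule h_mode_bd) (rule v)
    have "\<phi> (h (- int j - 1) (mode p v b x)) = 0" by (rule kill)
    then show ?thesis unfolding hv
      by (simp add: clin_add[OF \<phi>] clin_sum[OF \<phi>] clin_scale[OF \<phi>] add_eq_0_iff2 add_diff_eq)
  qed
  have "\<phi> (mode p v b (stepm n (mode p u) a w)) =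
      Sum_any (\<lambda>j. (of_nat j gchoose n) * \<phi> (mode p v b (h (- int j - 1) (mode p u (a + of_nat j - of_nat n) w))))
      + Sum_any (\<lambda>j. ((- of_nat j - 1) gchoose n) * \<phi> (mode p v b (mode p u (a - of_nat j - of_nat n - 1) (h (int j) w))))"
    unfolding stepm_def
    by (simp add: mode_add2 clin_add[OF \<phi>] Sum_any_clin[OF clin_mode[OF \<phi>]] evz_creation[OF good_mode]
        evz_annihilation[OF good_mode] clin_scale[OF clin_mode[OF \<phi>]])
  also have "Sum_any (\<lambda>j. (of_nat j gchoose n) * \<phi> (mode p v b (h (- int j - 1) (mode p u (a + of_nat j - of_nat n) w))))
      = Sum_any (\<lambda>j. \<Sum>i<I. - (((- of_nat j - 1) gchoose i) * (of_nat j gchoose n) * G i j))"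
    unfolding cr G_def
    by (simp only: sum_distrib_left mult_minus_right sum_negf mult.assoc mult.left_commute)
  also have "\<dots> = (\<Sum>i<I. Sum_any (\<lambda>j. - (((- of_nat j - 1) gchoose i) * (of_nat j gchoose n) * G i j)))"
    by (rule Sum_any_sum_swap(1)) (simp only: mult_minus_left[symmetric], rule evz_mult[OF ev])
  also have "\<dots> = (\<Sum>i<I. - ((- 1) ^ i * (of_nat (n + i) gchoose i) * Sum_any (\<lambda>t. (- 1) ^ t * ((- of_nat n - 1 - of_nat i) gchoose t) *
          \<phi> (mode p (h (int i) v) (b - of_nat n - 1 - of_nat i - of_nat t) (mode p u (a + of_nat t) w)))))"
  proof (rule sum.cong[OF refl])
    fix i
    have sym: "(of_nat (i + n) gchoose n :: complex) = of_nat (n + i) gchoose i"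
      by (metis add.commute binomial_gbinomial binomial_symmetric diff_add_inverse le_add1)
    have swap: "- of_nat i - 1 - of_nat n = (- of_nat n - 1 - of_nat i :: complex)" by simp
    have "Sum_any (\<lambda>j. - (((- of_nat j - 1) gchoose i) * (of_nat j gchoose n) * G i j))
        = - Sum_any (\<lambda>j. ((- of_nat j - 1) gchoose i) * (of_nat j gchoose n) * G i j)"
      using Sum_any_cmult[of "\<lambda>j. ((- of_nat j - 1) gchoose i) * (of_nat j gchoose n) * G i j" "- 1"]
        evz_mult[OF ev[of i], of "\<lambda>j. ((- of_nat j - 1) gchoose i) * (of_nat j gchoose n)"] by simp
    also have "\<dots> = - ((- 1) ^ i * (of_nat (n + i) gchoose i) * Sum_any (\<lambda>t. (- 1) ^ t * ((- of_nat n - 1 - of_nat i) gchoose t) *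
          \<phi> (mode p (h (int i) v) (b - of_nat n - 1 - of_nat i - of_nat t) (mode p u (a + of_nat t) w))))"
      by (subst cross_shift[OF ev], unfold sym G_def swap) (simp add: algebra_simps)
    finally show "Sum_any (\<lambda>j. - (((- of_nat j - 1) gchoose i) * (of_nat j gchoose n) * G i j))
      = - ((- 1) ^ i * (of_nat (n + i) gchoose i) * Sum_any (\<lambda>t. (- 1) ^ t * ((- of_nat n - 1 - of_nat i) gchoose t) *
          \<phi> (mode p (h (int i) v) (b - of_nat n - 1 - of_nat i - of_nat t) (mode p u (a + of_nat t) w))))" .
  qed
  also have "Sum_any (\<lambda>j. ((- of_nat j - 1) gchoose n) * \<phi> (mode p v b (mode p u (a - of_nat j - of_nat n - 1) (h (int j) w))))
      = (\<Sum>j<I. ((- of_nat j - 1) gchoose n) * \<phi> (mode p v b (mode p u (a - of_nat j - of_nat n - 1) (h (int j) w))))"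
    by (rule Sum_any_cut) (simp add: w mode_02 clin_0[OF \<phi>])
  finally show ?thesis by (simp add: sum_negf)
qed

lemma minus_one_powi: "(- 1 :: complex) powi (- int n - 1 - int i) = (- 1) ^ (n + 1 + i)"
proof -
  have "- int n - 1 - int i = - int (n + 1 + i)" by simp
  then have "(- 1 :: complex) powi (- int n - 1 - int i) = inverse ((- 1) ^ (n + 1 + i))"
    by (simp only: power_int_minus power_int_of_nat)
  then show ?thesis by (simp only: power_inverse[symmetric]) simp
qed

text \<open>Strips one letter off u. What remains are contractions with v and w, that is,
  multiplications by powers of \<open>x - y\<close> and x of arrays with fewer letters, as the
  induction in \<open>borch_arr_vac\<close> requires.\<close>

lemma mode_arr_u:
  assumes \<phi>: "clin \<phi>" and kill: "\<And>j x. \<phi> (h (- int j - 1) x) = 0"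
    and v: "\<And>i. i \<ge> I \<Longrightarrow> h (int i) v = 0" and w: "\<And>i. i \<ge> I \<Longrightarrow> h (int i) w = 0"
    and k: "k \<in> {1, 2, 3}"
  shows "mode_arr \<phi> (h (- int n - 1) u) v w k a b =
      (\<Sum>i<I. (- 1) ^ n * (of_nat (n + i) gchoose i) * mulz (- int n - 1 - int i) (mode_arr \<phi> u (h (int i) v) w) k a b)
    + (\<Sum>j<I. ((- of_nat j - 1) gchoose n) * mulx (- int j - int n - 1) (mode_arr \<phi> u v (h (int j) w)) k a b)"
proof -
  consider "k = 1" | "k = 2" | "k = 3" using k by auto
  then show ?thesis
  proof cases
    case 1
    then show ?thesis
      by (simp add: mode_arr_def mulx_def mulz_def mode_create move_annihilation[OF \<phi> kill v w, where n=n and u=u and a=a and b=b] algebra_simps)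
  next
    case 2
    have e: "(- 1) ^ n * (x * ((- 1) powi (- int n - 1 - int i) * y)) = - ((- 1) ^ i * (x * y))" for i :: nat and x y :: complex
      unfolding minus_one_powi by (simp add: power_add)
    show ?thesis unfolding 2
      by (simp add: mode_arr_def mulx_def mulz_def mode_create move_creation[OF \<phi> kill v w, where n=n and u=u and a=a and b=b]
          sum_negf e[unfolded diff_diff_eq] mult.assoc diff_diff_eq add_ac) (simp add: algebra_simps)
  next
    case 3
    define c3 where "c3 s q M = \<phi> (mode p (mode p u q v) M (h (int s) w))" for s :: nat and q M
    have ev: "evz (\<lambda>j. c3 s (a + of_nat j - of_nat n) (b - of_nat s - of_nat j - 1))" for s
      unfolding c3_def by (rule evz_comp0[OF good_evz[OF good_mode, of u a n v]])
        (simp add: mode_01 clin_0[OF \<phi>])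
    have cr: "\<phi> (mode p (h (- int j - 1) y) b w)
        = (\<Sum>s<I. ((- of_nat s - 1) gchoose j) * \<phi> (mode p y (b - of_nat s - of_nat j - 1) (h (int s) w)))" for j y
      unfolding mode_create kill_stepm[OF \<phi> kill good_mode]
      by (rule Sum_any_cut) (simp add: w mode_02 clin_0[OF \<phi>])
    note st = mode_create[of n u a v, unfolded stepm_def]
    have sym: "(of_nat j + of_nat n :: complex) gchoose n = (of_nat j + of_nat n) gchoose j" for j
      unfolding of_nat_add[symmetric]
      by (metis add.commute binomial_gbinomial binomial_symmetric diff_add_inverse le_add1)
    have "\<phi> (mode p (mode p (h (- int n - 1) u) a v) b w) =
        Sum_any (\<lambda>j. (of_nat j gchoose n) * \<phi> (mode p (h (- int j - 1) (mode p u (a + of_nat j - of_nat n) v)) b w))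
       + Sum_any (\<lambda>j. ((- of_nat j - 1) gchoose n) * \<phi> (mode p (mode p u (a - of_nat j - of_nat n - 1) (h (int j) v)) b w))"
      unfolding st
      by (simp add: mode_add1 clin_add[OF \<phi>] Sum_any_clin[OF clin_mode1[OF \<phi>]] evz_creation[OF good_mode]
        evz_annihilation[OF good_mode] clin_scale[OF clin_mode1[OF \<phi>]])
    also have "Sum_any (\<lambda>j. (of_nat j gchoose n) * \<phi> (mode p (h (- int j - 1) (mode p u (a + of_nat j - of_nat n) v)) b w))
       = Sum_any (\<lambda>j. \<Sum>s<I. ((- of_nat s - 1) gchoose j) * (of_nat j gchoose n) * c3 s (a + of_nat j - of_nat n) (b - of_nat s - of_nat j - 1))"
      unfolding cr c3_def by (simp add: sum_distrib_left mult.assoc mult.left_commute)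
    also have "\<dots> = (\<Sum>s<I. Sum_any (\<lambda>j. ((- of_nat s - 1) gchoose j) * (of_nat j gchoose n) * c3 s (a + of_nat j - of_nat n) (b - of_nat s - of_nat j - 1)))"
      by (rule Sum_any_sum_swap(1)) (rule evz_mult[OF ev])
    also have "\<dots> = (\<Sum>s<I. ((- of_nat s - 1) gchoose n) * Sum_any (\<lambda>t. ((- of_nat s - 1 - of_nat n) gchoose t) * c3 s (a + of_nat t) (b - of_nat s - of_nat n - 1 - of_nat t)))"
      by (rule sum.cong[OF refl], subst trinomial_shift[OF ev]) (simp add: algebra_simps)
    also have "Sum_any (\<lambda>j. ((- of_nat j - 1) gchoose n) * \<phi> (mode p (mode p u (a - of_nat j - of_nat n - 1) (h (int j) v)) b w))
       = (\<Sum>j<I. ((- of_nat j - 1) gchoose n) * \<phi> (mode p (mode p u (a - of_nat j - of_nat n - 1) (h (int j) v)) b w))"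
      by (rule Sum_any_cut) (simp add: v mode_01 mode_02 clin_0[OF \<phi>])
    finally show ?thesis
      unfolding 3 by (simp add: mode_arr_def mulx_def mulz_def c3_def gbinomial_neg sym add_ac diff_diff_eq)
        (simp add: algebra_simps)
  qed
qed

text \<open>The counterpart for v. In the third expansion the letter sits inside the iterate and is
  first brought in front of it by the commutator formula.\<close>

lemma mode_arr_v:
  assumes \<phi>: "clin \<phi>" and kill: "\<And>j x. \<phi> (h (- int j - 1) x) = 0"
    and u: "\<And>i. i \<ge> I \<Longrightarrow> h (int i) u = 0" and w: "\<And>i. i \<ge> I \<Longrightarrow> h (int i) w = 0"
    and k: "k \<in> {1, 2, 3}"
  shows "mode_arr \<phi> u (h (- int n - 1) v) w k a b =
      (\<Sum>i<I. (- ((- 1) ^ i)) * (of_nat (n + i) gchoose i) * mulz (- int n - 1 - int i) (mode_arr \<phi> (h (int i) u) v w) k a b)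
    + (\<Sum>j<I. ((- of_nat j - 1) gchoose n) * muly (- int j - int n - 1) (mode_arr \<phi> u v (h (int j) w)) k a b)"
proof -
  consider "k = 1" | "k = 2" | "k = 3" using k by auto
  then show ?thesis
  proof cases
    case 1
    then show ?thesis
      by (simp add: mode_arr_def muly_def mulz_def mode_create move_creation[OF \<phi> kill u w, where n=n and u=v and a=b and b=a] sum_negf algebra_simps)
  next
    case 2
    have e: "- ((- 1) ^ i * (x * ((- 1) powi (- int n - 1 - int i) * y))) = (- 1) ^ n * (x * y)" for i :: nat and x y :: complex
      unfolding minus_one_powi by (simp add: power_add)
    show ?thesis unfolding 2
      by (simp add: mode_arr_def muly_def mulz_def mode_create move_annihilation[OF \<phi> kill u w] diff_diff_eq add_ac
          sum_negf[symmetric] e[unfolded diff_diff_eq] mult.assoc) (simp add: algebra_simps)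
  next
    case 3
    have "h (- int n - 1) (mode p u a v) = mode p u a (h (- int n - 1) v)
      + (\<Sum>i<I. fscale ((- of_nat n - 1) gchoose i) (mode p (h (int i) u) (a - of_nat n - 1 - of_nat i) v))"
      using h_mode_bd[OF u, where r="- int n - 1"] by (simp add: add_diff_eq)
    then have m: "mode p u a (h (- int n - 1) v) = h (- int n - 1) (mode p u a v)
      - (\<Sum>i<I. fscale ((- of_nat n - 1) gchoose i) (mode p (h (int i) u) (a - of_nat n - 1 - of_nat i) v))"
      by (simp add: algebra_simps)
    have cr: "\<phi> (mode p (h (- int n - 1) y) b w)
        = (\<Sum>s<I. ((- of_nat s - 1) gchoose n) * \<phi> (mode p y (b - of_nat s - of_nat n - 1) (h (int s) w)))" for y
      unfolding mode_create kill_stepm[OF \<phi> kill good_mode]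
      by (rule Sum_any_cut) (simp add: w mode_02 clin_0[OF \<phi>])
    show ?thesis
      unfolding 3 by (simp add: mode_arr_def muly_def mulz_def m cr clin_diff[OF clin_mode1[OF \<phi>]] clin_sum[OF clin_mode1[OF \<phi>]]
          clin_scale[OF clin_mode1[OF \<phi>]] gbinomial_neg add_ac diff_diff_eq sum_negf) (simp add: algebra_simps)
  qed
qed

end

section \<open>Binomial series as solutions of recursions, and a residue identity\<close>

text \<open>The recursion says \<open>x F' = - s x / (1 - x) F\<close>, whose solution with constant
  term 1 is \<open>(1 - x)^s\<close>.\<close>

lemma binomial_recursion:
  fixes F :: "nat \<Rightarrow> complex"
  assumes "F 0 = 1" and rec: "\<And>t. of_nat t * F t = - s * (\<Sum>i=1..t. F (t - i))"
  shows "F t = (- 1) ^ t * (s gchoose t)"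
proof (induction t rule: less_induct)
  case (less t)
  show ?case
  proof (cases t)
    case (Suc u)
    have "(\<Sum>i=1..t. F (t - i)) = (\<Sum>j\<le>u. F j)"
      by (rule sum.reindex_bij_witness[of _ "\<lambda>j. t - j" "\<lambda>i. t - i"]) (auto simp: Suc)
    also have "\<dots> = (\<Sum>j\<le>u. (s gchoose j) * (- 1) ^ j)"
      by (rule sum.cong) (auto simp: less.IH Suc mult.commute)
    also have "\<dots> = (- 1) ^ u * (s - 1 gchoose u)"
      by (rule gbinomial_sum_lower_neg)
    finally have "of_nat t * F t = (- 1) ^ t * (s * (s - 1 gchoose u))"
      using rec[of t] by (simp add: Suc)
    also have "s * (s - 1 gchoose u) = of_nat t * (s gchoose t)"
      unfolding Suc by (rule gbinomial_absorption[symmetric])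
    finally have "of_nat t * F t = of_nat t * ((- 1) ^ t * (s gchoose t))"
      by (simp add: mult.left_commute)
    moreover have "(of_nat t :: complex) \<noteq> 0" unfolding Suc of_nat_eq_0_iff by simp
    ultimately show ?thesis by (simp only: mult_cancel_left simp_thms)
  qed (simp add: assms)
qed

text \<open>The substitution of \<open>- x\<close> for \<open>x\<close> reduces this to the
  preceding recursion; the solution is \<open>(1 + x)^s\<close>.\<close>

lemma binomial_recursion':
  fixes G :: "nat \<Rightarrow> complex"
  assumes "G 0 = 1" and rec: "\<And>t. of_nat t * G t = s * (\<Sum>i=1..t. (- 1) ^ (i - 1) * G (t - i))"
  shows "G t = s gchoose t"
proof -
  have sq: "(- 1) ^ n * ((- 1) ^ n * x) = x" for n and x :: complex
    by (simp flip: mult.assoc power_mult_distrib)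
  have "(- 1) ^ t * G t = (- 1) ^ t * (s gchoose t)"
  proof (rule binomial_recursion)
    fix t
    have "- s * (\<Sum>i=1..t. (- 1) ^ (t - i) * G (t - i)) = s * (\<Sum>i=1..t. (- 1) ^ t * ((- 1) ^ (i - 1) * G (t - i)))"
      unfolding sum_distrib_left
    proof (rule sum.cong[OF refl])
      fix i assume "i \<in> {1..t}"
      then obtain a b where ab: "i = Suc a" "t = Suc a + b"
        by (metis Suc_pred' atLeastAtMost_iff le_add_diff_inverse less_eq_Suc_le One_nat_def)
      show "- s * ((- 1) ^ (t - i) * G (t - i)) = s * ((- 1) ^ t * ((- 1) ^ (i - 1) * G (t - i)))"
        unfolding ab by (simp add: power_add)
    qed
    also have "\<dots> = (- 1) ^ t * (of_nat t * G t)"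
      unfolding rec by (simp add: sum_distrib_left[symmetric] mult.left_commute)
    finally show "of_nat t * ((- 1) ^ t * G t) = - s * (\<Sum>i=1..t. (- 1) ^ (t - i) * G (t - i))"
      by (simp add: mult.left_commute)
  qed (simp add: assms)
  then show ?thesis by simp
qed

text \<open>The residue theorem for \<open>x^M (x - y)^L\<close> with \<open>M = - N2 - 1\<close>:
  the residue at \<open>x = y\<close> is the difference of the coefficients of \<open>x^(-1)\<close>
  in the expansions for large and for small x.\<close>

lemma binomial_three_term:
  fixes N1 N2 L :: int
  assumes "N1 + N2 = L"
  shows "(if - L - 1 \<ge> 0 then (of_int (- N2 - 1) :: complex) gchoose nat (- L - 1) else 0)
    = (if N1 \<ge> 0 then (- 1) ^ nat N1 * (of_int L gchoose nat N1) else 0)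
      - (- 1) powi L * (if N2 \<ge> 0 then (- 1) ^ nat N2 * (of_int L gchoose nat N2) else 0)"
proof -
  have sq: "(- 1) ^ n * ((- 1) ^ n * x) = x" for n and x :: complex
    by (simp flip: mult.assoc power_mult_distrib)
  have neg: "((- of_nat n - 1) gchoose k :: complex) = (- 1) ^ k * of_nat ((n + k) choose k)" for n k
    by (simp only: gbinomial_neg binomial_gbinomial)
  have pm: "(- 1 :: complex) powi (- int n) = (- 1) ^ n" for n
    by (simp add: power_int_minus flip: power_inverse)
  consider a b where "N1 = int a" "N2 = int b" | a b where "N1 = int a" "N2 = - int b - 1"
    | a b where "N1 = - int a - 1" "N2 = int b" | a b where "N1 = - int a - 1" "N2 = - int b - 1"
  proof -
    have "(\<exists>a. N = int a) \<or> (\<exists>a. N = - int a - 1)" for N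
      by (metis add_diff_cancel_right' int_cases minus_diff_eq of_nat_Suc uminus_add_conv_diff add.commute)
    then show ?thesis using that by blast
  qed
  then show ?thesis
  proof cases
    case 1
    have L: "L = int (a + b)" using 1 assms by simp
    have "(of_nat (a + b) gchoose a :: complex) = of_nat (a + b) gchoose b"
      by (metis add.commute binomial_gbinomial binomial_symmetric diff_add_inverse le_add1)
    then show ?thesis unfolding 1 L
      by (simp add: power_int_of_nat power_add sq mult.assoc del: of_nat_add)
  next
    case 2
    show ?thesis
    proof (cases "b < a")
      case True
      then have L: "L = int (a - b - 1)" using 2 assms by simp
      have "((of_nat (a - b - 1) :: complex) gchoose a) = 0" using True by (intro gbinomial_small) simp
      then show ?thesis unfolding 2 L by (simp del: of_nat_diff)
    next
      case False
      then obtain d where d: "b = a + d" using le_Suc_ex not_less by blast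
      have L: "L = - int d - 1" using 2 assms d by simp
      have "of_int L = (- of_nat d - 1 :: complex)" by (simp add: L)
      moreover have "of_int (- N2 - 1) = (of_nat (a + d) :: complex)" by (simp add: 2 d)
      moreover have "(of_nat (a + d) :: complex) gchoose d = of_nat ((d + a) choose a)"
        by (metis add.commute binomial_gbinomial binomial_symmetric diff_add_inverse2 le_add2)
      moreover have "nat (- L - 1) = d" "- L - 1 \<ge> 0" "nat N1 = a" "N1 \<ge> 0" "\<not> N2 \<ge> 0" by (simp_all add: L 2)
      ultimately show ?thesis by (simp only: neg sq if_True if_False mult_zero_right diff_zero)
    qed
  next
    case 3
    show ?thesis
    proof (cases "a < b")
      case True
      then have L: "L = int (b - a - 1)" using 3 assms by simp
      have "((of_nat (b - a - 1) :: complex) gchoose b) = 0" using True by (intro gbinomial_small) simp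
      then show ?thesis unfolding 3 L by (simp del: of_nat_diff)
    next
      case False
      then obtain d where d: "a = b + d" using le_Suc_ex not_less by blast
      have L: "L = - int d - 1" using 3 assms d by simp
      have 1: "of_int L = (- of_nat d - 1 :: complex)" by (simp add: L)
      have 2: "of_int (- N2 - 1) = (- of_nat b - 1 :: complex)" by (simp add: 3)
      have "L = - int (d + 1)" using L by simp
      then have p: "(- 1 :: complex) powi L = - ((- 1) ^ d)" by (simp only: pm) simp
      have s: "(d + b) choose b = (b + d) choose d"
        by (metis add.commute binomial_symmetric diff_add_inverse2 le_add2)
      have "nat (- L - 1) = d" "- L - 1 \<ge> 0" "nat N2 = b" "N2 \<ge> 0" "\<not> N1 \<ge> 0" by (simp_all add: L 3)
      then show ?thesis
        by (simp only: 1 2 p neg sq s if_True if_False) simp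
    qed
  next
    case 4
    have L: "- L - 1 = int (a + b + 1)" using 4 assms by simp
    have "((of_nat b :: complex) gchoose (a + b + 1)) = 0" by (rule gbinomial_small) simp
    moreover have "nat (- L - 1) = a + b + 1" unfolding L by (rule nat_int)
    moreover have "of_int (- N2 - 1) = (of_nat b :: complex)" "\<not> N1 \<ge> 0" "\<not> N2 \<ge> 0" by (simp_all add: 4)
    ultimately show ?thesis by (simp only: if_False if_cancel mult_zero_right diff_zero)
  qed
qed

context lattice_va
begin

section \<open>Exponentials acting on exponentials\<close>

lemma mode_fexp: "mode p (fexp k) m v = exp_mode p k m v"
  by (simp add: fexp_def mode_basis mset_mode_empty)

lemma gr_fexp: "fexp k \<in> gr k 0"
  using gr_basis[of "{#}" k] by (simp add: fexp_def)

lemma exp_fexp: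
  "mode p (fexp k) m (fexp l) = (let c = - m - 1 - sp k l in if c \<in> \<int> then EM k \<lfloor>c\<rfloor> (fexp (k + l)) else 0)"
proof -
  have "vertop k C (fexp l') = EM k C (fexp l')" for C l'
  proof -
    have "EP k b (fexp l') = 0" if "b \<noteq> 0" for b
    proof (cases "b < 0")
      case False
      then show ?thesis using gr_EP[OF gr_fexp, of k b l'] that by (intro gr_neg) auto
    qed (simp add: EP_neg)
    then have "vertop k C (fexp l') = (\<Sum>b\<in>{0}. EM k (b + C) (EP k b (fexp l')))"
      by (intro vertop_superset) auto
    then show ?thesis by simp
  qed
  then show ?thesis
    unfolding mode_fexp unfolding fexp_def exp_mode_basis shift_charge_basis sp_def Let_def by (simp only: add.commute[of k l])
qed

lemma exp_fexp_int:
  assumes "- m - 1 - sp k l = of_int t"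
  shows "mode p (fexp k) m (fexp l) = EM k t (fexp (k + l))"
  using assms by (simp add: exp_fexp)

lemma EM_newton:
  "fscale (of_nat t) (EM k (int t) v)
    = (\<Sum>i=1..t. fscale (of_int k / (2 * of_nat p)) (h (- int i) (EM k (int (t - i)) v)))"
  using Eminus_newton[of t k v] by (simp add: EM_def cong: sum.cong)

lemma of_rat_sp: "of_rat (sp k l) = (of_int k * of_int l / (2 * of_nat p) :: complex)"
  by (simp add: sp_def of_rat_divide of_rat_mult)

text \<open>These are the coefficients of \<open>(1 - y/x)^(sp k1 k2)\<close>. Newton's formula for
  \<open>EM\<close> produces an \<alpha>(-i), and commuting it to the left, where it has no vacuum
  coefficient, gives the recursion of a binomial series.\<close>

lemma exp_EM_vac:
  assumes "m = of_nat t - 1 - sp k1 l"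
  shows "lk (mode p (fexp k1) m (EM k2 (int t) (fexp l))) ({#}, k1 + l) = (- 1) ^ t * (of_rat (sp k1 k2) gchoose t)"
proof -
  define F where "F t = lk (mode p (fexp k1) (of_nat t - 1 - sp k1 l) (EM k2 (int t) (fexp l))) ({#}, k1 + l)" for t
  have "F t = (- 1) ^ t * (of_rat (sp k1 k2) gchoose t)"
  proof (rule binomial_recursion)
    have "mode p (fexp k1) (of_nat 0 - 1 - sp k1 l) (fexp l) = EM k1 0 (fexp (k1 + l))"
      by (rule exp_fexp_int) simp
    then show "F 0 = 1" by (simp add: F_def fexp_def)
  next
    fix t
    let ?m = "of_nat t - 1 - sp k1 l"
    have create: "lk (mode p (fexp k1) ?m (h (- int i) (EM k2 (int (t - i)) (fexp l)))) ({#}, k1 + l) = - of_int k1 * F (t - i)"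
      if i: "i \<in> {1..t}" for i
    proof -
      have e: "?m + of_int (- int i) = of_nat (t - i) - 1 - sp k1 l" using i by (simp add: of_nat_diff)
      have "lk (h (- int i) (mode p (fexp k1) ?m (EM k2 (int (t - i)) (fexp l)))) ({#}, k1 + l) = 0"
        using i by (intro lk_create) simp
      then show ?thesis unfolding mode_fexp h_exp_mode e
        by (simp add: lookup_add lookup_fscale F_def mode_fexp add_eq_0_iff2)
    qed
    have "of_nat t * F t = lk (mode p (fexp k1) ?m (fscale (of_nat t) (EM k2 (int t) (fexp l)))) ({#}, k1 + l)"
      by (simp add: F_def mode_scale2 lookup_fscale)
    also have "\<dots> = (\<Sum>i=1..t. of_int k2 / (2 * of_nat p) * (- of_int k1 * F (t - i)))"
      unfolding EM_newton mode_sum2 mode_scale2 clin_sum[OF clin_lookup] lookup_fscale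
      by (rule sum.cong) (use create in auto)
    also have "\<dots> = - of_rat (sp k1 k2) * (\<Sum>i=1..t. F (t - i))"
      unfolding of_rat_sp sum_distrib_left by (rule sum.cong[OF refl]) simp
    finally show "of_nat t * F t = - of_rat (sp k1 k2) * (\<Sum>i=1..t. F (t - i))" .
  qed
  then show ?thesis by (simp add: F_def assms)
qed

text \<open>The same for the iterate: now the \<alpha>(-i) sits in the vector whose mode is taken,
  only its \<alpha>(0) part survives on \<open>fexp k3\<close>, and the series is
  \<open>(1 + z)^(sp k1 k3)\<close>.\<close>

lemma EM_fexp_vac:
  assumes "m = of_nat t - 1 - sp k k3"
  shows "lk (mode p (EM k1 (int t) (fexp k)) m (fexp k3)) ({#}, k + k3) = of_rat (sp k1 k3) gchoose t"
proof -
  define G where "G t = lk (mode p (EM k1 (int t) (fexp k)) (of_nat t - 1 - sp k k3) (fexp k3)) ({#}, k + k3)" for t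
  have "G t = of_rat (sp k1 k3) gchoose t"
  proof (rule binomial_recursion')
    have "mode p (fexp k) (of_nat 0 - 1 - sp k k3) (fexp k3) = EM k 0 (fexp (k + k3))"
      by (rule exp_fexp_int) simp
    then show "G 0 = 1" by (simp add: G_def fexp_def)
  next
    fix t
    let ?m = "of_nat t - 1 - sp k k3"
    have create: "lk (mode p (h (- int i) (EM k1 (int (t - i)) (fexp k))) ?m (fexp k3)) ({#}, k + k3)
        = (- 1) ^ (i - 1) * of_int k3 * G (t - i)" if i: "i \<in> {1..t}" for i
    proof -
      obtain n where n: "i = Suc n" using i by (cases i) auto
      have e: "?m - of_nat n - 1 = of_nat (t - i) - 1 - sp k k3" using i by (simp add: of_nat_diff n)
      have "- int i = - int n - 1" using n by simp
      then show ?thesis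
        by (simp only: mode_create lk_stepm_fexp[OF good_mode] e G_def) (simp add: n)
    qed
    have "of_nat t * G t = lk (mode p (fscale (of_nat t) (EM k1 (int t) (fexp k))) ?m (fexp k3)) ({#}, k + k3)"
      by (simp add: G_def mode_scale1 lookup_fscale)
    also have "\<dots> = (\<Sum>i=1..t. of_int k1 / (2 * of_nat p) * ((- 1) ^ (i - 1) * of_int k3 * G (t - i)))"
      unfolding EM_newton mode_sum1 mode_scale1 clin_sum[OF clin_lookup] lookup_fscale
      by (rule sum.cong) (use create in auto)
    also have "\<dots> = of_rat (sp k1 k3) * (\<Sum>i=1..t. (- 1) ^ (i - 1) * G (t - i))"
      by (simp add: of_rat_sp sum_distrib_left mult_ac)
    finally show "of_nat t * G t = of_rat (sp k1 k3) * (\<Sum>i=1..t. (- 1) ^ (i - 1) * G (t - i))" .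
  qed
  then show ?thesis by (simp add: G_def assms)
qed

abbreviation vacf :: "int \<Rightarrow> fock \<Rightarrow> complex" where "vacf K \<equiv> \<lambda>x. lk x ({#}, K)"

lemma lk_gr: "v \<in> gr k d \<Longrightarrow> k \<noteq> K \<or> d \<noteq> 0 \<Longrightarrow> lk v ({#}, K) = 0"
  unfolding gr_iff by (metis of_nat_0 wlev_simps(1))

lemma vandermonde_cut:
  "Sum_any (\<lambda>j::nat. (x gchoose j) * (if int j \<le> T then (y gchoose nat (T - int j)) else 0))
    = (if T \<ge> 0 then ((x + y) gchoose nat T) else 0 :: complex)"
proof (cases "T \<ge> 0")
  case True
  have "Sum_any (\<lambda>j::nat. (x gchoose j) * (if int j \<le> T then (y gchoose nat (T - int j)) else 0))
      = (\<Sum>j<Suc (nat T). (x gchoose j) * (if int j \<le> T then (y gchoose nat (T - int j)) else 0))"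
    by (rule Sum_any_bound) (use True in auto)
  also have "\<dots> = (\<Sum>j\<le>nat T. (x gchoose j) * (y gchoose (nat T - j)))"
    unfolding lessThan_Suc_atMost by (rule sum.cong) (use True in \<open>auto simp: nat_diff_distrib\<close>)
  also have "\<dots> = (x + y) gchoose nat T"
    using gbinomial_Vandermonde[of x y "nat T"] by (simp add: atMost_atLeast0)
  finally show ?thesis using True by simp
next
  case False
  then have "\<not> int j \<le> T" for j by simp
  then show ?thesis using False by simp
qed

text \<open>The base case: three exponentials have a product of powers of x, y and
  \<open>x - y\<close> as their correlation function. Vandermonde absorbs the fractional parts of
  the exponents, and \<open>binomial_three_term\<close> remains.\<close>

lemma borch_arr_fexp: "borch_arr (sp k1 k2) (sp k1 k3) (sp k2 k3) (mode_arr (vacf K) (fexp k1) (fexp k2) (fexp k3))"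
  unfolding borch_arr_def
proof (intro conjI trunc_arr_mode_arr clin_lookup)
  let ?T = "mode_arr (vacf K) (fexp k1) (fexp k2) (fexp k3)"
  let ?s = "sp k1 k2" and ?t = "sp k1 k3" and ?r = "sp k2 k3"
  show "borch_id ?s ?t ?r ?T"
    unfolding borch_id_def
  proof (intro allI)
    fix L M N :: int
    let ?l = "of_int L - ?s" and ?m = "of_int M - ?t" and ?n = "of_int N - ?r"
    \<comment> \<open>\<open>N1\<close>, \<open>N2\<close> and \<open>T\<close> are the levels of
      the three inner products at \<open>j = 0\<close>. A negative level means that the product
      vanishes.\<close>
    define N1 where "N1 = - N - 1"
    define N2 where "N2 = - M - 1"
    define T where "T = - L - 1"
    have i1: "mode p (fexp k2) (?n + of_nat j) (fexp k3) = EM k2 (N1 - int j) (fexp (k2 + k3))" for j :: nat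
      by (rule exp_fexp_int) (simp add: N1_def)
    have i2: "mode p (fexp k1) (?m + of_nat j) (fexp k3) = EM k1 (N2 - int j) (fexp (k1 + k3))" for j :: nat
      by (rule exp_fexp_int) (simp add: N2_def)
    have i3: "mode p (fexp k1) (?l + of_nat j) (fexp k2) = EM k1 (T - int j) (fexp (k1 + k2))" for j :: nat
      by (rule exp_fexp_int) (simp add: T_def)
    have g1: "mode p (fexp k1) (?m + ?l - of_nat j) (EM k2 (N1 - int j) (fexp (k2 + k3)))
        \<in> gr (k1 + (k2 + k3)) (- of_int (L + M + N + 2))" for j :: nat
      using gr_mode[OF gr_fexp gr_EM[OF gr_fexp, of k2 "N1 - int j" "k2 + k3"], where m="?m + ?l - of_nat j" and k=k1]
      by (simp add: N1_def sp_add2 algebra_simps)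
    have g2: "mode p (fexp k2) (?n + ?l - of_nat j) (EM k1 (N2 - int j) (fexp (k1 + k3)))
        \<in> gr (k2 + (k1 + k3)) (- of_int (L + M + N + 2))" for j :: nat
      using gr_mode[OF gr_fexp gr_EM[OF gr_fexp, of k1 "N2 - int j" "k1 + k3"], where m="?n + ?l - of_nat j" and k=k2]
      by (simp add: N2_def sp_add2 sp_commute[of k2 k1] algebra_simps)
    have g3: "mode p (EM k1 (T - int j) (fexp (k1 + k2))) (?m + ?n - of_nat j) (fexp k3)
        \<in> gr (k1 + k2 + k3) (- of_int (L + M + N + 2))" for j :: nat
      using gr_mode[OF gr_EM[OF gr_fexp, of k1 "T - int j" "k1 + k2"] gr_fexp, where m="?m + ?n - of_nat j" and l=k3]
      by (simp add: T_def sp_add1 algebra_simps)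
    show "Sum_any (\<lambda>j::nat. (of_rat ?m gchoose j) * ?T 3 (?l + of_nat j) (?m + ?n - of_nat j))
      = Sum_any (\<lambda>j::nat. (- 1) ^ j * (of_rat ?l gchoose j) * (?T 1 (?m + ?l - of_nat j) (?n + of_nat j)
       - (- 1) powi L * ?T 2 (?m + of_nat j) (?n + ?l - of_nat j)))"
    \<comment> \<open>Charge and degree are preserved, so outside this case all vacuum coefficients
      are 0.\<close>
    proof (cases "K = k1 + k2 + k3 \<and> L + M + N + 2 = 0")
      case False
      then have f: "k1 + (k2 + k3) \<noteq> K \<or> - rat_of_int (L + M + N + 2) \<noteq> 0"
        "k2 + (k1 + k3) \<noteq> K \<or> - rat_of_int (L + M + N + 2) \<noteq> 0"
        "k1 + k2 + k3 \<noteq> K \<or> - rat_of_int (L + M + N + 2) \<noteq> 0"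
        by (simp_all only: neg_equal_0_iff_equal of_int_eq_0_iff) auto
      have "?T 1 (?m + ?l - of_nat j) (?n + of_nat j) = 0"
        "?T 2 (?m + of_nat j) (?n + ?l - of_nat j) = 0" "?T 3 (?l + of_nat j) (?m + ?n - of_nat j) = 0" for j :: nat
        using lk_gr[OF g1 f(1)] lk_gr[OF g2 f(2)] lk_gr[OF g3 f(3)] by (simp_all add: mode_arr_def i1 i2 i3)
      then show ?thesis by simp
    next
      case True
      then have K: "K = k1 + k2 + k3" and Z: "L + M + N + 2 = 0" by auto
      have Zr: "rat_of_int M + of_int L = - of_int N - 2"
      proof -
        have "M + L = - N - 2" using Z by simp
        then show ?thesis by (metis of_int_add of_int_diff of_int_minus of_int_numeral)
      qed
      have c1: "?T 1 (?m + ?l - of_nat j) (?n + of_nat j) =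
          (- 1) ^ j * (if int j \<le> N1 then (- 1) ^ nat N1 * (of_rat ?s gchoose nat (N1 - int j)) else 0)" for j :: nat
      proof (cases "int j \<le> N1")
        case True
        then obtain t where t: "N1 = int j + int t" using zle_iff_zadd by blast
        have "lk (mode p (fexp k1) (?m + ?l - of_nat j) (EM k2 (int t) (fexp (k2 + k3)))) ({#}, k1 + (k2 + k3))
            = (- 1) ^ t * (of_rat ?s gchoose t)"
        proof (rule exp_EM_vac)
          have "rat_of_int N1 = of_nat j + of_nat t" using t by simp
          then show "?m + ?l - of_nat j = of_nat t - 1 - sp k1 (k2 + k3)"
            using Zr by (simp add: N1_def sp_add2 algebra_simps)
        qed
        moreover have "nat N1 = j + t" using t by simp
        moreover have "(- 1) ^ j * ((- 1) ^ j * x) = (x :: complex)" for x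
          by (simp flip: mult.assoc power_mult_distrib)
        ultimately show ?thesis
          by (simp add: mode_arr_def i1[simplified] t K add.assoc power_add)
      next
        case False
        then show ?thesis by (simp add: mode_arr_def i1[simplified] EM_neg mode_02)
      qed
      have c2: "?T 2 (?m + of_nat j) (?n + ?l - of_nat j) =
          (- 1) ^ j * (if int j \<le> N2 then (- 1) ^ nat N2 * (of_rat ?s gchoose nat (N2 - int j)) else 0)" for j :: nat
      proof (cases "int j \<le> N2")
        case True
        then obtain t where t: "N2 = int j + int t" using zle_iff_zadd by blast
        have "lk (mode p (fexp k2) (?n + ?l - of_nat j) (EM k1 (int t) (fexp (k1 + k3)))) ({#}, k2 + (k1 + k3))
            = (- 1) ^ t * (of_rat (sp k2 k1) gchoose t)"
        proof (rule exp_EM_vac)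
          have "rat_of_int N2 = of_nat j + of_nat t" using t by simp
          then show "?n + ?l - of_nat j = of_nat t - 1 - sp k2 (k1 + k3)"
            using Zr by (simp add: N2_def sp_add2 sp_commute[of k2 k1] algebra_simps)
        qed
        moreover have "nat N2 = j + t" using t by simp
        moreover have "(- 1) ^ j * ((- 1) ^ j * x) = (x :: complex)" for x
          by (simp flip: mult.assoc power_mult_distrib)
        ultimately show ?thesis
          by (simp add: mode_arr_def i2[simplified] t K add.left_commute[of k1 k2] add.assoc power_add sp_commute[of k2 k1])
      next
        case False
        then show ?thesis by (simp add: mode_arr_def i2[simplified] EM_neg mode_02)
      qed
      have c3: "?T 3 (?l + of_nat j) (?m + ?n - of_nat j) =
          (if int j \<le> T then (of_rat ?t gchoose nat (T - int j)) else 0)" for j :: nat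
      proof (cases "int j \<le> T")
        case True
        then obtain t where t: "T = int j + int t" using zle_iff_zadd by blast
        have "lk (mode p (EM k1 (int t) (fexp (k1 + k2))) (?m + ?n - of_nat j) (fexp k3)) ({#}, k1 + k2 + k3)
            = of_rat ?t gchoose t"
        proof (rule EM_fexp_vac)
          have "rat_of_int T = of_nat j + of_nat t" using t by simp
          then show "?m + ?n - of_nat j = of_nat t - 1 - sp (k1 + k2) k3"
            using Zr by (simp add: T_def sp_add1 algebra_simps)
        qed
        then show ?thesis
          by (simp add: mode_arr_def i3[simplified] t K)
      next
        case False
        then show ?thesis by (simp add: mode_arr_def i3[simplified] EM_neg mode_01)
      qed
      have sq: "(- 1) ^ j * x * ((- 1) ^ j * y - z * ((- 1) ^ j * w)) = x * y - x * (z * w)" for j and x y z w :: complex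
        by (simp add: algebra_simps)
      \<comment> \<open>These sums are the upper entries after Vandermonde; the fractional parts
        cancel and integers are left.\<close>
      have ms: "of_rat ?m + of_rat ?t = (of_int M :: complex)" "of_rat ?l + of_rat ?s = (of_int L :: complex)"
        by (simp_all add: of_rat_diff)
      have pull: "(x :: complex) * (if P then y * z else 0) = y * (x * (if P then z else 0))" for x y z P by simp
      define g :: "int \<Rightarrow> nat \<Rightarrow> complex" where "g N j = (of_rat ?l gchoose j) * (if int j \<le> N then (of_rat ?s gchoose nat (N - int j)) else 0)" for N and j :: nat
      have evg: "evz (g N)" for N
        unfolding evz_def g_def by (intro exI[of _ "Suc (nat N)"]) auto
      have Sg: "Sum_any (g N) = (if N \<ge> 0 then (of_int L gchoose nat N) else 0)" for N
        unfolding g_def vandermonde_cut ms ..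
      have "Sum_any (\<lambda>j::nat. (of_rat ?m gchoose j) * ?T 3 (?l + of_nat j) (?m + ?n - of_nat j))
          = (if T \<ge> 0 then (of_int M gchoose nat T) else 0)"
        unfolding c3 vandermonde_cut ms ..
      also have "\<dots> = (if N1 \<ge> 0 then (- 1) ^ nat N1 * (of_int L gchoose nat N1) else 0)
        - (- 1) powi L * (if N2 \<ge> 0 then (- 1) ^ nat N2 * (of_int L gchoose nat N2) else 0)"
      proof -
        have "N1 + N2 = L" using Z by (simp add: N1_def N2_def)
        moreover have "- N2 - 1 = M" by (simp add: N2_def)
        ultimately show ?thesis using binomial_three_term[of N1 N2 L] by (simp only: T_def)
      qed
      also have "\<dots> = (- 1) ^ nat N1 * Sum_any (g N1) - (- 1) powi L * (- 1) ^ nat N2 * Sum_any (g N2)"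
        unfolding Sg by simp
      also have "\<dots> = Sum_any (\<lambda>j. (- 1) ^ nat N1 * g N1 j - (- 1) powi L * (- 1) ^ nat N2 * g N2 j)"
        by (simp only: Sum_any_diff evz_cmult evg Sum_any_cmult)
      also have "\<dots> = Sum_any (\<lambda>j::nat. (- 1) ^ j * (of_rat ?l gchoose j) * (?T 1 (?m + ?l - of_nat j) (?n + of_nat j)
       - (- 1) powi L * ?T 2 (?m + of_nat j) (?n + ?l - of_nat j)))"
        unfolding c1 c2 sq g_def by (rule Sum_any.cong) (simp only: pull mult.assoc mult.left_commute)
      finally show ?thesis .
    qed
  qed
qed

section \<open>The Borcherds identity\<close>

lemma mode_arr_scale:
  assumes "clin \<phi>"
  shows "mode_arr \<phi> (fscale c u) v w = (\<lambda>k a b. c * mode_arr \<phi> u v w k a b)"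
    "mode_arr \<phi> u (fscale c v) w = (\<lambda>k a b. c * mode_arr \<phi> u v w k a b)"
    "mode_arr \<phi> u v (fscale c w) = (\<lambda>k a b. c * mode_arr \<phi> u v w k a b)"
  by (auto simp: mode_arr_def fun_eq_iff mode_scale1 mode_scale2 clin_scale[OF assms])

lemma h_basis_scaled:
  "\<exists>c \<nu>. h (int i) (basis \<mu> k) = fscale c (basis \<nu> k) \<and> size \<nu> \<le> size \<mu>"
proof (cases "i = 0")
  case True
  then show ?thesis by (auto simp: heis_basis)
next
  case False
  have "size (\<mu> - {#nat (int i - 1)#}) \<le> size \<mu>" by (rule size_mset_mono) simp
  then show ?thesis using False by (auto simp: heis_basis)
qed

lemma h_basis_scaled': "\<exists>c \<nu>. h r (basis \<mu> k) = fscale c (basis \<nu> k)"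
  by (auto simp: heis_basis intro: exI[of _ "1::complex"] exI[of _ "add_mset (nat (- r - 1)) \<mu>"])
    (metis fock.scale_one)

lemma common_bound: "\<exists>I. \<forall>i\<ge>I. h (int i) u = 0 \<and> h (int i) v = 0"
proof -
  obtain I J where "\<forall>i\<ge>I. h (int i) u = 0" "\<forall>i\<ge>J. h (int i) v = 0" using heis_eventually_0 by metis
  then have "\<forall>i\<ge>max I J. h (int i) u = 0 \<and> h (int i) v = 0" by simp
  then show ?thesis by blast
qed

lemma vacf_kill: "vacf K (h (- int j - 1) x) = 0"
  by (rule lk_create) simp

text \<open>Letters are removed from u, then from v, then from w. For w one uses
  \<open>mode_arr_comm\<close> with a creation operator, whose image the vacuum functional
  kills.\<close>

lemma borch_arr_vac:
  "borch_arr (sp k1 k2) (sp k1 k3) (sp k2 k3) (mode_arr (vacf K) (basis \<mu>1 k1) (basis \<mu>2 k2) (basis \<mu>3 k3))"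
proof (induction "size \<mu>1 + size \<mu>2 + size \<mu>3" arbitrary: \<mu>1 \<mu>2 \<mu>3 rule: less_induct)
  case less
  let ?B = "\<lambda>u v w. borch_arr (sp k1 k2) (sp k1 k3) (sp k2 k3) (mode_arr (vacf K) u v w)"
  have IHu: "?B (h (int i) (basis \<nu>1 k1)) (basis \<nu>2 k2) (basis \<nu>3 k3)"
    if "size \<nu>1 + size \<nu>2 + size \<nu>3 < size \<mu>1 + size \<mu>2 + size \<mu>3" for i \<nu>1 \<nu>2 \<nu>3
  proof -
    obtain c \<nu> where "h (int i) (basis \<nu>1 k1) = fscale c (basis \<nu> k1)" "size \<nu> \<le> size \<nu>1"
      using h_basis_scaled by blast
    then show ?thesis using that by (simp add: mode_arr_scale[OF clin_lookup] borch_arr_scale less.hyps)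
  qed
  have IHv: "?B (basis \<nu>1 k1) (h (int i) (basis \<nu>2 k2)) (basis \<nu>3 k3)"
    if "size \<nu>1 + size \<nu>2 + size \<nu>3 < size \<mu>1 + size \<mu>2 + size \<mu>3" for i \<nu>1 \<nu>2 \<nu>3
  proof -
    obtain c \<nu> where "h (int i) (basis \<nu>2 k2) = fscale c (basis \<nu> k2)" "size \<nu> \<le> size \<nu>2"
      using h_basis_scaled by blast
    then show ?thesis using that by (simp add: mode_arr_scale[OF clin_lookup] borch_arr_scale less.hyps)
  qed
  have IHw: "?B (basis \<nu>1 k1) (basis \<nu>2 k2) (h (int i) (basis \<nu>3 k3))"
    if "size \<nu>1 + size \<nu>2 + size \<nu>3 < size \<mu>1 + size \<mu>2 + size \<mu>3" for i \<nu>1 \<nu>2 \<nu>3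
  proof -
    obtain c \<nu> where "h (int i) (basis \<nu>3 k3) = fscale c (basis \<nu> k3)" "size \<nu> \<le> size \<nu>3"
      using h_basis_scaled by blast
    then show ?thesis using that by (simp add: mode_arr_scale[OF clin_lookup] borch_arr_scale less.hyps)
  qed
  have create: "basis (add_mset n \<mu>) k = h (- int n - 1) (basis \<mu> k)" for n \<mu> k
    by (simp add: heis_basis)
  show ?case
  proof (cases \<mu>1)
    case (add n \<nu>)
    obtain I where I: "\<And>i. i \<ge> I \<Longrightarrow> h (int i) (basis \<mu>2 k2) = 0" "\<And>i. i \<ge> I \<Longrightarrow> h (int i) (basis \<mu>3 k3) = 0"
      using common_bound by blast
    have "borch_arr (sp k1 k2) (sp k1 k3) (sp k2 k3) (\<lambda>k a b.
        (\<Sum>i<I. (- 1) ^ n * (of_nat (n + i) gchoose i) * mulz (- int n - 1 - int i) (mode_arr (vacf K) (basis \<nu> k1) (h (int i) (basis \<mu>2 k2)) (basis \<mu>3 k3)) k a b)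
      + (\<Sum>j<I. ((- of_nat j - 1) gchoose n) * mulx (- int j - int n - 1) (mode_arr (vacf K) (basis \<nu> k1) (basis \<mu>2 k2) (h (int j) (basis \<mu>3 k3))) k a b))"
      by (intro borch_arr_add borch_arr_sum borch_arr_scale borch_arr_mulz borch_arr_mulx IHv IHw) (auto simp: add)
    then show ?thesis unfolding add create
      by (rule borch_arr_cong[OF _ lattice_va_axioms]) (rule mode_arr_u[OF clin_lookup vacf_kill I, symmetric])
  next
    case empty1: empty
    show ?thesis
    proof (cases \<mu>2)
      case (add n \<nu>)
      obtain I where I: "\<And>i. i \<ge> I \<Longrightarrow> h (int i) (basis \<mu>1 k1) = 0" "\<And>i. i \<ge> I \<Longrightarrow> h (int i) (basis \<mu>3 k3) = 0"
        using common_bound by blast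
      have "borch_arr (sp k1 k2) (sp k1 k3) (sp k2 k3) (\<lambda>k a b.
          (\<Sum>i<I. (- ((- 1) ^ i)) * (of_nat (n + i) gchoose i) * mulz (- int n - 1 - int i) (mode_arr (vacf K) (h (int i) (basis \<mu>1 k1)) (basis \<nu> k2) (basis \<mu>3 k3)) k a b)
        + (\<Sum>j<I. ((- of_nat j - 1) gchoose n) * muly (- int j - int n - 1) (mode_arr (vacf K) (basis \<mu>1 k1) (basis \<nu> k2) (h (int j) (basis \<mu>3 k3))) k a b))"
        by (intro borch_arr_add borch_arr_sum borch_arr_scale borch_arr_mulz borch_arr_muly IHu IHw) (auto simp: add)
      then show ?thesis unfolding add create
        by (rule borch_arr_cong[OF _ lattice_va_axioms]) (rule mode_arr_v[OF clin_lookup vacf_kill I, symmetric])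
    next
      case empty2: empty
      show ?thesis
      proof (cases \<mu>3)
        case (add n \<nu>)
        let ?w = "basis \<nu> k3" and ?r = "- int n - 1"
        obtain I where I: "\<And>i. i \<ge> I \<Longrightarrow> h (int i) (basis \<mu>1 k1) = 0" "\<And>i. i \<ge> I \<Longrightarrow> h (int i) (basis \<mu>2 k2) = 0"
          using common_bound by blast
        have "borch_arr (sp k1 k2) (sp k1 k3) (sp k2 k3) (\<lambda>k a b. - 1 *
            ((\<Sum>i<I. (of_int ?r gchoose i) * mulx (?r - int i) (mode_arr (vacf K) (h (int i) (basis \<mu>1 k1)) (basis \<mu>2 k2) ?w) k a b)
           + (\<Sum>i<I. (of_int ?r gchoose i) * muly (?r - int i) (mode_arr (vacf K) (basis \<mu>1 k1) (h (int i) (basis \<mu>2 k2)) ?w) k a b)))"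
          by (rule borch_arr_scale, intro borch_arr_add borch_arr_sum borch_arr_scale borch_arr_mulx borch_arr_muly IHu IHv) (auto simp: add)
        then show ?thesis unfolding add create
        proof (rule borch_arr_cong[OF _ lattice_va_axioms])
          fix k :: nat and a b :: rat assume k: "k \<in> {1, 2, 3}"
          have 0: "mode_arr (\<lambda>x. vacf K (h ?r x)) (basis \<mu>1 k1) (basis \<mu>2 k2) ?w k a b = 0"
            by (simp add: mode_arr_def lk_create)
          have *: "x + y + z = 0 \<Longrightarrow> - 1 * (y + z) = x" for x y z :: complex
            by (simp add: add_eq_0_iff2 add.assoc)
          show "- 1 * ((\<Sum>i<I. (of_int ?r gchoose i) * mulx (?r - int i) (mode_arr (vacf K) (h (int i) (basis \<mu>1 k1)) (basis \<mu>2 k2) ?w) k a b)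
           + (\<Sum>i<I. (of_int ?r gchoose i) * muly (?r - int i) (mode_arr (vacf K) (basis \<mu>1 k1) (h (int i) (basis \<mu>2 k2)) ?w) k a b))
           = mode_arr (vacf K) (basis \<mu>1 k1) (basis \<mu>2 k2) (h ?r ?w) k a b"
            by (rule *, rule trans[OF mode_arr_comm[OF clin_lookup I k, symmetric] 0])
        qed
      next
        case empty
        then show ?thesis using borch_arr_fexp[of k1 k2 k3 K] empty1 empty2 by (simp add: fexp_def)
      qed
    qed
  qed
qed

abbreviation functional :: "int list \<Rightarrow> int \<Rightarrow> fock \<Rightarrow> complex" where
  "functional rs K \<equiv> \<lambda>x. lk (fold h rs x) ({#}, K)"

lemma flin_fold_h: "flin (fold h rs)"
proof (induction rs)
  case (Cons r rs)
  have "fold h (r # rs) = (\<lambda>x. fold h rs (h r x))" by (simp add: fun_eq_iff)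
  then show ?case using flin_comp[OF Cons flin_heis] by simp
qed (simp add: id_def)

lemma clin_functional: "clin (functional rs K)"
  by (rule clin_comp[OF clin_lookup flin_fold_h])

text \<open>These functionals separate vectors by \<open>fock_zeroI\<close>. Each \<alpha>(r) in
  them is moved through the product by \<open>mode_arr_comm\<close>; it changes the monomials only
  up to scalars and letters, and the claim covers all monomials.\<close>

lemma borch_arr_functional:
  "borch_arr (sp k1 k2) (sp k1 k3) (sp k2 k3) (mode_arr (functional rs K) (basis \<mu>1 k1) (basis \<mu>2 k2) (basis \<mu>3 k3))"
proof (induction rs arbitrary: \<mu>1 \<mu>2 \<mu>3)
  case Nil
  then show ?case using borch_arr_vac by simp
next
  case (Cons r rs)
  let ?B = "\<lambda>u v w. borch_arr (sp k1 k2) (sp k1 k3) (sp k2 k3) (mode_arr (functional rs K) u v w)"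
  have sc: "?B (h r1 (basis \<nu>1 k1)) (basis \<nu>2 k2) (basis \<nu>3 k3)"
    "?B (basis \<nu>1 k1) (h r1 (basis \<nu>2 k2)) (basis \<nu>3 k3)"
    "?B (basis \<nu>1 k1) (basis \<nu>2 k2) (h r1 (basis \<nu>3 k3))" for r1 \<nu>1 \<nu>2 \<nu>3
    using h_basis_scaled'[of r1 \<nu>1 k1] h_basis_scaled'[of r1 \<nu>2 k2] h_basis_scaled'[of r1 \<nu>3 k3]
    by (auto simp: mode_arr_scale[OF clin_functional] intro!: borch_arr_scale Cons.IH)
  obtain I where I: "\<And>i. i \<ge> I \<Longrightarrow> h (int i) (basis \<mu>1 k1) = 0" "\<And>i. i \<ge> I \<Longrightarrow> h (int i) (basis \<mu>2 k2) = 0"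
    using common_bound by blast
  have "borch_arr (sp k1 k2) (sp k1 k3) (sp k2 k3) (\<lambda>k a b. mode_arr (functional rs K) (basis \<mu>1 k1) (basis \<mu>2 k2) (h r (basis \<mu>3 k3)) k a b
     + (\<Sum>i<I. (of_int r gchoose i) * mulx (r - int i) (mode_arr (functional rs K) (h (int i) (basis \<mu>1 k1)) (basis \<mu>2 k2) (basis \<mu>3 k3)) k a b)
     + (\<Sum>i<I. (of_int r gchoose i) * muly (r - int i) (mode_arr (functional rs K) (basis \<mu>1 k1) (h (int i) (basis \<mu>2 k2)) (basis \<mu>3 k3)) k a b))"
    by (intro borch_arr_add borch_arr_sum borch_arr_scale borch_arr_mulx borch_arr_muly sc)
  then have "borch_arr (sp k1 k2) (sp k1 k3) (sp k2 k3) (mode_arr (\<lambda>x. functional rs K (h r x)) (basis \<mu>1 k1) (basis \<mu>2 k2) (basis \<mu>3 k3))"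
    by (rule borch_arr_cong[OF _ lattice_va_axioms]) (rule mode_arr_comm[OF clin_functional I, symmetric])
  then show ?case by simp
qed

definition borch_lhs :: "rat \<Rightarrow> rat \<Rightarrow> rat \<Rightarrow> fock \<Rightarrow> fock \<Rightarrow> fock \<Rightarrow> nat \<Rightarrow> fock" where
  "borch_lhs l m n u v w j = fscale (of_rat m gchoose j) (mode p (mode p u (l + of_nat j) v) (m + n - of_nat j) w)"

text \<open>\<open>L\<close> is a separate argument because \<open>l\<close> may be fractional; it
  will be the integer \<open>l + sp k1 k2\<close>.\<close>

definition borch_rhs :: "int \<Rightarrow> rat \<Rightarrow> rat \<Rightarrow> rat \<Rightarrow> fock \<Rightarrow> fock \<Rightarrow> fock \<Rightarrow> nat \<Rightarrow> fock" where
  "borch_rhs L l m n u v w j = fscale ((- 1) ^ j * (of_rat l gchoose j))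
     (mode p u (m + l - of_nat j) (mode p v (n + of_nat j) w)
      - fscale ((- 1) powi L) (mode p v (n + l - of_nat j) (mode p u (m + of_nat j) w)))"

lemma evz_mode_shift: "evz (\<lambda>j. mode p u (x + of_nat j) v)"
  using good_evz[OF good_mode, of u x 0 v] by simp

lemma evz_borch_lhs: "evz (borch_lhs l m n u v w)"
  unfolding borch_lhs_def by (rule evz_comp0[OF evz_mode_shift[of u l v]]) (simp add: mode_01)

lemma evz_borch_rhs: "evz (borch_rhs L l m n u v w)"
proof -
  have "evz (\<lambda>j. fscale ((- 1) ^ j * (of_rat l gchoose j)) (mode p u (m + l - of_nat j) (mode p v (n + of_nat j) w))
      + fscale (- ((- 1) ^ j * (of_rat l gchoose j) * (- 1) powi L)) (mode p v (n + l - of_nat j) (mode p u (m + of_nat j) w)))"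
    by (intro evz_add evz_comp0[OF evz_mode_shift[of v n w]] evz_comp0[OF evz_mode_shift[of u m w]]) (simp_all add: mode_02)
  moreover have "borch_rhs L l m n u v w = (\<lambda>j. fscale ((- 1) ^ j * (of_rat l gchoose j)) (mode p u (m + l - of_nat j) (mode p v (n + of_nat j) w))
      + fscale (- ((- 1) ^ j * (of_rat l gchoose j) * (- 1) powi L)) (mode p v (n + l - of_nat j) (mode p u (m + of_nat j) w)))"
    by (simp add: fun_eq_iff borch_rhs_def fock.scale_right_diff_distrib)
  ultimately show ?thesis by simp
qed

lemma flin_Sum_any:
  assumes "\<And>j. flin (g j)" "\<And>x. evz (\<lambda>j. g j x)"
  shows "flin (\<lambda>x. Sum_any (\<lambda>j::nat. g j x))"
  by (rule flinI) (simp_all add: flin_add[OF assms(1)] flin_scale[OF assms(1)] Sum_any_add Sum_any_fscale assms(2))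

lemma flin_borch_lhs: "flin (\<lambda>u. Sum_any (borch_lhs l m n u v w))" "flin (\<lambda>v. Sum_any (borch_lhs l m n u v w))"
  "flin (\<lambda>w. Sum_any (borch_lhs l m n u v w))"
proof -
  show "flin (\<lambda>u. Sum_any (borch_lhs l m n u v w))"
    by (rule flin_Sum_any[OF _ evz_borch_lhs]) (simp add: flin_def borch_lhs_def mode_add1 mode_scale1 fock.scale_right_distrib fock.scale_left_commute mult.commute)
  show "flin (\<lambda>v. Sum_any (borch_lhs l m n u v w))"
    by (rule flin_Sum_any[OF _ evz_borch_lhs]) (simp add: flin_def borch_lhs_def mode_add1 mode_scale1 mode_add2 mode_scale2 fock.scale_right_distrib fock.scale_left_commute mult.commute)
  show "flin (\<lambda>w. Sum_any (borch_lhs l m n u v w))"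
    by (rule flin_Sum_any[OF _ evz_borch_lhs]) (simp add: flin_def borch_lhs_def mode_add2 mode_scale2 fock.scale_right_distrib fock.scale_left_commute mult.commute)
qed

lemma flin_borch_rhs: "flin (\<lambda>u. Sum_any (borch_rhs L l m n u v w))" "flin (\<lambda>v. Sum_any (borch_rhs L l m n u v w))"
  "flin (\<lambda>w. Sum_any (borch_rhs L l m n u v w))"
proof -
  show "flin (\<lambda>u. Sum_any (borch_rhs L l m n u v w))"
    by (rule flin_Sum_any[OF _ evz_borch_rhs], unfold borch_rhs_def) (intro flin_fscale flin_minus flin_mode1 flin_comp[OF flin_mode2 flin_mode1])
  show "flin (\<lambda>v. Sum_any (borch_rhs L l m n u v w))"
    by (rule flin_Sum_any[OF _ evz_borch_rhs], unfold borch_rhs_def) (intro flin_fscale flin_minus flin_mode1 flin_comp[OF flin_mode2 flin_mode1])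
  show "flin (\<lambda>w. Sum_any (borch_rhs L l m n u v w))"
    by (rule flin_Sum_any[OF _ evz_borch_rhs], unfold borch_rhs_def) (intro flin_fscale flin_minus flin_comp[OF flin_mode2 flin_mode2])
qed

lemma flin_keys_eq:
  assumes "flin f" "flin g" "\<And>\<mu> k. (\<mu>, k) \<in> Poly_Mapping.keys v \<Longrightarrow> f (basis \<mu> k) = g (basis \<mu> k)"
  shows "f v = g v"
proof -
  have "f v = (\<Sum>a\<in>Poly_Mapping.keys v. fscale (lk v a) (f (Poly_Mapping.single a 1)))"
    using arg_cong[OF fock_expand, of f v] by (simp add: flin_sum[OF assms(1)] flin_scale[OF assms(1)])
  also have "\<dots> = (\<Sum>a\<in>Poly_Mapping.keys v. fscale (lk v a) (g (Poly_Mapping.single a 1)))"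
  proof (rule sum.cong[OF refl])
    fix a assume "a \<in> Poly_Mapping.keys v"
    then show "fscale (lk v a) (f (Poly_Mapping.single a 1)) = fscale (lk v a) (g (Poly_Mapping.single a 1))"
      using assms(3)[of "fst a" "snd a"] by simp
  qed
  also have "\<dots> = g v"
    using arg_cong[OF fock_expand, of g v] by (simp add: flin_sum[OF assms(2)] flin_scale[OF assms(2)])
  finally show ?thesis .
qed

lemma borcherds_basis:
  assumes "l = of_int L - sp k1 k2" "m = of_int M - sp k1 k3" "n = of_int N - sp k2 k3"
  shows "Sum_any (borch_lhs l m n (basis \<mu>1 k1) (basis \<mu>2 k2) (basis \<mu>3 k3)) = Sum_any (borch_rhs L l m n (basis \<mu>1 k1) (basis \<mu>2 k2) (basis \<mu>3 k3))"
proof -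
  let ?u = "basis \<mu>1 k1" and ?v = "basis \<mu>2 k2" and ?w = "basis \<mu>3 k3"
  have "Sum_any (borch_lhs l m n ?u ?v ?w) - Sum_any (borch_rhs L l m n ?u ?v ?w) = 0"
  proof (rule fock_zeroI[OF _ p0(1)])
    fix rs :: "int list" and K
    let ?f = "functional rs K"
    note f = clin_diff[OF clin_functional[where rs=rs and K=K]] clin_scale[OF clin_functional[where rs=rs and K=K]]
    have "?f (Sum_any (borch_lhs l m n ?u ?v ?w)) = Sum_any (\<lambda>j::nat. (of_rat m gchoose j) * mode_arr ?f ?u ?v ?w 3 (l + of_nat j) (m + n - of_nat j))"
      unfolding Sum_any_clin[OF clin_functional evz_borch_lhs] by (simp add: borch_lhs_def mode_arr_def f)
    also have "\<dots> = Sum_any (\<lambda>j::nat. (- 1) ^ j * (of_rat l gchoose j) *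
      (mode_arr ?f ?u ?v ?w 1 (m + l - of_nat j) (n + of_nat j) - (- 1) powi L * mode_arr ?f ?u ?v ?w 2 (m + of_nat j) (n + l - of_nat j)))"
      using borch_arr_functional[of k1 k2 k3 rs K \<mu>1 \<mu>2 \<mu>3] unfolding borch_arr_def borch_id_def assms by blast
    also have "\<dots> = ?f (Sum_any (borch_rhs L l m n ?u ?v ?w))"
      unfolding Sum_any_clin[OF clin_functional evz_borch_rhs] by (simp add: borch_rhs_def mode_arr_def f)
    finally show "?f (Sum_any (borch_lhs l m n ?u ?v ?w) - Sum_any (borch_rhs L l m n ?u ?v ?w)) = 0"
      by (simp add: f)
  qed
  then show ?thesis by simp
qed

definition Ch :: "int \<Rightarrow> fock set" where
  "Ch k = {v. \<forall>(\<mu>, l)\<in>Poly_Mapping.keys v. l = k}"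

text \<open>The charges of u and v must be fixed, since the sign depends on both. That of w matters
  only modulo 2p: a shift by a multiple of 2p changes its inner products by integers and leaves
  \<open>L\<close> alone.\<close>

theorem borcherds_rat:
  assumes u: "u \<in> Ch k1" and v: "v \<in> Ch k2" and w: "w \<in> VL p k3"
    and l: "l + sp k1 k2 = of_int L" and m: "m + sp k1 k3 \<in> \<int>" and n: "n + sp k2 k3 \<in> \<int>"
  shows "Sum_any (borch_lhs l m n u v w) = Sum_any (borch_rhs L l m n u v w)"
proof -
  have 0: "Sum_any (borch_lhs l m n (basis \<mu>1 k1) (basis \<mu>2 k2) (basis \<mu>3 k)) = Sum_any (borch_rhs L l m n (basis \<mu>1 k1) (basis \<mu>2 k2) (basis \<mu>3 k))"
    if k: "2 * int p dvd k - k3" for \<mu>1 \<mu>2 \<mu>3 k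
  proof -
    obtain z where z: "k = k3 + 2 * int p * z" using k by (metis add_diff_cancel_left' diff_add_cancel add.commute dvdE)
    have s: "sp x k = sp x k3 + of_int (x * z)" for x
      using p0 by (simp add: z sp_add2) (simp add: sp_def)
    obtain M where M: "m + sp k1 k3 = of_int M" using m by (elim Ints_cases)
    obtain N where N: "n + sp k2 k3 = of_int N" using n by (elim Ints_cases)
    show ?thesis
    proof (rule borcherds_basis)
      show "l = of_int L - sp k1 k2" using l by (simp add: algebra_simps)
      show "m = of_int (M + k1 * z) - sp k1 k" using M by (simp add: s algebra_simps)
      show "n = of_int (N + k2 * z) - sp k2 k" using N by (simp add: s algebra_simps)
    qed
  qed
  have 1: "Sum_any (borch_lhs l m n (basis \<mu>1 k1) (basis \<mu>2 k2) w) = Sum_any (borch_rhs L l m n (basis \<mu>1 k1) (basis \<mu>2 k2) w)" for \<mu>1 \<mu>2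
    by (rule flin_keys_eq[OF flin_borch_lhs(3) flin_borch_rhs(3)]) (use w 0 in \<open>auto simp: VL_def\<close>)
  have 2: "Sum_any (borch_lhs l m n (basis \<mu>1 k1) v w) = Sum_any (borch_rhs L l m n (basis \<mu>1 k1) v w)" for \<mu>1
    by (rule flin_keys_eq[OF flin_borch_lhs(2) flin_borch_rhs(2)]) (use v 1 in \<open>auto simp: Ch_def\<close>)
  show ?thesis
    by (rule flin_keys_eq[OF flin_borch_lhs(1) flin_borch_rhs(1)]) (use u 2 in \<open>auto simp: Ch_def\<close>)
qed

end

lemma Sum_any_single: "(\<And>j. j \<noteq> j0 \<Longrightarrow> f j = 0) \<Longrightarrow> Sum_any f = f j0"
  by (subst Sum_any.expand_superset[of "{j0}"]) auto

context lattice_va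
begin

section \<open>Commutators, iterates and charges\<close>

lemma subspace_keys: "fock.subspace {v. \<forall>a\<in>Poly_Mapping.keys v. P a}"
proof -
  have "P a" if "lk x a + lk y a \<noteq> 0" "\<forall>a\<in>Poly_Mapping.keys x. P a" "\<forall>a\<in>Poly_Mapping.keys y. P a" for a x y
    using that by (cases "lk x a = 0") (auto simp: in_keys_iff)
  then show ?thesis by (auto simp: fock.subspace_def in_keys_iff lookup_add lookup_fscale)
qed

lemma subspace_VL: "fock.subspace (VL p k)"
  unfolding VL_def by (rule subspace_keys)

lemma subspace_Ch: "fock.subspace (Ch k)"
  unfolding Ch_def by (rule subspace_keys)

lemma Ch_iff: "v \<in> Ch k \<longleftrightarrow> (\<forall>\<mu> l. lk v (\<mu>, l) \<noteq> 0 \<longrightarrow> l = k)"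
  by (auto simp: Ch_def in_keys_iff)

lemma gr_Ch: "v \<in> gr k d \<Longrightarrow> v \<in> Ch k"
  by (auto simp: Ch_iff gr_iff)

lemma Ch_VL: "v \<in> Ch k \<Longrightarrow> v \<in> VL p k"
  by (auto simp: Ch_def VL_def)

lemma VL_cong: "2 * int p dvd k - l \<Longrightarrow> VL p k = VL p l"
proof -
  assume kl: "2 * int p dvd k - l"
  have "2 * int p dvd x - k \<longleftrightarrow> 2 * int p dvd x - l" for x
    using dvd_add_right_iff[OF kl, of "x - k"] by simp
  then show ?thesis unfolding VL_def by simp
qed

lemma basis_Ch: "basis \<mu> k \<in> Ch k"
  by (rule gr_Ch[OF gr_basis])

lemma fexp_Ch: "fexp k \<in> Ch k"
  by (simp add: fexp_def basis_Ch)

lemma flin_keys_in: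
  assumes "flin f" "fock.subspace S" "\<And>\<mu> k. (\<mu>, k) \<in> Poly_Mapping.keys v \<Longrightarrow> f (basis \<mu> k) \<in> S"
  shows "f v \<in> S"
proof -
  have "f v = (\<Sum>a\<in>Poly_Mapping.keys v. fscale (lk v a) (f (Poly_Mapping.single a 1)))"
    using arg_cong[OF fock_expand, of f v] by (simp add: flin_sum[OF assms(1)] flin_scale[OF assms(1)])
  also have "\<dots> \<in> S"
    by (intro fock.subspace_sum[OF assms(2)] fock.subspace_scale[OF assms(2)]) (metis assms(3) surj_pair)
  finally show ?thesis .
qed

lemma mode_basis_gr: "mode p (basis \<mu> k) m (basis \<nu> l) \<in> gr (k + l) (of_nat (wlev \<mu>) + of_nat (wlev \<nu>) - m - 1 - sp k l)"
  by (rule gr_mode[OF gr_basis gr_basis])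

lemma Ch_mode:
  assumes "u \<in> Ch k" "v \<in> Ch l"
  shows "mode p u m v \<in> Ch (k + l)"
proof (rule flin_keys_in[OF flin_mode2 subspace_Ch])
  fix \<nu> l' assume "(\<nu>, l') \<in> Poly_Mapping.keys v"
  then have l: "l' = l" using assms(2) by (auto simp: Ch_def)
  show "mode p u m (basis \<nu> l') \<in> Ch (k + l)"
  proof (rule flin_keys_in[OF flin_mode1 subspace_Ch])
    fix \<mu> k' assume "(\<mu>, k') \<in> Poly_Mapping.keys u"
    then have "k' = k" using assms(1) by (auto simp: Ch_def)
    then show "mode p (basis \<mu> k') m (basis \<nu> l') \<in> Ch (k + l)" using gr_Ch[OF mode_basis_gr] l by blast
  qed
qed

lemma VL_mode:
  assumes "u \<in> VL p k" "v \<in> VL p l"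
  shows "mode p u m v \<in> VL p (k + l)"
proof (rule flin_keys_in[OF flin_mode2 subspace_VL])
  fix \<nu> l' assume "(\<nu>, l') \<in> Poly_Mapping.keys v"
  then have l: "2 * int p dvd l' - l" using assms(2) by (auto simp: VL_def)
  show "mode p u m (basis \<nu> l') \<in> VL p (k + l)"
  proof (rule flin_keys_in[OF flin_mode1 subspace_VL])
    fix \<mu> k' assume "(\<mu>, k') \<in> Poly_Mapping.keys u"
    then have "2 * int p dvd k' - k" using assms(1) by (auto simp: VL_def)
    then have "2 * int p dvd (k' + l') - (k + l)" using l dvd_add[of "2 * int p" "k' - k" "l' - l"] by (simp add: algebra_simps)
    from VL_cong[OF this]
    show "mode p (basis \<mu> k') m (basis \<nu> l') \<in> VL p (k + l)" using Ch_VL[OF gr_Ch[OF mode_basis_gr]] by metis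
  qed
qed

text \<open>The level of the result would not be an integer. So the integrality hypotheses of
  \<open>borcherds_rat\<close> exclude only modes that vanish.\<close>

lemma mode_nonint:
  assumes "u \<in> Ch k" "w \<in> VL p l" "m + sp k l \<notin> \<int>"
  shows "mode p u m w = 0"
proof -
  have "mode p u m w \<in> {0}"
  proof (rule flin_keys_in[OF flin_mode2 fock.subspace_single_0])
    fix \<nu> l' assume "(\<nu>, l') \<in> Poly_Mapping.keys w"
    then have "2 * int p dvd l' - l" using assms(2) by (auto simp: VL_def)
    then obtain z where z: "l' = l + 2 * int p * z" by (metis add_diff_cancel_left' diff_add_cancel add.commute dvdE)
    have s: "sp k l' = sp k l + of_int (k * z)"
      using p0 by (simp add: z sp_add2) (simp add: sp_def)
    show "mode p u m (basis \<nu> l') \<in> {0}"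
    proof (rule flin_keys_in[OF flin_mode1 fock.subspace_single_0])
      fix \<mu> k' assume "(\<mu>, k') \<in> Poly_Mapping.keys u"
      then have k: "k' = k" using assms(1) by (auto simp: Ch_def)
      let ?d = "of_nat (wlev \<mu>) + of_nat (wlev \<nu>) - m - 1 - sp k l'"
      have "?d \<notin> \<int>"
      proof
        assume "?d \<in> \<int>"
        moreover have "of_nat (wlev \<mu>) + of_nat (wlev \<nu>) - 1 - of_int (k * z) \<in> (\<int> :: rat set)" by (intro Ints_diff Ints_add) auto
        ultimately have "(of_nat (wlev \<mu>) + of_nat (wlev \<nu>) - 1 - of_int (k * z)) - ?d \<in> \<int>" by (rule Ints_diff[rotated])
        moreover have "(of_nat (wlev \<mu>) + of_nat (wlev \<nu>) - 1 - of_int (k * z)) - ?d = m + sp k l" by (simp add: s)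
        ultimately show False using assms(3) by simp
      qed
      then have "?d \<notin> \<nat>" using Nats_subset_Ints by blast
      then show "mode p (basis \<mu> k') m (basis \<nu> l') \<in> {0}"
        using gr_empty[OF mode_basis_gr[of \<mu> k m \<nu> l']] k by simp
    qed
  qed
  then show ?thesis by simp
qed

text \<open>The case \<open>l = 0\<close> of the Borcherds identity, which is admissible only if the
  charges of u and v have an integral inner product; its parity gives the sign.\<close>

lemma mode_commutator:
  assumes u: "u \<in> Ch k1" and v: "v \<in> Ch k2" and w: "w \<in> VL p k3"
    and L: "sp k1 k2 = of_int L" and m: "m + sp k1 k3 \<in> \<int>" and n: "n + sp k2 k3 \<in> \<int>"
  shows "mode p u m (mode p v n w) = fscale ((- 1) powi L) (mode p v n (mode p u m w))
    + Sum_any (\<lambda>j::nat. fscale (of_rat m gchoose j) (mode p (mode p u (of_nat j) v) (m + n - of_nat j) w))"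
proof -
  have "Sum_any (borch_rhs L 0 m n u v w) = borch_rhs L 0 m n u v w 0"
    by (rule Sum_any_single) (auto simp: borch_rhs_def gbinomial_0 gr0_conv_Suc)
  then show ?thesis
    using borcherds_rat[OF u v w _ m n, of 0 L] L by (simp add: borch_rhs_def borch_lhs_def[abs_def] algebra_simps)
qed

text \<open>The case \<open>m = 0\<close>, which is admissible only if the charges of u and w have
  an integral inner product. It is applied with u the conformal vector, of charge 0.\<close>

lemma mode_iterate:
  assumes u: "u \<in> Ch k1" and v: "v \<in> Ch k2" and w: "w \<in> VL p k3"
    and L: "l + sp k1 k2 = of_int L" and m: "sp k1 k3 \<in> \<int>" and n: "n + sp k2 k3 \<in> \<int>"
  shows "mode p (mode p u l v) n w = Sum_any (\<lambda>j::nat. fscale ((- 1) ^ j * (of_rat l gchoose j))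
     (mode p u (l - of_nat j) (mode p v (n + of_nat j) w)
      - fscale ((- 1) powi L) (mode p v (n + l - of_nat j) (mode p u (of_nat j) w))))"
proof -
  have "Sum_any (borch_lhs l 0 n u v w) = borch_lhs l 0 n u v w 0"
    by (rule Sum_any_single) (auto simp: borch_lhs_def gbinomial_0 gr0_conv_Suc)
  then show ?thesis
    using borcherds_rat[OF u v w L _ n, of 0] m by (simp add: borch_rhs_def[abs_def] borch_lhs_def)
qed

section \<open>Heisenberg fields and the Virasoro operators\<close>

lemma mode_vac: "mode p vac m v = (if m = - 1 then v else 0)"
proof -
  define D where "D m v = mode p vac m v - (if m = - 1 then v else 0)" for m v
  have "D m v = 0"
  proof (rule covariant_zero[of D 0])
    show "flin (D m)" for m
      unfolding D_def by (intro flin_minus flin_mode2) (cases "m = - 1", simp_all)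
    show "h r (D m v) = D m (h r v) + fscale (of_int 0) (D (m + of_int r) v)" for r m v
      by (simp add: D_def flin_diff[OF flin_heis] mode_fexp h_exp_mode h_0)
    show "lk (D m (fexp l)) ({#}, K) = 0" for m l K
    proof (cases "- m - 1 \<in> \<int>")
      case True
      then obtain t where t: "- m - 1 = of_int t" by (elim Ints_cases)
      have e: "mode p vac m (fexp l) = EM 0 t (fexp l)" using exp_fexp_int[of m 0 l t] t by (simp add: sp_def)
      have "EM 0 t (fexp l) \<in> gr l (0 + of_int t)" by (rule gr_EM[OF gr_fexp])
      then have "t \<noteq> 0 \<Longrightarrow> lk (EM 0 t (fexp l)) ({#}, K) = 0" by (rule lk_gr) simp
      moreover have "m = - 1 \<longleftrightarrow> t = 0" using t by auto
      ultimately show ?thesis by (auto simp: D_def e)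
    next
      case False
      then have "m \<noteq> - 1" by auto
      moreover have "mode p vac m (fexp l) = 0" using False by (simp add: exp_fexp sp_def)
      ultimately show ?thesis by (simp add: D_def)
    qed
  qed
  then show ?thesis by (simp add: D_def)
qed

lemma mode_h_vac: "mode p (h (- int n - 1) vac) (of_int m) v = fscale (of_int (int n - m - 1) gchoose n) (h (m - int n) v)"
proof -
  let ?f = "\<lambda>j::nat. fscale (of_nat j gchoose n) (h (- int j - 1) (mode p vac (of_int m + of_nat j - of_nat n) v))"
  let ?g = "\<lambda>j::nat. fscale ((- of_nat j - 1) gchoose n) (mode p vac (of_int m - of_nat j - of_nat n - 1) (h (int j) v))"
  have e1: "(of_int m + of_nat j - of_nat n = (- 1 :: rat)) \<longleftrightarrow> int j = int n - m - 1" for j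
  proof -
    have *: "of_int m + of_nat j - of_nat n = (of_int (m + int j - int n) :: rat)" "(- 1 :: rat) = of_int (- 1)" by simp_all
    show ?thesis unfolding * of_int_eq_iff by auto
  qed
  have e2: "(of_int m - of_nat j - of_nat n - 1 = (- 1 :: rat)) \<longleftrightarrow> int j = m - int n" for j
  proof -
    have *: "of_int m - of_nat j - of_nat n - 1 = (of_int (m - int j - int n - 1) :: rat)" "(- 1 :: rat) = of_int (- 1)" by simp_all
    show ?thesis unfolding * of_int_eq_iff by auto
  qed
  have "mode p (h (- int n - 1) vac) (of_int m) v = Sum_any ?f + Sum_any ?g"
    by (simp only: mode_create stepm_def)
  also have "\<dots> = fscale (of_int (int n - m - 1) gchoose n) (h (m - int n) v)"
  proof (cases "m - int n \<ge> 0")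
    case True
    then obtain t where t: "m - int n = int t" by (metis nonneg_int_cases)
    have "Sum_any ?f = 0" unfolding mode_vac e1 using True by (simp add: h_0)
    moreover have "Sum_any ?g = ?g t" by (rule Sum_any_single) (auto simp: mode_vac e2 t)
    moreover have "?g t = fscale (of_int (int n - m - 1) gchoose n) (h (m - int n) v)"
    proof -
      have "(- of_nat t - 1 :: complex) = of_int (- int t - 1)" by simp
      also have "- int t - 1 = int n - m - 1" using t by simp
      finally have "(- of_nat t - 1 :: complex) = of_int (int n - m - 1)" .
      then show ?thesis by (simp only: mode_vac e2 t) simp
    qed
    ultimately show ?thesis by simp
  next
    case False
    then obtain t where t: "int n - m - 1 = int t" by (metis nonneg_int_cases not_le zle_diff1_eq diff_less_0_iff_less diff_gt_0_iff_gt add_le_cancel_right int_one_le_iff_zero_less diff_ge_0_iff_ge)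
    have "Sum_any ?g = 0" unfolding mode_vac e2 using False by (simp)
    moreover have "Sum_any ?f = ?f t" by (rule Sum_any_single) (auto simp: mode_vac e1 t h_0)
    moreover have "?f t = fscale (of_int (int n - m - 1) gchoose n) (h (m - int n) v)"
    proof -
      have "- int t - 1 = m - int n" using t by simp
      then show ?thesis by (simp only: mode_vac e1 t) simp
    qed
    ultimately show ?thesis by simp
  qed
  finally show ?thesis .
qed

lemma mode_h1_vac: "mode p (h (- 1) vac) (of_int m) v = h m v"
  using mode_h_vac[of 0 m v] by simp

lemma mode_h2_vac: "mode p (h (- 2) vac) (of_int m) v = fscale (- of_int m) (h (m - 1) v)"
  using mode_h_vac[of 1 m v] by simp

abbreviation Li :: "int \<Rightarrow> fock \<Rightarrow> fock" where "Li n \<equiv> Vir p n"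

lemma flin_Vir: "flin (Li n)"
  unfolding Vir_def by (rule flin_mode2)

lemma conf_gr: "conf p \<in> gr 0 2"
proof -
  have 1: "h (- 1) (h (- 1) vac) \<in> gr 0 (0 - of_int (- 1) - of_int (- 1))"
    by (intro gr_heis gr_fexp)
  have 2: "h (- 2) vac \<in> gr 0 (0 - of_int (- 2))"
    by (intro gr_heis gr_fexp)
  from 1 2 show ?thesis unfolding conf_def by (intro gr_add gr_scale) simp_all
qed

lemma conf_Ch: "conf p \<in> Ch 0" by (rule gr_Ch[OF conf_gr])

lemma Vir_VL: "v \<in> VL p k \<Longrightarrow> Li n v \<in> VL p k"
  using VL_mode[OF Ch_VL[OF conf_Ch]] unfolding Vir_def by fastforce

lemma Vir_Ch: "v \<in> Ch k \<Longrightarrow> Li n v \<in> Ch k"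
  using Ch_mode[OF conf_Ch] unfolding Vir_def by fastforce

lemma gr_Vir: "v \<in> gr k d \<Longrightarrow> Li n v \<in> gr k (d - of_int n)"
  using gr_mode[OF conf_gr, of v k d "of_int (n + 1)"] by (simp add: Vir_def sp_def algebra_simps)

lemma h_conf: "h (int i) (conf p) = (if i = 1 then h (- 1) vac else if i = 2 then fscale (2 * (of_nat p - 1)) vac else 0)"
proof -
  have p: "of_nat p \<noteq> (0::complex)" using p0 by simp
  have 1: "h (int i) (h (- 1) (h (- 1) vac)) = (if i = 1 then fscale (4 * of_nat p) (h (- 1) vac) else 0)"
    using heis_comm[of p "int i" "- 1" "h (- 1) vac"] heis_comm[of p "int i" "- 1" vac] h_fexp(1)[of "int i" 0] h_fexp(2)[of 0]
    by (cases "i = 0") (auto simp: h_add h_scale h_0 fock.scale_left_distrib[symmetric])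
  have 2: "h (int i) (h (- 2) vac) = (if i = 2 then fscale (4 * of_nat p) vac else 0)"
    using heis_comm[of p "int i" "- 2" vac] h_fexp(1)[of "int i" 0] h_fexp(2)[of 0]
    by (cases "i = 0") (auto simp: h_0)
  show ?thesis
    unfolding conf_def using p by (simp add: h_add h_scale 1 2)
qed

text \<open>The last summand stems from the \<alpha>(-2) term of the conformal vector, which makes
  \<alpha>(x) fail to be primary.\<close>

lemma h_Vir: "h r (Li n v) = Li n (h r v) + fscale (of_int r) (h (r + n) v)
   + (if r + n = 0 then fscale ((of_nat p - 1) * of_int r * (of_int r - 1)) v else 0)"
proof -
  let ?f = "\<lambda>i::nat. fscale (of_int r gchoose i) (mode p (h (int i) (conf p)) (of_int (n + 1) + of_int r - of_nat i) v)"
  have "Sum_any ?f = sum ?f {..<3}"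
    by (rule Sum_any_bound) (auto simp: h_conf mode_01)
  also have "\<dots> = ?f 1 + ?f 2" using h_conf[of 0] by (simp add: eval_nat_numeral mode_01 lessThan_Suc)
  also have "?f 1 = fscale (of_int r) (h (r + n) v)"
    using mode_h1_vac[of "r + n" v] h_conf[of 1] by (simp add: algebra_simps)
  also have "?f 2 = (if r + n = 0 then fscale ((of_nat p - 1) * of_int r * (of_int r - 1)) v else 0)"
  proof -
    have "(of_int (n + 1) + of_int r - of_nat 2 = (- 1 :: rat)) \<longleftrightarrow> of_int (r + n) = (of_int 0 :: rat)" by auto
    then have "(of_int (n + 1) + of_int r - of_nat 2 = (- 1 :: rat)) \<longleftrightarrow> r + n = 0" unfolding of_int_eq_iff .
    moreover have g: "(of_int r gchoose 2) = (of_int r * (of_int r - 1) / 2 :: complex)"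
      by (simp add: gbinomial_prod_rev eval_nat_numeral)
    moreover have "(of_int r gchoose 2) * (2 * (of_nat p - 1)) = ((of_nat p - 1) * of_int r * (of_int r - 1) :: complex)" unfolding g by (simp add: field_simps)
    ultimately show ?thesis unfolding h_conf by (simp add: mode_scale1 mode_vac)
  qed
  finally show ?thesis using h_mode[of r "conf p" "of_int (n + 1)" v] by (simp add: Vir_def add.assoc)
qed

lemmas Vir_add = flin_add[OF flin_Vir] and Vir_scale = flin_scale[OF flin_Vir]
  and Vir_0 = flin_0[OF flin_Vir] and Vir_sum = flin_sum[OF flin_Vir] and Vir_diff = flin_diff[OF flin_Vir]

lemma Vir_fexp:
  "Li n (fexp l) = fscale (1 / (4 * of_nat p)) (Sum_any (\<lambda>j::nat. h (- int j - 1) (h (n + 1 + int j) (fexp l))) + fscale (of_int l) (h n (fexp l)))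
     - fscale ((of_nat p - 1) / (2 * of_nat p) * of_int (n + 1)) (h n (fexp l))"
proof -
  let ?m = "of_int (n + 1) :: rat"
  have "mode p (h (- 1) (h (- 1) vac)) ?m (fexp l) = stepm 0 (mode p (h (- 1) vac)) ?m (fexp l)"
    using mode_create[of 0 "h (- 1) vac" ?m "fexp l"] by simp
  also have "\<dots> = Sum_any (\<lambda>j::nat. h (- int j - 1) (mode p (h (- 1) vac) (?m + of_nat j) (fexp l)))
      + Sum_any (\<lambda>j::nat. mode p (h (- 1) vac) (?m - of_nat j - 1) (h (int j) (fexp l)))"
    by (simp add: stepm_def)
  also have "(\<lambda>j::nat. mode p (h (- 1) vac) (?m + of_nat j) (fexp l)) = (\<lambda>j. h (n + 1 + int j) (fexp l))"
    using mode_h1_vac[of "n + 1 + int j" "fexp l" for j] by simp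
  also have "Sum_any (\<lambda>j::nat. mode p (h (- 1) vac) (?m - of_nat j - 1) (h (int j) (fexp l))) =
      mode p (h (- 1) vac) (?m - of_nat 0 - 1) (h (int 0) (fexp l))"
    by (rule Sum_any_single) (simp add: h_fexp mode_02)
  also have "\<dots> = fscale (of_int l) (h n (fexp l))"
    using mode_h1_vac[of n "fexp l"] by (simp add: h_fexp mode_scale2)
  finally have 1: "mode p (h (- 1) (h (- 1) vac)) ?m (fexp l) = Sum_any (\<lambda>j::nat. h (- int j - 1) (h (n + 1 + int j) (fexp l)))
      + fscale (of_int l) (h n (fexp l))" .
  have 2: "mode p (h (- 2) vac) ?m (fexp l) = - fscale (of_int (n + 1)) (h n (fexp l))"
    using mode_h2_vac[of "n + 1" "fexp l"] fock.scale_minus_left[of "of_int (n + 1)" "h n (fexp l)"] by simp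
  show ?thesis
    unfolding Vir_def conf_def mode_add1 mode_scale1 1 2
    unfolding fock.scale_minus_right fock.scale_scale by simp
qed

text \<open>The conformal weight of exp(k\<alpha>/2p): a parabola in k with zeros 0 and 2p - 2 and
  minimum at p - 1.\<close>

definition hw :: "int \<Rightarrow> rat" where
  "hw k = of_int (k * (k - 2 * int p + 2)) / of_nat (4 * p)"

definition wt :: "nat multiset \<times> int \<Rightarrow> rat" where
  "wt a = hw (snd a) + of_nat (wlev (fst a))"

lemma of_rat_hw: "of_rat (hw k) = (of_int k * (of_int k - 2 * of_nat p + 2) / (4 * of_nat p) :: complex)"
  unfolding hw_def by (simp add: of_rat_divide of_rat_mult of_rat_add of_rat_diff)

lemma hw_add: "hw (k + l) = hw k + hw l + sp k l"
  using p0 by (simp add: hw_def sp_def field_simps)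

lemma Vir_pos_fexp: "n \<ge> 1 \<Longrightarrow> Li n (fexp l) = 0"
  using gr_neg[OF gr_Vir[OF gr_fexp[of l], of n]] by simp

lemma Vir0_fexp: "Li 0 (fexp l) = fscale (of_rat (hw l)) (fexp l)"
proof -
  have "Sum_any (\<lambda>j::nat. h (- int j - 1) (h (0 + 1 + int j) (fexp l))) = 0"
    by (simp add: h_fexp h_0)
  then show ?thesis
    using p0 unfolding Vir_fexp by (simp add: h_fexp fock.scale_left_diff_distrib[symmetric] of_rat_hw field_simps)
qed

lemma Virm1_fexp: "Li (- 1) (fexp l) = fscale (of_int l / (2 * of_nat p)) (h (- 1) (fexp l))"
proof -
  have "Sum_any (\<lambda>j::nat. h (- int j - 1) (h (- 1 + 1 + int j) (fexp l))) = h (- int 0 - 1) (h (- 1 + 1 + int 0) (fexp l))"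
    by (rule Sum_any_single) (simp add: h_fexp h_0)
  then show ?thesis
    using p0 unfolding Vir_fexp by (simp add: h_fexp h_scale fock.scale_left_distrib[symmetric] fock.scale_right_distrib field_simps)
qed

lemma Virm2_fexp: "Li (- 2) (fexp l) = fscale (1 / (4 * of_nat p)) (h (- 1) (h (- 1) (fexp l)))
   + fscale ((of_int l + of_nat p - 1) / (2 * of_nat p)) (h (- 2) (fexp l))"
proof -
  let ?f = "\<lambda>j::nat. h (- int j - 1) (h (- 2 + 1 + int j) (fexp l))"
  have "Sum_any ?f = sum ?f {..<2}"
    by (rule Sum_any_bound) (simp add: h_fexp h_0)
  also have "\<dots> = h (- 1) (h (- 1) (fexp l)) + fscale (of_int l) (h (- 2) (fexp l))"
    by (simp add: eval_nat_numeral h_fexp h_scale)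
  finally show ?thesis
    using p0 unfolding Vir_fexp
    by (simp add: fock.scale_left_distrib[symmetric] fock.scale_left_diff_distrib[symmetric] fock.scale_right_distrib add.assoc)
      (simp add: field_simps)
qed

lemma Vir0_basis: "Li 0 (basis \<mu> k) = fscale (of_rat (wt (\<mu>, k))) (basis \<mu> k)"
proof (induction \<mu>)
  case empty
  then show ?case using Vir0_fexp[of k] by (simp add: fexp_def wt_def)
next
  case (add n \<mu>)
  have e: "basis (add_mset n \<mu>) k = h (- int n - 1) (basis \<mu> k)" by (simp add: heis_basis)
  have "Li 0 (h (- int n - 1) (basis \<mu> k)) = h (- int n - 1) (Li 0 (basis \<mu> k)) - fscale (of_int (- int n - 1)) (h (- int n - 1) (basis \<mu> k))"
    using h_Vir[of "- int n - 1" 0 "basis \<mu> k"] by simp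
  also have "\<dots> = fscale (of_rat (wt (\<mu>, k)) - of_int (- int n - 1)) (h (- int n - 1) (basis \<mu> k))"
    by (simp add: add h_scale fock.scale_left_diff_distrib)
  finally show ?case unfolding e
    by (simp add: wt_def of_rat_add algebra_simps)
qed

lemma lk_Vir0: "lk (Li 0 v) a = of_rat (wt a) * lk v a"
proof (rule clin_eqI[of "\<lambda>v. lk (Li 0 v) a" "\<lambda>v. of_rat (wt a) * lk v a"])
  show "clin (\<lambda>v. lk (Li 0 v) a)" by (rule clin_comp[OF clin_lookup flin_Vir])
  show "clin (\<lambda>v. of_rat (wt a) * lk v a)" by (rule clinI) (simp_all add: lookup_add lookup_fscale algebra_simps)
  show "lk (Li 0 (basis \<mu> k)) a = of_rat (wt a) * lk (basis \<mu> k) a" for \<mu> k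
    by (auto simp: Vir0_basis lookup_fscale lookup_single when_def)
qed

section \<open>Weights\<close>

definition Wt :: "rat \<Rightarrow> fock set" where
  "Wt H = {v. \<forall>a\<in>Poly_Mapping.keys v. wt a = H}"

lemma subspace_Wt: "fock.subspace (Wt H)"
  unfolding Wt_def by (rule subspace_keys)

lemma Wt_iff: "v \<in> Wt H \<longleftrightarrow> Li 0 v = fscale (of_rat H) v"
proof
  assume v: "v \<in> Wt H"
  show "Li 0 v = fscale (of_rat H) v"
    by (rule poly_mapping_eqI) (use v in \<open>auto simp: lk_Vir0 lookup_fscale Wt_def in_keys_iff\<close>)
next
  assume v: "Li 0 v = fscale (of_rat H) v"
  show "v \<in> Wt H" unfolding Wt_def
  proof safe
    fix \<mu> k assume "(\<mu>, k) \<in> Poly_Mapping.keys v"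
    then have nz: "lk v (\<mu>, k) \<noteq> 0" by (simp add: in_keys_iff)
    have "of_rat (wt (\<mu>, k)) * lk v (\<mu>, k) = of_rat H * lk v (\<mu>, k)"
      using arg_cong[OF v, of "\<lambda>x. lk x (\<mu>, k)"] by (simp add: lk_Vir0 lookup_fscale)
    then show "wt (\<mu>, k) = H" using nz by simp
  qed
qed

lemma gr_Wt: "v \<in> gr k d \<Longrightarrow> v \<in> Wt (hw k + d)"
  by (auto simp: gr_def Wt_def wt_def)

lemma Wt_Ch: "v \<in> Wt H \<Longrightarrow> v \<in> Ch k \<Longrightarrow> v \<in> gr k (H - hw k)"
  by (fastforce simp: gr_def Ch_def Wt_def wt_def)

lemma fexp_Wt: "fexp k \<in> Wt (hw k)"
  using gr_Wt[OF gr_fexp] by simp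

lemma Wt_mode:
  assumes "u \<in> Wt H" "v \<in> Wt K"
  shows "mode p u m v \<in> Wt (H + K - m - 1)"
proof (rule flin_keys_in[OF flin_mode2 subspace_Wt])
  fix \<nu> l assume l: "(\<nu>, l) \<in> Poly_Mapping.keys v"
  show "mode p u m (basis \<nu> l) \<in> Wt (H + K - m - 1)"
  proof (rule flin_keys_in[OF flin_mode1 subspace_Wt])
    fix \<mu> k assume k: "(\<mu>, k) \<in> Poly_Mapping.keys u"
    have "hw (k + l) + (of_nat (wlev \<mu>) + of_nat (wlev \<nu>) - m - 1 - sp k l) = H + K - m - 1"
      using bspec[OF assms(1)[unfolded Wt_def, simplified] k] bspec[OF assms(2)[unfolded Wt_def, simplified] l]
      by (simp add: wt_def hw_add)
    then show "mode p (basis \<mu> k) m (basis \<nu> l) \<in> Wt (H + K - m - 1)"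
      using gr_Wt[OF mode_basis_gr[of \<mu> k m \<nu> l]] by metis
  qed
qed

lemma Vir_Wt: "v \<in> Wt H \<Longrightarrow> Li n v \<in> Wt (H - of_int n)"
proof -
  assume v: "v \<in> Wt H"
  have "conf p \<in> Wt 2" using gr_Wt[OF conf_gr] by (simp add: hw_def)
  from Wt_mode[OF this v, of "of_int (n + 1)"] show ?thesis by (simp add: Vir_def)
qed

lemma Wt_Ch_low: "v \<in> Wt H \<Longrightarrow> v \<in> Ch k \<Longrightarrow> H < hw k \<Longrightarrow> v = 0"
  using gr_neg[OF Wt_Ch] by simp

section \<open>Commutators with the Virasoro operators\<close>

lemma evz_Vir: "evz (\<lambda>j. Li (int j + c) v)"
  using evz_mode_shift[of "conf p" "of_int (c + 1)" v] unfolding Vir_def by (simp add: algebra_simps)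

text \<open>The conformal vector has charge 0, so its inner products are integral and the commutator
  formula applies; where the modes of v have a non-integral index, every term vanishes. Hence no
  integrality is assumed.\<close>

lemma Vir_mode:
  "Li n (mode p v k w) = mode p v k (Li n w)
    + Sum_any (\<lambda>j::nat. fscale (of_int (n + 1) gchoose j) (mode p (Li (int j - 1) v) (of_int (n + 1) + k - of_nat j) w))"
proof -
  let ?S = "\<lambda>v w (j::nat). fscale (of_int (n + 1) gchoose j) (mode p (Li (int j - 1) v) (of_int (n + 1) + k - of_nat j) w)"
  have evz: "evz (?S v w)" for v w
    by (rule evz_comp0[OF evz_Vir[of "- 1" v]]) (simp add: mode_01)
  have f1: "flin (\<lambda>v. Sum_any (?S v w))" for w
    by (rule flin_Sum_any[OF _ evz]) (intro flin_fscale flin_comp[OF flin_mode1 flin_Vir])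
  have f2: "flin (\<lambda>w. Sum_any (?S v w))" for v
    by (rule flin_Sum_any[OF _ evz]) (intro flin_fscale flin_mode2)
  have 0: "Li n (mode p (basis \<mu> a) k (basis \<nu> b)) = mode p (basis \<mu> a) k (Li n (basis \<nu> b)) + Sum_any (?S (basis \<mu> a) (basis \<nu> b))" for \<mu> a \<nu> b
  proof (cases "k + sp a b \<in> \<int>")
    case True
    have s: "sp 0 x = of_int 0" for x by (simp add: sp_def)
    have "Li n (mode p (basis \<mu> a) k (basis \<nu> b)) = fscale ((- 1) powi 0) (mode p (basis \<mu> a) k (Li n (basis \<nu> b)))
      + Sum_any (\<lambda>j::nat. fscale (of_rat (of_int (n + 1)) gchoose j) (mode p (mode p (conf p) (of_nat j) (basis \<mu> a)) (of_int (n + 1) + k - of_nat j) (basis \<nu> b)))"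
      unfolding Vir_def by (rule mode_commutator[OF conf_Ch basis_Ch Ch_VL[OF basis_Ch] s _ True]) (simp add: s)
    then show ?thesis unfolding Vir_def of_rat_of_int_eq by simp
  next
    case False
    have z: "mode p u k' x = 0" if "u \<in> Ch a" "x \<in> Ch b" "k' - k \<in> \<int>" for u x k'
    proof (rule mode_nonint[OF that(1) Ch_VL[OF that(2)]])
      show "k' + sp a b \<notin> \<int>"
      proof
        assume "k' + sp a b \<in> \<int>"
        from Ints_diff[OF this that(3)] show False using False by (simp add: algebra_simps)
      qed
    qed
    have "?S (basis \<mu> a) (basis \<nu> b) = (\<lambda>j. 0)"
      by (rule ext, subst z[OF Vir_Ch[OF basis_Ch] basis_Ch]) (auto intro!: Ints_diff Ints_add)
    then have "Sum_any (?S (basis \<mu> a) (basis \<nu> b)) = 0" by (simp only: Sum_any.neutral)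
    then show ?thesis
      by (simp add: z[OF basis_Ch basis_Ch] z[OF basis_Ch Vir_Ch[OF basis_Ch]] Vir_0)
  qed
  have 1: "Li n (mode p (basis \<mu> a) k w) = mode p (basis \<mu> a) k (Li n w) + Sum_any (?S (basis \<mu> a) w)" for \<mu> a
    by (rule flin_eqI[of "\<lambda>w. Li n (mode p (basis \<mu> a) k w)" "\<lambda>w. mode p (basis \<mu> a) k (Li n w) + Sum_any (?S (basis \<mu> a) w)"])
      (rule flin_comp[OF flin_Vir flin_mode2], rule flin_plus[OF flin_comp[OF flin_mode2 flin_Vir] f2], rule 0)
  show ?thesis
    by (rule flin_eqI[of "\<lambda>v. Li n (mode p v k w)" "\<lambda>v. mode p v k (Li n w) + Sum_any (?S v w)"])
      (rule flin_comp[OF flin_Vir flin_mode1], rule flin_plus[OF flin_mode1 f1], rule 1)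
qed

text \<open>The last clause is \<open>Y(L(-1) v, x) = d/dx Y(v, x)\<close> in modes. It is
  established for the fields in use, the exponentials and their images under Q.\<close>

definition primary :: "rat \<Rightarrow> fock \<Rightarrow> bool" where
  "primary H v \<longleftrightarrow> Li 0 v = fscale (of_rat H) v \<and> (\<forall>n\<ge>1. Li n v = 0)
     \<and> (\<forall>m w. mode p (Li (- 1) v) m w = fscale (- of_rat m) (mode p v (m - 1) w))"

lemma Vir_primary:
  assumes "primary H v"
  shows "Li n (mode p v k w) = mode p v k (Li n w) + fscale (of_rat (of_int (n + 1) * (H - 1) - k)) (mode p v (of_int n + k) w)"
proof -
  let ?S = "\<lambda>j::nat. fscale (of_int (n + 1) gchoose j) (mode p (Li (int j - 1) v) (of_int (n + 1) + k - of_nat j) w)"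
  have "Sum_any ?S = sum ?S {..<2}"
    by (rule Sum_any_bound) (use assms in \<open>simp add: primary_def mode_01\<close>)
  also have "\<dots> = fscale (- of_rat (of_int (n + 1) + k)) (mode p v (of_int n + k) w) + fscale (of_int (n + 1) * of_rat H) (mode p v (of_int n + k) w)"
    using assms by (simp add: primary_def eval_nat_numeral mode_scale1 algebra_simps)
  also have "\<dots> = fscale (of_rat (of_int (n + 1) * (H - 1) - k)) (mode p v (of_int n + k) w)"
    unfolding fock.scale_left_distrib[symmetric] by (simp add: of_rat_add of_rat_mult of_rat_diff algebra_simps)
  finally show ?thesis by (simp add: Vir_mode)
qed

lemma primary_fexp: "primary (hw k) (fexp k)"
  unfolding primary_def
proof (intro conjI allI impI)
  show "Li 0 (fexp k) = fscale (of_rat (hw k)) (fexp k)" by (rule Vir0_fexp)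
  show "Li n (fexp k) = 0" if "n \<ge> 1" for n using Vir_pos_fexp that .
  fix m w
  let ?u = "Li (- 1) (fexp k)"
  define D where "D m w = mode p ?u m w + fscale (of_rat m) (mode p (fexp k) (m - 1) w)" for m w
  have hu: "h (int i) ?u = (if i = 0 then fscale (of_int k) ?u else if i = 1 then fscale (of_int k) (fexp k) else 0)" for i
  proof -
    consider "i = 0" | "i = 1" | "i > 1" by linarith
    then show ?thesis
    proof cases
      case 3
      then have "int i - 1 > 0" by simp
      then show ?thesis using h_Vir[of "int i" "- 1" "fexp k"] 3 by (simp add: h_fexp Vir_0)
    qed (use h_Vir[of "int i" "- 1" "fexp k"] in \<open>simp_all add: h_fexp Vir_0 Vir_scale\<close>)
  qed
  have "D m w = 0"
  proof (rule covariant_zero[of D k])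
    show "flin (D m)" for m unfolding D_def by (intro flin_plus flin_mode2 flin_fscale)
    show "h r (D m v) = D m (h r v) + fscale (of_int k) (D (m + of_int r) v)" for r m v
    proof -
      let ?S = "\<lambda>i::nat. fscale (of_int r gchoose i) (mode p (h (int i) ?u) (m + of_int r - of_nat i) v)"
      have "Sum_any ?S = sum ?S {..<2}" by (rule Sum_any_bound) (simp add: hu mode_01)
      also have "\<dots> = fscale (of_int k) (mode p ?u (m + of_int r) v) + fscale (of_int r * of_int k) (mode p (fexp k) (m + of_int r - 1) v)"
        using hu[of 0] hu[of 1] by (simp add: eval_nat_numeral mode_scale1)
      finally have 1: "h r (mode p ?u m v) = mode p ?u m (h r v) + (fscale (of_int k) (mode p ?u (m + of_int r) v) + fscale (of_int r * of_int k) (mode p (fexp k) (m + of_int r - 1) v))"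
        using h_mode[of r ?u m v] by simp
      show ?thesis
        unfolding D_def h_add h_scale 1 mode_fexp h_exp_mode
        by (simp add: fock.scale_right_distrib fock.scale_left_distrib of_rat_add algebra_simps)
    qed
    show "lk (D m (fexp l)) ({#}, K) = 0" for m l K
    proof -
      have 1: "mode p (h (- 1) (fexp k)) m (fexp l) = stepm 0 (mode p (fexp k)) m (fexp l)"
        using mode_create[of 0 "fexp k" m "fexp l"] by simp
      have "lk (D m (fexp l)) ({#}, K) = (of_int k * of_int l / (2 * of_nat p) + of_rat m) * lk (mode p (fexp k) (m - 1) (fexp l)) ({#}, K)"
        unfolding D_def Virm1_fexp mode_scale1 1 lookup_add lookup_fscale lk_stepm_fexp[OF good_mode] by (simp add: algebra_simps)
      also have "\<dots> = of_rat (sp k l + m) * lk (mode p (fexp k) (m - 1) (fexp l)) ({#}, K)"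
        by (simp add: of_rat_add of_rat_sp)
      also have "\<dots> = 0"
      \<comment> \<open>Up to sign, the scalar in front is the level of the vector behind it, and
        only level 0 has a vacuum coefficient.\<close>
      proof (cases "sp k l + m = 0")
        case False
        have "mode p (fexp k) (m - 1) (fexp l) \<in> gr (k + l) (0 + 0 - (m - 1) - 1 - sp k l)"
          by (rule gr_mode[OF gr_fexp gr_fexp])
        then show ?thesis using False by (simp add: lk_gr)
      qed simp
      finally show ?thesis .
    qed
  qed
  then show "mode p ?u m w = fscale (- of_rat m) (mode p (fexp k) (m - 1) w)"
    by (simp add: D_def add_eq_0_iff2)
qed

section \<open>The screening operator and the two degenerate fields\<close>

abbreviation Qi :: "fock \<Rightarrow> fock" where "Qi \<equiv> Q p"

lemma flin_Q: "flin Qi"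
  unfolding Q_def by (rule flin_mode2)

lemmas Q_add = flin_add[OF flin_Q] and Q_scale = flin_scale[OF flin_Q]
  and Q_0 = flin_0[OF flin_Q] and Q_sum = flin_sum[OF flin_Q] and Q_diff = flin_diff[OF flin_Q]

lemma hw_2p: "hw (2 * int p) = 1"
  using p0 by (simp add: hw_def)

lemma sp_2p: "sp (2 * int p) k = of_int k"
  using p0 by (simp add: sp_def)

text \<open>exp(\<alpha>) is primary of weight 1, so the correction term of its residue has
  coefficient 0.\<close>

lemma Vir_Q: "Li n (Qi v) = Qi (Li n v)"
  using Vir_primary[OF primary_fexp, of n "2 * int p" 0 v]
  unfolding Q_def hw_2p by simp

lemma Q_Wt: "v \<in> Wt H \<Longrightarrow> Qi v \<in> Wt H"
  by (simp add: Wt_iff Vir_Q Q_scale)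

lemma Q_Ch: "v \<in> Ch k \<Longrightarrow> Qi v \<in> Ch (k + 2 * int p)"
  unfolding Q_def using Ch_mode[OF fexp_Ch, of v k "2 * int p" 0] by (simp add: add.commute)

lemma Q_VL: "v \<in> VL p k \<Longrightarrow> Qi v \<in> VL p k"
proof -
  assume v: "v \<in> VL p k"
  have "VL p (2 * int p + k) = VL p k" by (rule VL_cong) simp
  then show ?thesis unfolding Q_def using VL_mode[OF Ch_VL[OF fexp_Ch] v] by blast
qed

text \<open>A residue is a derivation up to a sign, here the parity of the inner product k of
  \<alpha> and k\<alpha>/2p. Where the modes of v have a non-integral index, all three terms
  vanish.\<close>

lemma Q_mode:
  assumes v: "v \<in> Ch k"
  shows "Qi (mode p v m w) = fscale ((- 1) powi k) (mode p v m (Qi w)) + mode p (Qi v) m w"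
proof (rule flin_eqI[of "\<lambda>w. Qi (mode p v m w)" "\<lambda>w. fscale ((- 1) powi k) (mode p v m (Qi w)) + mode p (Qi v) m w"])
  show "flin (\<lambda>w. Qi (mode p v m w))" by (rule flin_comp[OF flin_Q flin_mode2])
  show "flin (\<lambda>w. fscale ((- 1) powi k) (mode p v m (Qi w)) + mode p (Qi v) m w)"
    by (intro flin_plus flin_fscale flin_comp[OF flin_mode2 flin_Q] flin_mode2)
  show "Qi (mode p v m (basis \<mu> l)) = fscale ((- 1) powi k) (mode p v m (Qi (basis \<mu> l))) + mode p (Qi v) m (basis \<mu> l)" for \<mu> l
  proof (cases "m + sp k l \<in> \<int>")
    case True
    have "mode p (fexp (2 * int p)) 0 (mode p v m (basis \<mu> l)) = fscale ((- 1) powi k) (mode p v m (mode p (fexp (2 * int p)) 0 (basis \<mu> l)))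
      + Sum_any (\<lambda>j::nat. fscale (of_rat 0 gchoose j) (mode p (mode p (fexp (2 * int p)) (of_nat j) v) (0 + m - of_nat j) (basis \<mu> l)))"
      by (rule mode_commutator[OF fexp_Ch v Ch_VL[OF basis_Ch] sp_2p _ True]) (simp add: sp_2p)
    also have "Sum_any (\<lambda>j::nat. fscale (of_rat 0 gchoose j) (mode p (mode p (fexp (2 * int p)) (of_nat j) v) (0 + m - of_nat j) (basis \<mu> l)))
      = fscale (of_rat 0 gchoose 0) (mode p (mode p (fexp (2 * int p)) (of_nat 0) v) (0 + m - of_nat 0) (basis \<mu> l))"
      by (rule Sum_any_single) (auto simp: gbinomial_0 gr0_conv_Suc)
    finally show ?thesis by (simp add: Q_def)
  next
    case False
    have s: "sp k (l + 2 * int p) = sp k l + of_int k" "sp (k + 2 * int p) l = sp k l + of_int l"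
      using sp_commute[of k "2 * int p"] by (simp_all add: sp_add1 sp_add2 sp_2p)
    have n: "m + sp k l + of_int z \<notin> \<int>" for z
      using False by (metis Ints_diff Ints_of_int add_diff_cancel_right')
    have "mode p v m (basis \<mu> l) = 0" by (rule mode_nonint[OF v Ch_VL[OF basis_Ch] False])
    moreover have "mode p v m (Qi (basis \<mu> l)) = 0"
      by (rule mode_nonint[OF v Ch_VL[OF Q_Ch[OF basis_Ch]]]) (use n s in \<open>simp add: add.assoc\<close>)
    moreover have "mode p (Qi v) m (basis \<mu> l) = 0"
      by (rule mode_nonint[OF Q_Ch[OF v] Ch_VL[OF basis_Ch]]) (use n s in \<open>simp add: add.assoc\<close>)
    ultimately show ?thesis by (simp add: Q_0)
  qed
qed

lemma Virm1_mode: "Li (- 1) (mode p v k w) = mode p v k (Li (- 1) w) + mode p (Li (- 1) v) k w"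
proof -
  have "Sum_any (\<lambda>j::nat. fscale (of_int (- 1 + 1) gchoose j) (mode p (Li (int j - 1) v) (of_int (- 1 + 1) + k - of_nat j) w))
     = fscale (of_int (- 1 + 1) gchoose 0) (mode p (Li (int 0 - 1) v) (of_int (- 1 + 1) + k - of_nat 0) w)"
    by (rule Sum_any_single) (auto simp: gbinomial_0 gr0_conv_Suc)
  then show ?thesis by (simp add: Vir_mode[of "- 1"])
qed

lemma primary_Q:
  assumes "primary H v" "v \<in> Ch k"
  shows "primary H (Qi v)"
  unfolding primary_def
proof (intro conjI allI impI)
  show "Li 0 (Qi v) = fscale (of_rat H) (Qi v)" using assms by (simp add: primary_def Vir_Q Q_scale)
  show "Li n (Qi v) = 0" if "n \<ge> 1" for n using assms that by (simp add: primary_def Vir_Q Q_0)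
  fix m w
  have t: "mode p (Li (- 1) v) m w = fscale (- of_rat m) (mode p v (m - 1) w)" for w
    using assms(1) by (simp add: primary_def)
  have 1: "mode p (Qi v) m w = Qi (mode p v m w) - fscale ((- 1) powi k) (mode p v m (Qi w))" if "v \<in> Ch k" for m v
    using Q_mode[OF that] by simp
  show "mode p (Li (- 1) (Qi v)) m w = fscale (- of_rat m) (mode p (Qi v) (m - 1) w)"
    unfolding Vir_Q 1[OF Vir_Ch[OF assms(2)]] 1[OF assms(2)] t
    by (simp add: Q_scale fock.scale_right_diff_distrib mult.commute flin_uminus[OF flin_Q])
qed

text \<open>The relation \<open>L\<^sub>-\<^sub>1\<^sup>2 v = p L\<^sub>-\<^sub>2 v\<close> is the level two null vector equation of Belavin, Polyakov and Zamolodchikov.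
  It turns into a recursion in \<open>k\<close> for the vectors \<open>v\<^sub>k w\<close>.\<close>

definition degenerate :: "int \<Rightarrow> fock \<Rightarrow> bool" where
  "degenerate c v \<longleftrightarrow> v \<in> Ch c \<and> primary (hw (- int p)) v \<and> Li (- 1) (Li (- 1) v) = fscale (of_nat p) (Li (- 2) v)"

text \<open>The fields \<open>a\<^sup>-\<close> and \<open>a\<^sup>+\<close>.\<close>

abbreviation am :: fock where "am \<equiv> fexp (- int p)"
abbreviation ap :: fock where "ap \<equiv> Qi am"

text \<open>At charge -p both sides of the null vector equation equal
  \<open>h (- 1) (h (- 1) am) / 4 - h (- 2) am / 2\<close>.\<close>

lemma degenerate_am: "degenerate (- int p) am"
proof -
  have "Li (- 1) (h (- 1) am) = h (- 1) (Li (- 1) am) + h (- 2) am"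
    using h_Vir[of "- 1" "- 1" am] by simp
  then have "Li (- 1) (Li (- 1) am) = fscale (of_nat p) (Li (- 2) am)"
    using p0 unfolding Virm1_fexp Virm2_fexp Vir_scale h_scale
    by (simp add: fock.scale_right_distrib fock.scale_right_diff_distrib)
  then show ?thesis by (simp add: degenerate_def fexp_Ch primary_fexp)
qed

lemma degenerate_ap: "degenerate (int p) ap"
proof -
  have "primary (hw (- int p)) ap" by (rule primary_Q[OF primary_fexp fexp_Ch])
  moreover have "ap \<in> Ch (int p)" using Q_Ch[OF fexp_Ch, of "- int p"] by simp
  ultimately show ?thesis
    using degenerate_am by (simp add: degenerate_def Vir_Q Q_scale)
qed

lemma degenerate_Wt: "degenerate c v \<Longrightarrow> v \<in> Wt (hw (- int p))"
  by (simp add: degenerate_def primary_def Wt_iff)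

lemma hw_mp: "hw (- int p) = (3 * of_nat p - 2) / 4"
  using p0 by (simp add: hw_def field_simps)

text \<open>The null vector equation in modes: on the left L(-1) acts twice as a derivative, and on
  the right the iterate formula expands the modes of \<open>Li (- 2) v\<close>.\<close>

lemma bpz:
  assumes v: "degenerate c v" and w: "w \<in> VL p l"
  shows "fscale (of_rat (k * (k - 1))) (mode p v (k - 2) w)
    = fscale (of_nat p) (Sum_any (\<lambda>j::nat. Li (- 2 - int j) (mode p v (k + of_nat j) w))
       + Sum_any (\<lambda>j::nat. mode p v (k - 1 - of_nat j) (Li (int j - 1) w)))"
proof -
  have vc: "v \<in> Ch c" and t: "mode p (Li (- 1) v) m w = fscale (- of_rat m) (mode p v (m - 1) w)" for m w
    using v by (simp_all add: degenerate_def primary_def)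
  have 1: "Li (- 1) (mode p v k w) = mode p v k (Li (- 1) w) - fscale (of_rat k) (mode p v (k - 1) w)" for k w
    using Virm1_mode[of v k w] by (simp add: t)
  have "mode p (Li (- 1) (Li (- 1) v)) k w = Li (- 1) (mode p (Li (- 1) v) k w) - mode p (Li (- 1) v) k (Li (- 1) w)"
    using Virm1_mode[of "Li (- 1) v" k w] by simp
  also have "\<dots> = fscale (of_rat (k * (k - 1))) (mode p v (k - 2) w)"
    unfolding t Vir_scale 1 by (simp add: of_rat_mult of_rat_diff fock.scale_right_diff_distrib algebra_simps flin_uminus[OF flin_Vir])
  finally have 2: "mode p (Li (- 1) (Li (- 1) v)) k w = fscale (of_rat (k * (k - 1))) (mode p v (k - 2) w)" .
  have "mode p (Li (- 2) v) k w = Sum_any (\<lambda>j::nat. Li (- 2 - int j) (mode p v (k + of_nat j) w))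
       + Sum_any (\<lambda>j::nat. mode p v (k - 1 - of_nat j) (Li (int j - 1) w))"
  proof (cases "k + sp c l \<in> \<int>")
    case True
    have s: "sp 0 x = 0" for x by (simp add: sp_def)
    have a: "evz (\<lambda>j::nat. Li (- 2 - int j) (mode p v (k + of_nat j) w))"
      by (rule evz_comp0[OF evz_mode_shift[of v k w]]) (simp add: Vir_0)
    have b: "evz (\<lambda>j::nat. mode p v (k - 1 - of_nat j) (Li (int j - 1) w))"
      by (rule evz_comp0[OF evz_Vir[of "- 1" w]]) (simp add: mode_02)
    have cf: "mode p (conf p) (- 1 - of_nat j) x = Li (- 2 - int j) x" "mode p (conf p) (of_nat j) x = Li (int j - 1) x" for j x
      by (simp_all add: Vir_def)
    have g: "(- 1) ^ j * (of_rat (- 1) gchoose j) = (1 :: complex)" for j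
      by (simp add: of_rat_minus gbinomial_minus binomial_gbinomial[symmetric])
    have "mode p (mode p (conf p) (- 1) v) k w = Sum_any (\<lambda>j::nat. fscale ((- 1) ^ j * (of_rat (- 1) gchoose j))
     (mode p (conf p) (- 1 - of_nat j) (mode p v (k + of_nat j) w)
      - fscale ((- 1) powi (- 1)) (mode p v (k + (- 1) - of_nat j) (mode p (conf p) (of_nat j) w))))"
      by (rule mode_iterate[OF conf_Ch vc w _ _ True]) (simp_all add: s)
    also have "\<dots> = Sum_any (\<lambda>j::nat. Li (- 2 - int j) (mode p v (k + of_nat j) w) + mode p v (k - 1 - of_nat j) (Li (int j - 1) w))"
    proof -
      have e: "k + (- 1) - of_nat j = k - 1 - of_nat j" for j by simp
      have pw: "(- 1 :: complex) powi (- 1) = - 1" by simp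
      show ?thesis unfolding cf g e pw by (simp only: fock.scale_one fock.scale_minus_left diff_minus_eq_add)
    qed
    also have "mode p (conf p) (- 1) v = Li (- 2) v" by (simp add: Vir_def)
    finally show ?thesis unfolding Sum_any_add[OF a b] .
  next
    case False
    have n: "m - k \<in> \<int> \<Longrightarrow> m + sp c l \<notin> \<int>" for m
      using False Ints_diff[of "m + sp c l" "m - k"] by (auto simp: add.commute)
    have z: "mode p v m x = 0" if "m - k \<in> \<int>" "x \<in> VL p l" for m x
      by (rule mode_nonint[OF vc that(2) n[OF that(1)]])
    have "mode p v (k + of_nat j) w = 0" for j by (rule z[OF _ w]) simp
    moreover have "mode p v (k - 1 - of_nat j) (Li (int j - 1) w) = 0" for j by (rule z[OF _ Vir_VL[OF w]]) simp
    moreover have "mode p (Li (- 2) v) k w = 0" by (rule mode_nonint[OF Vir_Ch[OF vc] w False])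
    ultimately show ?thesis by (simp add: Vir_0)
  qed
  then show ?thesis using 2 v by (simp add: degenerate_def mode_scale1)
qed

text \<open>This is \<open>bpz\<close> at \<open>k = J + 1\<close> with the terms for L(-1) and L(0)
  of w collected on the left. What remains on the right are higher modes of v on w and images of w
  under L(n) with \<open>n > 0\<close>, which makes it a descending recursion.\<close>

lemma bpz_weight:
  assumes v: "degenerate c v" and w: "w \<in> VL p l" "w \<in> Wt H"
  shows "fscale (of_rat (J * (J + 1 - of_nat p) - of_nat p * H)) (mode p v (J - 1) w)
    = fscale (of_nat p) (Sum_any (\<lambda>r::nat. Li (- 1 - int r) (mode p v (J + of_nat r) w))
       + Sum_any (\<lambda>r::nat. mode p v (J - 2 - of_nat r) (Li (int r + 1) w)))"
proof -
  let ?A = "\<lambda>j::nat. Li (- 2 - int j) (mode p v (J + 1 + of_nat j) w)"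
  let ?B = "\<lambda>j::nat. mode p v (J + 1 - 1 - of_nat j) (Li (int j - 1) w)"
  let ?A' = "\<lambda>r::nat. Li (- 1 - int r) (mode p v (J + of_nat r) w)"
  let ?B' = "\<lambda>r::nat. mode p v (J - 2 - of_nat r) (Li (int r + 1) w)"
  have eA: "evz ?A'"
    by (rule evz_comp0[OF evz_mode_shift[of v J w]]) (simp add: Vir_0)
  have eB: "evz ?B"
    by (rule evz_comp0[OF evz_Vir[of "- 1" w]]) (simp add: mode_02)
  have eB1: "evz (\<lambda>j. ?B (Suc j))"
    by (rule evz_comp0[OF evz_Vir[of 0 w]]) (simp add: mode_02)
  have "Sum_any ?A' = Li (- 1) (mode p v J w) + Sum_any ?A"
  proof -
    have "- 1 - int (Suc j) = - 2 - int j" "J + of_nat (Suc j) = J + 1 + of_nat j" for j by simp_all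
    then show ?thesis by (subst Sum_any_rec[OF eA]) (simp add: add.assoc)
  qed
  moreover have "Sum_any ?B = mode p v J (Li (- 1) w) + (mode p v (J - 1) (Li 0 w) + Sum_any ?B')"
    by (subst Sum_any_rec[OF eB], subst Sum_any_rec[OF eB1]) (simp add: algebra_simps)
  moreover have "Li 0 w = fscale (of_rat H) w" using w(2) by (simp add: Wt_iff)
  moreover have "mode p v J (Li (- 1) w) = Li (- 1) (mode p v J w) + fscale (of_rat J) (mode p v (J - 1) w)"
    using Vir_primary[of "hw (- int p)" v "- 1" J w] v by (simp add: degenerate_def of_rat_minus)
  moreover have "fscale (of_rat ((J + 1) * J)) (mode p v (J - 1) w) = fscale (of_nat p) (Sum_any ?A + Sum_any ?B)"
    using bpz[OF v w(1), of "J + 1"] by (simp add: algebra_simps)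
  ultimately have "fscale (of_rat ((J + 1) * J)) (mode p v (J - 1) w) = fscale (of_nat p) (Sum_any ?A' + Sum_any ?B')
     + fscale (of_nat p * of_rat (J + H)) (mode p v (J - 1) w)"
    by (simp add: mode_scale2 fock.scale_right_distrib fock.scale_left_distrib of_rat_add algebra_simps)
  moreover have "of_rat (J * (J + 1 - of_nat p) - of_nat p * H) = of_rat ((J + 1) * J) - (of_nat p * of_rat (J + H) :: complex)"
    by (simp add: of_rat_add of_rat_mult of_rat_diff algebra_simps)
  ultimately show ?thesis by (simp only: fock.scale_left_diff_distrib) simp
qed

text \<open>The sign with which Q passes the modes of a field of charge p or -p.\<close>

definition eta :: complex where "eta = (- 1) ^ p"

lemma eta_sq: "eta * eta = 1" "eta * (eta * x) = x"
  by (simp_all add: eta_def power_mult_distrib[symmetric] mult.assoc[symmetric])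

lemma eta_powi: "(- 1) powi (- int p) = eta" "(- 1) powi (int p) = eta"
  by (cases "even p", simp_all add: eta_def power_int_minus)+

lemma ap_mode: "mode p ap m w = Qi (mode p am m w) - fscale eta (mode p am m (Qi w))"
  using Q_mode[OF fexp_Ch, of "- int p" m w] unfolding eta_powi by simp

lemma am_Q: "mode p am m (Qi w) = fscale eta (Qi (mode p am m w) - mode p ap m w)"
  by (simp add: ap_mode fock.scale_right_diff_distrib eta_sq)

lemma ap_Wt: "ap \<in> Wt (hw (- int p))" and ap_Ch: "ap \<in> Ch (int p)" and am_Ch: "am \<in> Ch (- int p)" and am_Wt: "am \<in> Wt (hw (- int p))"
  using degenerate_ap degenerate_Wt[OF degenerate_ap] degenerate_am degenerate_Wt[OF degenerate_am] by (auto simp: degenerate_def)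

text \<open>At charge 3p the lowest weight (3p + 6)/4 exceeds the weight (3p - 2)/4 of
  \<open>ap\<close>: the two fields form a doublet under Q.\<close>

lemma Q_ap: "Qi ap = 0"
proof (rule Wt_Ch_low[OF Q_Wt[OF ap_Wt] Q_Ch[OF ap_Ch]])
  show "hw (- int p) < hw (int p + 2 * int p)" using p0 by (simp add: hw_def field_simps)
qed

lemma ap_Q: "mode p ap m (Qi w) = fscale eta (Qi (mode p ap m w))"
  using Q_mode[OF ap_Ch, of m w] unfolding eta_powi by (simp add: Q_ap mode_01 eta_sq)

lemma Qpow_lin: "flin (Qi ^^ j)"
  by (induction j) (simp_all add: flin_comp[OF flin_Q] comp_def id_def)

lemmas Qpow_add = flin_add[OF Qpow_lin] and Qpow_scale = flin_scale[OF Qpow_lin]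
  and Qpow_0 = flin_0[OF Qpow_lin] and Qpow_diff = flin_diff[OF Qpow_lin]

lemma Vir_Qpow: "Li n ((Qi ^^ j) v) = (Qi ^^ j) (Li n v)"
  by (induction j) (simp_all add: Vir_Q)

lemma ap_Qpow: "mode p ap m ((Qi ^^ j) w) = fscale (eta ^ j) ((Qi ^^ j) (mode p ap m w))"
  by (induction j) (simp_all add: ap_Q Q_scale)

lemma am_Qpow: "mode p am m ((Qi ^^ j) w) = fscale (eta ^ j) ((Qi ^^ j) (mode p am m w) - fscale (of_nat j) ((Qi ^^ (j - 1)) (mode p ap m w)))"
proof (induction j)
  case (Suc j)
  have *: "fscale (of_nat j) (Qi ((Qi ^^ (j - Suc 0)) x)) = fscale (of_nat j) ((Qi ^^ j) x)" for x
    by (cases j) simp_all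
  show ?case
    by (simp add: am_Q Suc ap_Qpow Q_scale Q_diff fock.scale_right_diff_distrib fock.scale_left_distrib mult.assoc
        fock.scale_scale[symmetric] * fock.scale_right_distrib del: fock.scale_scale)
qed simp

lemma Qpow_Wt: "v \<in> Wt H \<Longrightarrow> (Qi ^^ j) v \<in> Wt H"
  by (induction j) (simp_all add: Q_Wt)

lemma Qpow_Ch: "v \<in> Ch k \<Longrightarrow> (Qi ^^ j) v \<in> Ch (k + 2 * int p * int j)"
proof (induction j)
  case (Suc j)
  then show ?case using Q_Ch[of "(Qi ^^ j) v" "k + 2 * int p * int j"] by (simp add: algebra_simps)
qed simp

lemma ap_EM: "ap = EM (2 * int p) (int p - 1) (fexp (int p))"
proof -
  have "mode p (fexp (2 * int p)) 0 am = EM (2 * int p) (int p - 1) (fexp (2 * int p + - int p))"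
    by (rule exp_fexp_int) (simp add: sp_2p)
  then show ?thesis by (simp add: Q_def)
qed

text \<open>The index (3p - 4)/2 is the one at which the product has weight 0. Writing
  \<open>ap\<close> as a coefficient of \<open>EM\<close>, the constant turns out to be the binomial
  coefficient of 2p - 2 over p - 1.\<close>

lemma am_ap_top: "\<exists>c. c \<noteq> 0 \<and> mode p am ((3 * of_nat p - 4) / 2) ap = fscale c vac"
proof -
  let ?x = "mode p am ((3 * of_nat p - 4) / 2) ap"
  obtain t where t: "p = Suc t" using p2 by (cases p) auto
  have "?x \<in> Wt (hw (- int p) + hw (- int p) - (3 * of_nat p - 4) / 2 - 1)"
    by (rule Wt_mode[OF am_Wt ap_Wt])
  moreover have "hw (- int p) + hw (- int p) - (3 * of_nat p - 4) / 2 - 1 = 0"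
    by (simp add: hw_mp field_simps)
  ultimately have w: "?x \<in> Wt 0" by simp
  have ch: "?x \<in> Ch 0" using Ch_mode[OF am_Ch ap_Ch] by simp
  have "?x \<in> gr 0 0" using Wt_Ch[OF w ch] by (simp add: hw_def)
  then have e: "?x = fscale (lk ?x ({#}, 0)) vac"
    by (intro poly_mapping_eqI) (auto simp: lookup_fscale fexp_def lookup_single when_def gr_iff wlev_0)
  have "lk (mode p am ((3 * of_nat p - 4) / 2) (EM (2 * int p) (int t) (fexp (int p)))) ({#}, - int p + int p)
      = (- 1) ^ t * (of_rat (sp (- int p) (2 * int p)) gchoose t)"
  proof (rule exp_EM_vac)
    have "sp (- int p) (int p) = - of_nat p / 2" using p0 by (simp add: sp_def)
    then show "(3 * of_nat p - 4) / 2 = of_nat t - 1 - sp (- int p) (int p)" using t by (simp add: field_simps)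
  qed
  moreover have "int p - 1 = int t" using t by simp
  moreover have "(of_rat (sp (- int p) (2 * int p)) gchoose t) = (- 1) ^ t * (of_nat (p + t - 1) gchoose t :: complex)"
    using sp_commute[of "- int p" "2 * int p"] gbinomial_minus[of "of_nat p :: complex" t] p0
    by (simp add: sp_2p of_rat_minus of_nat_diff)
  moreover have "(of_nat (p + t - 1) gchoose t :: complex) \<noteq> 0"
    using t by (simp add: binomial_gbinomial[symmetric] del: of_nat_add)
  ultimately have "lk ?x ({#}, 0) \<noteq> 0" by (simp add: ap_EM)
  with e show ?thesis by blast
qed

section \<open>Weight components\<close>

lemma keys_wt: "v \<in> Wt H \<Longrightarrow> lk v a \<noteq> 0 \<Longrightarrow> wt a = H"
  by (auto simp: Wt_def in_keys_iff)

lemma Vir0_product: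
  assumes S: "fock.subspace S" "\<And>w. w \<in> S \<Longrightarrow> Li 0 w \<in> S" and v: "v \<in> S" and F: "finite F"
  shows "\<exists>x\<in>S. \<forall>a. lk x a = (\<Prod>K\<in>F. of_rat (wt a - K)) * lk v a"
  using F
proof (induction F rule: finite_induct)
  case empty
  then show ?case using v by auto
next
  case (insert K F)
  then obtain x where x: "x \<in> S" "\<And>a. lk x a = (\<Prod>K\<in>F. of_rat (wt a - K)) * lk v a" by blast
  have "Li 0 x - fscale (of_rat K) x \<in> S"
    using S x(1) by (simp add: fock.subspace_diff fock.subspace_scale)
  moreover have "lk (Li 0 x - fscale (of_rat K) x) a = (\<Prod>K\<in>insert K F. of_rat (wt a - K)) * lk v a" for a
    using insert(1,2) by (simp add: lookup_minus lk_Vir0 lookup_fscale x(2) of_rat_diff algebra_simps)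
  ultimately show ?case by blast
qed

text \<open>A polynomial in L(0) that vanishes at the other weights of v cuts out the component and
  stays within S.\<close>

lemma weight_component:
  assumes S: "fock.subspace S" "\<And>w. w \<in> S \<Longrightarrow> Li 0 w \<in> S" and v: "v \<in> S"
  shows "\<exists>x\<in>S. \<forall>a. lk x a = (if wt a = H then lk v a else 0)"
proof -
  let ?F = "wt ` Poly_Mapping.keys v - {H}"
  let ?c = "(\<Prod>K\<in>?F. of_rat (H - K)) :: complex"
  obtain x where x: "x \<in> S" "\<And>a. lk x a = (\<Prod>K\<in>?F. of_rat (wt a - K)) * lk v a"
    using Vir0_product[OF S v, of ?F] by auto
  have c: "?c \<noteq> 0" by simp
  have "lk (fscale (1 / ?c) x) a = (if wt a = H then lk v a else 0)" for a
  proof (cases "wt a = H \<or> lk v a = 0")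
    case True
    then show ?thesis using c by (auto simp: lookup_fscale x(2))
  next
    case False
    then have "(\<Prod>K\<in>?F. of_rat (wt a - K) :: complex) = 0" by (intro prod_zero) (auto simp: in_keys_iff intro!: bexI[of _ "wt a"])
    then show ?thesis using False by (simp add: lookup_fscale x(2))
  qed
  moreover have "fscale (1 / ?c) x \<in> S" using S x(1) by (simp add: fock.subspace_scale)
  ultimately show ?thesis by blast
qed

lemma weight_decomposition:
  assumes S: "fock.subspace S" "\<And>w. w \<in> S \<Longrightarrow> Li 0 w \<in> S" and v: "v \<in> S"
  shows "v \<in> fock.span (\<Union>H. S \<inter> Wt H)"
proof -
  have "\<exists>x. x \<in> S \<and> (\<forall>a. lk x a = (if wt a = H then lk v a else 0))" for H
    using weight_component[OF S v, of H] by blast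
  then obtain x where x: "\<And>H. x H \<in> S" "\<And>H a. lk (x H) a = (if wt a = H then lk v a else 0)"
    by metis
  have "v = (\<Sum>H\<in>wt ` Poly_Mapping.keys v. x H)"
  proof (rule poly_mapping_eqI)
    fix a
    have "(\<Sum>H\<in>wt ` Poly_Mapping.keys v. if wt a = H then lk v a else 0) = (if wt a \<in> wt ` Poly_Mapping.keys v then lk v a else 0)"
      by (subst sum.delta') auto
    also have "\<dots> = lk v a" by (auto simp: in_keys_iff)
    finally show "lk v a = lk (\<Sum>H\<in>wt ` Poly_Mapping.keys v. x H) a"
      by (simp add: clin_sum[OF clin_lookup] x(2))
  qed
  also have "\<dots> \<in> fock.span (\<Union>H. S \<inter> Wt H)"
    by (intro fock.span_sum fock.span_base) (auto simp: x Wt_def in_keys_iff split: if_splits)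
  finally show ?thesis .
qed

text \<open>The possible weights: \<open>4p\<close> times a weight plus \<open>(p-1)\<^sup>2\<close> is a natural number, so that weights can be
  used for well-founded induction.\<close>

definition lowest :: "nat \<Rightarrow> rat" where
  "lowest n = (of_nat n - (of_nat p - 1)\<^sup>2) / (4 * of_nat p)"

lemma lowest_less: "lowest m < lowest n \<longleftrightarrow> m < n"
  using p0 by (simp add: lowest_def divide_strict_right_mono divide_less_cancel)

lemma wt_formula: "wt (\<mu>, k) = lowest (nat ((k - int p + 1)\<^sup>2) + 4 * p * wlev \<mu>)"
proof -
  define n where "n = nat ((k - int p + 1)\<^sup>2)"
  have "of_nat n = (of_int (int n) :: rat)" by simp
  also have "\<dots> = (of_int k - of_nat p + 1)\<^sup>2" unfolding n_def by simp
  finally have "wt (\<mu>, k) = lowest (n + 4 * p * wlev \<mu>)"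
    using p0 by (simp add: wt_def hw_def lowest_def field_simps power2_eq_square)
  then show ?thesis by (simp add: n_def)
qed

lemma wt_lowest: "\<exists>n. wt a = lowest n"
  by (metis surj_pair wt_formula)

lemma Wt_lowest: "v \<in> Wt H \<Longrightarrow> v \<noteq> 0 \<Longrightarrow> \<exists>n. H = lowest n"
  by (metis keys_wt lookup_zero poly_mapping_eqI wt_lowest)

section \<open>Singular vectors\<close>

text \<open>On charge l the mode of index l/2 - 1 preserves the level, so on vacuum coefficients it
  is just the shift of charge.\<close>

lemma vacf_am: "w \<in> Ch l \<Longrightarrow> vacf (l - int p) (mode p am (of_int l / 2 - 1) w) = vacf l w"
proof -
  assume w: "w \<in> Ch l"
  have s: "sp (- int p) l = - of_int l / 2" using p0 by (simp add: sp_def)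
  have "mode p am (of_int l / 2 - 1) w - fscale (vacf l w) (fexp (l - int p)) \<in> {x. vacf (l - int p) x = 0}"
  proof (rule flin_keys_in[of "\<lambda>w. mode p am (of_int l / 2 - 1) w - fscale (vacf l w) (fexp (l - int p))"])
    show "flin (\<lambda>w. mode p am (of_int l / 2 - 1) w - fscale (vacf l w) (fexp (l - int p)))"
      by (rule flinI) (simp_all add: mode_add2 mode_scale2 lookup_add lookup_fscale fock.scale_left_distrib fock.scale_right_diff_distrib)
    show "fock.subspace {x. vacf (l - int p) x = 0}"
      by (simp add: fock.subspace_def lookup_add lookup_fscale)
    fix \<mu> k assume "(\<mu>, k) \<in> Poly_Mapping.keys w"
    then have k: "k = l" using w by (auto simp: Ch_def)
    show "mode p am (of_int l / 2 - 1) (basis \<mu> k) - fscale (vacf l (basis \<mu> k)) (fexp (l - int p)) \<in> {x. vacf (l - int p) x = 0}"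
    proof (cases "\<mu> = {#}")
      case True
      have "mode p am (of_int l / 2 - 1) (fexp l) = EM (- int p) 0 (fexp (- int p + l))"
        by (rule exp_fexp_int) (simp add: s)
      then show ?thesis using True k by (simp add: fexp_def)
    next
      case False
      have "mode p am (of_int l / 2 - 1) (basis \<mu> l) \<in> gr (- int p + l) (0 + of_nat (wlev \<mu>) - (of_int l / 2 - 1) - 1 - sp (- int p) l)"
        by (rule gr_mode[OF gr_fexp gr_basis])
      moreover have "of_nat (wlev \<mu>) \<noteq> (0::rat)" using False by (simp add: wlev_0)
      ultimately have "vacf (l - int p) (mode p am (of_int l / 2 - 1) (basis \<mu> l)) = 0"
        by (intro lk_gr) (auto simp: s)
      then show ?thesis using False k by (simp add: lookup_minus lookup_fscale lookup_single when_def)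
    qed
  qed
  then show ?thesis by (simp add: lookup_minus lookup_fscale fexp_def)
qed

lemma h_Ch: "v \<in> Ch l \<Longrightarrow> h r v \<in> Ch l"
proof -
  assume v: "v \<in> Ch l"
  show ?thesis
  proof (rule flin_keys_in[OF flin_heis subspace_Ch])
    fix \<mu> k assume "(\<mu>, k) \<in> Poly_Mapping.keys v"
    then have "k = l" using v by (auto simp: Ch_def)
    then show "h r (basis \<mu> k) \<in> Ch l" using gr_Ch[OF gr_heis[OF gr_basis]] by blast
  qed
qed

text \<open>Commuting with \<alpha>(n) for \<open>n > 0\<close> only raises the index. If all these
  modes vanished on v, they would vanish on every vector obtained from v by annihilation operators,
  and \<open>vacf_am\<close> would make all vacuum coefficients of these 0.\<close>

lemma am_nonzero:
  assumes v: "v \<in> Ch l" "v \<noteq> 0"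
  shows "\<exists>j::nat. mode p am (of_int l / 2 - 1 + of_nat j) v \<noteq> 0"
proof (rule ccontr)
  assume "\<not> ?thesis"
  then have 0: "mode p am (of_int l / 2 - 1 + of_nat j) v = 0" for j :: nat by simp
  have *: "fold h rs v \<in> Ch l \<and> (\<forall>j::nat. mode p am (of_int l / 2 - 1 + of_nat j) (fold h rs v) = 0)"
    if "list_all (\<lambda>r. r > 0) rs" for rs
    using that v(1) 0
  proof (induction rs arbitrary: v)
    case (Cons r rs)
    have "r > 0" using Cons.prems(1) by simp
    then obtain n where n: "r = int n" by (metis pos_int_cases)
    have "mode p am (of_int l / 2 - 1 + of_nat j) (h r v) = 0" for j
      using h_exp_mode[of r "- int p" "of_int l / 2 - 1 + of_nat j" v] Cons.prems(3)[of j] Cons.prems(3)[of "j + n"]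
      by (simp add: mode_fexp n h_0 add.assoc)
    then show ?case using Cons.IH[of "h r v"] Cons.prems h_Ch by simp
  qed simp
  have "v = 0"
  proof (rule fock_zeroI[OF _ p0(1)])
    fix rs :: "int list" and K
    assume rs: "list_all (\<lambda>r. r > 0) rs"
    show "lk (fold h rs v) ({#}, K) = 0"
    proof (cases "K = l")
      case True
      then show ?thesis
        using vacf_am[of "fold h rs v" l] *[OF rs] by (metis add.right_neutral lookup_zero of_nat_0)
    next
      case False
      then show ?thesis using *[OF rs] by (auto simp: Ch_iff)
    qed
  qed
  then show False using v by simp
qed

text \<open>Take the largest \<open>J\<close> with \<open>(a\<^sup>-)\<^sub>J\<^sub>-\<^sub>1 v \<noteq> 0\<close>: the recursion forces \<open>J (J - p + 1) = p H\<close>, and \<open>D = J - l/2\<close>.\<close>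

lemma singular_level:
  assumes v: "v \<in> gr l d" "v \<noteq> 0" and d: "d > 0" and sing: "\<And>n. n \<ge> 1 \<Longrightarrow> Li n v = 0"
  shows "\<exists>D. 0 < D \<and> of_int D \<le> d \<and> of_int (D * (D + l - int p + 1)) = of_nat p * d"
proof -
  let ?a = "\<lambda>j::nat. mode p am (of_int l / 2 - 1 + of_nat j) v"
  have ch: "v \<in> Ch l" by (rule gr_Ch[OF v(1)])
  obtain N where N: "\<And>j. j \<ge> N \<Longrightarrow> ?a j = 0"
    using evz_mode_shift[of am "of_int l / 2 - 1" v] unfolding evz_def by blast
  obtain j0 where j0: "?a j0 \<noteq> 0" using am_nonzero[OF ch v(2)] by blast
  define j where "j = Max {j. ?a j \<noteq> 0}"
  have fin: "finite {j. ?a j \<noteq> 0}" by (rule finite_subset[of _ "{..<N}"]) (use N in \<open>auto simp: not_le[symmetric]\<close>)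
  have j: "?a j \<noteq> 0" using Max_in[OF fin] j0 unfolding j_def by blast
  have above: "?a i = 0" if "i > j" for i
    using Max_ge[OF fin, of i] that unfolding j_def by fastforce
  let ?J = "of_int l / 2 + of_nat j :: rat"
  let ?H = "hw l + d"
  have "mode p am (?J + of_nat r) v = 0" for r
    using above[of "j + r + 1"] by (simp add: algebra_simps)
  then have "fscale (of_rat (?J * (?J + 1 - of_nat p) - of_nat p * ?H)) (mode p am (?J - 1) v) = 0"
    using bpz_weight[OF degenerate_am Ch_VL[OF ch] gr_Wt[OF v(1)], of ?J] sing by (simp add: Vir_0 mode_02)
  moreover have "mode p am (?J - 1) v \<noteq> 0" using j by (simp add: algebra_simps)
  ultimately have "?J * (?J + 1 - of_nat p) - of_nat p * ?H = 0" by simp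
  moreover have ph: "of_nat p * hw l = of_int l * (of_int l - 2 * of_nat p + 2) / 4"
    using p0 by (simp add: hw_def field_simps)
  ultimately have e: "of_int (int j * (int j + l - int p + 1)) = of_nat p * d"
    unfolding distrib_left[of _ "hw l"] ph by (simp add: field_simps)
  have "mode p am (of_int l / 2 - 1 + of_nat j) v \<in> gr (- int p + l) (0 + d - (of_int l / 2 - 1 + of_nat j) - 1 - sp (- int p) l)"
    by (rule gr_mode[OF gr_fexp v(1)])
  moreover have "sp (- int p) l = - of_int l / 2" using p0 by (simp add: sp_def)
  then have "0 + d - (of_int l / 2 - 1 + of_nat j) - 1 - sp (- int p) l = d - of_nat j" by simp
  ultimately have "\<not> d - of_nat j < 0" using gr_neg j by metis
  moreover have "j \<noteq> 0"
  proof
    assume "j = 0"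
    then have "of_nat p * d = 0" using e by simp
    then show False using d p0 by simp
  qed
  ultimately show ?thesis using e by (intro exI[of _ "int j"]) simp
qed

text \<open>From \<open>D \<le> d\<close> and \<open>D (D + l - p + 1) = p d\<close> one gets
  \<open>l + 2D \<ge> 2p\<close>. Moreover \<open>hw l + d = hw (l + 2D)\<close>, and l + 2D lies
  beyond the larger zero 2p - 2 of the parabola.\<close>

lemma singular_weight:
  assumes v: "v \<in> gr l d" "v \<noteq> 0" and d: "d > 0" and sing: "\<And>n. n \<ge> 1 \<Longrightarrow> Li n v = 0"
  shows "hw l + d > 0"
proof -
  obtain D where D: "0 < D" "of_int D \<le> d" "of_int (D * (D + l - int p + 1)) = of_nat p * d"
    using singular_level[OF assms] by blast
  have "of_int (D * int p) \<le> (of_int (D * (D + l - int p + 1)) :: rat)"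
    unfolding D(3) using D(2) p0 by (simp add: mult.commute mult_left_mono)
  then have "D * int p \<le> D * (D + l - int p + 1)" by (simp only: of_int_le_iff)
  then have "int p \<le> D + l - int p + 1" using D(1) by simp
  then have x: "l + 2 * D \<ge> 2 * int p" using D(1) by linarith
  have "of_nat p * (hw l + d) = of_nat p * hw (l + 2 * D)"
    unfolding distrib_left D(3)[symmetric] using p0 by (simp add: hw_def field_simps)
  then have "hw l + d = hw (l + 2 * D)" using p0 by simp
  moreover have "(l + 2 * D) * (l + 2 * D - 2 * int p + 2) > 0" using x p2 by (intro mult_pos_pos) auto
  then have "(0 :: rat) < of_int ((l + 2 * D) * (l + 2 * D - 2 * int p + 2))" unfolding of_int_0_less_iff .
  then have "hw (l + 2 * D) > 0" unfolding hw_def using p0 by (intro divide_pos_pos) simp_all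
  ultimately show ?thesis by simp
qed

lemma hw_nonpos: "hw k \<le> 0 \<Longrightarrow> 0 \<le> k \<and> k \<le> 2 * int p - 2"
proof -
  assume "hw k \<le> 0"
  then have "(of_int (k * (k - 2 * int p + 2)) :: rat) \<le> of_int 0" using p0 by (simp add: hw_def divide_le_0_iff)
  then have "k * (k - 2 * int p + 2) \<le> 0" unfolding of_int_le_iff .
  then show ?thesis using p2 by (auto simp: mult_le_0_iff)
qed

text \<open>A submodule need not be graded by charge. Since this projection commutes with the
  Virasoro operators, singular vectors can nevertheless be examined one charge at a time.\<close>

definition charge_part :: "int \<Rightarrow> fock \<Rightarrow> fock" where
  "charge_part k = lin_ext (\<lambda>\<mu> l. if l = k then basis \<mu> l else 0)"

lemma flin_charge_part: "flin (charge_part k)"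
  unfolding charge_part_def by (rule flin_lin_ext)

lemma lk_charge_part: "lk (charge_part k v) (\<mu>, l) = (if l = k then lk v (\<mu>, l) else 0)"
proof (rule clin_eqI[of "\<lambda>v. lk (charge_part k v) (\<mu>, l)" "\<lambda>v. if l = k then lk v (\<mu>, l) else 0"])
  show "clin (\<lambda>v. lk (charge_part k v) (\<mu>, l))" by (rule clin_comp[OF clin_lookup flin_charge_part])
  show "clin (\<lambda>v. if l = k then lk v (\<mu>, l) else 0)" by (rule clinI) (simp_all add: lookup_add lookup_fscale)
qed (auto simp: charge_part_def lin_ext_basis lookup_single when_def)

lemma charge_part_Ch: "v \<in> Ch l \<Longrightarrow> charge_part k v = (if l = k then v else 0)"
proof (rule poly_mapping_eqI)
  fix a :: "nat multiset \<times> int"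
  obtain \<mu> l' where a: "a = (\<mu>, l')" by fastforce
  assume "v \<in> Ch l"
  then show "lk (charge_part k v) a = lk (if l = k then v else 0) a"
    unfolding Ch_iff a by (cases "lk v (\<mu>, l') = 0") (auto simp: lk_charge_part)
qed

lemma charge_part_Vir: "charge_part k (Li n v) = Li n (charge_part k v)"
  by (rule flin_eqI[of "\<lambda>v. charge_part k (Li n v)" "\<lambda>v. Li n (charge_part k v)"])
    (simp_all add: flin_comp[OF flin_charge_part flin_Vir] flin_comp[OF flin_Vir flin_charge_part] charge_part_Ch[OF Vir_Ch[OF basis_Ch]] charge_part_Ch[OF basis_Ch] Vir_0)

text \<open>A nonzero vector of minimal weight is singular, and so are its parts of fixed charge. By
  \<open>singular_weight\<close> a weight at most 0 forces level 0 on each part, so the vector is a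
  combination of exponentials, and the congruence modulo 2p leaves only one.\<close>

lemma lowest_vector:
  assumes M: "fock.subspace M" "M \<subseteq> VL p l" "\<And>n w. w \<in> M \<Longrightarrow> Li n w \<in> M"
    and v: "v \<in> M" "v \<noteq> 0" "v \<in> Wt H" "H \<le> 0"
  shows "\<exists>k. 0 \<le> k \<and> k \<le> 2 * int p - 2 \<and> 2 * int p dvd k - l \<and> fexp k \<in> M"
proof -
  let ?P = "\<lambda>n. \<exists>v\<in>M. v \<noteq> 0 \<and> v \<in> Wt (lowest n)"
  obtain n0 where n0: "H = lowest n0" using Wt_lowest v by blast
  define n where "n = (LEAST n. ?P n)"
  have "?P n0" using v n0 by blast
  then have Pn: "?P n" and nn: "n \<le> n0" unfolding n_def by (rule LeastI, rule Least_le)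
  then obtain w where w: "w \<in> M" "w \<noteq> 0" "w \<in> Wt (lowest n)" by blast
  have low: "lowest n \<le> 0" using v(4) n0 nn lowest_less[of n0 n] by linarith
  have sing: "Li r w = 0" if "r \<ge> 1" for r
  proof (rule ccontr)
    assume nz: "Li r w \<noteq> 0"
    have wr: "Li r w \<in> Wt (lowest n - of_int r)" by (rule Vir_Wt[OF w(3)])
    obtain m where m: "lowest n - of_int r = lowest m" using Wt_lowest[OF wr nz] by blast
    have "lowest m < lowest n" using m[symmetric] that by simp
    then have "m < n" using lowest_less by blast
    moreover have "?P m" using M(3)[OF w(1)] wr nz m by metis
    ultimately show False unfolding n_def using not_less_Least by blast
  qed
  have key: "\<mu> = {#} \<and> 0 \<le> k \<and> k \<le> 2 * int p - 2 \<and> 2 * int p dvd k - l" if k: "lk w (\<mu>, k) \<noteq> 0" for \<mu> k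
  proof -
    let ?w = "charge_part k w"
    have nz: "?w \<noteq> 0" using k by (metis lk_charge_part lookup_zero)
    have ch: "?w \<in> Ch k" by (auto simp: Ch_iff lk_charge_part)
    have wt: "?w \<in> Wt (lowest n)"
      unfolding Wt_def using keys_wt[OF w(3)] by (auto simp: in_keys_iff lk_charge_part split: if_splits)
    have gr: "?w \<in> gr k (lowest n - hw k)" by (rule Wt_Ch[OF wt ch])
    have "\<not> lowest n - hw k > 0"
    proof
      assume "lowest n - hw k > 0"
      from singular_weight[OF gr nz this] show False using low by (simp add: charge_part_Vir[symmetric] sing flin_0[OF flin_charge_part])
    qed
    moreover have "\<not> lowest n - hw k < 0" using gr_neg[OF gr] nz by blast
    ultimately have e: "lowest n = hw k" by simp
    have "wt (\<mu>, k) = lowest n" by (rule keys_wt[OF w(3) k])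
    then have "\<mu> = {#}" using e by (simp add: wt_def wlev_0[symmetric])
    moreover have "w \<in> VL p l" using w(1) M(2) by blast
    then have "2 * int p dvd k - l" using k by (auto simp: VL_def in_keys_iff)
    ultimately show ?thesis using hw_nonpos[of k] low e by simp
  qed
  obtain \<mu> k where k: "lk w (\<mu>, k) \<noteq> 0" using w(2) by (metis lookup_zero poly_mapping_eqI surj_pair)
  have \<mu>: "\<mu> = {#}" using key[OF k] by simp
  \<comment> \<open>Two charges between 0 and 2p - 2 that are congruent modulo 2p coincide.\<close>
  have un: "k' = k" if "lk w (\<mu>', k') \<noteq> 0" for \<mu>' k'
  proof -
    have "2 * int p dvd (k' - l) - (k - l)" using key[OF k] key[OF that] by (metis dvd_diff)
    then have "2 * int p dvd k' - k" by simp
    moreover have "\<bar>k' - k\<bar> < 2 * int p" using key[OF k] key[OF that] by linarith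
    ultimately show ?thesis using dvd_imp_le_int[of "k' - k" "2 * int p"] by fastforce
  qed
  have "w = fscale (lk w (\<mu>, k)) (fexp k)"
    by (rule poly_mapping_eqI) (use key un \<mu> in \<open>auto simp: lookup_fscale fexp_def lookup_single when_def\<close>)
  then have "fexp k = fscale (1 / lk w (\<mu>, k)) w" using k by (metis fock.scale_scale fock.scale_one nonzero_divide_eq_eq times_divide_eq_left mult_1 divide_self)
  then have "fexp k \<in> M" using w(1) M(1) by (metis fock.subspace_scale)
  then show ?thesis using key[OF k] by blast
qed

section \<open>Stable families\<close>

text \<open>A family is indexed by the charge modulo \<open>2p\<close>; the fields \<open>a\<^sup>\<plusminus>\<close> of charge \<open>\<plusminus>p\<close> move between its members.\<close>

definition stable :: "(int \<Rightarrow> fock set) \<Rightarrow> bool" where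
  "stable M \<longleftrightarrow> (\<forall>l. fock.subspace (M l) \<and> M l \<subseteq> VL p l \<and>
     (\<forall>w\<in>M l. (\<forall>n. Li n w \<in> M l) \<and> (\<forall>k. mode p am k w \<in> M (l - int p) \<and> mode p ap k w \<in> M (l + int p))))"

lemma stableD:
  assumes "stable M"
  shows "fock.subspace (M l)" "M l \<subseteq> VL p l" "w \<in> M l \<Longrightarrow> Li n w \<in> M l"
    "w \<in> M l \<Longrightarrow> mode p am k w \<in> M (l - int p)" "w \<in> M l \<Longrightarrow> mode p ap k w \<in> M (l + int p)"
  using assms by (auto simp: stable_def)

text \<open>The coefficient of the recursion vanishes for nonnegative \<open>J\<close> only if \<open>J > p - 1\<close>, and then
  \<open>v\<^sub>J\<^sub>-\<^sub>1 w\<close> has smaller weight than \<open>w\<close>.\<close>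

lemma creation_modes:
  assumes v: "degenerate c v" and w: "w \<in> VL p l" "w \<in> Wt H" and H: "H > 0"
    and S: "fock.subspace S" "\<And>n x. x \<in> S \<Longrightarrow> Li n x \<in> S"
    and high: "\<And>k. k > hw (- int p) - 1 \<Longrightarrow> mode p v k w \<in> S"
    and low: "\<And>j r. mode p v j (Li (int r + 1) w) \<in> S"
    and k: "k \<ge> - 1"
  shows "mode p v k w \<in> S"
proof -
  obtain N :: int where N: "\<And>m. m \<ge> of_int N \<Longrightarrow> mode p v m w = 0"
    using good_mode[of v] unfolding good_def by blast
  \<comment> \<open>Descending induction on \<open>k\<close> from the truncation bound
    \<open>N\<close>, with \<open>n\<close> measuring the distance.\<close>
  have "mode p v k w \<in> S" if "k \<ge> - 1" "k \<ge> of_int N - of_nat n" for n k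
    using that
  proof (induction n arbitrary: k)
    case 0
    then show ?case using N S(1) by (simp add: fock.subspace_0)
  next
    case (Suc n)
    let ?J = "k + 1"
    let ?c = "?J * (?J + 1 - of_nat p) - of_nat p * H"
    have IH: "mode p v (?J + of_nat r) w \<in> S" for r
      by (rule Suc.IH) (use Suc.prems in auto)
    have "fscale (of_rat ?c) (mode p v (?J - 1) w) \<in> S"
      unfolding bpz_weight[OF v w]
      by (intro fock.subspace_scale fock.subspace_add Sum_any_subspace S low IH)
    then have s: "fscale (of_rat ?c) (mode p v k w) \<in> S" by simp
    show ?case
    proof (cases "?c = 0")
      case False
      then have "mode p v k w = fscale (1 / of_rat ?c) (fscale (of_rat ?c) (mode p v k w))" by simp
      then show ?thesis using s S(1) by (metis fock.subspace_scale)
    next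
      case True
      have "?J * (?J + 1 - of_nat p) > 0" using True H p0 by simp
      moreover have "?J \<ge> 0" using Suc.prems by simp
      ultimately have "?J + 1 - of_nat p > 0" by (simp add: zero_less_mult_iff)
      \<comment> \<open>Here \<open>p \<ge> 2\<close> enters: \<open>J > p - 1\<close> means
        \<open>k > p - 2\<close>, and \<open>p - 2 \<ge> (3p - 2)/4 - 1\<close>.\<close>
      moreover have "of_nat p \<ge> (2::rat)" using of_nat_mono[OF p2, where 'a = rat] by simp
      moreover have "(3 * q - 2) / 4 - 1 < k" if "0 < k + 1 + 1 - q" "q \<ge> 2" for q :: rat
        using that by (simp add: field_simps)
      ultimately show ?thesis by (intro high, unfold hw_mp) blast
    qed
  qed
  moreover have "\<exists>n::nat. k \<ge> of_int N - of_nat n"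
  proof -
    obtain n :: nat where "of_int N - k \<le> of_nat n" using real_arch_simple by blast
    then show ?thesis by (intro exI[of _ n]) simp
  qed
  ultimately show ?thesis using k by blast
qed

text \<open>By the top product \<open>(a\<^sup>-)\<^sub>t a\<^sup>+ = c \<^bold>1\<close> with \<open>c \<noteq> 0\<close>, the Borcherds identity expresses \<open>c w\<close> through
  \<open>a\<^sup>\<plusminus>\<^sub>k w\<close> with \<open>k \<ge> -1\<close>.\<close>

lemma positive_weight_step:
  assumes M: "stable M" and S: "stable S" and w: "w \<in> M l" "w \<in> Wt H" and H: "H > 0"
    and low: "\<And>l' H' x. H' < H \<Longrightarrow> x \<in> M l' \<Longrightarrow> x \<in> Wt H' \<Longrightarrow> x \<in> S l'"
  shows "w \<in> S l"
proof -
  have wl: "w \<in> VL p l" using stableD(2)[OF M] w(1) by blast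
  have Lw: "Li (int r + 1) w \<in> S l" for r
    by (rule low[OF _ stableD(3)[OF M w(1)] Vir_Wt[OF w(2)]]) simp
  have am: "mode p am k w \<in> S (l - int p)" if "k \<ge> - 1" for k
  proof (rule creation_modes[OF degenerate_am wl w(2) H stableD(1,3)[OF S] _ _ that])
    show "mode p am k w \<in> S (l - int p)" if "k > hw (- int p) - 1" for k
      by (rule low[OF _ stableD(4)[OF M w(1)] Wt_mode[OF am_Wt w(2)]]) (use that in simp)
    show "mode p am j (Li (int r + 1) w) \<in> S (l - int p)" for j r
      by (rule stableD(4)[OF S Lw])
  qed
  have ap: "mode p ap k w \<in> S (l + int p)" if "k \<ge> - 1" for k
  proof (rule creation_modes[OF degenerate_ap wl w(2) H stableD(1,3)[OF S] _ _ that])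
    show "mode p ap k w \<in> S (l + int p)" if "k > hw (- int p) - 1" for k
      by (rule low[OF _ stableD(5)[OF M w(1)] Wt_mode[OF ap_Wt w(2)]]) (use that in simp)
    show "mode p ap j (Li (int r + 1) w) \<in> S (l + int p)" for j r
      by (rule stableD(5)[OF S Lw])
  qed
  define t :: rat where "t = (3 * of_nat p - 4) / 2"
  obtain c where c: "c \<noteq> 0" "mode p am t ap = fscale c vac" using am_ap_top unfolding t_def by blast
  have s: "sp (- int p) (int p) = - of_nat p / 2" "sp (- int p) l = - of_int l / 2" "sp (int p) l = of_int l / 2"
    using p0 by (simp_all add: sp_def)
  \<comment> \<open>The sum -1 turns the top product into the identity on w, the lower bounds bring
    all inner modes on the right within reach of \<open>am\<close> and \<open>ap\<close>, and the
    parity of \<open>l\<close> decides between integers and half-integers.\<close>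
  obtain m n :: rat where mn: "m + n = - 1" "m \<ge> - 1" "n \<ge> - 1" "m + sp (- int p) l \<in> \<int>" "n + sp (int p) l \<in> \<int>"
  proof (cases "even l")
    case True
    then obtain z where z: "l = 2 * z" by (elim evenE)
    have e: "0 + sp (- int p) l = of_int (- z)" "- 1 + sp (int p) l = of_int (z - 1)"
      unfolding s by (simp_all add: z)
    show ?thesis by (rule that[of 0 "- 1"]) (simp, simp, simp, unfold e, (rule Ints_of_int)+)
  next
    case False
    then obtain z where z: "l = 2 * z + 1" by (elim oddE)
    have e: "(- 1 / 2 + sp (- int p) l) = of_int (- z - 1)" "(- 1 / 2 + sp (int p) l) = of_int z"
      unfolding s by (simp_all add: z field_simps)
    show ?thesis by (rule that[of "- 1 / 2" "- 1 / 2"]) (simp, simp, simp, unfold e, (rule Ints_of_int)+)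
  qed
  have B: "Sum_any (borch_lhs t m n am ap w) = Sum_any (borch_rhs (int p - 2) t m n am ap w)"
  proof (rule borcherds_rat[OF am_Ch ap_Ch wl _ mn(4,5)])
    show "t + sp (- int p) (int p) = of_int (int p - 2)" by (simp add: s t_def field_simps)
  qed
  \<comment> \<open>Above the top product the weight is negative, which does not occur at charge
    0.\<close>
  have "Sum_any (borch_lhs t m n am ap w) = borch_lhs t m n am ap w 0"
  proof (rule Sum_any_single)
    fix j :: nat assume j: "j \<noteq> 0"
    have "mode p am (t + of_nat j) ap = 0"
    proof (rule Wt_Ch_low[OF Wt_mode[OF am_Wt ap_Wt]])
      show "mode p am (t + of_nat j) ap \<in> Ch 0" using Ch_mode[OF am_Ch ap_Ch] by simp
      show "hw (- int p) + hw (- int p) - (t + of_nat j) - 1 < hw 0"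
        unfolding hw_mp t_def using j by (simp add: hw_def field_simps)
    qed
    then show "borch_lhs t m n am ap w j = 0" by (simp add: borch_lhs_def mode_01)
  qed
  also have "\<dots> = fscale c w" using c(2) mn(1) by (simp add: borch_lhs_def mode_scale1 mode_vac)
  finally have "fscale c w = Sum_any (borch_rhs (int p - 2) t m n am ap w)" using B by simp
  also have "\<dots> \<in> S l"
  proof (rule Sum_any_subspace[OF stableD(1)[OF S]])
    fix j :: nat
    have 1: "mode p am (m + t - of_nat j) (mode p ap (n + of_nat j) w) \<in> S l"
      using stableD(4)[OF S ap[of "n + of_nat j"]] mn(3) by simp
    have 2: "mode p ap (n + t - of_nat j) (mode p am (m + of_nat j) w) \<in> S l"
      using stableD(5)[OF S am[of "m + of_nat j"]] mn(2) by simp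
    show "borch_rhs (int p - 2) t m n am ap w j \<in> S l"
      unfolding borch_rhs_def by (intro fock.subspace_scale fock.subspace_diff stableD(1)[OF S] 1 2)
  qed
  finally have "fscale (1 / c) (fscale c w) \<in> S l" by (rule fock.subspace_scale[OF stableD(1)[OF S]])
  then show ?thesis using c(1) by simp
qed

text \<open>The weights form the discrete, bounded below set of values of \<open>lowest\<close>, so
  \<open>positive_weight_step\<close> can be iterated. The theorem serves for the kernel of the
  second screening operator, for the full spaces when i = p, and, with S zero, for
  irreducibility.\<close>

theorem stable_determined:
  assumes M: "stable M" and S: "stable S"
    and low: "\<And>l H x. H \<le> 0 \<Longrightarrow> x \<in> M l \<Longrightarrow> x \<in> Wt H \<Longrightarrow> x \<in> S l"
  shows "M l \<subseteq> S l"
proof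
  have *: "x \<in> M l \<Longrightarrow> x \<in> Wt (lowest n) \<Longrightarrow> x \<in> S l" for n l x
  proof (induction n arbitrary: l x rule: less_induct)
    case (less n)
    show ?case
    proof (cases "lowest n \<le> 0")
      case True
      then show ?thesis using low less.prems by blast
    next
      case False
      show ?thesis
      proof (rule positive_weight_step[OF M S less.prems])
        show "lowest n > 0" using False by simp
        fix l' H' x assume x: "H' < lowest n" "x \<in> M l'" "x \<in> Wt H'"
        show "x \<in> S l'"
        proof (cases "x = 0")
          case True
          then show ?thesis using fock.subspace_0[OF stableD(1)[OF S]] by simp
        next
          case False
          then obtain m where "H' = lowest m" using Wt_lowest x by blast
          then show ?thesis using x less.IH[of m] lowest_less by blast
        qed
      qed
    qed
  qed
  fix v assume v: "v \<in> M l"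
  have "v \<in> fock.span (\<Union>H. M l \<inter> Wt H)"
    by (rule weight_decomposition[OF stableD(1,3)[OF M] v])
  moreover have "(\<Union>H. M l \<inter> Wt H) \<subseteq> S l"
  proof safe
    fix x H assume x: "x \<in> M l" "x \<in> Wt H"
    show "x \<in> S l"
    proof (cases "x = 0")
      case True
      then show ?thesis using fock.subspace_0[OF stableD(1)[OF S]] by simp
    next
      case False
      then show ?thesis using Wt_lowest x * by blast
    qed
  qed
  ultimately show "v \<in> S l" using fock.span_minimal[OF _ stableD(1)[OF S]] by blast
qed

section \<open>Virasoro submodules\<close>

abbreviation vir_hull :: "fock set \<Rightarrow> fock set" where "vir_hull X \<equiv> vir_submodule p hull X"

lemma vir_submoduleD:
  assumes "vir_submodule p N"
  shows "fock.subspace N" "w \<in> N \<Longrightarrow> Li n w \<in> N"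
  using assms by (auto simp: vir_submodule_def)

lemma vir_submodule_Inter: "(\<And>N. N \<in> T \<Longrightarrow> vir_submodule p N) \<Longrightarrow> vir_submodule p (\<Inter> T)"
  by (auto simp: vir_submodule_def fock.subspace_def)

lemma vir_hull_sub: "vir_submodule p (vir_hull X)"
  by (rule hull_in) (auto intro: vir_submodule_Inter)

lemma vir_hull_base: "x \<in> X \<Longrightarrow> x \<in> vir_hull X"
  using hull_subset by fast

lemma vir_hull_min: "X \<subseteq> N \<Longrightarrow> vir_submodule p N \<Longrightarrow> vir_hull X \<subseteq> N"
  by (rule hull_minimal)

lemmas vir_hull_subspace = vir_submoduleD(1)[OF vir_hull_sub] and vir_hull_Vir = vir_submoduleD(2)[OF vir_hull_sub]

lemma vir_submodule_VL: "vir_submodule p (VL p l)"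
  by (simp add: vir_submodule_def subspace_VL Vir_VL)

lemma vir_hull_linear:
  assumes f: "flin f" "\<And>n x. Li n (f x) = f (Li n x)" and N: "vir_submodule p N"
    and X: "\<And>x. x \<in> X \<Longrightarrow> f x \<in> N" and x: "x \<in> vir_hull X"
  shows "f x \<in> N"
proof -
  have "vir_submodule p {x. f x \<in> N}"
    unfolding vir_submodule_def fock.subspace_def
    using vir_submoduleD[OF N] by (simp add: f(2)[symmetric] flin_add[OF f(1)] flin_scale[OF f(1)] flin_0[OF f(1)]
        fock.subspace_0 fock.subspace_add fock.subspace_scale)
  then show ?thesis using vir_hull_min[of X "{x. f x \<in> N}"] X x by blast
qed

text \<open>Moving L(n) past a mode of a primary v produces only modes of v, so the vectors that all
  modes of v send into N form a Virasoro submodule.\<close>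

lemma vir_hull_primary:
  assumes v: "primary H v" and N: "vir_submodule p N"
    and X: "\<And>x k. x \<in> X \<Longrightarrow> mode p v k x \<in> N" and x: "x \<in> vir_hull X"
  shows "mode p v k x \<in> N"
proof -
  have 1: "mode p v k (Li n x) = Li n (mode p v k x) - fscale (of_rat (of_int (n + 1) * (H - 1) - k)) (mode p v (of_int n + k) x)" for n k x
    using Vir_primary[OF v] by simp
  have "vir_submodule p {x. \<forall>k. mode p v k x \<in> N}"
    unfolding vir_submodule_def fock.subspace_def
    using vir_submoduleD[OF N] by (simp add: 1 mode_add2 mode_scale2 mode_02
        fock.subspace_0 fock.subspace_add fock.subspace_scale fock.subspace_diff)
  then show ?thesis using vir_hull_min[of X "{x. \<forall>k. mode p v k x \<in> N}"] X x by blast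
qed

text \<open>By the iterate formula, the modes of \<open>Li n u\<close> are sums of products of a
  mode of u with a Virasoro operator; in the non-integral case they vanish.\<close>

lemma mode_Vir_closed:
  assumes N: "N \<subseteq> VL p l" "vir_submodule p N" and N': "vir_submodule p N'"
    and u: "u \<in> Ch k" "\<And>m w. w \<in> N \<Longrightarrow> mode p u m w \<in> N'" and w: "w \<in> N"
  shows "mode p (Li n u) m w \<in> N'"
proof (cases "m + sp k l \<in> \<int>")
  case True
  have s: "sp 0 x = 0" for x by (simp add: sp_def)
  have wl: "w \<in> VL p l" using N(1) w by blast
  have cf: "mode p (conf p) (of_int (n + 1) - of_nat j) x = Li (n - int j) x" "mode p (conf p) (of_nat j) x = Li (int j - 1) x" for j x
    by (simp_all add: Vir_def algebra_simps)
  have "mode p (Li n u) m w = Sum_any (\<lambda>j::nat. fscale ((- 1) ^ j * (of_rat (of_int (n + 1)) gchoose j))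
     (mode p (conf p) (of_int (n + 1) - of_nat j) (mode p u (m + of_nat j) w)
      - fscale ((- 1) powi (n + 1)) (mode p u (m + of_int (n + 1) - of_nat j) (mode p (conf p) (of_nat j) w))))"
    unfolding Vir_def[of p n] by (rule mode_iterate[OF conf_Ch u(1) wl _ _ True]) (simp_all add: s)
  also have "\<dots> \<in> N'"
    unfolding cf
    by (intro Sum_any_subspace fock.subspace_scale fock.subspace_diff vir_submoduleD[OF N'] u(2) vir_submoduleD(2)[OF N(2)] w)
  finally show ?thesis .
next
  case False
  then have "mode p (Li n u) m w = 0" using mode_nonint[OF Vir_Ch[OF u(1)]] N(1) w by blast
  then show ?thesis by (simp add: fock.subspace_0 vir_submoduleD[OF N'])
qed

lemma mode_vir_hull_closed:
  assumes N: "N \<subseteq> VL p l" "vir_submodule p N" and N': "vir_submodule p N'"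
    and X: "X \<subseteq> Ch k" "\<And>x m w. x \<in> X \<Longrightarrow> w \<in> N \<Longrightarrow> mode p x m w \<in> N'" and u: "u \<in> vir_hull X" and w: "w \<in> N"
  shows "mode p u m w \<in> N'"
proof -
  let ?T = "{u \<in> Ch k. \<forall>m. \<forall>w\<in>N. mode p u m w \<in> N'}"
  have "vir_submodule p ?T"
    unfolding vir_submodule_def
  proof (intro conjI allI ballI)
    show "fock.subspace ?T"
      unfolding fock.subspace_def using vir_submoduleD[OF N'] subspace_Ch[of k]
      by (simp add: mode_add1 mode_scale1 mode_01 fock.subspace_0 fock.subspace_add fock.subspace_scale)
    fix n u assume u: "u \<in> ?T"
    then have u': "u \<in> Ch k" "\<And>m w. w \<in> N \<Longrightarrow> mode p u m w \<in> N'" by auto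
    show "Li n u \<in> ?T"
      using Vir_Ch[OF u'(1)] mode_Vir_closed[OF N N' u'] by blast
  qed
  then have "vir_hull X \<subseteq> ?T" by (intro vir_hull_min) (use X in blast)
  then show ?thesis using u w by blast
qed

section \<open>Creation property and skew symmetry\<close>

lemma mode_u_vac:
  assumes "m \<ge> 0"
  shows "mode p u (of_int (m - 1)) vac = (if m = 0 then u else 0)"
proof -
  have "mode p (basis \<mu> k) (of_int (m - 1)) vac = (if m = 0 then basis \<mu> k else 0)" if "m \<ge> 0" for \<mu> k m
    using that
  proof (induction \<mu> arbitrary: m)
    case empty
    have "mode p (fexp k) (of_int (m - 1)) vac = EM k (- m) (fexp (k + 0))"
      by (rule exp_fexp_int) (simp add: sp_def)
    then show ?case using empty by (simp add: fexp_def EM_neg)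
  next
    case (add n \<mu>)
    let ?u = "basis \<mu> k"
    have e: "basis (add_mset n \<mu>) k = h (- int n - 1) ?u" by (simp add: heis_basis)
    have 0: "h (int j) vac = 0" for j using h_fexp(1)[of "int j" 0] h_fexp(2)[of 0] by (cases "j = 0") auto
    have "mode p (h (- int n - 1) ?u) (of_int (m - 1)) vac
      = Sum_any (\<lambda>j::nat. fscale (of_nat j gchoose n) (h (- int j - 1) (mode p ?u (of_int (m - 1) + of_nat j - of_nat n) vac)))"
      unfolding mode_create stepm_def by (simp add: 0 mode_02)
    also have "\<dots> = fscale (of_nat n gchoose n) (h (- int n - 1) (mode p ?u (of_int (m - 1) + of_nat n - of_nat n) vac))"
    proof (rule Sum_any_single)
      fix j :: nat assume j: "j \<noteq> n"
      show "fscale (of_nat j gchoose n) (h (- int j - 1) (mode p ?u (of_int (m - 1) + of_nat j - of_nat n) vac)) = 0"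
      proof (cases "j < n")
        case True
        then show ?thesis by (simp add: gbinomial_small)
      next
        case False
        then have "mode p ?u (of_int (m + int j - int n - 1)) vac = 0" using add.IH[of "m + int j - int n"] add.prems j by simp
        moreover have "(of_int (m + int j - int n - 1) :: rat) = of_int (m - 1) + of_nat j - of_nat n" by simp
        ultimately have "mode p ?u (of_int (m - 1) + of_nat j - of_nat n) vac = 0" by metis
        then show ?thesis by (simp only: h_0 fock.scale_zero_right)
      qed
    qed
    also have "\<dots> = (if m = 0 then h (- int n - 1) ?u else 0)"
      using add.IH[OF add.prems] by (simp add: binomial_gbinomial[symmetric] h_0)
    finally show ?case unfolding e .
  qed
  from this[OF assms] show ?thesis
    by (cases "m = 0") (auto intro: flin_eqI[OF flin_mode1 flin_id] flin_eqI[OF flin_mode1 flin_zero])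
qed

text \<open>The Borcherds identity on the vacuum with \<open>m = - 1\<close> and
  \<open>n = 0\<close>: the creation property collapses the right side to one term.\<close>

lemma skew_symmetry:
  assumes u: "u \<in> Ch k1" and v: "v \<in> Ch k2" and L: "l + sp k1 k2 = of_int L"
  shows "fscale (- ((- 1) powi L)) (mode p v l u) = Sum_any (\<lambda>j::nat. fscale ((- 1) ^ j) (mode p (mode p u (l + of_nat j) v) (- 1 - of_nat j) vac))"
proof -
  have s: "sp k 0 = 0" for k by (simp add: sp_def)
  have 1: "mode p x (of_nat j) vac = 0" for x j using mode_u_vac[of "int j + 1" x] by simp
  have 2: "mode p x (- 1 + of_nat j) vac = (if j = 0 then x else 0)" for x j using mode_u_vac[of "int j" x] by simp
  have g: "(of_rat (- 1) gchoose j) = ((- 1) ^ j :: complex)" for j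
    by (simp add: of_rat_minus gbinomial_minus binomial_gbinomial[symmetric])
  have "Sum_any (borch_lhs l (- 1) 0 u v vac) = Sum_any (borch_rhs L l (- 1) 0 u v vac)"
    by (rule borcherds_rat[OF u v Ch_VL[OF fexp_Ch] L]) (simp_all add: s)
  also have "\<dots> = borch_rhs L l (- 1) 0 u v vac 0"
    by (rule Sum_any_single) (simp add: borch_rhs_def 1 2[simplified add.commute[of "- 1"], simplified] mode_02)
  also have "\<dots> = fscale (- ((- 1) powi L)) (mode p v l u)"
    using 1[of v 0] by (simp add: borch_rhs_def 2[of u 0, simplified] mode_02)
  finally show ?thesis unfolding borch_lhs_def[abs_def] g by simp
qed

section \<open>Products of the degenerate fields\<close>

lemma sp_am: "sp (- int p) l = - of_int l / 2" "sp (int p) l = of_int l / 2"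
  using p0 by (simp_all add: sp_def)

lemma recursion_in:
  assumes v: "degenerate c v" and w: "w \<in> VL p l" "w \<in> Wt H" and sing: "\<And>n. n \<ge> 1 \<Longrightarrow> Li n w = 0"
    and N: "vir_submodule p N" and nz: "J * (J + 1 - of_nat p) \<noteq> of_nat p * H"
    and IH: "\<And>r::nat. mode p v (J + of_nat r) w \<in> N"
  shows "mode p v (J - 1) w \<in> N"
proof -
  let ?c = "of_rat (J * (J + 1 - of_nat p) - of_nat p * H) :: complex"
  have c: "?c \<noteq> 0" using nz by simp
  have "fscale ?c (mode p v (J - 1) w) \<in> N"
    unfolding bpz_weight[OF v w] using sing
    by (auto simp: mode_02 intro!: fock.subspace_scale Sum_any_subspace vir_submoduleD[OF N] IH)
  then have "fscale (1 / ?c) (fscale ?c (mode p v (J - 1) w)) \<in> N"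
    by (rule fock.subspace_scale[OF vir_submoduleD(1)[OF N]])
  then show ?thesis using c by simp
qed

text \<open>The recursion descends from the leading mode, which yields the exponential itself. Its
  coefficient is \<open>j (j - l + p - 1)\<close>, and the bound on \<open>l\<close> keeps this from
  vanishing for \<open>j \<ge> 1\<close>.\<close>

lemma am_fexp_closed:
  assumes l: "l \<le> int p - 1"
  shows "mode p am k (fexp l) \<in> vir_hull {fexp (l - int p)}"
proof -
  let ?N = "vir_hull {fexp (l - int p)}"
  have big: "mode p am (of_int l / 2 + of_nat r) (fexp l) = 0" for r
  proof -
    have "mode p am (of_int l / 2 + of_nat r) (fexp l) = EM (- int p) (- 1 - int r) (fexp (- int p + l))"
      by (rule exp_fexp_int) (simp add: sp_am)
    then show ?thesis by (simp add: EM_neg)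
  qed
  have *: "mode p am (of_int l / 2 - 1 - of_nat j) (fexp l) \<in> ?N" for j
  proof (induction j rule: less_induct)
    case (less j)
    show ?case
    proof (cases "j = 0")
      case True
      have "mode p am (of_int l / 2 - 1) (fexp l) = EM (- int p) 0 (fexp (- int p + l))"
        by (rule exp_fexp_int) (simp add: sp_am)
      then show ?thesis using True by (simp add: vir_hull_base)
    next
      case False
      let ?J = "of_int l / 2 - of_nat j :: rat"
      have "mode p am (?J - 1) (fexp l) \<in> ?N"
      proof (rule recursion_in[OF degenerate_am Ch_VL[OF fexp_Ch] fexp_Wt Vir_pos_fexp vir_hull_sub])
        have "of_int (int j * (int j - l + int p - 1)) \<noteq> (0::rat)" unfolding of_int_eq_0_iff using False l by auto
        moreover have "?J * (?J + 1 - of_nat p) - of_nat p * hw l = of_int (int j * (int j - l + int p - 1))"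
          using p0 by (simp add: hw_def field_simps)
        ultimately show "?J * (?J + 1 - of_nat p) \<noteq> of_nat p * hw l" by auto
        show "mode p am (?J + of_nat r) (fexp l) \<in> ?N" for r
        proof (cases "r < j")
          case True
          then have e: "?J + of_nat r = of_int l / 2 - 1 - of_nat (j - 1 - r)" by simp
          show ?thesis unfolding e by (rule less) (use True in simp)
        next
          case False
          then have e: "?J + of_nat r = of_int l / 2 + of_nat (r - j)" by simp
          show ?thesis unfolding e big by (rule fock.subspace_0[OF vir_hull_subspace])
        qed
      qed
      then show ?thesis by (simp add: algebra_simps)
    qed
  qed
  show ?thesis
  proof (cases "k + sp (- int p) l \<in> \<int>")
    case True
    then obtain z where z: "k = of_int l / 2 + of_int z" by (auto simp: sp_am elim!: Ints_cases) (metis add.commute diff_add_cancel)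
    show ?thesis
    proof (cases "z \<ge> 0")
      case True
      then have "k = of_int l / 2 + of_nat (nat z)" using z by simp
      then show ?thesis using big by (simp add: fock.subspace_0[OF vir_hull_subspace])
    next
      case False
      then have "k = of_int l / 2 - 1 - of_nat (nat (- z - 1))" using z by simp
      then show ?thesis using * by metis
    qed
  next
    case False
    then show ?thesis using mode_nonint[OF am_Ch Ch_VL[OF fexp_Ch]] by (simp add: fock.subspace_0[OF vir_hull_subspace])
  qed
qed

lemma primary_am: "primary (hw (- int p)) am" and primary_ap: "primary (hw (- int p)) ap"
  using degenerate_am degenerate_ap by (simp_all add: degenerate_def)

lemma vac_multiple: "x \<in> Wt 0 \<Longrightarrow> x \<in> Ch 0 \<Longrightarrow> \<exists>c. x = fscale c vac"
proof -
  assume x: "x \<in> Wt 0" "x \<in> Ch 0"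
  have "x \<in> gr 0 0" using Wt_Ch[OF x] by (simp add: hw_def)
  then have "x = fscale (lk x ({#}, 0)) vac"
    by (intro poly_mapping_eqI) (auto simp: lookup_fscale fexp_def lookup_single when_def gr_iff wlev_0)
  then show ?thesis by blast
qed

text \<open>Both products satisfy the same recursion; its coefficient vanishes at \<open>J = -p/2\<close>, where
  skew symmetry takes over.\<close>

lemma degenerate_product:
  "mode p ap n am - fscale eta (mode p am n ap) \<in> vir_hull {vac}"
proof -
  let ?N = "vir_hull {vac}"
  let ?A = "\<lambda>n. mode p am n ap" and ?B = "\<lambda>n. mode p ap n am"
  let ?top = "3 * of_nat p / 2 - 1 :: rat"
  note z = fock.subspace_0[OF vir_hull_subspace[of "{vac}"]]
  have wA: "?A n \<in> Wt (2 * hw (- int p) - n - 1)" "?A n \<in> Ch 0" "?B n \<in> Wt (2 * hw (- int p) - n - 1)" "?B n \<in> Ch 0" for n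
    using Wt_mode[OF am_Wt ap_Wt, of n] Ch_mode[OF am_Ch ap_Ch, of n] Wt_mode[OF ap_Wt am_Wt, of n] Ch_mode[OF ap_Ch am_Ch, of n] by simp_all
  have big: "?A (?top + of_nat r) = 0" "?B (?top + of_nat r) = 0" for r
    using Wt_Ch_low[OF wA(1,2)] Wt_Ch_low[OF wA(3,4)] by (simp_all add: hw_mp) (simp_all add: hw_def field_simps)
  have sing: "Li n am = 0" "Li n ap = 0" if "n \<ge> 1" for n
    using primary_am primary_ap that by (auto simp: primary_def)
  \<comment> \<open>Measured from the top, the coefficient is \<open>j (j - (2p - 1))\<close>; the
    zero \<open>j = 2p - 1\<close> is \<open>J = - p/2\<close>.\<close>
  have coef: "J * (J + 1 - of_nat p) \<noteq> of_nat p * hw (- int p)" if "J = ?top - of_nat j" "j \<noteq> 0" "j \<noteq> 2 * p - 1" for J j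
  proof -
    have "of_int (int j * (int j - (2 * int p - 1))) \<noteq> (0::rat)" unfolding of_int_eq_0_iff using that(2,3) p0 by auto
    moreover have "J * (J + 1 - of_nat p) - of_nat p * hw (- int p) = of_int (int j * (int j - (2 * int p - 1)))"
      unfolding that(1) hw_mp by (simp add: field_simps)
    ultimately show ?thesis by auto
  qed
  have AB: "?A (?top - 1 - of_nat j) \<in> ?N \<and> ?B (?top - 1 - of_nat j) \<in> ?N" if "j < 2 * p - 1" for j
    using that
  proof (induction j rule: less_induct)
    case (less j)
    let ?J = "?top - of_nat j"
    have above: "?A (?J + of_nat r) \<in> ?N" "?B (?J + of_nat r) \<in> ?N" for r
    proof -
      have "?A (?J + of_nat r) \<in> ?N \<and> ?B (?J + of_nat r) \<in> ?N"
      proof (cases "r < j")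
        case True
        then have e: "?J + of_nat r = ?top - 1 - of_nat (j - 1 - r)" by simp
        show ?thesis unfolding e using less.IH[of "j - 1 - r"] less.prems True by simp
      next
        case False
        then have e: "?J + of_nat r = ?top + of_nat (r - j)" by simp
        show ?thesis unfolding e big using z by simp
      qed
      then show "?A (?J + of_nat r) \<in> ?N" "?B (?J + of_nat r) \<in> ?N" by auto
    qed
    have "?A (?J - 1) \<in> ?N \<and> ?B (?J - 1) \<in> ?N"
    proof (cases "j = 0")
      case True
      have "2 * hw (- int p) - (?J - 1) - 1 = 0" using True by (simp add: hw_mp field_simps)
      then obtain a b where "?A (?J - 1) = fscale a vac" "?B (?J - 1) = fscale b vac"
        using wA[of "?J - 1"] vac_multiple by metis
      then show ?thesis by (simp add: fock.subspace_scale[OF vir_hull_subspace] vir_hull_base)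
    next
      case False
      have c: "?J * (?J + 1 - of_nat p) \<noteq> of_nat p * hw (- int p)" using coef[OF refl False] less.prems by simp
      show ?thesis
        using recursion_in[OF degenerate_am Ch_VL[OF ap_Ch] ap_Wt sing(2) vir_hull_sub c above(1)]
          recursion_in[OF degenerate_ap Ch_VL[OF am_Ch] am_Wt sing(1) vir_hull_sub c above(2)] by simp
    qed
    moreover have "?J - 1 = ?top - 1 - of_nat j" by simp
    ultimately show ?case by metis
  qed
  let ?s = "\<lambda>n. ?B n - fscale eta (?A n)"
  have sbig: "?s (?top + of_nat r) = 0" for r by (simp add: big)
  have *: "?s (?top - 1 - of_nat j) \<in> ?N" for j
  proof (induction j rule: less_induct)
    case (less j)
    consider "j < 2 * p - 1" | "j = 2 * p - 1" | "j > 2 * p - 1" by linarith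
    then show ?case
    proof cases
      case 1
      then show ?thesis using AB[OF 1] by (auto intro!: fock.subspace_diff fock.subspace_scale vir_hull_subspace)
    next
      case 2
      \<comment> \<open>The recursion is silent here. Skew symmetry expresses \<open>eta\<close>
        times \<open>?B ?n\<close> as \<open>?A ?n\<close> plus modes of the higher products
        \<open>?A\<close> on the vacuum, and these are already under control.\<close>
      let ?n = "?top - 1 - of_nat j"
      have j: "(of_nat j :: rat) = 2 * of_nat p - 1" using p2 by (subst 2) (simp add: of_nat_diff)
      have n: "?n = - of_nat p / 2 - 1" unfolding j by (simp add: field_simps)
      let ?f = "\<lambda>j::nat. fscale ((- 1) ^ j) (mode p (?A (?n + of_nat j)) (- 1 - of_nat j) vac)"
      have ev: "evz ?f" by (rule evz_comp0[OF evz_mode_shift[of am ?n ap]]) (simp add: mode_01)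
      have f: "?f (Suc i) \<in> ?N" for i
      proof -
        have a0: "?A (?n + of_nat (Suc i)) \<in> ?N"
        proof (cases "i < j")
          case True
          then have e: "?n + of_nat (Suc i) = ?top - 1 - of_nat (j - 1 - i)" by simp
          show ?thesis unfolding e by (rule AB[THEN conjunct1]) (use 2 True in simp)
        next
          case False
          then have e: "?n + of_nat (Suc i) = ?top + of_nat (i - j)" by simp
          show ?thesis unfolding e big by (rule z)
        qed
        have a1: "?N \<subseteq> VL p 0" by (rule vir_hull_min[OF _ vir_submodule_VL]) (simp add: Ch_VL[OF fexp_Ch])
        have a2: "{vac} \<subseteq> Ch 0" by (simp add: fexp_Ch)
        have a3: "mode p x m w \<in> ?N" if "x \<in> {vac}" "w \<in> ?N" for x m w
          using that by (simp add: mode_vac z)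
        have "mode p (?A (?n + of_nat (Suc i))) m vac \<in> ?N" for m
          by (rule mode_vir_hull_closed[OF a1 vir_hull_sub vir_hull_sub a2 a3 a0 vir_hull_base]) simp_all
        then show ?thesis by (intro fock.subspace_scale vir_hull_subspace)
      qed
      have "fscale (- ((- 1) powi (- int p - 1))) (?B ?n) = Sum_any ?f"
        by (rule skew_symmetry[OF am_Ch ap_Ch]) (unfold n sp_am, simp)
      also have "\<dots> = ?A ?n + Sum_any (\<lambda>j. ?f (Suc j))"
        using mode_u_vac[of 0 "?A ?n"] by (subst Sum_any_rec[OF ev]) simp
      also have "- ((- 1) powi (- int p - 1)) = eta"
        using eta_powi(1) by (simp add: power_int_diff)
      finally have "fscale eta (fscale eta (?B ?n)) = fscale eta (?A ?n) + fscale eta (Sum_any (\<lambda>j. ?f (Suc j)))"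
        by (simp only: fock.scale_right_distrib)
      then have "?s ?n = fscale eta (Sum_any (\<lambda>j. ?f (Suc j)))" by (simp add: eta_sq)
      also have "\<dots> \<in> ?N" by (intro fock.subspace_scale vir_hull_subspace Sum_any_subspace f)
      finally show ?thesis .
    next
      case 3
      \<comment> \<open>Past the zero only the difference is known to lie in the module, but
        \<open>?A\<close> and \<open>?B\<close> satisfy the same linear recursion, so the difference
        satisfies it too.\<close>
      let ?J = "?top - of_nat j"
      let ?c = "?J * (?J + 1 - of_nat p) - of_nat p * hw (- int p)"
      have c: "?c \<noteq> 0" using coef[of ?J j] 3 by simp
      have above: "?s (?J + of_nat r) \<in> ?N" for r
      proof (cases "r < j")
        case True
        then have e: "?J + of_nat r = ?top - 1 - of_nat (j - 1 - r)" by simp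
        show ?thesis unfolding e by (rule less) (use True in simp)
      next
        case False
        then have e: "?J + of_nat r = ?top + of_nat (r - j)" by simp
        show ?thesis unfolding e sbig by (rule z)
      qed
      have ev: "evz (\<lambda>r::nat. Li (- 1 - int r) (?A (?J + of_nat r)))" "evz (\<lambda>r::nat. Li (- 1 - int r) (?B (?J + of_nat r)))"
        by (rule evz_comp0[OF evz_mode_shift[of am ?J ap]], simp add: Vir_0) (rule evz_comp0[OF evz_mode_shift[of ap ?J am]], simp add: Vir_0)
      have ev': "evz (\<lambda>r::nat. fscale eta (Li (- 1 - int r) (?A (?J + of_nat r))))"
        by (rule evz_comp0[OF ev(1)]) simp
      have A: "fscale (of_rat ?c) (?A (?J - 1)) = fscale (of_nat p) (Sum_any (\<lambda>r::nat. Li (- 1 - int r) (?A (?J + of_nat r))))"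
        unfolding bpz_weight[OF degenerate_am Ch_VL[OF ap_Ch] ap_Wt] by (simp add: sing mode_02)
      have B: "fscale (of_rat ?c) (?B (?J - 1)) = fscale (of_nat p) (Sum_any (\<lambda>r::nat. Li (- 1 - int r) (?B (?J + of_nat r))))"
        unfolding bpz_weight[OF degenerate_ap Ch_VL[OF am_Ch] am_Wt] by (simp add: sing mode_02)
      have "fscale (of_rat ?c) (?s (?J - 1)) = fscale (of_rat ?c) (?B (?J - 1)) - fscale eta (fscale (of_rat ?c) (?A (?J - 1)))"
        by (simp add: fock.scale_right_diff_distrib mult.commute)
      also have "\<dots> = fscale (of_nat p) (Sum_any (\<lambda>r::nat. Li (- 1 - int r) (?B (?J + of_nat r))) - fscale eta (Sum_any (\<lambda>r::nat. Li (- 1 - int r) (?A (?J + of_nat r)))))"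
        unfolding A B by (simp add: fock.scale_right_diff_distrib mult.commute)
      also have "\<dots> = fscale (of_nat p) (Sum_any (\<lambda>r::nat. Li (- 1 - int r) (?s (?J + of_nat r))))"
        by (simp only: Sum_any_fscale[OF ev(1), symmetric] Sum_any_diff[OF ev(2) ev', symmetric] Vir_diff Vir_scale)
      also have "\<dots> \<in> ?N" by (intro fock.subspace_scale vir_hull_subspace Sum_any_subspace vir_hull_Vir above)
      finally have "fscale (1 / of_rat ?c) (fscale (of_rat ?c) (?s (?J - 1))) \<in> ?N"
        by (rule fock.subspace_scale[OF vir_hull_subspace])
      moreover have "?J - 1 = ?top - 1 - of_nat j" by simp
      ultimately show ?thesis using c by simp
    qed
  qed
  show ?thesis
  proof (cases "n + sp (int p) (- int p) \<in> \<int>")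
    case True
    then obtain y where y: "n + sp (int p) (- int p) = of_int y" by (elim Ints_cases)
    have n: "n = ?top + of_int (y + 1 - int p)" using y by (simp add: sp_am field_simps)
    show ?thesis
    proof (cases "y + 1 - int p \<ge> 0")
      case True
      then have e: "n = ?top + of_nat (nat (y + 1 - int p))" unfolding n by simp
      show ?thesis unfolding e sbig by (rule z)
    next
      case False
      then have "(of_nat (nat (int p - y - 2)) :: rat) = of_int (int p - y - 2)" by simp
      then have e: "n = ?top - 1 - of_nat (nat (int p - y - 2))" unfolding n by simp
      show ?thesis unfolding e by (rule *)
    qed
  next
    case False
    then have "mode p ap n am = 0" by (rule mode_nonint[OF ap_Ch Ch_VL[OF am_Ch]])
    moreover have "mode p am n ap = 0"
      by (rule mode_nonint[OF am_Ch Ch_VL[OF ap_Ch]]) (use False in \<open>simp add: sp_am\<close>)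
    ultimately show ?thesis by (simp add: z)
  qed
qed

text \<open>Compare the Borcherds identities of the pairs \<open>ap\<close>, \<open>am\<close> and
  \<open>am\<close>, \<open>ap\<close>. Their left sides differ by modes of vectors in the Virasoro
  module of the vacuum, and these preserve N. For large \<open>m\<close> only one order of the
  factors survives on the right, with the wanted term at \<open>j = 0\<close> and larger
  \<open>q\<close> in the others.\<close>

lemma degenerate_exchange:
  assumes N: "vir_submodule p N" "N \<subseteq> VL p l" and w: "w \<in> N"
  shows "mode p ap k (mode p am q w) - fscale eta (mode p am k (mode p ap q w)) \<in> N"
proof -
  let ?S = "\<lambda>k q. mode p ap k (mode p am q w) - fscale eta (mode p am k (mode p ap q w))"
  note z = fock.subspace_0[OF vir_submoduleD(1)[OF N(1)]]
  have wl: "w \<in> VL p l" using N w by blast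
  obtain N1 N2 :: int where "\<And>m. m \<ge> of_int N1 \<Longrightarrow> mode p am m w = 0" "\<And>m. m \<ge> of_int N2 \<Longrightarrow> mode p ap m w = 0"
    using good_mode[of am] good_mode[of ap] unfolding good_def by blast
  then have "mode p am m w = 0 \<and> mode p ap m w = 0" if "m \<ge> of_int (max N1 N2)" for m
    using that by (metis max.cobounded1 max.cobounded2 of_int_le_iff order_trans)
  then obtain T :: int where T: "\<And>m. m \<ge> of_int T \<Longrightarrow> mode p am m w = 0" "\<And>m. m \<ge> of_int T \<Longrightarrow> mode p ap m w = 0" by blast
  have main: "?S k q \<in> N" if "q \<ge> of_int T - of_nat n" "q - of_int l / 2 \<in> \<int>" "k + of_int l / 2 - of_nat p / 2 \<in> \<int>" for n q k
    using that
  proof (induction n arbitrary: q k)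
    case 0
    then show ?case using T[of q] z by (simp add: mode_02)
  next
    case (Suc n)
    \<comment> \<open>Any index beyond the truncation bound \<open>T\<close> in the right coset
      would do: the summand \<open>l/2\<close> fixes the coset, and \<open>\<bar>l\<bar>\<close>
      compensates for it if it is negative.\<close>
    define m :: rat where "m = of_int T + of_int \<bar>l\<bar> + of_int l / 2"
    have "\<bar>of_int l\<bar> + of_int l / 2 \<ge> (0::rat)" by linarith
    then have mT: "m + of_nat j \<ge> of_int T" for j unfolding m_def by simp
    have m1: "m - of_int l / 2 \<in> \<int>" unfolding m_def by simp
    have m2: "m + of_int l / 2 \<in> \<int>"
    proof -
      have "m + of_int l / 2 = of_int (T + \<bar>l\<bar> + l)" by (simp add: m_def)
      then show ?thesis by (metis Ints_of_int)
    qed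
    have e: "k - m + sp (int p) (- int p) = (k + of_int l / 2 - of_nat p / 2) - (m + of_int l / 2)" by (simp add: sp_am)
    have "k - m + sp (int p) (- int p) \<in> \<int>" unfolding e by (rule Ints_diff[OF Suc.prems(3) m2])
    then obtain L where L: "k - m + sp (int p) (- int p) = of_int L" by (elim Ints_cases)
    have L': "k - m + sp (- int p) (int p) = of_int L" using L by (simp add: sp_am)
    have q: "q + sp (- int p) l \<in> \<int>" "q + sp (int p) l \<in> \<int>"
    proof -
      show "q + sp (- int p) l \<in> \<int>" using Suc.prems(2) by (simp add: sp_am)
      have "q + sp (int p) l = q - of_int l / 2 + of_int l" by (simp add: sp_am)
      then show "q + sp (int p) l \<in> \<int>" using Ints_add[OF Suc.prems(2) Ints_of_int] by metis
    qed
    have B1: "Sum_any (borch_lhs (k - m) m q ap am w) = Sum_any (borch_rhs L (k - m) m q ap am w)"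
      by (rule borcherds_rat[OF ap_Ch am_Ch wl L _ q(1)]) (use m2 in \<open>simp add: sp_am\<close>)
    have B2: "Sum_any (borch_lhs (k - m) m q am ap w) = Sum_any (borch_rhs L (k - m) m q am ap w)"
      by (rule borcherds_rat[OF am_Ch ap_Ch wl L' _ q(2)]) (use m1 in \<open>simp add: sp_am\<close>)
    have ev: "evz (\<lambda>j. fscale eta (borch_lhs (k - m) m q am ap w j))" "evz (\<lambda>j. fscale eta (borch_rhs L (k - m) m q am ap w j))"
      by (rule evz_comp0[OF evz_borch_lhs[where l="k - m" and m=m and n=q and u=am and v=ap and w=w]], simp)
        (rule evz_comp0[OF evz_borch_rhs[where L=L and l="k - m" and m=m and n=q and u=am and v=ap and w=w]], simp)
    let ?f = "\<lambda>j::nat. fscale ((- 1) ^ j * (of_rat (k - m) gchoose j)) (?S (k - of_nat j) (q + of_nat j))"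
    have f: "borch_rhs L (k - m) m q ap am w j - fscale eta (borch_rhs L (k - m) m q am ap w j) = ?f j" for j
    proof -
      have "m + (k - m) - of_nat j = k - of_nat j" by simp
      then show ?thesis
        using mT[of j] by (simp add: borch_rhs_def T mode_02 fock.scale_right_diff_distrib mult.commute mult.left_commute)
    qed
    have "evz (\<lambda>j. borch_rhs L (k - m) m q ap am w j + - fscale eta (borch_rhs L (k - m) m q am ap w j))"
      by (intro evz_add evz_borch_rhs evz_comp0[OF ev(2)]) simp
    then have evf: "evz ?f" unfolding f[symmetric] by simp
    have "Sum_any ?f = Sum_any (borch_lhs (k - m) m q ap am w) - fscale eta (Sum_any (borch_lhs (k - m) m q am ap w))"
      unfolding B1 B2 f[symmetric] Sum_any_diff[OF evz_borch_rhs ev(2)] Sum_any_fscale[OF evz_borch_rhs] ..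
    also have "\<dots> = Sum_any (\<lambda>j. borch_lhs (k - m) m q ap am w j - fscale eta (borch_lhs (k - m) m q am ap w j))"
      unfolding Sum_any_diff[OF evz_borch_lhs ev(1)] Sum_any_fscale[OF evz_borch_lhs] ..
    also have "\<dots> \<in> N"
    proof (rule Sum_any_subspace[OF vir_submoduleD(1)[OF N(1)]])
      fix j :: nat
      let ?s = "mode p ap (k - m + of_nat j) am - fscale eta (mode p am (k - m + of_nat j) ap)"
      have "borch_lhs (k - m) m q ap am w j - fscale eta (borch_lhs (k - m) m q am ap w j)
        = fscale (of_rat m gchoose j) (mode p ?s (m + q - of_nat j) w)"
        by (simp add: borch_lhs_def flin_diff[OF flin_mode1] mode_scale1 fock.scale_right_diff_distrib mult.commute)
      also have "\<dots> \<in> N"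
        by (intro fock.subspace_scale vir_submoduleD(1)[OF N(1)] mode_vir_hull_closed[where k=0, OF N(2,1,1) _ _ degenerate_product w])
          (auto simp: mode_vac z fexp_Ch)
      finally show "borch_lhs (k - m) m q ap am w j - fscale eta (borch_lhs (k - m) m q am ap w j) \<in> N" .
    qed
    finally have "?f 0 + Sum_any (\<lambda>j. ?f (Suc j)) \<in> N" unfolding Sum_any_rec[OF evf] .
    moreover have "Sum_any (\<lambda>j. ?f (Suc j)) \<in> N"
    proof (intro Sum_any_subspace fock.subspace_scale vir_submoduleD(1)[OF N(1)])
      fix j :: nat
      show "?S (k - of_nat (Suc j)) (q + of_nat (Suc j)) \<in> N"
      proof (rule Suc.IH)
        show "q + of_nat (Suc j) \<ge> of_int T - of_nat n" using Suc.prems(1) by simp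
        have "q + of_nat (Suc j) - of_int l / 2 = (q - of_int l / 2) + of_nat (Suc j)" by simp
        also have "\<dots> \<in> \<int>" by (rule Ints_add[OF Suc.prems(2) Ints_of_nat])
        finally show "q + of_nat (Suc j) - of_int l / 2 \<in> \<int>" .
        have "k - of_nat (Suc j) + of_int l / 2 - of_nat p / 2 = (k + of_int l / 2 - of_nat p / 2) - of_nat (Suc j)" by simp
        also have "\<dots> \<in> \<int>" by (rule Ints_diff[OF Suc.prems(3) Ints_of_nat])
        finally show "k - of_nat (Suc j) + of_int l / 2 - of_nat p / 2 \<in> \<int>" .
      qed
    qed
    ultimately have "?f 0 + Sum_any (\<lambda>j. ?f (Suc j)) - Sum_any (\<lambda>j. ?f (Suc j)) \<in> N"
      by (rule fock.subspace_diff[OF vir_submoduleD(1)[OF N(1)]])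
    then show ?case by simp
  qed
  show ?thesis
  proof (cases "q - of_int l / 2 \<in> \<int>")
    case q: True
    show ?thesis
    proof (cases "k + of_int l / 2 - of_nat p / 2 \<in> \<int>")
      case True
      obtain n :: nat where "of_int T - q \<le> of_nat n" using real_arch_simple by blast
      then show ?thesis using main[of n q k] q True by simp
    next
      case False
      have "mode p ap k (mode p am q w) = 0"
      proof (rule mode_nonint[OF ap_Ch VL_mode[OF Ch_VL[OF am_Ch] wl]])
        have "k + sp (int p) (- int p + l) = k + of_int l / 2 - of_nat p / 2" by (simp add: sp_am field_simps)
        then show "k + sp (int p) (- int p + l) \<notin> \<int>" using False by metis
      qed
      moreover have "mode p am k (mode p ap q w) = 0"
      proof (rule mode_nonint[OF am_Ch VL_mode[OF Ch_VL[OF ap_Ch] wl]])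
        have "k + sp (- int p) (int p + l) + of_int l = k + of_int l / 2 - of_nat p / 2" by (simp add: sp_am field_simps)
        then show "k + sp (- int p) (int p + l) \<notin> \<int>" using False by (metis Ints_add Ints_of_int)
      qed
      ultimately show ?thesis by (simp add: z)
    qed
  next
    case False
    have "mode p am q w = 0"
      by (rule mode_nonint[OF am_Ch wl]) (use False in \<open>simp add: sp_am\<close>)
    moreover have "mode p ap q w = 0"
    proof (rule mode_nonint[OF ap_Ch wl])
      have "q + sp (int p) l - of_int l = q - of_int l / 2" by (simp add: sp_am)
      then show "q + sp (int p) l \<notin> \<int>" using False by (metis Ints_diff Ints_of_int)
    qed
    ultimately show ?thesis by (simp add: z mode_02)
  qed
qed

section \<open>The candidate irreducible modules\<close>

text \<open>The singular vectors generating the modules are \<open>Q\<^sup>j e\<^sub>m\<close> with \<open>e\<^sub>m = exp((i - pm)\<alpha>/2p)\<close> and \<open>j \<le> m\<close>; even and odd \<open>m\<close>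
  give \<open>\<Lambda>\<close> and \<open>\<Pi>\<close>.\<close>

definition evec :: "int \<Rightarrow> nat \<Rightarrow> fock" where
  "evec i m = fexp (i - int p * int m)"

lemma evec_Suc: "vir_hull {evec i (Suc m)} = vir_hull {fexp (i - int p * int m - int p)}"
  by (simp add: evec_def algebra_simps)

text \<open>Q keeps the weight and raises the charge by 2p. After m + 1 steps the lowest weight of
  the new charge exceeds the weight of \<open>evec i m\<close> by
  \<open>(m + 1) (i + 1)\<close>.\<close>

lemma Qpow_evec:
  assumes "0 \<le> i" "j > m"
  shows "(Qi ^^ j) (evec i m) = 0"
proof -
  have "(Qi ^^ Suc m) (evec i m) = 0"
  proof (rule Wt_Ch_low[OF Qpow_Wt Qpow_Ch])
    show "evec i m \<in> Wt (hw (i - int p * int m))" "evec i m \<in> Ch (i - int p * int m)"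
      by (simp_all add: evec_def fexp_Wt fexp_Ch)
    let ?a = "i - int p * int m" and ?b = "i - int p * int m + 2 * int p * int (Suc m)"
    have "?b * (?b - 2 * int p + 2) - ?a * (?a - 2 * int p + 2) = 4 * int p * (int m + 1) * (i + 1)"
      by (simp add: algebra_simps)
    also have "\<dots> > 0" using assms(1) p0 by (intro mult_pos_pos) auto
    finally have "(of_int (?a * (?a - 2 * int p + 2)) :: rat) < of_int (?b * (?b - 2 * int p + 2))"
      unfolding of_int_less_iff by simp
    then show "hw ?a < hw ?b" unfolding hw_def using p0 by (intro divide_strict_right_mono) simp_all
  qed
  moreover have "(Qi ^^ j) (evec i m) = (Qi ^^ (j - Suc m)) ((Qi ^^ Suc m) (evec i m))"
    using assms(2) by (simp only: funpow_add[of "j - Suc m" "Suc m", unfolded comp_def, symmetric, THEN fun_cong] le_add_diff_inverse2 Suc_le_eq)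
  ultimately show ?thesis by (simp add: Qpow_0)
qed

text \<open>The error space of \<open>ap_evec\<close>; there is no earlier generator at
  \<open>m = 0\<close>, where the relation is exact.\<close>

definition prevs :: "int \<Rightarrow> nat \<Rightarrow> fock set" where
  "prevs i m = (if m = 0 then {0} else vir_hull {evec i (m - 1)})"

lemma am_evec: "i \<le> int p - 1 \<Longrightarrow> mode p am k (evec i m) \<in> vir_hull {evec i (Suc m)}"
  unfolding evec_Suc unfolding evec_def by (rule am_fexp_closed) (smt (verit) mult_nonneg_nonneg of_nat_0_le_iff)

lemma am_prevs:
  assumes i: "i \<le> int p - 1" and x: "x \<in> prevs i m"
  shows "mode p am k x \<in> vir_hull {evec i m}"
proof (cases m)
  case 0
  then show ?thesis using x by (simp add: prevs_def mode_02 fock.subspace_0[OF vir_hull_subspace])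
next
  case (Suc n)
  then have "x \<in> vir_hull {evec i n}" using x by (simp add: prevs_def)
  then show ?thesis unfolding Suc by (rule vir_hull_primary[OF primary_am vir_hull_sub, rotated]) (auto intro: am_evec[OF i])
qed

text \<open>The next vector E is obtained from \<open>evec i m\<close> by the leading mode of
  \<open>am\<close>. Exchanging the two fields turns \<open>ap\<close> on E into \<open>am\<close>
  on \<open>Qi E / (m + 1)\<close> up to error terms, and commuting Q to the front returns
  \<open>ap\<close> on E once more. With \<open>x = 1/(m + 1)\<close> this gives the factor
  \<open>x / (1 + x) = 1/(m + 2)\<close>.\<close>

lemma ap_evec:
  assumes i: "0 \<le> i" "i \<le> int p - 1"
  shows "mode p ap k (evec i m) - fscale (1 / of_nat (Suc m)) (Qi (mode p am k (evec i m))) \<in> prevs i m"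
proof (induction m arbitrary: k)
  case 0
  have "Qi (evec i 0) = 0" using Qpow_evec[OF i(1), of 0 1] by simp
  then show ?case by (simp add: ap_mode mode_02 prevs_def)
next
  case (Suc m)
  let ?E = "evec i (Suc m)" and ?N = "vir_hull {evec i m}"
  let ?l = "i - int p * int m"
  let ?q = "of_int ?l / 2 - 1 :: rat"
  let ?x = "1 / of_nat (Suc m) :: complex"
  have lead: "mode p am ?q (evec i m) = ?E"
  proof -
    have "mode p am ?q (fexp ?l) = EM (- int p) 0 (fexp (- int p + ?l))"
      by (rule exp_fexp_int) (unfold sp_am, simp add: field_simps)
    then show ?thesis by (simp add: evec_def algebra_simps)
  qed
  define v where "v = mode p ap ?q (evec i m) - fscale ?x (Qi ?E)"
  have v: "v \<in> prevs i m" using Suc.IH[of ?q] unfolding v_def lead .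
  have S: "mode p ap k ?E - fscale eta (mode p am k (mode p ap ?q (evec i m))) \<in> ?N"
    unfolding lead[symmetric]
  proof (rule degenerate_exchange)
    show "?N \<subseteq> VL p ?l" by (rule vir_hull_min[OF _ vir_submodule_VL]) (simp add: evec_def Ch_VL[OF fexp_Ch])
  qed (simp_all add: vir_hull_sub vir_hull_base)
  have avN: "mode p am k v \<in> ?N" by (rule am_prevs[OF i(2) v])
  have "mode p ap ?q (evec i m) = fscale ?x (Qi ?E) + v" by (simp add: v_def)
  then have "mode p ap k ?E - fscale eta (mode p am k (mode p ap ?q (evec i m)))
     = fscale (1 + ?x) (mode p ap k ?E) - fscale ?x (Qi (mode p am k ?E)) - fscale eta (mode p am k v)"
    by (simp only: mode_add2 mode_scale2 am_Q)
      (simp add: fock.scale_right_distrib fock.scale_right_diff_distrib fock.scale_left_distrib eta_sq mult.left_commute[of eta])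
  then have "fscale (1 + ?x) (mode p ap k ?E) - fscale ?x (Qi (mode p am k ?E))
    = (mode p ap k ?E - fscale eta (mode p am k (mode p ap ?q (evec i m)))) + fscale eta (mode p am k v)" by simp
  also have "\<dots> \<in> ?N" by (intro fock.subspace_add fock.subspace_scale vir_hull_subspace S avN)
  finally have "fscale (1 / (1 + ?x)) (fscale (1 + ?x) (mode p ap k ?E) - fscale ?x (Qi (mode p am k ?E))) \<in> ?N"
    by (rule fock.subspace_scale[OF vir_hull_subspace])
  moreover have x: "1 + ?x \<noteq> 0" "1 / (1 + ?x) * ?x = 1 / of_nat (Suc (Suc m))"
  proof -
    have "1 + ?x = of_nat (Suc (Suc m)) / of_nat (Suc m)" by (simp add: field_simps del: of_nat_Suc) simp
    moreover have "(of_nat (Suc (Suc m)) :: complex) \<noteq> 0" "(of_nat (Suc m) :: complex) \<noteq> 0" by (simp_all only: of_nat_eq_0_iff)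
    ultimately show "1 + ?x \<noteq> 0" "1 / (1 + ?x) * ?x = 1 / of_nat (Suc (Suc m))" by simp_all
  qed
  ultimately show ?case by (simp add: prevs_def fock.scale_right_diff_distrib del: of_nat_Suc)
qed

text \<open>The remainder of l modulo p is the index i, and the divisibility selects a parity of m:
  even for l = i, odd for l = i + p. Only the class of l modulo 2p matters.\<close>

definition gens :: "int \<Rightarrow> fock set" where
  "gens l = {(Qi ^^ j) (evec (l mod int p) m) | j m. j \<le> m \<and> 2 * int p dvd l mod int p - int p * int m - l}"

definition Vbar :: "int \<Rightarrow> fock set" where
  "Vbar l = vir_hull (gens l)"

lemma Vbar_sub: "vir_submodule p (Vbar l)"
  unfolding Vbar_def by (rule vir_hull_sub)

lemma i_bounds: "0 \<le> l mod int p" "l mod int p \<le> int p - 1"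
  using p0 pos_mod_bound[of "int p" l] by auto

lemma Qpow_in_Vbar:
  assumes "2 * int p dvd l mod int p - int p * int m - l"
  shows "(Qi ^^ j) (evec (l mod int p) m) \<in> Vbar l"
proof (cases "j \<le> m")
  case True
  then show ?thesis unfolding Vbar_def gens_def using assms by (intro vir_hull_base) blast
next
  case False
  then show ?thesis using Qpow_evec[OF i_bounds(1)] by (simp add: fock.subspace_0[OF vir_submoduleD(1)[OF Vbar_sub]])
qed

lemma Qpow_vir_hull_in_Vbar:
  assumes "2 * int p dvd l mod int p - int p * int m - l" "x \<in> vir_hull {evec (l mod int p) m}"
  shows "(Qi ^^ j) x \<in> Vbar l"
  by (rule vir_hull_linear[OF Qpow_lin Vir_Qpow Vbar_sub _ assms(2)]) (use Qpow_in_Vbar[OF assms(1)] in simp)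

lemma Qpow_VL: "v \<in> VL p l \<Longrightarrow> (Qi ^^ j) v \<in> VL p l"
  by (induction j) (simp_all add: Q_VL)

lemma Vbar_VL: "Vbar l \<subseteq> VL p l"
  unfolding Vbar_def
proof (rule vir_hull_min[OF _ vir_submodule_VL])
  show "gens l \<subseteq> VL p l"
    unfolding gens_def evec_def using VL_cong Ch_VL[OF fexp_Ch] by (auto intro!: Qpow_VL)
qed

lemma Vbar_Q: "x \<in> Vbar l \<Longrightarrow> Qi x \<in> Vbar l"
  unfolding Vbar_def[of l]
proof (rule vir_hull_linear[OF flin_Q Vir_Q Vbar_sub[unfolded Vbar_def]])
  fix x assume "x \<in> gens l"
  then obtain j m where "x = (Qi ^^ j) (evec (l mod int p) m)" "2 * int p dvd l mod int p - int p * int m - l"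
    unfolding gens_def by blast
  then show "Qi x \<in> vir_hull (gens l)" using Qpow_in_Vbar[of l m "Suc j"] by (simp add: Vbar_def)
qed

lemma dvd_shift:
  assumes "2 * int p dvd i - int p * int m - l"
  shows "2 * int p dvd i - int p * int (Suc m) - (l - int p)"
    "2 * int p dvd i - int p * int (Suc m) - (l + int p)"
    "m > 0 \<Longrightarrow> 2 * int p dvd i - int p * int (m - 1) - (l - int p)"
    "m > 0 \<Longrightarrow> 2 * int p dvd i - int p * int (m - 1) - (l + int p)"
proof -
  let ?a = "i - int p * int m - l"
  have "2 * int p dvd ?a - 2 * int p" "2 * int p dvd ?a + 2 * int p" using assms by (simp_all)
  note d = assms this
  show "2 * int p dvd i - int p * int (Suc m) - (l - int p)"
    "2 * int p dvd i - int p * int (Suc m) - (l + int p)" using d by (simp_all add: algebra_simps)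
  assume "m > 0"
  then obtain n where "m = Suc n" by (cases m) auto
  then show "2 * int p dvd i - int p * int (m - 1) - (l - int p)"
    "2 * int p dvd i - int p * int (m - 1) - (l + int p)" using d by (simp_all add: algebra_simps)
qed

text \<open>By \<open>am_Qpow\<close>, \<open>ap_Qpow\<close> and \<open>ap_evec\<close>, both
  fields send \<open>Q^j e_m\<close> to powers of Q applied to the modules of \<open>e_(m+1)\<close>
  and \<open>e_(m-1)\<close>. Both neighbours belong to l - p as well as to l + p, since these agree
  modulo 2p.\<close>

lemma degenerate_gens:
  assumes x: "x \<in> gens l"
  shows "mode p am k x \<in> Vbar (l - int p)" "mode p ap k x \<in> Vbar (l + int p)"
proof -
  let ?i = "l mod int p"
  obtain j m where x: "x = (Qi ^^ j) (evec ?i m)" and d: "2 * int p dvd ?i - int p * int m - l"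
    using x unfolding gens_def by blast
  let ?a = "mode p am k (evec ?i m)"
  define v where "v = mode p ap k (evec ?i m) - fscale (1 / of_nat (Suc m)) (Qi ?a)"
  have ap: "mode p ap k (evec ?i m) = fscale (1 / of_nat (Suc m)) (Qi ?a) + v" by (simp add: v_def)
  have v: "v \<in> prevs ?i m" unfolding v_def by (rule ap_evec[OF i_bounds])
  have mods: "(l - int p) mod int p = ?i" "(l + int p) mod int p = ?i" by simp_all
  have a: "(Qi ^^ t) ?a \<in> Vbar (l - int p)" "(Qi ^^ t) ?a \<in> Vbar (l + int p)" for t
    using Qpow_vir_hull_in_Vbar[of "l - int p" "Suc m" ?a t, unfolded mods, OF dvd_shift(1)[OF d] am_evec[OF i_bounds(2)]]
      Qpow_vir_hull_in_Vbar[of "l + int p" "Suc m" ?a t, unfolded mods, OF dvd_shift(2)[OF d] am_evec[OF i_bounds(2)]] by simp_all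
  have Qv: "(Qi ^^ t) v \<in> Vbar (l - int p)" "(Qi ^^ t) v \<in> Vbar (l + int p)" for t
  proof -
    have "(Qi ^^ t) v \<in> Vbar (l - int p) \<and> (Qi ^^ t) v \<in> Vbar (l + int p)"
    proof (cases "m = 0")
      case True
      then show ?thesis using v by (simp add: prevs_def Qpow_0 fock.subspace_0[OF vir_submoduleD(1)[OF Vbar_sub]])
    next
      case False
      then have v': "v \<in> vir_hull {evec ?i (m - 1)}" using v by (simp add: prevs_def)
      show ?thesis
        using Qpow_vir_hull_in_Vbar[of "l - int p" "m - 1" v t, unfolded mods, OF dvd_shift(3)[OF d] v']
          Qpow_vir_hull_in_Vbar[of "l + int p" "m - 1" v t, unfolded mods, OF dvd_shift(4)[OF d] v'] False by simp
    qed
    then show "(Qi ^^ t) v \<in> Vbar (l - int p)" "(Qi ^^ t) v \<in> Vbar (l + int p)" by auto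
  qed
  have Qa: "(Qi ^^ t) (Qi y) = (Qi ^^ Suc t) y" for t y by (simp add: funpow_swap1)
  note sub = vir_submoduleD(1)[OF Vbar_sub]
  show "mode p am k x \<in> Vbar (l - int p)"
    unfolding x am_Qpow ap Qpow_add Qpow_scale Qa
    by (intro fock.subspace_scale fock.subspace_diff fock.subspace_add sub a Qv)
  show "mode p ap k x \<in> Vbar (l + int p)"
    unfolding x ap_Qpow ap Qpow_add Qpow_scale Qa
    by (intro fock.subspace_scale fock.subspace_add sub a Qv)
qed

theorem stable_Vbar: "stable Vbar"
  unfolding stable_def
proof (intro allI conjI ballI)
  fix l w n k
  show "fock.subspace (Vbar l)" "Vbar l \<subseteq> VL p l" by (rule vir_submoduleD(1)[OF Vbar_sub], rule Vbar_VL)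
  assume w: "w \<in> Vbar l"
  show "Li n w \<in> Vbar l" by (rule vir_submoduleD(2)[OF Vbar_sub w])
  show "mode p am k w \<in> Vbar (l - int p)"
    by (rule vir_hull_primary[OF primary_am Vbar_sub degenerate_gens(1) w[unfolded Vbar_def]])
  show "mode p ap k w \<in> Vbar (l + int p)"
    by (rule vir_hull_primary[OF primary_ap Vbar_sub degenerate_gens(2) w[unfolded Vbar_def]])
qed

section \<open>The kernel of the second screening operator\<close>

abbreviation Qt :: "fock \<Rightarrow> fock" where "Qt \<equiv> Qtilde p"

lemma flin_Qt: "flin Qt"
  unfolding Qtilde_def by (rule flin_mode2)

text \<open>exp(-\<alpha>/p) has weight 1 as well: the charges 2p and -2 are the two solutions of
  \<open>hw k = 1\<close>.\<close>

lemma Vir_Qt: "Li n (Qt v) = Qt (Li n v)"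
proof -
  have "hw (- 2) = 1" using p0 by (simp add: hw_def field_simps)
  then show ?thesis using Vir_primary[OF primary_fexp, of n "- 2" 0 v] unfolding Qtilde_def by simp
qed

lemma sp_m2: "sp (- 2) (int p * z) = - of_int z"
  using p0 by (simp add: sp_def field_simps)

text \<open>A commutator formula; divisibility of the charges by p makes their inner products with
  -\<alpha>/p integral. The scalar is a sign, or 0 where the modes of v vanish.\<close>

lemma Qt_mode:
  assumes v: "v \<in> Ch k" and w: "w \<in> VL p l" and k: "int p dvd k" and l: "int p dvd l"
    and z: "mode p (Qt v) m w = 0"
  shows "\<exists>c. Qt (mode p v m w) = fscale c (mode p v m (Qt w))"
proof (cases "m + sp k l \<in> \<int>")
  case True
  obtain y where y: "k = int p * y" using k by (elim dvdE)
  obtain x where x: "l = int p * x" using l by (elim dvdE)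
  have "mode p (fexp (- 2)) 0 (mode p v m w) = fscale ((- 1) powi (- y)) (mode p v m (mode p (fexp (- 2)) 0 w))
      + Sum_any (\<lambda>j::nat. fscale (of_rat 0 gchoose j) (mode p (mode p (fexp (- 2)) (of_nat j) v) (0 + m - of_nat j) w))"
    by (rule mode_commutator[OF fexp_Ch v w _ _ True]) (simp_all add: x y sp_m2)
  also have "Sum_any (\<lambda>j::nat. fscale (of_rat 0 gchoose j) (mode p (mode p (fexp (- 2)) (of_nat j) v) (0 + m - of_nat j) w))
      = fscale (of_rat 0 gchoose 0) (mode p (mode p (fexp (- 2)) (of_nat 0) v) (0 + m - of_nat 0) w)"
    by (rule Sum_any_single) (auto simp: gbinomial_0 gr0_conv_Suc)
  finally show ?thesis using z by (auto simp: Qtilde_def)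
next
  case False
  then have "mode p v m w = 0" by (rule mode_nonint[OF v w])
  then show ?thesis by (intro exI[of _ 0]) (simp add: flin_0[OF flin_Qt])
qed

lemma Qt_fexp: "- 1 - sp (- 2) k = of_int t \<Longrightarrow> Qt (fexp k) = EM (- 2) t (fexp (k - 2))"
  using exp_fexp_int[of 0 "- 2" k t] by (simp add: Qtilde_def)

text \<open>The second screening operator sends exp(\<alpha>) to a multiple of
  \<open>Li (- 1) (fexp (2 * int p - 2))\<close>, a total derivative, whose residue is 0. This is
  why the two screening operators are compatible.\<close>

lemma Qt_2p_mode: "mode p (Qt (fexp (2 * int p))) 0 w = 0"
proof -
  have "Qt (fexp (2 * int p)) = EM (- 2) 1 (fexp (2 * int p - 2))"
    using sp_m2[of 2] by (intro Qt_fexp) (simp add: mult.commute)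
  also have "\<dots> = fscale (of_int (- 2) / (2 * of_nat p)) (h (- 1) (fexp (2 * int p - 2)))"
    using EM_newton[of 1 "- 2" "fexp (2 * int p - 2)"] by simp
  also have "\<dots> = fscale (- 1 / (of_nat p - 1)) (Li (- 1) (fexp (2 * int p - 2)))"
  proof -
    have "(of_nat p - 1 :: complex) \<noteq> 0" using p2 by (simp only: right_minus_eq of_nat_eq_1_iff)
    then show ?thesis unfolding Virm1_fexp using p0 by (simp add: field_simps)
  qed
  finally have e: "Qt (fexp (2 * int p)) = fscale (- 1 / (of_nat p - 1)) (Li (- 1) (fexp (2 * int p - 2)))" .
  have "mode p (Li (- 1) (fexp (2 * int p - 2))) 0 w = 0"
    using primary_fexp[of "2 * int p - 2"] by (simp add: primary_def)
  then show ?thesis unfolding e mode_scale1 by simp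
qed

lemma Qt_Q:
  assumes "w \<in> VL p l" "int p dvd l" "Qt w = 0"
  shows "Qt (Qi w) = 0"
proof -
  have "\<exists>c. Qt (mode p (fexp (2 * int p)) 0 w) = fscale c (mode p (fexp (2 * int p)) 0 (Qt w))"
    by (rule Qt_mode[OF fexp_Ch assms(1) _ assms(2) Qt_2p_mode]) simp
  then show ?thesis using assms(3) by (auto simp: Q_def mode_02)
qed

lemma Qt_am: "Qt am = 0" and Qt_ap: "Qt ap = 0"
proof -
  show 1: "Qt am = 0"
    using Qt_fexp[of "- int p" "- 2"] sp_m2[of "- 1"] by (simp add: EM_neg)
  show "Qt ap = 0" by (rule Qt_Q[OF Ch_VL[OF am_Ch] _ 1]) simp
qed

text \<open>Embeds the triplet algebra into a stable family. Only charges divisible by p have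
  integral inner products with -\<alpha>/p; at the others the zero space keeps the family
  stable.\<close>

definition ker_Qt :: "int \<Rightarrow> fock set" where
  "ker_Qt l = (if int p dvd l then {v \<in> VL p l. Qt v = 0} else {0})"

lemma stable_ker_Qt: "stable ker_Qt"
  unfolding stable_def
proof (intro allI conjI ballI)
  fix l w n k
  show "fock.subspace (ker_Qt l)"
    using subspace_VL[of l] by (auto simp: ker_Qt_def fock.subspace_def flin_add[OF flin_Qt] flin_scale[OF flin_Qt] flin_0[OF flin_Qt])
  show "ker_Qt l \<subseteq> VL p l" using fock.subspace_0[OF subspace_VL] by (auto simp: ker_Qt_def)
  assume w: "w \<in> ker_Qt l"
  show "Li n w \<in> ker_Qt l"
    using w by (auto simp: ker_Qt_def Vir_Qt[symmetric] Vir_0 Vir_VL split: if_splits)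
  have "mode p am k w \<in> ker_Qt (l - int p) \<and> mode p ap k w \<in> ker_Qt (l + int p)"
  proof (cases "int p dvd l")
    case True
    then have wl: "w \<in> VL p l" "Qt w = 0" using w by (auto simp: ker_Qt_def)
    have "Qt (mode p am k w) = 0"
      using Qt_mode[OF am_Ch wl(1) _ True, of k] wl(2) by (auto simp: Qt_am mode_01 mode_02)
    moreover have "Qt (mode p ap k w) = 0"
      using Qt_mode[OF ap_Ch wl(1) _ True, of k] wl(2) by (auto simp: Qt_ap mode_01 mode_02)
    moreover have "mode p am k w \<in> VL p (l - int p)" "mode p ap k w \<in> VL p (l + int p)"
      using VL_mode[OF Ch_VL[OF am_Ch] wl(1)] VL_mode[OF Ch_VL[OF ap_Ch] wl(1)] by (simp_all add: algebra_simps)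
    ultimately show ?thesis using True by (simp add: ker_Qt_def)
  next
    case False
    moreover have "int p dvd l - int p \<longleftrightarrow> int p dvd l" using dvd_add_left_iff[of "int p" "int p" "l - int p"] by simp
    ultimately have "w = 0" "\<not> int p dvd l - int p" "\<not> int p dvd l + int p" using w by (auto simp: ker_Qt_def)
    then show ?thesis by (simp add: ker_Qt_def mode_02)
  qed
  then show "mode p am k w \<in> ker_Qt (l - int p)" "mode p ap k w \<in> ker_Qt (l + int p)" by auto
qed

lemma low_keys:
  assumes "x \<in> VL p l" "x \<in> Wt H" "H \<le> 0" "lk x (\<mu>, k) \<noteq> 0"
  shows "0 \<le> k \<and> k \<le> 2 * int p - 2 \<and> 2 * int p dvd k - l \<and> H = hw k + of_nat (wlev \<mu>)"
proof -
  have "hw k + of_nat (wlev \<mu>) = H" using keys_wt[OF assms(2,4)] by (simp add: wt_def)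
  moreover from this have "hw k \<le> 0" using assms(3) of_nat_0_le_iff[of "wlev \<mu>", where 'a = rat] by linarith
  moreover have "2 * int p dvd k - l" using assms(1,4) by (auto simp: VL_def in_keys_iff)
  ultimately show ?thesis using hw_nonpos by auto
qed

lemma mult_p_small:
  assumes "int p dvd k" "0 \<le> k" "k \<le> 2 * int p - 2"
  shows "k = 0 \<or> k = int p"
proof -
  obtain z where z: "k = int p * z" using assms(1) by (elim dvdE)
  have "z < 2"
  proof (rule ccontr)
    assume "\<not> z < 2"
    then have "int p * 2 \<le> int p * z" by (intro mult_left_mono) auto
    then show False using z assms(3) by simp
  qed
  moreover have "z \<ge> 0" using z assms(2) p0 by (simp add: zero_le_mult_iff)
  ultimately have "z = 0 \<or> z = 1" by auto
  then show ?thesis using z by auto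
qed

lemma fexp_nonzero: "fexp k \<noteq> 0"
  by (metis fexp_def lookup_single_eq lookup_zero zero_neq_one)

lemma dvd_2p_p: "2 * int p dvd a \<Longrightarrow> int p dvd a"
  by (rule dvd_mult_right)

text \<open>At weight at most 0 the kernel contains only multiples of the vacuum, which lie in
  \<open>Vbar\<close>; the comparison of stable families extends this to all weights. The reverse
  inclusion is checked on generators.\<close>

lemma ker_Qt_Vbar: "int p dvd l \<Longrightarrow> ker_Qt l = Vbar l"
proof
  have low: "x \<in> Vbar l'" if x: "H \<le> 0" "x \<in> ker_Qt l'" "x \<in> Wt H" for l' H x
  proof (cases "x = 0")
    case True
    then show ?thesis by (simp add: fock.subspace_0[OF vir_submoduleD(1)[OF Vbar_sub]])
  next
    case nz: False
    have p: "int p dvd l'" using x nz by (auto simp: ker_Qt_def split: if_splits)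
    have xl: "x \<in> VL p l'" using x p by (simp add: ker_Qt_def)
    have key: "(k = 0 \<or> k = int p) \<and> 2 * int p dvd k - l' \<and> H = hw k + of_nat (wlev \<mu>)" if "lk x (\<mu>, k) \<noteq> 0" for \<mu> k
    proof -
      note lo = low_keys[OF xl x(3,1) that]
      have "int p dvd k - l'" using lo dvd_2p_p by blast
      then have "int p dvd k" using p by (metis dvd_diffD1 dvd_diff_commute dvd_add_right_iff diff_add_cancel dvd_add)
      then show ?thesis using lo mult_p_small by blast
    qed
    show ?thesis
    proof (cases "2 * int p dvd l'")
      case True
      have key0: "\<mu> = {#} \<and> k = 0" if "lk x (\<mu>, k) \<noteq> 0" for \<mu> k
      proof -
        have "k \<noteq> int p"
        proof
          assume "k = int p"
          then have "2 * int p dvd (int p - l') + l'" using key[OF that] True by (intro dvd_add) auto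
          then have "2 * int p dvd int p" by simp
          then show False using p0 zdvd_imp_le[of "2 * int p" "int p"] by simp
        qed
        then have k: "k = 0" using key[OF that] by blast
        have "H = of_nat (wlev \<mu>)" using key[OF that] k by (simp add: hw_def)
        then have "wlev \<mu> = 0" using x(1) by simp
        then show ?thesis using k by (simp add: wlev_0)
      qed
      have "x = fscale (lk x ({#}, 0)) vac"
        by (rule poly_mapping_eqI) (use key0 in \<open>auto simp: lookup_fscale fexp_def lookup_single when_def\<close>)
      moreover have "(Qi ^^ 0) (evec (l' mod int p) 0) \<in> Vbar l'"
        by (rule Qpow_in_Vbar) (use True p in \<open>simp add: dvd_imp_mod_0\<close>)
      then have "vac \<in> Vbar l'" using p by (simp add: evec_def dvd_imp_mod_0)
      ultimately show ?thesis by (metis fock.subspace_scale[OF vir_submoduleD(1)[OF Vbar_sub]])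
    next
      case False
      \<comment> \<open>In the odd class a nonzero vector of weight at most 0 would put
        exp(\<alpha>/2) into the kernel, but its image is the nonzero exponential of charge p -
        2.\<close>
      obtain k where k: "0 \<le> k" "k \<le> 2 * int p - 2" "2 * int p dvd k - l'" "fexp k \<in> ker_Qt l'"
        using lowest_vector[OF stableD(1-3)[OF stable_ker_Qt] x(2) nz x(3,1)] by blast
      have "int p dvd k - l'" using k dvd_2p_p by blast
      then have "int p dvd k" using p by (metis dvd_diffD1 dvd_diff_commute dvd_add_right_iff diff_add_cancel dvd_add)
      then have "k = 0 \<or> k = int p" using k mult_p_small by blast
      moreover have "k \<noteq> 0" using k(3) False by auto
      ultimately have "k = int p" by blast
      then have "Qt (fexp (int p)) = 0" using k(4) p by (simp add: ker_Qt_def)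
      moreover have "Qt (fexp (int p)) = EM (- 2) 0 (fexp (int p - 2))"
        using sp_m2[of 1] by (intro Qt_fexp) simp
      moreover have "fexp (int p - 2) \<noteq> 0" by (rule fexp_nonzero)
      ultimately show ?thesis by simp
    qed
  qed
  show "ker_Qt l \<subseteq> Vbar l" by (rule stable_determined[OF stable_ker_Qt stable_Vbar low])
  assume l: "int p dvd l"
  have "vir_submodule p (ker_Qt l)" using stableD[OF stable_ker_Qt] by (simp add: vir_submodule_def)
  moreover have "gens l \<subseteq> ker_Qt l"
  proof
    fix x assume "x \<in> gens l"
    then obtain j m where x: "x = (Qi ^^ j) (evec 0 m)" and d: "2 * int p dvd 0 - int p * int m - l"
      using l unfolding gens_def by (auto simp: dvd_imp_mod_0)
    have e: "evec 0 m \<in> VL p l" using VL_cong[OF d] Ch_VL[OF fexp_Ch] by (auto simp: evec_def)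
    have "Qt (evec 0 m) = EM (- 2) (- 1 - int m) (fexp (- int p * int m - 2))"
      using sp_m2[of "- int m"] Qt_fexp[of "0 - int p * int m" "- 1 - int m"] by (simp add: evec_def)
    then have q0: "Qt (evec 0 m) = 0" by (simp add: EM_neg)
    have "Qt ((Qi ^^ j) (evec 0 m)) = 0"
      by (induction j) (simp_all add: q0 Qt_Q[OF Qpow_VL[OF e] l])
    then show "x \<in> ker_Qt l" using l e by (simp add: ker_Qt_def x Qpow_VL)
  qed
  ultimately show "Vbar l \<subseteq> ker_Qt l" unfolding Vbar_def by (intro vir_hull_min)
qed

lemma triplet_Vbar: "triplet p = Vbar 0"
  using ker_Qt_Vbar[of 0] by (simp add: ker_Qt_def triplet_def)

section \<open>Closure under modes of products\<close>

text \<open>In the Borcherds identity the terms on the left with \<open>j > 0\<close> involve the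
  product of u and v at index \<open>q + j\<close>, so a descending induction on \<open>q\<close>
  isolates the term \<open>j = 0\<close>.\<close>

lemma iterate_closed:
  assumes u: "u \<in> Ch k1" and v: "v \<in> Ch k2" and F: "\<And>l. fock.subspace (F l)" "\<And>l. F l \<subseteq> VL p l"
    and um: "\<And>l m w. w \<in> F l \<Longrightarrow> mode p u m w \<in> F (l + k1)"
    and vm: "\<And>l m w. w \<in> F l \<Longrightarrow> mode p v m w \<in> F (l + k2)" and w: "w \<in> F l"
  shows "mode p (mode p u q v) t w \<in> F (l + (k1 + k2))"
proof -
  note z = fock.subspace_0[OF F(1)]
  have wl: "w \<in> VL p l" using w F(2) by blast
  obtain T :: int where T: "\<And>m. m \<ge> of_int T \<Longrightarrow> mode p u m v = 0"
    using good_mode[of u] unfolding good_def by blast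
  have main: "mode p (mode p u q v) t w \<in> F (l + (k1 + k2))" if "q \<ge> of_int T - of_nat n" for n q t
    using that
  proof (induction n arbitrary: q t)
    case 0
    then show ?case using T[of q] z by (simp add: mode_01)
  next
    case (Suc n)
    show ?case
    proof (cases "q + sp k1 k2 \<in> \<int> \<and> t + sp (k1 + k2) l \<in> \<int>")
      case True
      then obtain L where L: "q + sp k1 k2 = of_int L" by (elim conjE Ints_cases)
      \<comment> \<open>Chosen for integrality: \<open>?m + sp k1 l = 0\<close>. The sum
        \<open>?m + ?n = t\<close> makes \<open>j = 0\<close> the wanted term.\<close>
      let ?m = "- sp k1 l" and ?n = "t + sp k1 l"
      have B: "Sum_any (borch_lhs q ?m ?n u v w) = Sum_any (borch_rhs L q ?m ?n u v w)"
        by (rule borcherds_rat[OF u v wl L]) (use True in \<open>simp_all add: sp_add1 add.assoc\<close>)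
      have "Sum_any (borch_rhs L q ?m ?n u v w) \<in> F (l + (k1 + k2))"
      proof (rule Sum_any_subspace[OF F(1)])
        fix j
        have 1: "mode p u (?m + q - of_nat j) (mode p v (?n + of_nat j) w) \<in> F (l + (k1 + k2))"
        proof -
          have e: "l + (k1 + k2) = l + k2 + k1" by simp
          show ?thesis unfolding e by (rule um[OF vm[OF w]])
        qed
        have 2: "mode p v (?n + q - of_nat j) (mode p u (?m + of_nat j) w) \<in> F (l + (k1 + k2))"
          using vm[OF um[OF w]] by (simp add: add.assoc)
        show "borch_rhs L q ?m ?n u v w j \<in> F (l + (k1 + k2))"
          unfolding borch_rhs_def by (intro fock.subspace_scale fock.subspace_diff F(1) 1 2)
      qed
      then have "borch_lhs q ?m ?n u v w 0 + Sum_any (\<lambda>j. borch_lhs q ?m ?n u v w (Suc j)) \<in> F (l + (k1 + k2))"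
        unfolding B[symmetric] Sum_any_rec[OF evz_borch_lhs] .
      moreover have "Sum_any (\<lambda>j. borch_lhs q ?m ?n u v w (Suc j)) \<in> F (l + (k1 + k2))"
        unfolding borch_lhs_def
        by (intro Sum_any_subspace fock.subspace_scale F(1) Suc.IH) (use Suc.prems in simp)
      ultimately have "borch_lhs q ?m ?n u v w 0 + Sum_any (\<lambda>j. borch_lhs q ?m ?n u v w (Suc j)) - Sum_any (\<lambda>j. borch_lhs q ?m ?n u v w (Suc j)) \<in> F (l + (k1 + k2))"
        by (rule fock.subspace_diff[OF F(1)])
      then show ?thesis by (simp add: borch_lhs_def)
    next
      case False
      then show ?thesis
        using mode_nonint[OF u Ch_VL[OF v], of q] mode_nonint[OF Ch_mode[OF u v] wl, of t] z by (auto simp: mode_01)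
    qed
  qed
  obtain n :: nat where "of_int T - q \<le> of_nat n" using real_arch_simple by blast
  then show ?thesis by (intro main[of n]) simp
qed

text \<open>The converse passage, from iterates to products. With \<open>m\<close> beyond the
  truncation bound of u on w, one of the two orders disappears from the Borcherds identity, and
  descending induction on \<open>n\<close> isolates the product.\<close>

lemma product_in:
  assumes u: "u \<in> Ch k1" and v: "v \<in> Ch k2" and w: "w \<in> VL p l" and N: "fock.subspace N"
    and uv: "\<And>q t. mode p (mode p u q v) t w \<in> N"
  shows "mode p u k (mode p v n w) \<in> N"
proof -
  note z = fock.subspace_0[OF N]
  obtain T U :: int where T: "\<And>m. m \<ge> of_int T \<Longrightarrow> mode p v m w = 0" and U: "\<And>m. m \<ge> of_int U \<Longrightarrow> mode p u m w = 0"
    using good_mode[of u] good_mode[of v] unfolding good_def by blast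
  have main: "mode p u k (mode p v n w) \<in> N" if "n \<ge> of_int T - of_nat i" for i n k
    using that
  proof (induction i arbitrary: n k)
    case 0
    then show ?case using T[of n] z by (simp add: mode_02)
  next
    case (Suc i)
    show ?case
    proof (cases "k + sp k1 (k2 + l) \<in> \<int> \<and> n + sp k2 l \<in> \<int>")
      case True
      obtain s :: nat where s: "of_int U + sp k1 l \<le> of_nat s" using real_arch_simple by blast
      define m where "m = of_nat s - sp k1 l"
      have mU: "m + of_nat j \<ge> of_int U" for j
        using s of_nat_0_le_iff[of j, where 'a = rat] unfolding m_def by linarith
      have "k - m + sp k1 k2 = (k + sp k1 (k2 + l)) - of_nat s" by (simp add: m_def sp_add2)
      then have "k - m + sp k1 k2 \<in> \<int>" using True Ints_diff Ints_of_nat by metis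
      then obtain L where L: "k - m + sp k1 k2 = of_int L" by (elim Ints_cases)
      have "m + sp k1 l \<in> \<int>" by (simp add: m_def)
      then have B: "Sum_any (borch_lhs (k - m) m n u v w) = Sum_any (borch_rhs L (k - m) m n u v w)"
        using True by (intro borcherds_rat[OF u v w L]) simp_all
      have borch_rhs: "borch_rhs L (k - m) m n u v w j = fscale ((- 1) ^ j * (of_rat (k - m) gchoose j)) (mode p u (k - of_nat j) (mode p v (n + of_nat j) w))" for j
        using U[OF mU[of j]] by (simp add: borch_rhs_def mode_02)
      have "Sum_any (borch_lhs (k - m) m n u v w) \<in> N"
        unfolding borch_lhs_def by (intro Sum_any_subspace fock.subspace_scale N uv)
      then have "borch_rhs L (k - m) m n u v w 0 + Sum_any (\<lambda>j. borch_rhs L (k - m) m n u v w (Suc j)) \<in> N"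
        unfolding B Sum_any_rec[OF evz_borch_rhs] .
      moreover have "Sum_any (\<lambda>j. borch_rhs L (k - m) m n u v w (Suc j)) \<in> N"
        unfolding borch_rhs by (intro Sum_any_subspace fock.subspace_scale N Suc.IH) (use Suc.prems in simp)
      ultimately have "borch_rhs L (k - m) m n u v w 0 + Sum_any (\<lambda>j. borch_rhs L (k - m) m n u v w (Suc j)) - Sum_any (\<lambda>j. borch_rhs L (k - m) m n u v w (Suc j)) \<in> N"
        by (rule fock.subspace_diff[OF N])
      then show ?thesis by (simp add: borch_rhs)
    next
      case False
      then show ?thesis
        using mode_nonint[OF v w, of n] mode_nonint[OF u VL_mode[OF Ch_VL[OF v] w], of k] z by (auto simp: mode_02)
    qed
  qed
  obtain i :: nat where "of_int T - n \<le> of_nat i" using real_arch_simple by blast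
  then show ?thesis by (intro main[of i]) simp
qed

section \<open>The action of the triplet algebra\<close>

lemma Vbar_cong: "2 * int p dvd l - l' \<Longrightarrow> Vbar l = Vbar l'"
proof -
  assume d: "2 * int p dvd l - l'"
  have "int p dvd l - l'" using d dvd_2p_p by blast
  then have m: "l mod int p = l' mod int p" by (simp add: mod_eq_dvd_iff)
  have "2 * int p dvd x - l \<longleftrightarrow> 2 * int p dvd x - l'" for x
    using dvd_add_right_iff[OF d, of "x - l"] by simp
  then show ?thesis unfolding Vbar_def gens_def m by simp
qed

text \<open>\<open>mode_vir_hull_closed\<close> wants generators of a single charge, whereas
  \<open>gens 0\<close> has many charges; hence the hull is split.\<close>

lemma vir_hull_union: "vir_hull X \<subseteq> fock.span (\<Union>x\<in>X. vir_hull {x})"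
proof (rule vir_hull_min)
  show "X \<subseteq> fock.span (\<Union>x\<in>X. vir_hull {x})" by (auto intro!: fock.span_base vir_hull_base)
  let ?S = "fock.span (\<Union>x\<in>X. vir_hull {x})"
  have "Li n w \<in> ?S" if "w \<in> ?S" for n w
  proof -
    have "fock.subspace {w. Li n w \<in> ?S}"
      using fock.subspace_span[of "\<Union>x\<in>X. vir_hull {x}"] by (auto simp: fock.subspace_def Vir_add Vir_scale Vir_0)
    moreover have "(\<Union>x\<in>X. vir_hull {x}) \<subseteq> {w. Li n w \<in> ?S}"
      by (auto intro!: fock.span_base vir_hull_Vir)
    ultimately have "?S \<subseteq> {w. Li n w \<in> ?S}" by (rule fock.span_minimal[rotated])
    then show ?thesis using that by blast
  qed
  then show "vir_submodule p ?S" by (simp add: vir_submodule_def fock.subspace_span)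
qed

text \<open>exp(-(m+1)\<alpha>/2) is the leading mode of \<open>am\<close> on exp(-m\<alpha>/2), so
  the action of all these exponentials comes from that of \<open>am\<close> by
  \<open>iterate_closed\<close>.\<close>

lemma evec0_closed: "w \<in> Vbar l \<Longrightarrow> mode p (evec 0 m) t w \<in> Vbar (l - int p * int m)"
proof (induction m arbitrary: l t w)
  case 0
  then show ?case by (simp add: evec_def mode_vac fock.subspace_0[OF vir_submoduleD(1)[OF Vbar_sub]])
next
  case (Suc m)
  let ?q = "- (of_nat p * of_nat m / 2) - 1 :: rat"
  have "mode p am ?q (fexp (- (int p * int m))) = EM (- int p) 0 (fexp (- int p + - (int p * int m)))"
    by (rule exp_fexp_int) (unfold sp_am, simp add: field_simps)
  then have e: "evec 0 (Suc m) = mode p am ?q (evec 0 m)" by (simp add: evec_def algebra_simps)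
  have "mode p (mode p am ?q (evec 0 m)) t w \<in> Vbar (l + (- int p + - (int p * int m)))"
  proof (rule iterate_closed[OF am_Ch _ stableD(1,2)[OF stable_Vbar] _ _ Suc.prems])
    show "evec 0 m \<in> Ch (- (int p * int m))" by (simp add: evec_def fexp_Ch)
    show "mode p am m' w \<in> Vbar (l + - int p)" if "w \<in> Vbar l" for l m' w
      using stableD(4)[OF stable_Vbar that] by simp
    show "mode p (evec 0 m) m' w \<in> Vbar (l + - (int p * int m))" if "w \<in> Vbar l" for l m' w
      using Suc.IH[OF that] by simp
  qed
  then show ?case unfolding e by (simp add: algebra_simps)
qed

lemma gens0_closed: "w \<in> Vbar l \<Longrightarrow> mode p ((Qi ^^ j) (evec 0 m)) t w \<in> Vbar (l - int p * int m)"
proof (induction j arbitrary: t w)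
  case 0
  then show ?case by (simp add: evec0_closed)
next
  case (Suc j)
  let ?u = "(Qi ^^ j) (evec 0 m)"
  obtain k where "?u \<in> Ch k" using Qpow_Ch[of "evec 0 m" "0 - int p * int m" j] fexp_Ch by (auto simp: evec_def)
  then have "mode p (Qi ?u) t w = Qi (mode p ?u t w) - fscale ((- 1) powi k) (mode p ?u t (Qi w))"
    using Q_mode[of ?u k t w] by simp
  also have "\<dots> \<in> Vbar (l - int p * int m)"
    by (intro fock.subspace_diff fock.subspace_scale vir_submoduleD(1)[OF Vbar_sub] Vbar_Q Suc.IH Suc.prems)
  finally show ?case by simp
qed

lemma triplet_closed:
  assumes u: "u \<in> Vbar 0" and w: "w \<in> Vbar l"
  shows "mode p u t w \<in> Vbar l"
proof -
  have "u \<in> fock.span (\<Union>x\<in>gens 0. vir_hull {x})" using u vir_hull_union unfolding Vbar_def by blast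
  then show ?thesis
  proof (rule fock.span_induct)
    show "fock.subspace {u. mode p u t w \<in> Vbar l}"
      using vir_submoduleD(1)[OF Vbar_sub[of l]] by (auto simp: fock.subspace_def mode_add1 mode_scale1 mode_01)
    fix x assume "x \<in> (\<Union>x\<in>gens 0. vir_hull {x})"
    then obtain j m where x: "x \<in> vir_hull {(Qi ^^ j) (evec 0 m)}" and d: "2 * int p dvd - (int p * int m)"
      by (auto simp: gens_def)
    obtain k where k: "(Qi ^^ j) (evec 0 m) \<in> Ch k" using Qpow_Ch[of "evec 0 m" "0 - int p * int m" j] fexp_Ch by (auto simp: evec_def)
    have "Vbar (l - int p * int m) = Vbar l" by (rule Vbar_cong) (use d in simp)
    then have c: "mode p y t w \<in> Vbar l" if "y \<in> {(Qi ^^ j) (evec 0 m)}" "w \<in> Vbar l" for y t w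
      using gens0_closed that by auto
    have k': "{(Qi ^^ j) (evec 0 m)} \<subseteq> Ch k" using k by simp
    show "mode p x t w \<in> Vbar l"
      by (rule mode_vir_hull_closed[OF Vbar_VL Vbar_sub Vbar_sub k' c x w])
  qed
qed

section \<open>Irreducibility\<close>

lemma mode_nonint_VL0:
  assumes u: "u \<in> VL p 0" and w: "w \<in> VL p l" and m: "m \<notin> \<int>"
  shows "mode p u m w = 0"
proof -
  have "mode p u m w \<in> {0}"
  proof (rule flin_keys_in[OF flin_mode1 fock.subspace_single_0])
    fix \<mu> k assume "(\<mu>, k) \<in> Poly_Mapping.keys u"
    then have "2 * int p dvd k" using u by (auto simp: VL_def)
    then obtain z where z: "k = 2 * int p * z" by (elim dvdE)
    have "sp k l = of_int (z * l)" using p0 by (simp add: z sp_def)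
    then have "m + sp k l \<notin> \<int>" using m Ints_diff[of "m + sp k l" "sp k l"] by auto
    then show "mode p (basis \<mu> k) m w \<in> {0}" using mode_nonint[OF basis_Ch w] by simp
  qed
  then show ?thesis by simp
qed

lemma fexp_in_Vbar:
  assumes "2 * int p dvd l mod int p - int p * int m - l"
  shows "evec (l mod int p) m \<in> Vbar l"
  using Qpow_in_Vbar[OF assms, of 0] by simp

lemma vac_in_Vbar: "vac \<in> Vbar 0"
  using fexp_in_Vbar[of 0 0] by (simp add: evec_def)

lemma conf_in_Vbar: "conf p \<in> Vbar 0"
proof -
  have "Li (- 2) vac = conf p" using mode_u_vac[of 0 "conf p"] by (simp add: Vir_def)
  then show ?thesis using vir_submoduleD(2)[OF Vbar_sub vac_in_Vbar, of "- 2"] by simp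
qed

lemma degenerate_in_Vbar: "am \<in> Vbar (- int p)" "am \<in> Vbar (int p)" "ap \<in> Vbar (- int p)" "ap \<in> Vbar (int p)"
proof -
  have c: "Vbar (- int p) = Vbar (int p)" by (rule Vbar_cong) simp
  show 1: "am \<in> Vbar (- int p)" using fexp_in_Vbar[of "- int p" 1] by (simp add: evec_def)
  show 2: "ap \<in> Vbar (- int p)" by (rule Vbar_Q[OF 1])
  show "am \<in> Vbar (int p)" "ap \<in> Vbar (int p)" using 1 2 c by auto
qed

lemma stable_zero: "stable (\<lambda>l. {0})"
  by (simp add: stable_def Vir_0 mode_02 fock.subspace_0[OF subspace_VL])

text \<open>Reads \<open>ap_evec\<close> backwards: the leading mode of \<open>am\<close> produces
  the next exponential, and that of \<open>ap\<close> on \<open>Q^t e_n\<close> produces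
  \<open>Q^(t+1) e_(n+1)\<close> up to a nonzero factor and a term from
  \<open>e_(n-1)\<close>.\<close>

lemma fexp_generates:
  assumes M: "stable M" and per: "\<And>k l. 2 * int p dvd k - l \<Longrightarrow> M k = M l"
    and i: "0 \<le> i" "i \<le> int p - 1" and f: "fexp i \<in> M i"
  shows "j \<le> m \<Longrightarrow> (Qi ^^ j) (evec i m) \<in> M (i - int p * int m)"
proof (induction m arbitrary: j rule: less_induct)
  case (less m)
  have vsM: "vir_submodule p (M l)" for l using stableD[OF M] by (simp add: vir_submodule_def)
  show ?case
  proof (cases m)
    case 0
    then show ?thesis using less.prems f by (simp add: evec_def)
  next
    case (Suc n)
    let ?l = "i - int p * int n"
    let ?q = "of_int ?l / 2 - 1 :: rat"
    have lead: "mode p am ?q (evec i n) = evec i m"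
    proof -
      have "mode p am ?q (fexp ?l) = EM (- int p) 0 (fexp (- int p + ?l))"
        by (rule exp_fexp_int) (unfold sp_am, simp add: field_simps)
      then show ?thesis by (simp add: evec_def Suc algebra_simps)
    qed
    have IH: "(Qi ^^ t) (evec i n) \<in> M ?l" if "t \<le> n" for t
      using less.IH[of n t] that Suc by simp
    have m: "i - int p * int m = ?l - int p" by (simp add: Suc algebra_simps)
    show ?thesis
    proof (cases j)
      case 0
      then show ?thesis unfolding m using stableD(4)[OF M IH[of 0], of ?q] lead by simp
    next
      case j: (Suc t)
      then have t: "t \<le> n" using less.prems Suc by simp
      \<comment> \<open>The error term; it lies in the module of the generator two steps back, which
        the induction covers because \<open>M\<close> is 2p-periodic.\<close>
      define v where "v = mode p ap ?q (evec i n) - fscale (1 / of_nat (Suc n)) (Qi (evec i m))"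
      have v: "v \<in> prevs i n" unfolding v_def lead[symmetric] by (rule ap_evec[OF i])
      have e: "mode p ap ?q (evec i n) = fscale (1 / of_nat (Suc n)) (Qi (evec i m)) + v" by (simp add: v_def)
      have Mper: "M (?l + int p) = M (?l - int p)" by (rule per) simp
      have Qv: "(Qi ^^ t) v \<in> M (?l - int p)"
      proof (cases n)
        case 0
        then show ?thesis using v by (simp add: prevs_def Qpow_0 fock.subspace_0[OF stableD(1)[OF M]])
      next
        case n: (Suc n')
        have c: "(Qi ^^ t) (evec i n') \<in> M (i - int p * int n')"
        proof (cases "t \<le> n'")
          case True
          then show ?thesis using less.IH[of n' t] Suc n by simp
        next
          case False
          then show ?thesis using Qpow_evec[OF i(1)] by (simp add: fock.subspace_0[OF stableD(1)[OF M]])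
        qed
        have "M (i - int p * int n') = M (?l - int p)" by (rule per) (simp add: n algebra_simps)
        with c have c': "\<And>x. x \<in> {evec i n'} \<Longrightarrow> (Qi ^^ t) x \<in> M (?l - int p)" by simp
        have "v \<in> vir_hull {evec i n'}" using v n by (simp add: prevs_def)
        from vir_hull_linear[OF Qpow_lin Vir_Qpow vsM c' this] show ?thesis .
      qed
      have "mode p ap ?q ((Qi ^^ t) (evec i n)) \<in> M (?l - int p)"
        using stableD(5)[OF M IH[OF t]] Mper by simp
      then have "fscale (eta ^ t) ((Qi ^^ t) (fscale (1 / of_nat (Suc n)) (Qi (evec i m)) + v)) \<in> M (?l - int p)"
        unfolding ap_Qpow e .
      then have "fscale (eta ^ t) (fscale (eta ^ t) ((Qi ^^ t) (fscale (1 / of_nat (Suc n)) (Qi (evec i m)) + v))) \<in> M (?l - int p)"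
        by (rule fock.subspace_scale[OF stableD(1)[OF M]])
      moreover have "eta ^ t * eta ^ t = 1" by (simp add: power_mult_distrib[symmetric] eta_sq)
      ultimately have "fscale (1 / of_nat (Suc n)) ((Qi ^^ t) (Qi (evec i m))) + (Qi ^^ t) v \<in> M (?l - int p)"
        by (simp add: Qpow_add Qpow_scale)
      from fock.subspace_diff[OF stableD(1)[OF M] this Qv]
      have "fscale (1 / of_nat (Suc n)) ((Qi ^^ t) (Qi (evec i m))) \<in> M (?l - int p)" by simp
      then have "fscale (of_nat (Suc n)) (fscale (1 / of_nat (Suc n)) ((Qi ^^ t) (Qi (evec i m)))) \<in> M (?l - int p)"
        by (rule fock.subspace_scale[OF stableD(1)[OF M]])
      moreover have "(of_nat (Suc n) :: complex) \<noteq> 0" by (simp only: of_nat_eq_0_iff)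
      ultimately have "(Qi ^^ t) (Qi (evec i m)) \<in> M (?l - int p)" by (simp del: of_nat_Suc)
      then show ?thesis unfolding m j by (simp add: funpow_swap1)
    qed
  qed
qed

text \<open>A submodule is closed only under the triplet algebra. It becomes a member of a stable
  family because products of two of the fields \<open>am\<close> and \<open>ap\<close> act on it
  through modes of vectors of the triplet algebra.\<close>

theorem Vbar_irreducible:
  assumes N: "N \<subseteq> Vbar l0" "fock.subspace N" "action_closed p (Vbar 0) N" and nz: "N \<noteq> {0}"
  shows "N = Vbar l0"
proof
  show "N \<subseteq> Vbar l0" by (rule N(1))
  have NV: "N \<subseteq> VL p l0" using N(1) Vbar_VL by blast
  have act: "mode p u m w \<in> N" if "u \<in> Vbar 0" "w \<in> N" for u m w
  proof (cases "m \<in> \<int>")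
    case True
    then obtain z where "m = of_int z" by (elim Ints_cases)
    then show ?thesis using N(3) that by (auto simp: action_closed_def)
  next
    case False
    then have "mode p u m w = 0" using mode_nonint_VL0 that Vbar_VL NV by blast
    then show ?thesis using fock.subspace_0[OF N(2)] by simp
  qed
  have LN: "Li n w \<in> N" if "w \<in> N" for n w
    unfolding Vir_def by (rule act[OF conf_in_Vbar that])
  define N1 where "N1 = fock.span {mode p a k w | a k w. a \<in> {am, ap} \<and> w \<in> N}"
  have N1g: "mode p a k w \<in> N1" if "a \<in> {am, ap}" "w \<in> N" for a k w
    unfolding N1_def using that by (intro fock.span_base) blast
  have N1m: "f x \<in> S" if "flin f" "fock.subspace S" "\<And>a k w. a \<in> {am, ap} \<Longrightarrow> w \<in> N \<Longrightarrow> f (mode p a k w) \<in> S" "x \<in> N1" for f S x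
  proof -
    have "fock.subspace {x. f x \<in> S}"
      using that(1,2) by (auto simp: fock.subspace_def flin_add flin_scale flin_0)
    then have "N1 \<subseteq> {x. f x \<in> S}" unfolding N1_def by (intro fock.span_minimal) (use that(3) in auto)
    then show ?thesis using that(4) by blast
  qed
  have N1V: "N1 \<subseteq> VL p (l0 - int p)" "N1 \<subseteq> VL p (l0 + int p)"
  proof -
    have c: "VL p (l0 + int p) = VL p (l0 - int p)" by (rule VL_cong) simp
    have "mode p a k w \<in> VL p (l0 - int p)" if "a \<in> {am, ap}" "w \<in> N" for a k w
      using that VL_mode[OF Ch_VL[OF am_Ch], of w l0 k] VL_mode[OF Ch_VL[OF ap_Ch], of w l0 k] NV c by (auto simp: algebra_simps)
    then show "N1 \<subseteq> VL p (l0 - int p)" using N1m[OF flin_id subspace_VL] by blast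
    then show "N1 \<subseteq> VL p (l0 + int p)" using c by simp
  qed
  have prod: "mode p a k (mode p a' k' w) \<in> N" if a: "a \<in> {am, ap}" "a' \<in> {am, ap}" and w: "w \<in> N" for a a' k k' w
  proof -
    have aa: "mode p a q a' \<in> Vbar 0" for q
    proof -
      have "mode p am q x \<in> Vbar 0" "mode p ap q y \<in> Vbar 0" if "x \<in> Vbar (int p)" "y \<in> Vbar (- int p)" for x y
        using stableD(4)[OF stable_Vbar that(1)] stableD(5)[OF stable_Vbar that(2)] by simp_all
      then show ?thesis using a degenerate_in_Vbar by auto
    qed
    obtain c c' where c: "a \<in> Ch c" "a' \<in> Ch c'" using a am_Ch ap_Ch by blast
    have wl: "w \<in> VL p l0" using NV w by blast
    show ?thesis by (rule product_in[OF c wl N(2)]) (rule act[OF aa w])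
  qed
  define M where "M l = (if 2 * int p dvd l - l0 then N else if 2 * int p dvd l - l0 - int p then N1 else {0})" for l
  have per: "M k = M l" if d: "2 * int p dvd k - l" for k l
  proof -
    have "2 * int p dvd k - x \<longleftrightarrow> 2 * int p dvd l - x" for x
      using dvd_add_right_iff[OF d, of "l - x"] by simp
    from this[of l0] this[of "l0 + int p"] show ?thesis unfolding M_def by (simp add: diff_diff_eq)
  qed
  have excl: "\<not> (2 * int p dvd x \<and> 2 * int p dvd x - int p)" for x
  proof
    assume "2 * int p dvd x \<and> 2 * int p dvd x - int p"
    then have "2 * int p dvd x - (x - int p)" by (elim conjE) (rule dvd_diff)
    then have "2 * int p dvd int p" by simp
    then show False using p0 zdvd_imp_le[of "2 * int p" "int p"] by simp
  qed
  have par: "2 * int p dvd x - int p - int p \<longleftrightarrow> 2 * int p dvd x" "2 * int p dvd x + int p \<longleftrightarrow> 2 * int p dvd x - int p" for x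
    using dvd_add_left_iff[of "2 * int p" "2 * int p" "x - int p - int p"] dvd_add_left_iff[of "2 * int p" "2 * int p" "x - int p"] by (simp_all add: algebra_simps)
  have M0: "M l = N" "M (l - int p) = N1" "M (l + int p) = N1" if "2 * int p dvd l - l0" for l
    using that par[of "l - l0"] excl[of "l - l0"] by (simp_all add: M_def algebra_simps)
  have M1: "M l = N1" "M (l - int p) = N" "M (l + int p) = N" if "2 * int p dvd l - l0 - int p" for l
    using that par[of "l - l0"] excl[of "l - l0"] by (simp_all add: M_def algebra_simps)
  have stab: "stable M"
    unfolding stable_def
  proof (intro allI)
    fix l
    consider "2 * int p dvd l - l0" | "2 * int p dvd l - l0 - int p" | "M l = {0}" unfolding M_def by metis
    then show "fock.subspace (M l) \<and> M l \<subseteq> VL p l \<and>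
     (\<forall>w\<in>M l. (\<forall>n. Li n w \<in> M l) \<and> (\<forall>k. mode p am k w \<in> M (l - int p) \<and> mode p ap k w \<in> M (l + int p)))"
    proof cases
      case 1
      show ?thesis unfolding M0[OF 1] VL_cong[OF 1] using N(2) NV LN N1g by blast
    next
      case 2
      have v: "VL p l = VL p (l0 + int p)" by (rule VL_cong) (use 2 in \<open>simp add: diff_diff_eq\<close>)
      have "fock.subspace N1" unfolding N1_def by (rule fock.subspace_span)
      moreover have "Li n w \<in> N1" if "w \<in> N1" for n w
      proof (rule N1m[OF flin_Vir _ _ that])
        show "fock.subspace N1" unfolding N1_def by (rule fock.subspace_span)
        fix a k w assume a: "a \<in> {am, ap}" and w: "w \<in> N"
        have "primary (hw (- int p)) a" using a primary_am primary_ap by blast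
        from Vir_primary[OF this, of n k w] show "Li n (mode p a k w) \<in> N1"
          using N1g[OF a LN[OF w]] N1g[OF a w] \<open>fock.subspace N1\<close> by (simp add: fock.subspace_add fock.subspace_scale)
      qed
      moreover have "mode p a k w \<in> N" if "w \<in> N1" "a \<in> {am, ap}" for a k w
        by (rule N1m[OF flin_mode2 N(2) _ that(1)]) (rule prod[OF that(2)])
      ultimately show ?thesis unfolding M1[OF 2] v using N1V by blast
    next
      case 3
      moreover have "0 \<in> M l" for l unfolding M_def N1_def using fock.subspace_0[OF N(2)] fock.span_zero by simp
      ultimately show ?thesis by (simp add: Vir_0 mode_02 fock.subspace_0[OF subspace_VL])
    qed
  qed
  \<comment> \<open>A stable family without nonzero vectors of weight at most 0 is contained in the
    zero family, so here such a vector exists.\<close>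
  have "\<not> M l0 \<subseteq> {0}" using M0(1)[of l0] nz fock.subspace_0[OF N(2)] by auto
  then obtain l H x where x: "H \<le> 0" "x \<in> M l" "x \<in> Wt H" "x \<noteq> 0"
    using stable_determined[OF stab stable_zero] by blast
  obtain k where k: "0 \<le> k" "k \<le> 2 * int p - 2" "2 * int p dvd k - l" "fexp k \<in> M l"
    using lowest_vector[OF stableD(1-3)[OF stab] x(2,4,3,1)] by blast
  have fk: "fexp k \<in> M k" using k(4) per[OF k(3)] by simp
  then have "M k \<noteq> {0}" using fexp_nonzero by blast
  then have "2 * int p dvd k - l0 \<or> 2 * int p dvd k - l0 - int p" unfolding M_def by metis
  then have "int p dvd k - l0"
    using dvd_2p_p dvd_add[of "int p" "k - l0 - int p" "int p"] by fastforce
  then have mod: "k mod int p = l0 mod int p" by (simp add: mod_eq_dvd_iff)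
  let ?i = "l0 mod int p"
  have f: "fexp ?i \<in> M ?i"
  proof (cases "k < int p")
    case True
    then have "?i = k" using k(1) mod by simp
    then show ?thesis using fk by simp
  next
    case False
    have "(k - int p) mod int p = k - int p" using False k(2) by (intro mod_pos_pos_trivial) auto
    then have i: "?i = k - int p" using mod by simp
    \<comment> \<open>The leading mode of \<open>am\<close> brings a charge from the upper half down
      to the remainder modulo p.\<close>
    have "mode p am (of_int k / 2 - 1) (fexp k) = EM (- int p) 0 (fexp (- int p + k))"
      by (rule exp_fexp_int) (simp add: sp_am)
    then show ?thesis unfolding i using stableD(4)[OF stab fk, of "of_int k / 2 - 1"] by simp
  qed
  have "gens l0 \<subseteq> M l0"
  proof
    fix y assume "y \<in> gens l0"
    then obtain j m where y: "y = (Qi ^^ j) (evec ?i m)" "j \<le> m" "2 * int p dvd ?i - int p * int m - l0"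
      unfolding gens_def by blast
    show "y \<in> M l0"
      unfolding y(1) per[OF y(3), symmetric] by (rule fexp_generates[OF stab per i_bounds f y(2)])
  qed
  moreover have "vir_submodule p (M l0)" using stableD[OF stab] by (simp add: vir_submodule_def)
  ultimately show "Vbar l0 \<subseteq> N" unfolding Vbar_def using vir_hull_min M0(1)[of l0] by simp
qed

section \<open>The case \<open>i = p\<close>\<close>

text \<open>This is dual to the fact that every nonzero vector has a nonzero image under some mode \<open>(a\<^sup>-)\<^sub>k\<close>
  with \<open>k \<ge> l/2 - 1\<close>.\<close>

lemma Ch_in_subspace:
  assumes T: "fock.subspace T" and am: "\<And>k w. k \<le> of_nat p - 3 / 2 \<Longrightarrow> w \<in> Ch (2 * int p - 1) \<Longrightarrow> mode p am k w \<in> T"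
  shows "basis \<mu> (int p - 1) \<in> T"
  using assms
proof (induction \<mu> arbitrary: T)
  case empty
  have "mode p am (of_nat p - 3 / 2) (fexp (2 * int p - 1)) = EM (- int p) 0 (fexp (- int p + (2 * int p - 1)))"
    by (rule exp_fexp_int) (unfold sp_am, simp add: field_simps)
  then show ?case using empty(2)[OF order_refl fexp_Ch] by (simp add: fexp_def)
next
  case (add n \<mu>)
  let ?r = "- int n - 1"
  have "basis \<mu> (int p - 1) \<in> {x. h ?r x \<in> T}"
  proof (rule add.IH)
    show "fock.subspace {x. h ?r x \<in> T}"
      using add.prems(1) by (auto simp: fock.subspace_def h_add h_scale h_0)
    fix k :: rat and w assume k: "k \<le> of_nat p - 3 / 2" and w: "w \<in> Ch (2 * int p - 1)"
    have "h ?r (mode p am k w) = mode p am k (h ?r w) + fscale (of_int (- int p)) (mode p am (k + of_int ?r) w)"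
      unfolding mode_fexp by (rule h_exp_mode)
    also have "\<dots> \<in> T"
    proof (intro fock.subspace_add fock.subspace_scale add.prems)
      have "of_int ?r \<le> (0::rat)" by simp
      then show "k + of_int ?r \<le> of_nat p - 3 / 2" using k by linarith
    qed (use k w h_Ch in auto)
    finally show "mode p am k w \<in> {x. h ?r x \<in> T}" by simp
  qed
  then show ?case by (simp add: heis_basis)
qed

definition level_part :: "int \<Rightarrow> nat \<Rightarrow> fock \<Rightarrow> fock" where
  "level_part k d = lin_ext (\<lambda>\<mu> l. if l = k \<and> wlev \<mu> = d then basis \<mu> l else 0)"

lemma flin_level_part: "flin (level_part k d)"
  unfolding level_part_def by (rule flin_lin_ext)

lemma level_part_gr: "v \<in> gr l e \<Longrightarrow> level_part k d v = (if l = k \<and> e = of_nat d then v else 0)"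
proof -
  assume v: "v \<in> gr l e"
  have 1: "level_part k d (basis \<mu> l') = (if l = k \<and> e = of_nat d then basis \<mu> l' else 0)" if "(\<mu>, l') \<in> Poly_Mapping.keys v" for \<mu> l'
    using v that by (auto simp: gr_def level_part_def lin_ext_basis)
  show ?thesis
  proof (cases "l = k \<and> e = of_nat d")
    case True
    then show ?thesis using flin_keys_eq[OF flin_level_part flin_id, of v k d] 1 by simp
  next
    case False
    then have "level_part k d (basis \<mu> l') = 0" if "(\<mu>, l') \<in> Poly_Mapping.keys v" for \<mu> l' using 1[OF that] by (simp only: if_False)
    then have "level_part k d v = 0" by (rule flin_keys_eq[OF flin_level_part flin_zero])
    then show ?thesis using False by (simp only: if_False)
  qed
qed

text \<open>If \<open>T\<close> consists of the vectors whose component of level \<open>d\<close> lies in the submodule, then the recursion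
  modulo \<open>T\<close> can only stop at a \<open>D\<close> with \<open>D\<^sup>2 = p d\<close> and \<open>0 \<le> D \<le> d\<close>, which is impossible for \<open>0 < d < p\<close>.\<close>

lemma low_levels:
  assumes d: "d < p" and v: "v \<in> gr (int p - 1) (of_nat d)"
  shows "v \<in> vir_hull {fexp (int p - 1)}"
  using d v
proof (induction d arbitrary: v rule: less_induct)
  case (less d)
  let ?c = "int p - 1" and ?U = "vir_hull {fexp (int p - 1)}"
  note z = fock.subspace_0[OF vir_hull_subspace[of "{fexp (int p - 1)}"]]
  show ?case
  proof (cases "d = 0")
    case True
    have "v = fscale (lk v ({#}, ?c)) (fexp ?c)"
      by (rule poly_mapping_eqI) (use less.prems(2) True in \<open>auto simp: lookup_fscale fexp_def lookup_single when_def gr_iff wlev_0\<close>)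
    then show ?thesis using vir_hull_base[of "fexp ?c" "{fexp ?c}"] fock.subspace_scale[OF vir_hull_subspace] by (metis singletonI)
  next
    case False
    let ?T = "{x. level_part ?c d x \<in> ?U}"
    have T: "fock.subspace ?T"
      using vir_hull_subspace[of "{fexp ?c}"] by (auto simp: fock.subspace_def flin_add[OF flin_level_part] flin_scale[OF flin_level_part] flin_0[OF flin_level_part])
    have other: "x \<in> ?T" if "x \<in> gr k e" "e \<noteq> of_nat d" for x k e
      using level_part_gr[OF that(1), of ?c d] that(2) z by simp
    have LT: "Li (- 1 - int r) x \<in> ?T" if "x \<in> Ch ?c" for x r
    proof (rule flin_keys_in[OF flin_Vir T])
      fix \<mu> k assume "(\<mu>, k) \<in> Poly_Mapping.keys x"
      then have k: "k = ?c" using that by (auto simp: Ch_def)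
      have g: "Li (- 1 - int r) (basis \<mu> ?c) \<in> gr ?c (of_nat (wlev \<mu>) - of_int (- 1 - int r))"
        by (rule gr_Vir[OF gr_basis])
      show "Li (- 1 - int r) (basis \<mu> k) \<in> ?T"
      proof (cases "wlev \<mu> + 1 + r = d")
        case True
        have "of_nat (wlev \<mu>) - of_int (- 1 - int r) = (of_nat d :: rat)" by (simp add: True[symmetric])
        then have "level_part ?c d (Li (- 1 - int r) (basis \<mu> ?c)) = Li (- 1 - int r) (basis \<mu> ?c)" using level_part_gr[OF g, of ?c d] by simp
        moreover have "basis \<mu> ?c \<in> ?U" by (rule less.IH[OF _ _ gr_basis]) (use True less.prems(1) in auto)
        ultimately show ?thesis using k by (simp add: vir_hull_Vir)
      next
        case False
        have "of_nat (wlev \<mu>) - of_int (- 1 - int r) = (of_nat (wlev \<mu> + 1 + r) :: rat)" by simp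
        then have "of_nat (wlev \<mu>) - of_int (- 1 - int r) \<noteq> (of_nat d :: rat)" using False by (metis of_nat_eq_iff)
        then show ?thesis using other[OF g] k by blast
      qed
    qed
    let ?l = "2 * int p - 1"
    have s: "sp (- int p) ?l = - of_nat p + 1 / 2" by (unfold sp_am, simp add: field_simps)
    have chm: "mode p am k w \<in> Ch ?c" if "w \<in> Ch ?l" for k w
      using Ch_mode[OF am_Ch that, of k] by simp
    \<comment> \<open>These modes raise the level by more than d, so their images have no part of
      level d.\<close>
    have deep: "mode p am (of_nat p - 3 / 2 - of_nat d - 2 - of_nat r) w \<in> ?T" if w: "w \<in> Ch ?l" for r w
    proof (rule flin_keys_in[OF flin_mode2 T])
      let ?k = "of_nat p - 3 / 2 - of_nat d - 2 - of_nat r :: rat"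
      fix \<mu> k assume "(\<mu>, k) \<in> Poly_Mapping.keys w"
      then have k: "k = ?l" using w by (auto simp: Ch_def)
      have "mode p am ?k (basis \<mu> ?l) \<in> gr (- int p + ?l) (0 + of_nat (wlev \<mu>) - ?k - 1 - sp (- int p) ?l)"
        by (rule gr_mode[OF gr_fexp gr_basis])
      moreover have "0 + of_nat (wlev \<mu>) - ?k - 1 - sp (- int p) ?l = of_nat (wlev \<mu> + d + 2 + r)"
        unfolding s by simp
      moreover have "of_nat (wlev \<mu> + d + 2 + r) \<noteq> (of_nat d :: rat)" unfolding of_nat_eq_iff by simp
      ultimately show "mode p am ?k (basis \<mu> k) \<in> ?T" unfolding k by (metis other)
    qed
    \<comment> \<open>Here the recursion is used upwards: modulo \<open>?T\<close> the Virasoro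
      terms vanish, and what remains are modes of lower index.\<close>
    have step: "mode p am (of_nat p - 3 / 2 - of_nat d - 1 + of_nat n) w \<in> ?T" if "n \<le> d + 1" "w \<in> Ch ?l" for n w
      using that
    proof (induction n arbitrary: w rule: less_induct)
      case (less n)
      let ?k = "of_nat p - 3 / 2 - of_nat d - 1 + of_nat n :: rat"
      have below: "mode p am (?k - 1 - of_nat r) w \<in> ?T" if w: "w \<in> Ch ?l" for r w
      proof (cases "r + 1 \<le> n")
        case True
        then have e: "?k - 1 - of_nat r = of_nat p - 3 / 2 - of_nat d - 1 + of_nat (n - 1 - r)" by (simp add: of_nat_diff)
        show ?thesis unfolding e by (rule less.IH[OF _ _ w]) (use True less.prems(1) in auto)
      next
        case False
        then have e: "?k - 1 - of_nat r = of_nat p - 3 / 2 - of_nat d - 2 - of_nat (r - n)" by (simp add: of_nat_diff)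
        show ?thesis unfolding e by (rule deep[OF w])
      qed
      show ?case
      proof (rule flin_keys_in[OF flin_mode2 T])
        fix \<mu> k assume "(\<mu>, k) \<in> Poly_Mapping.keys w"
        then have k: "k = ?l" using less.prems(2) by (auto simp: Ch_def)
        let ?w = "basis \<mu> ?l" and ?J = "?k + 1"
        let ?H = "hw ?l + of_nat (wlev \<mu>)"
        let ?x = "?J * (?J + 1 - of_nat p) - of_nat p * ?H"
        have g: "mode p am ?k ?w \<in> gr (- int p + ?l) (0 + of_nat (wlev \<mu>) - ?k - 1 - sp (- int p) ?l)"
          by (rule gr_mode[OF gr_fexp gr_basis])
        have "fscale (of_rat ?x) (mode p am (?J - 1) ?w) \<in> ?T"
          unfolding bpz_weight[OF degenerate_am Ch_VL[OF basis_Ch] gr_Wt[OF gr_basis]]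
        proof (intro fock.subspace_scale[OF T] fock.subspace_add[OF T] Sum_any_subspace[OF T])
          fix r :: nat
          show "Li (- 1 - int r) (mode p am (?J + of_nat r) ?w) \<in> ?T" by (rule LT[OF chm[OF basis_Ch]])
          show "mode p am (?J - 2 - of_nat r) (Li (int r + 1) ?w) \<in> ?T"
            using below[OF Vir_Ch[OF basis_Ch], of r] by simp
        qed
        moreover have "?J - 1 = ?k" by simp
        ultimately have sc: "fscale (of_rat ?x) (mode p am ?k ?w) \<in> ?T" by metis
        have "mode p am ?k ?w \<in> ?T"
        proof (cases "?x = 0")
          case False
          from fock.subspace_scale[OF T sc, of "1 / of_rat ?x"] False show ?thesis by simp
        next
          case True
          show ?thesis
          proof (cases "0 + of_nat (wlev \<mu>) - ?k - 1 - sp (- int p) ?l = (of_nat d :: rat)")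
            case False
            then show ?thesis using other[OF g] by blast
          next
            case e: True
            \<comment> \<open>The amount by which this mode raises the level. A vanishing
              coefficient would mean \<open>D * D = p d\<close>, contradicting
              \<open>0 \<le> D \<le> d < p\<close> and \<open>d > 0\<close>.\<close>
            define D :: int where "D = int d + 1 - int n"
            have w: "of_nat (wlev \<mu>) = (of_nat d - of_int D :: rat)" using e unfolding s D_def by (simp add: field_simps)
            have "of_nat p * hw ?l = (2 * of_nat p - 1) / 4" using p0 by (simp add: hw_def field_simps)
            then have "?x = (of_int D)\<^sup>2 - of_nat p * of_nat d"
              unfolding distrib_left[of _ "hw ?l"] w D_def by (simp add: field_simps power2_eq_square)
            then have "of_int (D * D) = (of_int (int p * int d) :: rat)" using True by (simp add: power2_eq_square)
            then have DD: "D * D = int p * int d" unfolding of_int_eq_iff .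
            have "(0::rat) \<le> of_int (int d - D)" using w of_nat_0_le_iff[of "wlev \<mu>", where 'a = rat] by simp
            then have "D \<le> int d" by simp
            moreover have "D \<ge> 0" unfolding D_def using less.prems(1) by simp
            ultimately have "D * D \<le> int d * int d" by (intro mult_mono) auto
            then have "int p * int d \<le> int d * int d" using DD by simp
            then have "int p \<le> int d" using False by simp
            then show ?thesis using \<open>d < p\<close> by simp
          qed
        qed
        then show "mode p am ?k (basis \<mu> k) \<in> ?T" unfolding k .
      qed
    qed
    have below: "mode p am k w \<in> ?T" if k: "k \<le> of_nat p - 3 / 2" and w: "w \<in> Ch ?l" for k w
    proof (cases "k + sp (- int p) ?l \<in> \<int>")
      case True
      then obtain y where "k + sp (- int p) ?l = of_int y" by (elim Ints_cases)
      then have y: "k = of_nat p - 1 / 2 + of_int y" unfolding s by simp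
      then have "of_int (y + 1) \<le> (of_int 0 :: rat)" using k by simp
      then have y0: "y + 1 \<le> 0" unfolding of_int_le_iff .
      show ?thesis
      proof (cases "y + int d + 2 \<ge> 0")
        case True
        then have "(of_nat (nat (y + int d + 2)) :: rat) = of_int (y + int d + 2)" by simp
        then have e: "k = of_nat p - 3 / 2 - of_nat d - 1 + of_nat (nat (y + int d + 2))" unfolding y by simp
        show ?thesis unfolding e by (rule step[OF _ w]) (use y0 in simp)
      next
        case False
        then have "(of_nat (nat (- y - int d - 3)) :: rat) = of_int (- y - int d - 3)" by simp
        then have e: "k = of_nat p - 3 / 2 - of_nat d - 2 - of_nat (nat (- y - int d - 3))" unfolding y by simp
        show ?thesis unfolding e by (rule deep[OF w])
      qed
    next
      case False
      then have "mode p am k w = 0" by (rule mode_nonint[OF am_Ch Ch_VL[OF w]])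
      then show ?thesis using fock.subspace_0[OF T] by simp
    qed
    have "v \<in> ?T"
    proof (rule flin_keys_in[OF flin_id T])
      fix \<mu> k assume "(\<mu>, k) \<in> Poly_Mapping.keys v"
      then have "k = ?c" using less.prems(2) by (auto simp: gr_def)
      then show "basis \<mu> k \<in> ?T" using Ch_in_subspace[OF T below] by simp
    qed
    then show ?thesis using level_part_gr[OF less.prems(2), of ?c d] by simp
  qed
qed

text \<open>By \<open>stable_determined\<close> only weights at most 0 matter. Among the charges in
  question these occur only at p - 1, whose exponential has weight -(p - 1)^2/4p; so the level is at
  most (p - 1)^2/4p, within the range of \<open>low_levels\<close>.\<close>

lemma Vbar_top:
  assumes "l mod int p = int p - 1"
  shows "Vbar l = VL p l"
proof
  show "Vbar l \<subseteq> VL p l" by (rule Vbar_VL)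
  define M where "M l = (if l mod int p = int p - 1 then VL p l else {0})" for l
  have stab: "stable M"
    unfolding stable_def
  proof (intro allI)
    fix l
    have m: "(l - int p) mod int p = l mod int p" "(l + int p) mod int p = l mod int p" by simp_all
    have V: "mode p am k w \<in> VL p (l - int p)" "mode p ap k w \<in> VL p (l + int p)" if "w \<in> VL p l" for k w
      using VL_mode[OF Ch_VL[OF am_Ch] that] VL_mode[OF Ch_VL[OF ap_Ch] that] by (simp_all add: algebra_simps)
    show "fock.subspace (M l) \<and> M l \<subseteq> VL p l \<and>
     (\<forall>w\<in>M l. (\<forall>n. Li n w \<in> M l) \<and> (\<forall>k. mode p am k w \<in> M (l - int p) \<and> mode p ap k w \<in> M (l + int p)))"
      unfolding M_def m using V subspace_VL[of l] Vir_VL fock.subspace_0[OF subspace_VL]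
      by (auto simp: Vir_0 mode_02)
  qed
  have "x \<in> Vbar l'" if x: "H \<le> 0" "x \<in> M l'" "x \<in> Wt H" for l' H x
  proof (cases "x = 0")
    case True
    then show ?thesis by (simp add: fock.subspace_0[OF vir_submoduleD(1)[OF Vbar_sub]])
  next
    case nz: False
    have l': "l' mod int p = int p - 1" using x nz by (auto simp: M_def split: if_splits)
    have xl: "x \<in> VL p l'" using x l' by (simp add: M_def)
    have key: "k = int p - 1 \<and> 2 * int p dvd k - l' \<and> H = hw k + of_nat (wlev \<mu>)" if "lk x (\<mu>, k) \<noteq> 0" for \<mu> k
    proof -
      note lo = low_keys[OF xl x(3,1) that]
      have "int p dvd k - l'" using lo dvd_2p_p by blast
      then have "k mod int p = l' mod int p" by (simp add: mod_eq_dvd_iff)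
      then have km: "k mod int p = int p - 1" using l' by simp
      have "k < int p"
      proof (rule ccontr)
        assume "\<not> k < int p"
        then have "(k - int p) mod int p = k - int p" using lo by (intro mod_pos_pos_trivial) auto
        then show False using km lo by simp
      qed
      then have "k mod int p = k" using lo by simp
      then show ?thesis using km lo by simp
    qed
    obtain \<mu> k where k: "lk x (\<mu>, k) \<noteq> 0" using nz by (metis lookup_zero poly_mapping_eqI surj_pair)
    have H: "H = hw (int p - 1) + of_nat (wlev \<mu>)" using key[OF k] by simp
    have d: "2 * int p dvd int p - 1 - l'" using key[OF k] by auto
    have g: "x \<in> gr (int p - 1) (of_nat (wlev \<mu>))"
      unfolding gr_iff using key H by fastforce
    have "wlev \<mu> < p"
    proof -
      have "of_nat p * (4 * of_nat (wlev \<mu>)) \<le> ((of_nat p - 1)\<^sup>2 :: rat)"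
      proof -
        have "hw (int p - 1) = - ((of_nat p - 1)\<^sup>2) / (4 * of_nat p)" using p0 by (simp add: hw_def field_simps power2_eq_square)
        then have "of_nat (wlev \<mu>) \<le> ((of_nat p - 1)\<^sup>2) / (4 * of_nat p :: rat)" using H x(1) by simp
        then show ?thesis using p0 by (simp add: field_simps)
      qed
      also have "\<dots> < of_nat p * of_nat p" 
      proof -
        have "(of_nat p :: rat) > 1 / 2" using of_nat_mono[OF p2, where 'a = rat] by simp
        then show ?thesis by (simp add: power2_eq_square algebra_simps)
      qed
      finally have "4 * of_nat (wlev \<mu>) < (of_nat p :: rat)" using p0 by simp
      then have "of_nat (4 * wlev \<mu>) < (of_nat p :: rat)" by simp
      then have "4 * wlev \<mu> < p" unfolding of_nat_less_iff .
      then show ?thesis by simp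
    qed
    then have "x \<in> vir_hull {fexp (int p - 1)}" using low_levels g by blast
    moreover have "vir_hull {fexp (int p - 1)} \<subseteq> Vbar l'"
      using fexp_in_Vbar[of l' 0] l' d by (intro vir_hull_min Vbar_sub) (simp add: evec_def)
    ultimately show ?thesis by blast
  qed
  from stable_determined[OF stab stable_Vbar this, where l = l] show "VL p l \<subseteq> Vbar l" using assms by (simp add: M_def)
qed

end

lemma finite_wlev: "finite {\<mu>. wlev \<mu> = d}"
proof (induction d rule: less_induct)
  case (less d)
  have "{\<mu>. wlev \<mu> = d} \<subseteq> {{#}} \<union> (\<Union>n\<in>{..<d}. add_mset n ` {\<mu>. wlev \<mu> = d - n - 1})"
  proof
    fix \<mu> assume "\<mu> \<in> {\<mu>. wlev \<mu> = d}"
    then show "\<mu> \<in> {{#}} \<union> (\<Union>n\<in>{..<d}. add_mset n ` {\<mu>. wlev \<mu> = d - n - 1})"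
    proof (cases \<mu>)
      case (add n \<nu>)
      then have "wlev \<nu> = d - n - 1" "n < d" using \<open>\<mu> \<in> _\<close> by auto
      then show ?thesis unfolding add by blast
    qed simp
  qed
  moreover have "finite ({{#}} \<union> (\<Union>n\<in>{..<d}. add_mset n ` {\<mu>. wlev \<mu> = d - n - 1}))"
    using less by auto
  ultimately show ?case by (rule finite_subset)
qed

context lattice_va
begin

section \<open>Module axioms\<close>

text \<open>L is an even lattice, so the inner product of two charges does not affect the sign, and
  parts of different charge may be added.\<close>

lemma borcherds_VL0:
  assumes u: "u \<in> VL p 0" and v: "v \<in> VL p 0" and w: "w \<in> VL p l"
  shows "borcherds p u v w"
  unfolding borcherds_def
proof (intro allI)
  fix L m n :: int
  let ?l = "of_int L :: rat" and ?m = "of_int m :: rat" and ?n = "of_int n :: rat"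
  have 0: "Sum_any (borch_lhs ?l ?m ?n (basis \<mu>1 k1) (basis \<mu>2 k2) w) = Sum_any (borch_rhs L ?l ?m ?n (basis \<mu>1 k1) (basis \<mu>2 k2) w)"
    if k: "2 * int p dvd k1" "2 * int p dvd k2" for \<mu>1 k1 \<mu>2 k2
  proof -
    obtain z1 where z1: "k1 = 2 * int p * z1" using k(1) by (elim dvdE)
    obtain z2 where z2: "k2 = 2 * int p * z2" using k(2) by (elim dvdE)
    have s: "sp k1 x = of_int (z1 * x)" "sp k2 x = of_int (z2 * x)" for x
      using p0 by (simp_all add: z1 z2 sp_def)
    have "Sum_any (borch_lhs ?l ?m ?n (basis \<mu>1 k1) (basis \<mu>2 k2) w) = Sum_any (borch_rhs (L + z1 * k2) ?l ?m ?n (basis \<mu>1 k1) (basis \<mu>2 k2) w)"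
      by (rule borcherds_rat[OF basis_Ch basis_Ch w]) (simp_all add: s)
    moreover have "(- 1) powi (L + z1 * k2) = ((- 1) powi L :: complex)"
    proof -
      have e: "z1 * k2 = 2 * (z1 * int p * z2)" by (simp add: z2)
      have "(- 1) powi (z1 * k2) = (1 :: complex)" unfolding e by (simp only: power_int_mult) simp
      then show ?thesis by (simp add: power_int_add)
    qed
    ultimately show ?thesis by (simp only: borch_rhs_def[abs_def])
  qed
  have 1: "Sum_any (borch_lhs ?l ?m ?n (basis \<mu>1 k1) v w) = Sum_any (borch_rhs L ?l ?m ?n (basis \<mu>1 k1) v w)" if "2 * int p dvd k1" for \<mu>1 k1
    by (rule flin_keys_eq[OF flin_borch_lhs(2) flin_borch_rhs(2)]) (use v 0[OF that] in \<open>auto simp: VL_def\<close>)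
  have "Sum_any (borch_lhs ?l ?m ?n u v w) = Sum_any (borch_rhs L ?l ?m ?n u v w)"
    by (rule flin_keys_eq[OF flin_borch_lhs(1) flin_borch_rhs(1)]) (use u 1 in \<open>auto simp: VL_def\<close>)
  then show "Sum_any (\<lambda>j :: nat. fscale (of_int m gchoose j)
       (mode p (mode p u (of_int (L + int j)) v) (of_int (m + n - int j)) w))
   = Sum_any (\<lambda>j :: nat. fscale ((- 1) ^ j * (of_int L gchoose j))
       (mode p u (of_int (m + L - int j)) (mode p v (of_int (n + int j)) w)
        - fscale ((- 1) powi L)
            (mode p v (of_int (n + L - int j)) (mode p u (of_int (m + int j)) w))))"
    by (simp add: borch_lhs_def[abs_def] borch_rhs_def[abs_def])
qed

lemma weight_space_keys:
  assumes "v \<in> weight_space p M c" "lk v a \<noteq> 0"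
  shows "of_rat (wt a) = c"
proof -
  have "of_rat (wt a) * lk v a = c * lk v a"
    using assms(1) unfolding lk_Vir0[symmetric] by (simp add: weight_space_def lookup_fscale)
  then show ?thesis by (rule iffD1[OF mult_right_cancel[OF assms(2)]])
qed

text \<open>The weight fixes the value of \<open>(k - p + 1)^2 + 4p wlev\<close>, which bounds both
  the charge and the level.\<close>

lemma finite_wt: "finite {a. of_rat (wt a) = (c :: complex)}"
proof (cases "\<exists>n. c = of_rat (lowest n)")
  case True
  then obtain n where n: "c = of_rat (lowest n)" by blast
  have "{a. of_rat (wt a) = c} \<subseteq> (\<Union>d\<in>{..n}. {\<mu>. wlev \<mu> = d}) \<times> {int p - 1 - int n..int p - 1 + int n}"
  proof
    fix a assume a: "a \<in> {a. of_rat (wt a) = c}"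
    obtain \<mu> k where e: "a = (\<mu>, k)" by fastforce
    let ?t = "k - int p + 1"
    have "lowest (nat (?t\<^sup>2) + 4 * p * wlev \<mu>) = lowest n" using a n by (simp add: e wt_formula)
    then have q: "nat (?t\<^sup>2) + 4 * p * wlev \<mu> = n" using lowest_less by (metis linorder_neq_iff less_irrefl)
    have "wlev \<mu> \<le> 4 * p * wlev \<mu>" using p0 by simp
    then have "wlev \<mu> \<le> n" using q by linarith
    moreover have "\<bar>?t\<bar> \<le> ?t\<^sup>2" using self_le_power[of "\<bar>?t\<bar>" 2] by (cases "?t = 0") auto
    then have "\<bar>?t\<bar> \<le> int n" using q by linarith
    ultimately show "a \<in> (\<Union>d\<in>{..n}. {\<mu>. wlev \<mu> = d}) \<times> {int p - 1 - int n..int p - 1 + int n}"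
      by (auto simp: e)
  qed
  then show ?thesis by (rule finite_subset) (auto simp: finite_wlev)
next
  case False
  then have e: "{a. of_rat (wt a) = c} = {}" using wt_lowest by (metis (mono_tags) empty_Collect_eq)
  show ?thesis unfolding e by simp
qed

lemma voa_module_Vbar: "voa_module p (triplet p) (Vbar l)"
  unfolding voa_module_def triplet_Vbar
proof (intro conjI)
  note sub = vir_submoduleD(1)[OF Vbar_sub]
  show "fock.subspace (Vbar l)" by (rule sub)
  show "action_closed p (Vbar 0) (Vbar l)" by (simp add: action_closed_def triplet_closed)
  show "\<forall>u\<in>Vbar 0. \<forall>v\<in>Vbar 0. \<forall>w\<in>Vbar l. \<forall>w'\<in>Vbar l. \<forall>c. \<forall>n :: int.
        mode p (u + v) (of_int n) w = mode p u (of_int n) w + mode p v (of_int n) w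
      \<and> mode p (fscale c u) (of_int n) w = fscale c (mode p u (of_int n) w)
      \<and> mode p u (of_int n) (w + w') = mode p u (of_int n) w + mode p u (of_int n) w'
      \<and> mode p u (of_int n) (fscale c w) = fscale c (mode p u (of_int n) w)"
    by (simp add: mode_add1 mode_scale1 mode_add2 mode_scale2)
  show "\<forall>u\<in>Vbar 0. \<forall>w\<in>Vbar l. \<exists>N::int. \<forall>n\<ge>N. mode p u (of_int n) w = 0"
  proof (intro ballI)
    fix u w
    obtain N :: int where "\<And>m. m \<ge> of_int N \<Longrightarrow> mode p u m w = 0"
      using good_mode[of u] unfolding good_def by blast
    then show "\<exists>N::int. \<forall>n\<ge>N. mode p u (of_int n) w = 0" by (intro exI[of _ N]) simp
  qed
  show "\<forall>w\<in>Vbar l. \<forall>n::int. mode p vac (of_int n) w = (if n = - 1 then w else 0)"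
  proof (intro ballI allI)
    fix w and n :: int
    have "(of_int n = (- 1 :: rat)) \<longleftrightarrow> n = - 1" using of_int_eq_iff[of n "- 1", where 'a = rat] by simp
    then show "mode p vac (of_int n) w = (if n = - 1 then w else 0)" by (simp add: mode_vac)
  qed
  show "\<forall>u\<in>Vbar 0. \<forall>v\<in>Vbar 0. \<forall>w\<in>Vbar l. borcherds p u v w"
    using borcherds_VL0 Vbar_VL by blast
  show "Vbar l = fock.span (\<Union>c. weight_space p (Vbar l) c)"
  proof
    show "Vbar l \<subseteq> fock.span (\<Union>c. weight_space p (Vbar l) c)"
    proof
      fix v assume v: "v \<in> Vbar l"
      have "Vbar l \<inter> Wt H \<subseteq> weight_space p (Vbar l) (of_rat H)" for H
        by (auto simp: weight_space_def Wt_iff)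
      then have "(\<Union>H. Vbar l \<inter> Wt H) \<subseteq> (\<Union>c. weight_space p (Vbar l) c)" by blast
      from fock.span_mono[OF this] show "v \<in> fock.span (\<Union>c. weight_space p (Vbar l) c)"
        using weight_decomposition[OF sub vir_submoduleD(2)[OF Vbar_sub] v] by blast
    qed
    show "fock.span (\<Union>c. weight_space p (Vbar l) c) \<subseteq> Vbar l"
      by (rule fock.span_minimal[OF _ sub]) (auto simp: weight_space_def)
  qed
  show "\<forall>c. \<exists>B. finite B \<and> weight_space p (Vbar l) c \<subseteq> fock.span B"
  proof
    fix c :: complex
    let ?B = "(\<lambda>(\<mu>, k). basis \<mu> k) ` {a. of_rat (wt a) = c}"
    have "v \<in> fock.span ?B" if v: "v \<in> weight_space p (Vbar l) c" for v
    proof -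
      have "Poly_Mapping.single a 1 \<in> ?B" if "a \<in> Poly_Mapping.keys v" for a
        using weight_space_keys[OF v, of a] that by (cases a) (auto simp: in_keys_iff intro!: image_eqI[of _ _ a])
      then have "(\<Sum>a\<in>Poly_Mapping.keys v. fscale (lk v a) (Poly_Mapping.single a 1)) \<in> fock.span ?B"
        by (intro fock.span_sum fock.span_scale fock.span_base)
      then show ?thesis using fock_expand[of v] by simp
    qed
    then show "\<exists>B. finite B \<and> weight_space p (Vbar l) c \<subseteq> fock.span B"
      using finite_wt[of c] by (intro exI[of _ ?B]) auto
  qed
  show "\<forall>c. \<exists>N::nat. \<forall>n\<ge>N. weight_space p (Vbar l) (c - of_nat n) = {0}"
  proof
    fix c :: complex
    have z: "0 \<in> weight_space p (Vbar l) x" for x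
      by (simp add: weight_space_def fock.subspace_0[OF sub] Vir_0)
    show "\<exists>N::nat. \<forall>n\<ge>N. weight_space p (Vbar l) (c - of_nat n) = {0}"
    proof (cases "\<exists>H. c = of_rat H")
      case True
      then obtain H where H: "c = of_rat H" by blast
      obtain N :: nat where N: "H - lowest 0 < of_nat N" using reals_Archimedean2 by blast
      have "v = 0" if n: "n \<ge> N" and v: "v \<in> weight_space p (Vbar l) (c - of_nat n)" for n v
      proof (rule ccontr)
        assume "v \<noteq> 0"
        then obtain a where a: "lk v a \<noteq> 0" by (metis lookup_zero poly_mapping_eqI)
        have "(of_rat (wt a) :: complex) = of_rat (H - of_nat n)" using weight_space_keys[OF v a] H by (simp add: of_rat_diff)
        then have "wt a = H - of_nat n" by simp
        moreover obtain m where "wt a = lowest m" using wt_lowest by blast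
        moreover have "\<not> lowest m < lowest 0" using lowest_less by simp
        moreover have "of_nat N \<le> (of_nat n :: rat)" using n by simp
        ultimately show False using N by linarith
      qed
      then show ?thesis using z by (intro exI[of _ N]) blast
    next
      case False
      have "v = 0" if v: "v \<in> weight_space p (Vbar l) (c - of_nat n)" for n v
      proof (rule ccontr)
        assume "v \<noteq> 0"
        then obtain a where a: "lk v a \<noteq> 0" by (metis lookup_zero poly_mapping_eqI)
        have "c = of_rat (wt a + of_nat n)" using weight_space_keys[OF v a] by (simp add: of_rat_add)
        then show False using False by blast
      qed
      then show ?thesis using z by (intro exI[of _ 0]) blast
    qed
  qed
qed

lemma dvd_2p_even: "2 * int p dvd int p * z \<longleftrightarrow> even z"
  using p0 dvd_times_left_cancel_iff[of "int p" 2 z] by (simp add: mult.commute)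

lemma Vbar_nonzero: "Vbar l \<noteq> {0}"
proof -
  \<comment> \<open>The class of l modulo 2p requires m to have the parity of the quotient of l by
    p.\<close>
  define m :: nat where "m = (if even (l div int p) then 0 else 1)"
  have "even (- (l div int p) - int m)" by (auto simp: m_def)
  then have "2 * int p dvd int p * (- (l div int p) - int m)" unfolding dvd_2p_even .
  moreover have "int p * (- (l div int p) - int m) = l mod int p - int p * int m - l"
    using mult_div_mod_eq[of "int p" l] unfolding right_diff_distrib mult_minus_right by linarith
  ultimately have "evec (l mod int p) m \<in> Vbar l" by (intro fexp_in_Vbar) simp
  then show ?thesis using fexp_nonzero by (auto simp: evec_def)
qed

theorem Vbar_irreducible_voa_module: "irreducible_voa_module p (triplet p) (Vbar l)"
  unfolding irreducible_voa_module_def triplet_Vbar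
proof (intro conjI allI impI)
  show "voa_module p (Vbar 0) (Vbar l)" using voa_module_Vbar unfolding triplet_Vbar .
  show "Vbar l \<noteq> {0}" by (rule Vbar_nonzero)
  fix N assume "N \<subseteq> Vbar l \<and> fock.subspace N \<and> action_closed p (Vbar 0) N"
  then show "N = {0} \<or> N = Vbar l" using Vbar_irreducible[of N l] by argo
qed

lemma VLbar_low:
  assumes "0 \<le> i" "i \<le> int p - 2"
  shows "VLbar p i = Vbar i"
proof -
  have i: "i mod int p = i" using assms by (intro mod_pos_pos_trivial) auto
  have d: "2 * int p dvd i - int p * int m - i \<longleftrightarrow> even m" for m
    using dvd_2p_even[of "- int m"] by simp
  have "{(Qi ^^ j) (fexp (i - 2 * int p * int n)) | j n :: nat.
        0 \<le> i \<and> i \<le> int p - 2 \<and> int j \<le> 2 * int n \<or> int p \<le> i \<and> i \<le> 2 * int p - 2 \<and> 1 \<le> n \<and> int j \<le> 2 * int n - 1} = gens i"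
    (is "?A = _")
  proof
    show "?A \<subseteq> gens i"
    proof
      fix x assume "x \<in> ?A"
      then obtain j n where x: "x = (Qi ^^ j) (fexp (i - 2 * int p * int n))" "int j \<le> 2 * int n" using assms by auto
      then have "x = (Qi ^^ j) (evec i (2 * n))" "j \<le> 2 * n" by (simp_all add: evec_def mult.assoc mult.left_commute)
      then show "x \<in> gens i" unfolding gens_def i d by force
    qed
    show "gens i \<subseteq> ?A"
    proof
      fix x assume "x \<in> gens i"
      then obtain j m where x: "x = (Qi ^^ j) (evec i m)" "j \<le> m" "even m" unfolding gens_def i d by blast
      then obtain n where "m = 2 * n" by (elim evenE)
      then have "x = (Qi ^^ j) (fexp (i - 2 * int p * int n))" "int j \<le> 2 * int n" using x by (simp_all add: evec_def mult.assoc mult.left_commute)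
      then show "x \<in> ?A" using assms by blast
    qed
  qed
  then show ?thesis by (simp only: VLbar_def Vbar_def)
qed

text \<open>With \<open>i = l - p\<close> one has \<open>l - 2pn = i - p (2n - 1)\<close>. So
  \<open>m = 2n - 1\<close>, which explains why \<open>n\<close> starts at 1 and \<open>j\<close>
  ends at 2n - 1.\<close>

lemma VLbar_high:
  assumes "int p \<le> l" "l \<le> 2 * int p - 2"
  shows "VLbar p l = Vbar l"
proof -
  define i where "i = l - int p"
  have "l mod int p = i mod int p" by (simp add: i_def)
  also have "\<dots> = i" using assms by (intro mod_pos_pos_trivial) (simp_all add: i_def)
  finally have i: "l mod int p = i" .
  have d: "2 * int p dvd i - int p * int m - l \<longleftrightarrow> odd m" for m
  proof -
    have e: "i - int p * int m - l = int p * (- int m - 1)" by (simp add: i_def algebra_simps)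
    show ?thesis unfolding e dvd_2p_even by simp
  qed
  have "{(Qi ^^ j) (fexp (l - 2 * int p * int n)) | j n :: nat.
        0 \<le> l \<and> l \<le> int p - 2 \<and> int j \<le> 2 * int n \<or> int p \<le> l \<and> l \<le> 2 * int p - 2 \<and> 1 \<le> n \<and> int j \<le> 2 * int n - 1} = gens l"
    (is "?A = _")
  proof
    show "?A \<subseteq> gens l"
    proof
      fix x assume "x \<in> ?A"
      then obtain j n where x: "x = (Qi ^^ j) (fexp (l - 2 * int p * int n))" "int j \<le> 2 * int n - 1" "n \<ge> 1" using assms by auto
      then obtain n' where n: "n = Suc n'" by (cases n) auto
      then have "x = (Qi ^^ j) (evec i (2 * n' + 1))" "j \<le> 2 * n' + 1" using x by (simp_all add: evec_def i_def algebra_simps)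
      moreover have "odd (2 * n' + 1)" by simp
      ultimately show "x \<in> gens l" unfolding gens_def i d by blast
    qed
    show "gens l \<subseteq> ?A"
    proof
      fix x assume "x \<in> gens l"
      then obtain j m where x: "x = (Qi ^^ j) (evec i m)" "j \<le> m" "odd m" unfolding gens_def i d by blast
      then obtain n where "m = 2 * n + 1" by (elim oddE)
      then have "x = (Qi ^^ j) (fexp (l - 2 * int p * int (Suc n)))" "int j \<le> 2 * int (Suc n) - 1" using x by (simp_all add: evec_def i_def algebra_simps)
      moreover have "1 \<le> Suc n" by simp
      ultimately show "x \<in> ?A" using assms by blast
    qed
  qed
  then show ?thesis by (simp only: VLbar_def Vbar_def)
qed

lemma Lam_Vbar:
  assumes "1 \<le> i" "i \<le> p"
  shows "Lam p i = Vbar (int i - 1)"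
proof (cases "i = p")
  case True
  have "(int p - 1) mod int p = int p - 1" using p0 by (intro mod_pos_pos_trivial) auto
  then show ?thesis using Vbar_top[of "int p - 1"] True by (simp add: Lam_def)
next
  case False
  then show ?thesis using VLbar_low[of "int i - 1"] assms by (simp add: Lam_def)
qed

lemma Pi_Vbar:
  assumes "1 \<le> i" "i \<le> p"
  shows "Pi_mod p i = Vbar (int p + int i - 1)"
proof (cases "i = p")
  case True
  have "(2 * int p - 1) mod int p = (int p - 1) mod int p" by (simp add: mod_eq_dvd_iff)
  also have "\<dots> = int p - 1" using p0 by (intro mod_pos_pos_trivial) auto
  finally show ?thesis using Vbar_top[of "2 * int p - 1"] True by (simp add: Pi_mod_def)
next
  case False
  have "2 * int p - (int p - int i) - 1 = int p + int i - 1" by simp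
  then show ?thesis using VLbar_high[of "int p + int i - 1"] assms False by (simp add: Pi_mod_def)
qed

end

theorem theorem3p7:
  fixes p i :: nat
  assumes "p \<ge> 2" and "1 \<le> i" and "i \<le> p"
  shows "irreducible_voa_module p (triplet p) (Lam p i)
       \<and> irreducible_voa_module p (triplet p) (Pi_mod p i)"
proof -
  interpret lattice_va p using assms(1) by unfold_locales
  show ?thesis
    using Vbar_irreducible_voa_module Lam_Vbar[OF assms(2,3)] Pi_Vbar[OF assms(2,3)] by simp
qed

end
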